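(* Let $G$ be a second-countable locally compact group, and let $$(A,\alpha,\mathfrak u)\xrightarrow{(\phi,\mathsf u)}(\mathcal M(B),\beta,\mathfrak v),\quad(B,\beta,\mathfrak v)\xrightarrow{(\psi,\mathsf v)}(\mathcal M(C),\gamma,\mathfrak w)$$ be two non-degenerate cocycle representations between twisted $G$-C*-algebras. Then the crossed product construction is compatible with compositions, i.e. $$\big((\psi,\mathsf v)\rtimes G\big)\circ\big((\phi,\mathsf u)\rtimes G\big)=\big((\psi,\mathsf v)\circ(\phi,\mathsf u)\big)\rtimes G.$$ In particular, if one restricts to non-degenerate maps, then the (twisted) crossed product construction is functorial on the (twisted) cocycle category $\mathrm C^*_{G,t}$, whose objects are the twisted $G$-C*-algebras and whose morphisms are the cocycle morphisms.
   Context: $\mathcal M(A)$ denotes the multiplier algebra, $\mathcal U(\cdot)$ the unitary group, $\mathrm{Ad}(u)=u(\cdot)u^*$; automorphisms of $A$ and non-degenerate $*$-homomorphisms $A\to\mathcal M(B)$ are extended canonically to $\mathcal M(A)$. A twisted action $(\alpha,\mathfrak u):G\curvearrowright A$ consists of a point-norm continuous map $\alpha:G\to\mathrm{Aut}(A)$ and a strictly continuous map $\mathfrak u:G\times G\to\mathcal U(\mathcal M(A))$ with $\alpha_1=\mathrm{id}_A$, $\alpha_s\circ\alpha_t=\mathrm{Ad}(\mathfrak u_{s,t})\circ\alpha_{st}$, $\mathfrak u_{s,1}=\mathfrak u_{1,s}=\mathbf 1$ and $\alpha_r(\mathfrak u_{s,t})\mathfrak u_{r,st}=\mathfrak u_{r,s}\mathfrak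 u_{rs,t}$ for all $r,s,t\in G$; $(A,\alpha,\mathfrak u)$ is a twisted $G$-C*-algebra. A non-degenerate cocycle representation $(\psi,\mathsf v):(A,\alpha,\mathfrak u)\to(\mathcal M(B),\beta,\mathfrak v)$ is a pair of a non-degenerate $*$-homomorphism $\psi:A\to\mathcal M(B)$ and a strictly continuous map $\mathsf v:G\to\mathcal U(\mathcal M(B))$ with $\mathrm{Ad}(\mathsf v_g)\circ\beta_g\circ\psi=\psi\circ\alpha_g$ and $\psi(\mathfrak u_{g,h})=\mathsf v_g\beta_g(\mathsf v_h)\mathfrak v_{g,h}\mathsf v_{gh}^*$ for all $g,h\in G$. It is a (non-degenerate) cocycle morphism into $(B,\beta,\mathfrak v)$ if $\psi(A)\subseteq B$. Composition is $(\psi,\mathsf v)\circ(\phi,\mathsf u)=(\psi\circ\phi,\psi(\mathsf u_\bullet)\mathsf v_\bullet)$. The (maximal) twisted crossed product $A\rtimes_{\alpha,\mathfrak u}G$ comes with its universal covariant representation: a non-degenerate $*$-homomorphism $\pi^A:A\to\mathcal M(A\rtimes_{\alpha,\mathfrak u}G)$ and a strictly continuous map $\mathsf u^\alpha:G\to\mathcal U(\mathcal M(A\rtimes_{\alpha,\mathfrak u}G))$ with $\mathsf u^\alpha_g\mathsf u^\alpha_h=\pi^A(\mathfrak u_{g,h})\mathsf u^\alpha_{gh}$ and $\mathrm{Ad}(\mathsf u^\alpha_g)\circ\pi^A=\pi^A\circ\alpha_g$, such that every other non-degenerate covariant representation of $(A,\alpha,\mathfrak u)$ into some $\mathcal M(D)$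 factors through it via a unique non-degenerate $*$-homomorphism $A\rtimes_{\alpha,\mathfrak u}G\to\mathcal M(D)$. For a non-degenerate cocycle representation $(\theta,\mathsf x):(A,\alpha,\mathfrak u)\to(\mathcal M(B),\beta,\mathfrak v)$, $\Theta=(\theta,\mathsf x)\rtimes G:A\rtimes_{\alpha,\mathfrak u}G\to\mathcal M(B\rtimes_{\beta,\mathfrak v}G)$ is the unique non-degenerate $*$-homomorphism with $\Theta\circ\pi^A=\pi^B\circ\theta$ and $\Theta(\mathsf u^\alpha_g)=\pi^B(\mathsf x_g)\mathsf u^\beta_g$ for $g\in G$. If $(\theta,\mathsf x)$ is a cocycle morphism into $(B,\beta,\mathfrak v)$, the image of $\Theta$ is contained in $B\rtimes_{\beta,\mathfrak v}G$. *)

theory Defs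
  imports
    "HOL-Analysis.Analysis"
    "HOL-Algebra.Algebraic_Closure_Type"
begin

section \<open>C*-algebras\<close>

text \<open>
  C*-algebras are explicit-carrier structures, so that one can quantify over them inside a formula.
  They need not be unital: the field \<open>one\<close> inherited from \<open>HOL-Algebra\<close> is unconstrained
  in a general C*-algebra and is only ever used for multiplier algebras.
\<close>

record 'a cstar = "(complex, 'a) module" +
  star :: "'a \<Rightarrow> 'a"
  nrm :: "'a \<Rightarrow> real"

text \<open>The library theory of metric spaces wants a distance that is total, hence the case split.\<close>

definition cdist :: "'a cstar \<Rightarrow> 'a \<Rightarrow> 'a \<Rightarrow> real" where
  "cdist A x y = (if x \<in> carrier A \<and> y \<in> carrier A then nrm A (x \<ominus>\<^bsub>A\<^esub> y) else 0)"

definition norm_topology :: "'a cstar \<Rightarrow> 'a topology" where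
  "norm_topology A = Metric_space.mtopology (carrier A) (cdist A)"

locale cstar_algebra = Module.module "ring_of_type_algebra :: complex ring" A
  for A :: "'a cstar" +
  assumes mult_closed:
      "\<lbrakk>x \<in> carrier A; y \<in> carrier A\<rbrakk> \<Longrightarrow> x \<otimes>\<^bsub>A\<^esub> y \<in> carrier A"
    and mult_assoc:
      "\<lbrakk>x \<in> carrier A; y \<in> carrier A; z \<in> carrier A\<rbrakk> \<Longrightarrow>
        (x \<otimes>\<^bsub>A\<^esub> y) \<otimes>\<^bsub>A\<^esub> z = x \<otimes>\<^bsub>A\<^esub> (y \<otimes>\<^bsub>A\<^esub> z)"
    and mult_l_distr:
      "\<lbrakk>x \<in> carrier A; y \<in> carrier A; z \<in> carrier A\<rbrakk> \<Longrightarrow>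
        (x \<oplus>\<^bsub>A\<^esub> y) \<otimes>\<^bsub>A\<^esub> z = (x \<otimes>\<^bsub>A\<^esub> z) \<oplus>\<^bsub>A\<^esub> (y \<otimes>\<^bsub>A\<^esub> z)"
    and mult_r_distr:
      "\<lbrakk>x \<in> carrier A; y \<in> carrier A; z \<in> carrier A\<rbrakk> \<Longrightarrow>
        x \<otimes>\<^bsub>A\<^esub> (y \<oplus>\<^bsub>A\<^esub> z) = (x \<otimes>\<^bsub>A\<^esub> y) \<oplus>\<^bsub>A\<^esub> (x \<otimes>\<^bsub>A\<^esub> z)"
    and smult_mult_left:
      "\<lbrakk>x \<in> carrier A; y \<in> carrier A\<rbrakk> \<Longrightarrow>
        (c \<odot>\<^bsub>A\<^esub> x) \<otimes>\<^bsub>A\<^esub> y = c \<odot>\<^bsub>A\<^esub> (x \<otimes>\<^bsub>A\<^esub> y)"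
    and smult_mult_right:
      "\<lbrakk>x \<in> carrier A; y \<in> carrier A\<rbrakk> \<Longrightarrow>
        x \<otimes>\<^bsub>A\<^esub> (c \<odot>\<^bsub>A\<^esub> y) = c \<odot>\<^bsub>A\<^esub> (x \<otimes>\<^bsub>A\<^esub> y)"
    and star_closed: "x \<in> carrier A \<Longrightarrow> star A x \<in> carrier A"
    and star_star: "x \<in> carrier A \<Longrightarrow> star A (star A x) = x"
    and star_add:
      "\<lbrakk>x \<in> carrier A; y \<in> carrier A\<rbrakk> \<Longrightarrow> star A (x \<oplus>\<^bsub>A\<^esub> y) = star A x \<oplus>\<^bsub>A\<^esub> star A y"
    and star_smult: "x \<in> carrier A \<Longrightarrow> star A (c \<odot>\<^bsub>A\<^esub> x) = cnj c \<odot>\<^bsub>A\<^esub> star A x"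
    and star_mult:
      "\<lbrakk>x \<in> carrier A; y \<in> carrier A\<rbrakk> \<Longrightarrow> star A (x \<otimes>\<^bsub>A\<^esub> y) = star A y \<otimes>\<^bsub>A\<^esub> star A x"
    and nrm_nonneg: "x \<in> carrier A \<Longrightarrow> 0 \<le> nrm A x"
    and nrm_eq_0: "x \<in> carrier A \<Longrightarrow> nrm A x = 0 \<longleftrightarrow> x = \<zero>\<^bsub>A\<^esub>"
    and nrm_triangle:
      "\<lbrakk>x \<in> carrier A; y \<in> carrier A\<rbrakk> \<Longrightarrow> nrm A (x \<oplus>\<^bsub>A\<^esub> y) \<le> nrm A x + nrm A y"
    and nrm_smult: "x \<in> carrier A \<Longrightarrow> nrm A (c \<odot>\<^bsub>A\<^esub> x) = cmod c * nrm A x"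
    and nrm_mult:
      "\<lbrakk>x \<in> carrier A; y \<in> carrier A\<rbrakk> \<Longrightarrow> nrm A (x \<otimes>\<^bsub>A\<^esub> y) \<le> nrm A x * nrm A y"
    and cstar_identity: "x \<in> carrier A \<Longrightarrow> nrm A (star A x \<otimes>\<^bsub>A\<^esub> x) = (nrm A x)\<^sup>2"
    and complete: "Metric_space.mcomplete (carrier A) (cdist A)"

text \<open>
  Maps between carriers are extensional (\<open>undefined\<close> outside the carrier), so that equality of
  homomorphisms is equality of functions.
\<close>

definition star_hom :: "'a cstar \<Rightarrow> 'b cstar \<Rightarrow> ('a \<Rightarrow> 'b) set" where
  "star_hom A B = {f \<in> carrier A \<rightarrow>\<^sub>E carrier B.
     (\<forall>x\<in>carrier A. \<forall>y\<in>carrier A. f (x \<oplus>\<^bsub>A\<^esub> y) = f x \<oplus>\<^bsub>B\<^esub> f y) \<and>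
     (\<forall>c. \<forall>x\<in>carrier A. f (c \<odot>\<^bsub>A\<^esub> x) = c \<odot>\<^bsub>B\<^esub> f x) \<and>
     (\<forall>x\<in>carrier A. \<forall>y\<in>carrier A. f (x \<otimes>\<^bsub>A\<^esub> y) = f x \<otimes>\<^bsub>B\<^esub> f y) \<and>
     (\<forall>x\<in>carrier A. f (star A x) = star B (f x))}"

definition star_aut :: "'a cstar \<Rightarrow> ('a \<Rightarrow> 'a) set" where
  "star_aut A = {f \<in> star_hom A A. bij_betw f (carrier A) (carrier A)}"


section \<open>Multiplier algebras\<close>

text \<open>
  \<open>\<M>(A)\<close> is the algebra of double centralizers \<open>(L, R)\<close>, where a multiplier \<open>m\<close>
  corresponds to \<open>L a = m a\<close> and \<open>R a = a m\<close>.
\<close>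

type_synonym 'a mult = "('a \<Rightarrow> 'a) \<times> ('a \<Rightarrow> 'a)"

definition bounded_op :: "'a cstar \<Rightarrow> ('a \<Rightarrow> 'a) \<Rightarrow> bool" where
  "bounded_op A T \<longleftrightarrow> T \<in> carrier A \<rightarrow>\<^sub>E carrier A \<and>
     (\<forall>x\<in>carrier A. \<forall>y\<in>carrier A. T (x \<oplus>\<^bsub>A\<^esub> y) = T x \<oplus>\<^bsub>A\<^esub> T y) \<and>
     (\<forall>c. \<forall>x\<in>carrier A. T (c \<odot>\<^bsub>A\<^esub> x) = c \<odot>\<^bsub>A\<^esub> T x) \<and>
     (\<exists>K. \<forall>x\<in>carrier A. nrm A (T x) \<le> K * nrm A x)"

definition double_centralizers :: "'a cstar \<Rightarrow> 'a mult set" where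
  "double_centralizers A = {(L, R). bounded_op A L \<and> bounded_op A R \<and>
     (\<forall>x\<in>carrier A. \<forall>y\<in>carrier A.
        L (x \<otimes>\<^bsub>A\<^esub> y) = L x \<otimes>\<^bsub>A\<^esub> y \<and>
        R (x \<otimes>\<^bsub>A\<^esub> y) = x \<otimes>\<^bsub>A\<^esub> R y \<and>
        R x \<otimes>\<^bsub>A\<^esub> y = x \<otimes>\<^bsub>A\<^esub> L y)}"

definition mult_alg :: "'a cstar \<Rightarrow> 'a mult cstar" where
  "mult_alg A = \<lparr>
     carrier = double_centralizers A,
     monoid.mult = (\<lambda>(L, R) (L', R').
       (\<lambda>x\<in>carrier A. L (L' x), \<lambda>x\<in>carrier A. R' (R x))),
     one = (\<lambda>x\<in>carrier A. x, \<lambda>x\<in>carrier A. x),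
     zero = (\<lambda>x\<in>carrier A. \<zero>\<^bsub>A\<^esub>, \<lambda>x\<in>carrier A. \<zero>\<^bsub>A\<^esub>),
     add = (\<lambda>(L, R) (L', R').
       (\<lambda>x\<in>carrier A. L x \<oplus>\<^bsub>A\<^esub> L' x, \<lambda>x\<in>carrier A. R x \<oplus>\<^bsub>A\<^esub> R' x)),
     smult = (\<lambda>c (L, R). (\<lambda>x\<in>carrier A. c \<odot>\<^bsub>A\<^esub> L x, \<lambda>x\<in>carrier A. c \<odot>\<^bsub>A\<^esub> R x)),
     star = (\<lambda>(L, R).
       (\<lambda>x\<in>carrier A. star A (R (star A x)), \<lambda>x\<in>carrier A. star A (L (star A x)))),
     nrm = (\<lambda>(L, R). SUP x\<in>{x \<in> carrier A. nrm A x \<le> 1}. nrm A (L x))\<rparr>"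

definition mult_embed :: "'a cstar \<Rightarrow> 'a \<Rightarrow> 'a mult" where
  "mult_embed A = (\<lambda>a\<in>carrier A.
     (\<lambda>x\<in>carrier A. a \<otimes>\<^bsub>A\<^esub> x, \<lambda>x\<in>carrier A. x \<otimes>\<^bsub>A\<^esub> a))"

definition mult_unitaries :: "'a cstar \<Rightarrow> 'a mult set" where
  "mult_unitaries A = {u \<in> carrier (mult_alg A).
     star (mult_alg A) u \<otimes>\<^bsub>mult_alg A\<^esub> u = \<one>\<^bsub>mult_alg A\<^esub> \<and>
     u \<otimes>\<^bsub>mult_alg A\<^esub> star (mult_alg A) u = \<one>\<^bsub>mult_alg A\<^esub>}"

definition Ad :: "'a cstar \<Rightarrow> 'a mult \<Rightarrow> 'a mult \<Rightarrow> 'a mult" where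
  "Ad A u m = u \<otimes>\<^bsub>mult_alg A\<^esub> m \<otimes>\<^bsub>mult_alg A\<^esub> star (mult_alg A) u"

text \<open>The strict topology is the initial topology of the maps \<open>m \<mapsto> m a\<close> and \<open>m \<mapsto> a m\<close>.\<close>

definition strictly_continuous :: "'a cstar \<Rightarrow> ('p::topological_space \<Rightarrow> 'a mult) \<Rightarrow> bool" where
  "strictly_continuous A f \<longleftrightarrow> (\<forall>a\<in>carrier A.
     continuous_map euclidean (norm_topology A) (\<lambda>p. fst (f p) a) \<and>
     continuous_map euclidean (norm_topology A) (\<lambda>p. snd (f p) a))"

text \<open>Non-degeneracy of \<open>\<phi> : A \<rightarrow> \<M>(B)\<close>: the linear span of \<open>\<phi>(A)B\<close> is dense in \<open>B\<close>.\<close>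

definition nondegenerate_hom :: "'a cstar \<Rightarrow> 'b cstar \<Rightarrow> ('a \<Rightarrow> 'b mult) \<Rightarrow> bool" where
  "nondegenerate_hom A B \<phi> \<longleftrightarrow> \<phi> \<in> star_hom A (mult_alg B) \<and>
     norm_topology B closure_of
       {\<Oplus>\<^bsub>B\<^esub>i\<in>{..<n}. fst (\<phi> (a i)) (b i) | (n::nat) a b.
          a \<in> {..<n} \<rightarrow> carrier A \<and> b \<in> {..<n} \<rightarrow> carrier B} = carrier B"

text \<open>
  The canonical extension of a non-degenerate \<open>\<phi> : A \<rightarrow> \<M>(B)\<close> to \<open>\<M>(A)\<close>. It is unique
  among all *-homomorphisms \<open>\<Phi>\<close> extending \<open>\<phi>\<close>, because \<open>\<Phi>(m)\<phi>(a) = \<phi>(ma)\<close>.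
\<close>

definition mult_ext :: "'a cstar \<Rightarrow> 'b cstar \<Rightarrow> ('a \<Rightarrow> 'b mult) \<Rightarrow> 'a mult \<Rightarrow> 'b mult" where
  "mult_ext A B \<phi> = (THE \<Phi>. \<Phi> \<in> star_hom (mult_alg A) (mult_alg B) \<and>
     (\<forall>a\<in>carrier A. \<Phi> (mult_embed A a) = \<phi> a))"

definition aut_ext :: "'a cstar \<Rightarrow> ('a \<Rightarrow> 'a) \<Rightarrow> 'a mult \<Rightarrow> 'a mult" where
  "aut_ext A \<alpha> = mult_ext A A (compose (carrier A) (mult_embed A) \<alpha>)"

text \<open>Composition of non-degenerate \<open>\<phi> : A \<rightarrow> \<M>(B)\<close> and \<open>\<psi> : B \<rightarrow> \<M>(C)\<close>.\<close>

definition hom_comp ::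
  "'a cstar \<Rightarrow> 'b cstar \<Rightarrow> 'c cstar \<Rightarrow> ('b \<Rightarrow> 'c mult) \<Rightarrow> ('a \<Rightarrow> 'b mult) \<Rightarrow> 'a \<Rightarrow> 'c mult" where
  "hom_comp A B C \<psi> \<phi> = compose (carrier A) (mult_ext B C \<psi>) \<phi>"


section \<open>Twisted actions and cocycle representations\<close>

text \<open>
  The (not necessarily abelian) group \<open>G\<close> is a type of class \<open>topological_group_add\<close>, so its
  group law is written additively: \<open>s + t\<close> is the product \<open>st\<close> and \<open>0\<close> is the unit.
\<close>

record ('g, 'a) twisted =
  alg :: "'a cstar"
  act :: "'g \<Rightarrow> 'a \<Rightarrow> 'a"
  twist :: "'g \<Rightarrow> 'g \<Rightarrow> 'a mult"

definition twisted_algebra :: "('g::topological_group_add, 'a) twisted \<Rightarrow> bool" where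
  "twisted_algebra \<A> \<longleftrightarrow>
     (let A = alg \<A>; M = mult_alg A; \<alpha> = act \<A>; u = twist \<A> in
       cstar_algebra A \<and>
       (\<forall>g. \<alpha> g \<in> star_aut A) \<and>
       (\<forall>a\<in>carrier A. continuous_map euclidean (norm_topology A) (\<lambda>g. \<alpha> g a)) \<and>
       (\<forall>s t. u s t \<in> mult_unitaries A) \<and>
       strictly_continuous A (\<lambda>(s, t). u s t) \<and>
       (\<forall>a\<in>carrier A. \<alpha> 0 a = a) \<and>
       (\<forall>s t. \<forall>a\<in>carrier A.
          mult_embed A (\<alpha> s (\<alpha> t a)) = Ad A (u s t) (mult_embed A (\<alpha> (s + t) a))) \<and>
       (\<forall>s. u s 0 = \<one>\<^bsub>M\<^esub> \<and> u 0 s = \<one>\<^bsub>M\<^esub>) \<and>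
       (\<forall>r s t. aut_ext A (\<alpha> r) (u s t) \<otimes>\<^bsub>M\<^esub> u r (s + t) = u r s \<otimes>\<^bsub>M\<^esub> u (r + s) t))"

type_synonym ('g, 'a, 'b) cocycle_pair = "('a \<Rightarrow> 'b mult) \<times> ('g \<Rightarrow> 'b mult)"

text \<open>Non-degenerate cocycle representations \<open>(A, \<alpha>, u) \<rightarrow> (\<M>(B), \<beta>, w)\<close>.\<close>

definition cocycle_rep ::
  "('g::topological_group_add, 'a) twisted \<Rightarrow> ('g, 'b) twisted \<Rightarrow>
   ('g, 'a, 'b) cocycle_pair \<Rightarrow> bool" where
  "cocycle_rep \<A> \<B> = (\<lambda>(\<psi>, v).
     (let A = alg \<A>; B = alg \<B>; M = mult_alg B in
       nondegenerate_hom A B \<psi> \<and>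
       (\<forall>g. v g \<in> mult_unitaries B) \<and>
       strictly_continuous B v \<and>
       (\<forall>g. \<forall>a\<in>carrier A. Ad B (v g) (aut_ext B (act \<B> g) (\<psi> a)) = \<psi> (act \<A> g a)) \<and>
       (\<forall>g h. mult_ext A B \<psi> (twist \<A> g h) =
          v g \<otimes>\<^bsub>M\<^esub> aut_ext B (act \<B> g) (v h) \<otimes>\<^bsub>M\<^esub> twist \<B> g h \<otimes>\<^bsub>M\<^esub> star M (v (g + h)))))"

definition cocycle_morphism ::
  "('g::topological_group_add, 'a) twisted \<Rightarrow> ('g, 'b) twisted \<Rightarrow>
   ('g, 'a, 'b) cocycle_pair \<Rightarrow> bool" where
  "cocycle_morphism \<A> \<B> f \<longleftrightarrow> cocycle_rep \<A> \<B> f \<and>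
     fst f ` carrier (alg \<A>) \<subseteq> mult_embed (alg \<B>) ` carrier (alg \<B>)"

definition cocycle_comp ::
  "('g, 'a) twisted \<Rightarrow> ('g, 'b) twisted \<Rightarrow> ('g, 'c) twisted \<Rightarrow>
   ('g, 'b, 'c) cocycle_pair \<Rightarrow> ('g, 'a, 'b) cocycle_pair \<Rightarrow> ('g, 'a, 'c) cocycle_pair" where
  "cocycle_comp \<A> \<B> \<C> = (\<lambda>(\<psi>, v) (\<phi>, u).
     (hom_comp (alg \<A>) (alg \<B>) (alg \<C>) \<psi> \<phi>,
      \<lambda>g. mult_ext (alg \<B>) (alg \<C>) \<psi> (u g) \<otimes>\<^bsub>mult_alg (alg \<C>)\<^esub> v g))"


section \<open>Crossed products\<close>

definition covariant_rep ::
  "('g::topological_group_add, 'a) twisted \<Rightarrow> 'd cstar \<Rightarrow> ('g, 'a, 'd) cocycle_pair \<Rightarrow> bool" where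
  "covariant_rep \<A> D = (\<lambda>(\<pi>, U).
     (let A = alg \<A>; M = mult_alg D in
       nondegenerate_hom A D \<pi> \<and>
       (\<forall>g. U g \<in> mult_unitaries D) \<and>
       strictly_continuous D U \<and>
       (\<forall>g h. U g \<otimes>\<^bsub>M\<^esub> U h = mult_ext A D \<pi> (twist \<A> g h) \<otimes>\<^bsub>M\<^esub> U (g + h)) \<and>
       (\<forall>g. \<forall>a\<in>carrier A. Ad D (U g) (\<pi> a) = \<pi> (act \<A> g a))))"

record ('g, 'a, 'x) crossed =
  cp_alg :: "'x cstar"
  cp_hom :: "'a \<Rightarrow> 'x mult"
  cp_unitary :: "'g \<Rightarrow> 'x mult"

text \<open>
  The maximal twisted crossed product, given by its universal covariant representation.
  HOL cannot quantify over types inside a formula, so the test algebras \<open>D\<close> range over all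
  C*-algebras carried by subsets of the fixed type \<open>'x mult\<close>. Up to isomorphism these include
  all C*-algebras carried by subsets of \<open>'x\<close> (embed \<open>D\<close> into \<open>\<M>(D)\<close>) and all
  C*-subalgebras of multiplier algebras of such. The genuine crossed product always satisfies this
  property once \<open>'x\<close> is large enough to carry it, and the property then determines it up to
  isomorphism.
\<close>

definition is_crossed_product ::
  "('g::topological_group_add, 'a) twisted \<Rightarrow> ('g, 'a, 'x) crossed \<Rightarrow> bool" where
  "is_crossed_product \<A> K \<longleftrightarrow>
     cstar_algebra (cp_alg K) \<and>
     covariant_rep \<A> (cp_alg K) (cp_hom K, cp_unitary K) \<and>
     (\<forall>(D :: 'x mult cstar) \<pi> U. cstar_algebra D \<and> covariant_rep \<A> D (\<pi>, U) \<longrightarrow>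
       (\<exists>!\<Theta>. nondegenerate_hom (cp_alg K) D \<Theta> \<and>
          (\<forall>a\<in>carrier (alg \<A>). mult_ext (cp_alg K) D \<Theta> (cp_hom K a) = \<pi> a) \<and>
          (\<forall>g. mult_ext (cp_alg K) D \<Theta> (cp_unitary K g) = U g)))"

text \<open>\<open>(\<theta>, x) \<rtimes> G\<close>, with respect to crossed products \<open>K\<close> of the source and \<open>K'\<close> of the target.\<close>

definition crossed_map ::
  "('g::topological_group_add, 'a) twisted \<Rightarrow> ('g, 'b) twisted \<Rightarrow>
   ('g, 'a, 'x) crossed \<Rightarrow> ('g, 'b, 'x) crossed \<Rightarrow> ('g, 'a, 'b) cocycle_pair \<Rightarrow>
   'x \<Rightarrow> 'x mult" where
  "crossed_map \<A> \<B> K K' = (\<lambda>(\<theta>, x).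
     (let A = alg \<A>; B = alg \<B>; P = cp_alg K; Q = cp_alg K' in
       THE \<Theta>. nondegenerate_hom P Q \<Theta> \<and>
         (\<forall>a\<in>carrier A. mult_ext P Q \<Theta> (cp_hom K a) = mult_ext B Q (cp_hom K') (\<theta> a)) \<and>
         (\<forall>g. mult_ext P Q \<Theta> (cp_unitary K g) =
            mult_ext B Q (cp_hom K') (x g) \<otimes>\<^bsub>mult_alg Q\<^esub> cp_unitary K' g)))"


section \<open>Categories and functors\<close>

text \<open>\<open>Comp C x y z g f\<close> is the composite of \<open>f : x \<rightarrow> y\<close> and \<open>g : y \<rightarrow> z\<close>.\<close>

record ('o, 'm) cat =
  Obj :: "'o set"
  Hom :: "'o \<Rightarrow> 'o \<Rightarrow> 'm set"
  Id :: "'o \<Rightarrow> 'm"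
  Comp :: "'o \<Rightarrow> 'o \<Rightarrow> 'o \<Rightarrow> 'm \<Rightarrow> 'm \<Rightarrow> 'm"

definition is_category :: "('o, 'm) cat \<Rightarrow> bool" where
  "is_category C \<longleftrightarrow>
     (\<forall>x\<in>Obj C. Id C x \<in> Hom C x x) \<and>
     (\<forall>x\<in>Obj C. \<forall>y\<in>Obj C. \<forall>z\<in>Obj C. \<forall>f\<in>Hom C x y. \<forall>g\<in>Hom C y z.
        Comp C x y z g f \<in> Hom C x z) \<and>
     (\<forall>x\<in>Obj C. \<forall>y\<in>Obj C. \<forall>f\<in>Hom C x y.
        Comp C x x y f (Id C x) = f \<and> Comp C x y y (Id C y) f = f) \<and>
     (\<forall>w\<in>Obj C. \<forall>x\<in>Obj C. \<forall>y\<in>Obj C. \<forall>z\<in>Obj C.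
        \<forall>f\<in>Hom C w x. \<forall>g\<in>Hom C x y. \<forall>h\<in>Hom C y z.
        Comp C w x z (Comp C x y z h g) f = Comp C w y z h (Comp C w x y g f))"

definition is_functor ::
  "('o, 'm) cat \<Rightarrow> ('p, 'n) cat \<Rightarrow> ('o \<Rightarrow> 'p) \<Rightarrow> ('o \<Rightarrow> 'o \<Rightarrow> 'm \<Rightarrow> 'n) \<Rightarrow> bool" where
  "is_functor C D F F' \<longleftrightarrow> is_category C \<and> is_category D \<and>
     (\<forall>x\<in>Obj C. F x \<in> Obj D) \<and>
     (\<forall>x\<in>Obj C. \<forall>y\<in>Obj C. \<forall>f\<in>Hom C x y. F' x y f \<in> Hom D (F x) (F y)) \<and>
     (\<forall>x\<in>Obj C. F' x x (Id C x) = Id D (F x)) \<and>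
     (\<forall>x\<in>Obj C. \<forall>y\<in>Obj C. \<forall>z\<in>Obj C. \<forall>f\<in>Hom C x y. \<forall>g\<in>Hom C y z.
        F' x z (Comp C x y z g f) = Comp D (F x) (F y) (F z) (F' y z g) (F' x y f))"

text \<open>The subcategory of \<open>C*\<^bsub>G,t\<^esub>\<close> of non-degenerate cocycle morphisms.\<close>

definition cocycle_cat ::
  "(('g::topological_group_add, 'a) twisted, ('g, 'a, 'a) cocycle_pair) cat" where
  "cocycle_cat = \<lparr>
     Obj = {\<A>. twisted_algebra \<A>},
     Hom = (\<lambda>\<A> \<B>. {f. cocycle_morphism \<A> \<B> f}),
     Id = (\<lambda>\<A>. (mult_embed (alg \<A>), \<lambda>g. \<one>\<^bsub>mult_alg (alg \<A>)\<^esub>)),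
     Comp = cocycle_comp\<rparr>"

text \<open>
  C*-algebras with non-degenerate *-homomorphisms \<open>P \<rightarrow> Q\<close>. As for cocycle morphisms, these are
  represented as maps into \<open>\<M>(Q)\<close> with range contained in the canonical copy of \<open>Q\<close>.
\<close>

definition cstar_cat :: "('x cstar, 'x \<Rightarrow> 'x mult) cat" where
  "cstar_cat = \<lparr>
     Obj = {P. cstar_algebra P},
     Hom = (\<lambda>P Q. {f. nondegenerate_hom P Q f \<and> f ` carrier P \<subseteq> mult_embed Q ` carrier Q}),
     Id = mult_embed,
     Comp = hom_comp\<rparr>"

end

theory Submission
  imports Defs
begin

text \<open>A covariant representation in \<open>\<M>(D)\<close> is a cocycle representation into \<open>D\<close> with trivial action
  and twist. In these terms the map \<open>\<Theta>\<close> induced by \<open>(\<theta>, x)\<close> is the unique solution of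
  \<open>\<Theta> \<circ> k\<^sub>A = k\<^sub>B \<circ> (\<theta>, x)\<close>, where \<open>k\<close> denotes the universal covariant representation in the
  crossed product \<open>P\<close>, so compatibility with composition is associativity of the composition of
  cocycle representations together with uniqueness.

  Extensions to multiplier algebras need no approximate units and no spectral theory. For a unitary
  multiplier \<open>u\<close> the map \<open>\<phi>(a)b \<mapsto> \<phi>(ua)b\<close> is isometric on the span of \<open>\<phi>(A)B\<close>, and a unital C*-algebra is
  spanned by its unitaries: a self-adjoint \<open>h\<close> of small norm is \<open>(u + u*) / 2\<close> for
  \<open>u = h + i (1 - h\<^sup>2)\<^sup>1\<^sup>/\<^sup>2\<close>, the square root being a fixed point of a contraction.

  That \<open>\<Theta>\<close> maps into \<open>P\<^sub>B\<close> when \<open>\<theta>(A) \<subseteq> B\<close> also follows from the universal property alone, without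
  integrated forms or Haar measure. Let \<open>n\<close> range over the multipliers of \<open>P\<^sub>B\<close> for which all maps
  \<open>g \<mapsto> \<pi>(b) U\<^sub>g n\<close> are norm continuous. The products \<open>\<pi>(b) n n'* \<pi>(b')*\<close> span a C*-algebra \<open>H\<close> that contains
  \<open>P\<^sub>B\<close> and the range of \<open>\<Theta>\<close>, and \<open>(\<pi>, U)\<close> acts on \<open>H\<close> as a covariant representation. The
  homomorphism \<open>P\<^sub>B \<rightarrow> \<M>(H)\<close> given by the universal property is non-degenerate and, by uniqueness,
  multiplies by elements of \<open>P\<^sub>B\<close>; hence \<open>H \<subseteq> P\<^sub>B\<close>.\<close>

text \<open>The continuity condition on \<open>n\<close> is cut down by \<open>\<pi>(b)\<close>
  because of the twist: moving \<open>U_g\<close> past \<open>U_k\<close> produces a multiplier that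
  depends on \<open>g\<close> only strictly continuously, and such a multiplier becomes norm
  continuous once it is multiplied by an element \<open>b\<close>. The same device absorbs the
  cocycle: \<open>U_g \<Theta>(r)\<close> is the extension of \<open>\<pi>\<close> at
  \<open>star x_g\<close> times \<open>\<Theta>(U_g r)\<close>, and the last factor is norm
  continuous in \<open>g\<close>. The condition on the range of \<open>\<theta>\<close> enters where
  \<open>\<Theta>(\<pi>(a) r)\<close> is written as \<open>\<pi>(b) \<Theta>(r)\<close> with
  \<open>b\<close> in \<open>B\<close>. The algebra \<open>H\<close> is a legitimate test algebra
  because it is carried by multipliers of the crossed product, the very type over which the
  universal property quantifies. Two traces of spectral theory remain. Homomorphisms are bounded by
  the constant 4, which suffices since every use is a limit argument. And each \<open>b\<close> must
  be close to some \<open>x b\<close>, so that products span the algebra; the witness comes from a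
  Banach fixed point.\<close>

lemma atin_euclidean: "atin euclidean a = at a"
  by (rule filter_eqI) (auto simp: eventually_atin eventually_at_topological)

section \<open>Algebra, metric and limits in a single C*-algebra\<close>

context cstar_algebra
begin

declare mult_closed [simp, intro] star_closed [simp, intro] star_star [simp]

lemma carrier_complex_ring [simp]: "carrier (ring_of_type_algebra :: complex ring) = UNIV"
  by (simp add: ring_of_type_algebra_def)

lemma smult_carrier [simp, intro]: "x \<in> carrier A \<Longrightarrow> c \<odot>\<^bsub>A\<^esub> x \<in> carrier A"
  by (rule smult_closed) simp_all

lemma smult_plus_left: "x \<in> carrier A \<Longrightarrow> (c + d) \<odot>\<^bsub>A\<^esub> x = c \<odot>\<^bsub>A\<^esub> x \<oplus>\<^bsub>A\<^esub> d \<odot>\<^bsub>A\<^esub> x"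
  using smult_l_distr[of c d x] by (simp add: ring_of_type_algebra_def)

lemma smult_plus_right:
  "\<lbrakk>x \<in> carrier A; y \<in> carrier A\<rbrakk> \<Longrightarrow> c \<odot>\<^bsub>A\<^esub> (x \<oplus>\<^bsub>A\<^esub> y) = c \<odot>\<^bsub>A\<^esub> x \<oplus>\<^bsub>A\<^esub> c \<odot>\<^bsub>A\<^esub> y"
  using smult_r_distr[of c x y] by simp

lemma smult_smult: "x \<in> carrier A \<Longrightarrow> c \<odot>\<^bsub>A\<^esub> (d \<odot>\<^bsub>A\<^esub> x) = (c * d) \<odot>\<^bsub>A\<^esub> x"
  using smult_assoc1[of c d x] by (simp add: ring_of_type_algebra_def)

lemma smult_1 [simp]: "x \<in> carrier A \<Longrightarrow> 1 \<odot>\<^bsub>A\<^esub> x = x"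
  using smult_one[of x] by (simp add: ring_of_type_algebra_def)

lemma smult_0_left [simp]: "x \<in> carrier A \<Longrightarrow> 0 \<odot>\<^bsub>A\<^esub> x = \<zero>\<^bsub>A\<^esub>"
  using smult_l_null[of x] by (simp add: ring_of_type_algebra_def)

lemma smult_0_right [simp]: "c \<odot>\<^bsub>A\<^esub> \<zero>\<^bsub>A\<^esub> = \<zero>\<^bsub>A\<^esub>"
  using smult_r_null[of c] by simp

lemma uminus_eq_smult: "x \<in> carrier A \<Longrightarrow> \<ominus>\<^bsub>A\<^esub> x = (-1) \<odot>\<^bsub>A\<^esub> x"
  using smult_plus_left[of x 1 "-1"] by (intro M.minus_equality) (auto simp: M.a_comm)

lemma minus_eq_smult: "\<lbrakk>x \<in> carrier A; y \<in> carrier A\<rbrakk> \<Longrightarrow> x \<ominus>\<^bsub>A\<^esub> y = x \<oplus>\<^bsub>A\<^esub> (-1) \<odot>\<^bsub>A\<^esub> y"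
  by (simp add: a_minus_def uminus_eq_smult)

lemma minus_carrier [simp, intro]: "\<lbrakk>x \<in> carrier A; y \<in> carrier A\<rbrakk> \<Longrightarrow> x \<ominus>\<^bsub>A\<^esub> y \<in> carrier A"
  by (simp add: a_minus_def)

lemma smult_minus_right:
  "\<lbrakk>x \<in> carrier A; y \<in> carrier A\<rbrakk> \<Longrightarrow> c \<odot>\<^bsub>A\<^esub> (x \<ominus>\<^bsub>A\<^esub> y) = c \<odot>\<^bsub>A\<^esub> x \<ominus>\<^bsub>A\<^esub> c \<odot>\<^bsub>A\<^esub> y"
  by (simp add: minus_eq_smult smult_plus_right smult_smult mult.commute)

lemma minus_mult_left:
  "\<lbrakk>x \<in> carrier A; y \<in> carrier A; z \<in> carrier A\<rbrakk> \<Longrightarrow> (x \<ominus>\<^bsub>A\<^esub> y) \<otimes>\<^bsub>A\<^esub> z = x \<otimes>\<^bsub>A\<^esub> z \<ominus>\<^bsub>A\<^esub> y \<otimes>\<^bsub>A\<^esub> z"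
  by (simp add: minus_eq_smult mult_l_distr smult_mult_left)

lemma minus_mult_right:
  "\<lbrakk>x \<in> carrier A; y \<in> carrier A; z \<in> carrier A\<rbrakk> \<Longrightarrow> x \<otimes>\<^bsub>A\<^esub> (y \<ominus>\<^bsub>A\<^esub> z) = x \<otimes>\<^bsub>A\<^esub> y \<ominus>\<^bsub>A\<^esub> x \<otimes>\<^bsub>A\<^esub> z"
  by (simp add: minus_eq_smult mult_r_distr smult_mult_right)

lemma zero_mult [simp]: "x \<in> carrier A \<Longrightarrow> \<zero>\<^bsub>A\<^esub> \<otimes>\<^bsub>A\<^esub> x = \<zero>\<^bsub>A\<^esub>"
  using smult_mult_left[of "\<zero>\<^bsub>A\<^esub>" x 0] by simp

lemma mult_zero [simp]: "x \<in> carrier A \<Longrightarrow> x \<otimes>\<^bsub>A\<^esub> \<zero>\<^bsub>A\<^esub> = \<zero>\<^bsub>A\<^esub>"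
  using smult_mult_right[of x "\<zero>\<^bsub>A\<^esub>" 0] by simp

lemma star_zero [simp]: "star A \<zero>\<^bsub>A\<^esub> = \<zero>\<^bsub>A\<^esub>"
  using star_smult[of "\<zero>\<^bsub>A\<^esub>" 0] by simp

lemma star_minus:
  "\<lbrakk>x \<in> carrier A; y \<in> carrier A\<rbrakk> \<Longrightarrow> star A (x \<ominus>\<^bsub>A\<^esub> y) = star A x \<ominus>\<^bsub>A\<^esub> star A y"
  by (simp add: minus_eq_smult star_add star_smult)

lemma minus_self [simp]: "x \<in> carrier A \<Longrightarrow> x \<ominus>\<^bsub>A\<^esub> x = \<zero>\<^bsub>A\<^esub>"
  by (simp add: a_minus_def M.r_neg)

lemma minus_zero [simp]: "x \<in> carrier A \<Longrightarrow> x \<ominus>\<^bsub>A\<^esub> \<zero>\<^bsub>A\<^esub> = x"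
  by (simp add: minus_eq_smult)

lemma minus_eq_zero_iff: "\<lbrakk>x \<in> carrier A; y \<in> carrier A\<rbrakk> \<Longrightarrow> x \<ominus>\<^bsub>A\<^esub> y = \<zero>\<^bsub>A\<^esub> \<longleftrightarrow> x = y"
  by (metis M.minus_equality M.minus_minus M.a_inv_closed a_minus_def minus_self)

lemma minus_plus_cancel [simp]: "\<lbrakk>x \<in> carrier A; y \<in> carrier A\<rbrakk> \<Longrightarrow> (x \<ominus>\<^bsub>A\<^esub> y) \<oplus>\<^bsub>A\<^esub> y = x"
  by (simp add: a_minus_def M.a_assoc M.l_neg)

lemma minus_triangle_eq:
  "\<lbrakk>x \<in> carrier A; y \<in> carrier A; z \<in> carrier A\<rbrakk> \<Longrightarrow> (x \<ominus>\<^bsub>A\<^esub> y) \<oplus>\<^bsub>A\<^esub> (y \<ominus>\<^bsub>A\<^esub> z) = x \<ominus>\<^bsub>A\<^esub> z"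
  by (simp add: a_minus_def M.a_assoc) (simp add: M.a_assoc[symmetric] M.l_neg)

lemma add_minus_add:
  "\<lbrakk>x \<in> carrier A; y \<in> carrier A; x' \<in> carrier A; y' \<in> carrier A\<rbrakk> \<Longrightarrow>
    (x \<oplus>\<^bsub>A\<^esub> y) \<ominus>\<^bsub>A\<^esub> (x' \<oplus>\<^bsub>A\<^esub> y') = (x \<ominus>\<^bsub>A\<^esub> x') \<oplus>\<^bsub>A\<^esub> (y \<ominus>\<^bsub>A\<^esub> y')"
  by (simp add: a_minus_def M.minus_add M.a_ac)

lemma mult_minus_mult:
  "\<lbrakk>x \<in> carrier A; y \<in> carrier A; x' \<in> carrier A; y' \<in> carrier A\<rbrakk> \<Longrightarrow>
    (x \<otimes>\<^bsub>A\<^esub> y) \<ominus>\<^bsub>A\<^esub> (x' \<otimes>\<^bsub>A\<^esub> y') = (x \<ominus>\<^bsub>A\<^esub> x') \<otimes>\<^bsub>A\<^esub> y \<oplus>\<^bsub>A\<^esub> x' \<otimes>\<^bsub>A\<^esub> (y \<ominus>\<^bsub>A\<^esub> y')"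
  by (simp add: minus_mult_left minus_mult_right minus_triangle_eq)

lemma nrm_zero [simp]: "nrm A \<zero>\<^bsub>A\<^esub> = 0"
  by (simp add: nrm_eq_0)

lemma nrm_minus_commute:
  "\<lbrakk>x \<in> carrier A; y \<in> carrier A\<rbrakk> \<Longrightarrow> nrm A (x \<ominus>\<^bsub>A\<^esub> y) = nrm A (y \<ominus>\<^bsub>A\<^esub> x)"
proof -
  assume x: "x \<in> carrier A" and y: "y \<in> carrier A"
  then have "x \<ominus>\<^bsub>A\<^esub> y = (-1) \<odot>\<^bsub>A\<^esub> (y \<ominus>\<^bsub>A\<^esub> x)"
    by (simp add: minus_eq_smult smult_plus_right smult_smult M.a_comm)
  then show ?thesis using nrm_smult[of "y \<ominus>\<^bsub>A\<^esub> x" "-1"] x y by simp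
qed

lemma nrm_minus_triangle:
  "\<lbrakk>x \<in> carrier A; y \<in> carrier A; z \<in> carrier A\<rbrakk> \<Longrightarrow>
    nrm A (x \<ominus>\<^bsub>A\<^esub> z) \<le> nrm A (x \<ominus>\<^bsub>A\<^esub> y) + nrm A (y \<ominus>\<^bsub>A\<^esub> z)"
  by (metis minus_triangle_eq nrm_triangle minus_carrier)

lemma nrm_minus_le: "\<lbrakk>x \<in> carrier A; y \<in> carrier A\<rbrakk> \<Longrightarrow> nrm A (x \<ominus>\<^bsub>A\<^esub> y) \<le> nrm A x + nrm A y"
  using nrm_minus_triangle[of x "\<zero>\<^bsub>A\<^esub>" y] nrm_minus_commute[of "\<zero>\<^bsub>A\<^esub>" y] by simp

lemma nrm_le_minus: "\<lbrakk>x \<in> carrier A; y \<in> carrier A\<rbrakk> \<Longrightarrow> nrm A x \<le> nrm A (x \<ominus>\<^bsub>A\<^esub> y) + nrm A y"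
  using nrm_minus_triangle[of x y "\<zero>\<^bsub>A\<^esub>"] by simp

text \<open>Isometry of the involution is not among the axioms: the C*-identity and
  submultiplicativity give \<open>||y||^2 <= ||star y|| ||y||\<close>, and cancelling
  \<open>||y||\<close>, once at \<open>x\<close> and once at \<open>star x\<close>, yields both
  inequalities.\<close>

lemma nrm_star [simp]: "x \<in> carrier A \<Longrightarrow> nrm A (star A x) = nrm A x"
proof -
  have *: "nrm A y \<le> nrm A (star A y)" if y: "y \<in> carrier A" for y
  proof (cases "nrm A y = 0")
    case True then show ?thesis using y nrm_nonneg by auto
  next
    case False
    then have "nrm A y > 0" using nrm_nonneg[OF y] by simp
    moreover have "nrm A y * nrm A y \<le> nrm A (star A y) * nrm A y"
      using cstar_identity[OF y] nrm_mult[of "star A y" y] y by (simp add: power2_eq_square)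
    ultimately show ?thesis by simp
  qed
  assume x: "x \<in> carrier A"
  then show ?thesis using *[OF x] *[of "star A x"] by simp
qed

lemma cstar_identity': "x \<in> carrier A \<Longrightarrow> nrm A (x \<otimes>\<^bsub>A\<^esub> star A x) = (nrm A x)\<^sup>2"
  using cstar_identity[of "star A x"] by simp

lemma star_mult_self_eq_zero: "\<lbrakk>x \<in> carrier A; star A x \<otimes>\<^bsub>A\<^esub> x = \<zero>\<^bsub>A\<^esub>\<rbrakk> \<Longrightarrow> x = \<zero>\<^bsub>A\<^esub>"
  using cstar_identity[of x] nrm_eq_0[of x] by simp

text \<open>Taking \<open>z\<close> to be the adjoint of \<open>x - y\<close>, the C*-identity
  forces \<open>x = y\<close>. In an algebra without unit this replaces multiplication by one:
  identities about multipliers are proved by testing them on products.\<close>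

lemma left_cancel:
  assumes "x \<in> carrier A" "y \<in> carrier A" "\<And>z. z \<in> carrier A \<Longrightarrow> z \<otimes>\<^bsub>A\<^esub> x = z \<otimes>\<^bsub>A\<^esub> y"
  shows "x = y"
proof -
  have "star A (x \<ominus>\<^bsub>A\<^esub> y) \<otimes>\<^bsub>A\<^esub> (x \<ominus>\<^bsub>A\<^esub> y) = \<zero>\<^bsub>A\<^esub>"
    using assms by (simp add: minus_mult_right)
  then show ?thesis using star_mult_self_eq_zero[of "x \<ominus>\<^bsub>A\<^esub> y"] assms minus_eq_zero_iff by simp
qed

lemma right_cancel:
  assumes "x \<in> carrier A" "y \<in> carrier A" "\<And>z. z \<in> carrier A \<Longrightarrow> x \<otimes>\<^bsub>A\<^esub> z = y \<otimes>\<^bsub>A\<^esub> z"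
  shows "x = y"
proof -
  have "star A x = star A y"
  proof (rule left_cancel)
    fix z assume z: "z \<in> carrier A"
    show "z \<otimes>\<^bsub>A\<^esub> star A x = z \<otimes>\<^bsub>A\<^esub> star A y"
      using star_mult[of x "star A z"] star_mult[of y "star A z"] assms z by simp
  qed (use assms in auto)
  then show ?thesis using assms star_star by metis
qed

sublocale metric: Metric_space "carrier A" "cdist A"
proof
  show "0 \<le> cdist A x y" for x y by (simp add: cdist_def nrm_nonneg)
  show "cdist A x y = cdist A y x" for x y by (simp add: cdist_def nrm_minus_commute)
  show "cdist A x y = 0 \<longleftrightarrow> x = y" if "x \<in> carrier A" "y \<in> carrier A" for x y
    using that by (simp add: cdist_def nrm_eq_0 minus_eq_zero_iff)
  show "cdist A x z \<le> cdist A x y + cdist A y z"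
    if "x \<in> carrier A" "y \<in> carrier A" "z \<in> carrier A" for x y z
    using that by (simp add: cdist_def nrm_minus_triangle)
qed

lemma in_closure_of_iff:
  assumes "S \<subseteq> carrier A"
  shows "x \<in> norm_topology A closure_of S \<longleftrightarrow> x \<in> carrier A \<and> (\<forall>e>0. \<exists>y\<in>S. nrm A (x \<ominus>\<^bsub>A\<^esub> y) < e)"
  using assms unfolding norm_topology_def metric.metric_closure_of
  by (fastforce simp: cdist_def subset_iff)

lemma topspace_norm_topology [simp]: "topspace (norm_topology A) = carrier A"
  by (simp add: norm_topology_def)

lemma limitin_norm_iff:
  assumes "\<And>n. f n \<in> carrier A"
  shows "limitin (norm_topology A) f x F \<longleftrightarrow> x \<in> carrier A \<and> ((\<lambda>n. nrm A (f n \<ominus>\<^bsub>A\<^esub> x)) \<longlongrightarrow> 0) F"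
proof -
  have "limitin (norm_topology A) f x F \<longleftrightarrow>
      x \<in> carrier A \<and> (\<forall>e>0. \<forall>\<^sub>F n in F. f n \<in> carrier A \<and> cdist A (f n) x < e)"
    unfolding norm_topology_def by (rule metric.limitin_metric)
  also have "\<dots> \<longleftrightarrow> x \<in> carrier A \<and> ((\<lambda>n. nrm A (f n \<ominus>\<^bsub>A\<^esub> x)) \<longlongrightarrow> 0) F"
    using assms by (auto simp: tendsto_iff cdist_def nrm_nonneg)
  finally show ?thesis .
qed

text \<open>Later continuity proofs are norm estimates along the punctured filter
  \<open>at p\<close>; this reduces the topological definitions to that form.\<close>

lemma continuous_norm_iff:
  "continuous_map euclidean (norm_topology A) f \<longleftrightarrow>
    (\<forall>p. f p \<in> carrier A) \<and> (\<forall>p. ((\<lambda>q. nrm A (f q \<ominus>\<^bsub>A\<^esub> f p)) \<longlongrightarrow> 0) (at p))"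
proof (cases "\<forall>p. f p \<in> carrier A")
  case True
  then show ?thesis
    by (simp add: continuous_map_atin limitin_norm_iff atin_euclidean)
next
  case False
  then show ?thesis
    using continuous_map_image_subset_topspace[of euclidean "norm_topology A" f] by auto
qed

lemma Cauchy_converges:
  fixes s :: "nat \<Rightarrow> 'a"
  assumes "\<And>n. s n \<in> carrier A"
    and "\<And>e. e > 0 \<Longrightarrow> \<exists>N. \<forall>m\<ge>N. \<forall>n\<ge>N. nrm A (s m \<ominus>\<^bsub>A\<^esub> s n) < e"
  obtains x where "x \<in> carrier A" "(\<lambda>n. nrm A (s n \<ominus>\<^bsub>A\<^esub> x)) \<longlonglongrightarrow> 0"
proof -
  have "metric.MCauchy s"
    using assms unfolding metric.MCauchy_def by (fastforce simp: cdist_def)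
  then obtain x where "limitin metric.mtopology s x sequentially"
    using complete unfolding metric.mcomplete_def by blast
  then show ?thesis
    using that limitin_norm_iff[of s x sequentially] assms by (auto simp: norm_topology_def)
qed

lemma limit_unique:
  assumes "\<And>n. s n \<in> carrier A" "x \<in> carrier A" "y \<in> carrier A" "F \<noteq> bot"
    and x: "((\<lambda>n. nrm A (s n \<ominus>\<^bsub>A\<^esub> x)) \<longlongrightarrow> 0) F" and y: "((\<lambda>n. nrm A (s n \<ominus>\<^bsub>A\<^esub> y)) \<longlongrightarrow> 0) F"
  shows "x = y"
proof -
  have "((\<lambda>n. nrm A (s n \<ominus>\<^bsub>A\<^esub> x) + nrm A (s n \<ominus>\<^bsub>A\<^esub> y)) \<longlongrightarrow> 0) F"
    using tendsto_add[OF x y] by simp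
  moreover have "nrm A (x \<ominus>\<^bsub>A\<^esub> y) \<le> nrm A (s n \<ominus>\<^bsub>A\<^esub> x) + nrm A (s n \<ominus>\<^bsub>A\<^esub> y)" for n
    using nrm_minus_triangle[of x "s n" y] assms nrm_minus_commute[of x "s n"] by simp
  ultimately have "nrm A (x \<ominus>\<^bsub>A\<^esub> y) \<le> 0"
    using assms(4) by (intro tendsto_lowerbound[of _ 0 F]) auto
  then show ?thesis using assms nrm_nonneg[of "x \<ominus>\<^bsub>A\<^esub> y"] nrm_eq_0 minus_eq_zero_iff by auto
qed

end


text \<open>Differences appear as \<open>x \<oplus> (-1) \<odot> y\<close> because
  \<open>\<ominus>\<close> is a definite description over the carrier: it is awkward before the
  additive group is established, and it changes when the carrier is cut down to a
  subalgebra.\<close>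

lemma cstar_algebraI:
  fixes A :: "'a cstar" (structure)
  assumes add_closed: "\<And>x y. \<lbrakk>x \<in> carrier A; y \<in> carrier A\<rbrakk> \<Longrightarrow> x \<oplus> y \<in> carrier A"
    and zero_closed: "\<zero> \<in> carrier A"
    and add_assoc: "\<And>x y z. \<lbrakk>x \<in> carrier A; y \<in> carrier A; z \<in> carrier A\<rbrakk> \<Longrightarrow> (x \<oplus> y) \<oplus> z = x \<oplus> (y \<oplus> z)"
    and add_commute: "\<And>x y. \<lbrakk>x \<in> carrier A; y \<in> carrier A\<rbrakk> \<Longrightarrow> x \<oplus> y = y \<oplus> x"
    and zero_add: "\<And>x. x \<in> carrier A \<Longrightarrow> \<zero> \<oplus> x = x"
    and smult_closed: "\<And>c x. x \<in> carrier A \<Longrightarrow> c \<odot> x \<in> carrier A"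
    and smult_plus_left: "\<And>c d x. x \<in> carrier A \<Longrightarrow> (c + d) \<odot> x = c \<odot> x \<oplus> d \<odot> x"
    and smult_plus_right:
      "\<And>c x y. \<lbrakk>x \<in> carrier A; y \<in> carrier A\<rbrakk> \<Longrightarrow> c \<odot> (x \<oplus> y) = c \<odot> x \<oplus> c \<odot> y"
    and smult_smult: "\<And>c d x. x \<in> carrier A \<Longrightarrow> (c * d) \<odot> x = c \<odot> (d \<odot> x)"
    and smult_1: "\<And>x. x \<in> carrier A \<Longrightarrow> 1 \<odot> x = x"
    and smult_0: "\<And>x. x \<in> carrier A \<Longrightarrow> 0 \<odot> x = \<zero>"
    and mult_closed: "\<And>x y. \<lbrakk>x \<in> carrier A; y \<in> carrier A\<rbrakk> \<Longrightarrow> x \<otimes> y \<in> carrier A"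
    and mult_assoc: "\<And>x y z. \<lbrakk>x \<in> carrier A; y \<in> carrier A; z \<in> carrier A\<rbrakk> \<Longrightarrow> (x \<otimes> y) \<otimes> z = x \<otimes> (y \<otimes> z)"
    and mult_l_distr:
      "\<And>x y z. \<lbrakk>x \<in> carrier A; y \<in> carrier A; z \<in> carrier A\<rbrakk> \<Longrightarrow> (x \<oplus> y) \<otimes> z = (x \<otimes> z) \<oplus> (y \<otimes> z)"
    and mult_r_distr:
      "\<And>x y z. \<lbrakk>x \<in> carrier A; y \<in> carrier A; z \<in> carrier A\<rbrakk> \<Longrightarrow> x \<otimes> (y \<oplus> z) = (x \<otimes> y) \<oplus> (x \<otimes> z)"
    and smult_mult_left: "\<And>c x y. \<lbrakk>x \<in> carrier A; y \<in> carrier A\<rbrakk> \<Longrightarrow> (c \<odot> x) \<otimes> y = c \<odot> (x \<otimes> y)"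
    and smult_mult_right: "\<And>c x y. \<lbrakk>x \<in> carrier A; y \<in> carrier A\<rbrakk> \<Longrightarrow> x \<otimes> (c \<odot> y) = c \<odot> (x \<otimes> y)"
    and star_closed: "\<And>x. x \<in> carrier A \<Longrightarrow> star A x \<in> carrier A"
    and star_star: "\<And>x. x \<in> carrier A \<Longrightarrow> star A (star A x) = x"
    and star_add: "\<And>x y. \<lbrakk>x \<in> carrier A; y \<in> carrier A\<rbrakk> \<Longrightarrow> star A (x \<oplus> y) = star A x \<oplus> star A y"
    and star_smult: "\<And>c x. x \<in> carrier A \<Longrightarrow> star A (c \<odot> x) = cnj c \<odot> star A x"
    and star_mult: "\<And>x y. \<lbrakk>x \<in> carrier A; y \<in> carrier A\<rbrakk> \<Longrightarrow> star A (x \<otimes> y) = star A y \<otimes> star A x"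
    and nrm_nonneg: "\<And>x. x \<in> carrier A \<Longrightarrow> 0 \<le> nrm A x"
    and nrm_eq_0: "\<And>x. x \<in> carrier A \<Longrightarrow> nrm A x = 0 \<longleftrightarrow> x = \<zero>"
    and nrm_triangle: "\<And>x y. \<lbrakk>x \<in> carrier A; y \<in> carrier A\<rbrakk> \<Longrightarrow> nrm A (x \<oplus> y) \<le> nrm A x + nrm A y"
    and nrm_smult: "\<And>c x. x \<in> carrier A \<Longrightarrow> nrm A (c \<odot> x) = cmod c * nrm A x"
    and nrm_mult: "\<And>x y. \<lbrakk>x \<in> carrier A; y \<in> carrier A\<rbrakk> \<Longrightarrow> nrm A (x \<otimes> y) \<le> nrm A x * nrm A y"
    and cstar_identity: "\<And>x. x \<in> carrier A \<Longrightarrow> nrm A (star A x \<otimes> x) = (nrm A x)\<^sup>2"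
    and complete: "\<And>s :: nat \<Rightarrow> 'a. \<lbrakk>\<And>n. s n \<in> carrier A;
        \<And>e. e > 0 \<Longrightarrow> \<exists>N. \<forall>m\<ge>N. \<forall>n\<ge>N. nrm A (s m \<oplus> (-1) \<odot> s n) < e\<rbrakk> \<Longrightarrow>
        \<exists>x\<in>carrier A. (\<lambda>n. nrm A (s n \<oplus> (-1) \<odot> x)) \<longlonglongrightarrow> 0"
  shows "cstar_algebra A"
proof -
  have neg: "(-1) \<odot> x \<oplus> x = \<zero>" if "x \<in> carrier A" for x
    using smult_plus_left[of x "-1" 1] that by (simp add: smult_0 smult_1)
  have ag: "abelian_group A"
  proof (rule abelian_groupI)
    show "\<exists>y\<in>carrier A. y \<oplus> x = \<zero>" if "x \<in> carrier A" for x
      using neg[OF that] smult_closed[OF that] by blast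
  qed (use add_closed zero_closed add_assoc add_commute zero_add in auto)
  then interpret M: abelian_group A .
  have um: "\<ominus> x = (-1) \<odot> x" if "x \<in> carrier A" for x
    using neg that smult_closed by (intro M.minus_equality) auto
  have minus: "x \<ominus> y = x \<oplus> (-1) \<odot> y" if "x \<in> carrier A" "y \<in> carrier A" for x y
    using that by (simp add: a_minus_def um)
  interpret metric: Metric_space "carrier A" "cdist A"
  proof
    show "0 \<le> cdist A x y" for x y by (simp add: cdist_def nrm_nonneg)
    show "cdist A x y = cdist A y x" for x y
    proof (cases "x \<in> carrier A \<and> y \<in> carrier A")
      case True
      then have "x \<ominus> y = (-1) \<odot> (y \<ominus> x)"
        by (simp add: minus smult_plus_right smult_smult[symmetric] smult_closed M.a_comm smult_1)
      then show ?thesis using True nrm_smult[of "y \<ominus> x" "-1"] by (simp add: cdist_def)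
    qed (auto simp: cdist_def)
    show "cdist A x y = 0 \<longleftrightarrow> x = y" if "x \<in> carrier A" "y \<in> carrier A" for x y
    proof -
      have "x \<ominus> y = \<zero> \<longleftrightarrow> x = y"
        using that by (metis M.minus_equality M.minus_minus M.a_inv_closed M.r_neg a_minus_def)
      then show ?thesis using that by (simp add: cdist_def nrm_eq_0)
    qed
    show "cdist A x z \<le> cdist A x y + cdist A y z"
      if "x \<in> carrier A" "y \<in> carrier A" "z \<in> carrier A" for x y z
    proof -
      have "(x \<ominus> y) \<oplus> (y \<ominus> z) = x \<ominus> z"
        using that by (simp add: a_minus_def M.a_assoc) (simp add: M.a_assoc[symmetric] M.l_neg)
      then show ?thesis using that nrm_triangle[of "x \<ominus> y" "y \<ominus> z"] by (simp add: cdist_def)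
    qed
  qed
  have "metric.mcomplete"
    unfolding metric.mcomplete_def
  proof (intro allI impI)
    fix s assume s: "metric.MCauchy s"
    then have car: "s n \<in> carrier A" for n by (auto simp: metric.MCauchy_def)
    have "\<exists>x\<in>carrier A. (\<lambda>n. nrm A (s n \<oplus> (-1) \<odot> x)) \<longlonglongrightarrow> 0"
    proof (rule complete)
      show "\<exists>N. \<forall>m\<ge>N. \<forall>n\<ge>N. nrm A (s m \<oplus> (-1) \<odot> s n) < e" if "e > 0" for e
        using s that car unfolding metric.MCauchy_def by (simp add: cdist_def minus)
    qed (rule car)
    then obtain x where x: "x \<in> carrier A" "(\<lambda>n. nrm A (s n \<oplus> (-1) \<odot> x)) \<longlonglongrightarrow> 0" by blast
    then have "limitin metric.mtopology s x sequentially"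
      unfolding metric.limitin_metric using car
      by (auto simp: tendsto_iff cdist_def minus nrm_nonneg add_closed smult_closed)
    then show "\<exists>x. limitin metric.mtopology s x sequentially" ..
  qed
  moreover have "Module.module (ring_of_type_algebra :: complex ring) A"
    by (rule moduleI)
      (auto simp: ring_of_type_algebra_def smult_plus_left smult_plus_right smult_smult smult_1
        smult_closed ag intro: cring_from_type_algebra[unfolded ring_of_type_algebra_def])
  ultimately show ?thesis
    by (intro cstar_algebra.intro cstar_algebra_axioms.intro)
      (use assms in auto)
qed

section \<open>Closed linear spans\<close>

text \<open>There is no rule for scalars because the generating sets in use, such as all
  \<open>\<phi>(a) b\<close>, are themselves stable under scalars. Being inductive, the span
  supports proofs that pass from generators to sums and then to limits.\<close>

inductive_set clspan :: "'a cstar \<Rightarrow> 'a set \<Rightarrow> 'a set" for A :: "'a cstar" and S :: "'a set" where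
  clspan_base: "x \<in> S \<Longrightarrow> x \<in> clspan A S"
| clspan_add: "\<lbrakk>x \<in> clspan A S; y \<in> clspan A S\<rbrakk> \<Longrightarrow> x \<oplus>\<^bsub>A\<^esub> y \<in> clspan A S"
| clspan_limit: "\<lbrakk>x \<in> carrier A; \<And>e::real. e > 0 \<Longrightarrow> \<exists>y. y \<in> clspan A S \<and> nrm A (x \<ominus>\<^bsub>A\<^esub> y) < e\<rbrakk> \<Longrightarrow>
    x \<in> clspan A S"

context cstar_algebra
begin

lemma clspan_carrier:
  assumes "S \<subseteq> carrier A" "x \<in> clspan A S"
  shows "x \<in> carrier A"
  using assms(2) by induction (use assms(1) in auto)

lemma clspan_eqI:
  assumes "x \<in> clspan A S" "S \<subseteq> carrier A" "cstar_algebra B"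
    and f: "\<And>x. x \<in> carrier A \<Longrightarrow> f x \<in> carrier B" and g: "\<And>x. x \<in> carrier A \<Longrightarrow> g x \<in> carrier B"
    and fadd: "\<And>x y. \<lbrakk>x \<in> carrier A; y \<in> carrier A\<rbrakk> \<Longrightarrow> f (x \<oplus>\<^bsub>A\<^esub> y) = f x \<oplus>\<^bsub>B\<^esub> f y"
    and gadd: "\<And>x y. \<lbrakk>x \<in> carrier A; y \<in> carrier A\<rbrakk> \<Longrightarrow> g (x \<oplus>\<^bsub>A\<^esub> y) = g x \<oplus>\<^bsub>B\<^esub> g y"
    and fK: "\<And>x y. \<lbrakk>x \<in> carrier A; y \<in> carrier A\<rbrakk> \<Longrightarrow> nrm B (f x \<ominus>\<^bsub>B\<^esub> f y) \<le> K * nrm A (x \<ominus>\<^bsub>A\<^esub> y)"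
    and gK: "\<And>x y. \<lbrakk>x \<in> carrier A; y \<in> carrier A\<rbrakk> \<Longrightarrow> nrm B (g x \<ominus>\<^bsub>B\<^esub> g y) \<le> L * nrm A (x \<ominus>\<^bsub>A\<^esub> y)"
    and eq: "\<And>x. x \<in> S \<Longrightarrow> f x = g x"
  shows "f x = g x"
  using assms(1)
proof induction
  case (clspan_limit x)
  interpret B: cstar_algebra B by fact
  have "nrm B (f x \<ominus>\<^bsub>B\<^esub> g x) \<le> 0 + e" if "e > 0" for e
  proof -
    \<comment> \<open>The Lipschitz constants are arbitrary reals, so absolute values and the
      summand 1 keep the denominator positive.\<close>
    define d where "d = e / (\<bar>K\<bar> + \<bar>L\<bar> + 1)"
    have "d > 0" using that by (simp add: d_def)
    then obtain y where y: "y \<in> clspan A S" "nrm A (x \<ominus>\<^bsub>A\<^esub> y) < d" "f y = g y"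
      using clspan_limit.IH by blast
    have yc: "y \<in> carrier A" using clspan_carrier[OF assms(2)] y by blast
    have "nrm B (f x \<ominus>\<^bsub>B\<^esub> g x) \<le> nrm B (f x \<ominus>\<^bsub>B\<^esub> f y) + nrm B (f y \<ominus>\<^bsub>B\<^esub> g x)"
      using clspan_limit.hyps yc f g by (intro B.nrm_minus_triangle) auto
    also have "\<dots> \<le> K * nrm A (x \<ominus>\<^bsub>A\<^esub> y) + L * nrm A (x \<ominus>\<^bsub>A\<^esub> y)"
      using fK[OF clspan_limit.hyps yc] gK[OF clspan_limit.hyps yc] y(3)
        B.nrm_minus_commute[OF f g, of y x] clspan_limit.hyps yc g by (simp add: B.nrm_minus_commute)
    also have "\<dots> \<le> (\<bar>K\<bar> + \<bar>L\<bar> + 1) * nrm A (x \<ominus>\<^bsub>A\<^esub> y)"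
    proof -
      have n: "0 \<le> nrm A (x \<ominus>\<^bsub>A\<^esub> y)" using nrm_nonneg clspan_limit.hyps yc by simp
      show ?thesis
        using mult_right_mono[OF abs_ge_self n, of K] mult_right_mono[OF abs_ge_self n, of L] n
        unfolding distrib_right by linarith
    qed
    also have "\<dots> \<le> e"
      using y(2) by (simp add: d_def field_simps)
    finally show ?thesis by simp
  qed
  then have "nrm B (f x \<ominus>\<^bsub>B\<^esub> g x) \<le> 0" by (rule field_le_epsilon)
  then show ?case
    using f g clspan_limit.hyps B.nrm_nonneg[of "f x \<ominus>\<^bsub>B\<^esub> g x"] B.nrm_eq_0 B.minus_eq_zero_iff by auto
qed (use assms clspan_carrier[OF assms(2)] in auto)

text \<open>The lemmas on scalars, one-sided products and adjoints below are instances for the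
  corresponding additive Lipschitz map.\<close>

lemma clspan_map:
  assumes "x \<in> clspan A S" "S \<subseteq> carrier A"
    and f: "\<And>x. x \<in> carrier A \<Longrightarrow> f x \<in> carrier B"
    and fadd: "\<And>x y. \<lbrakk>x \<in> carrier A; y \<in> carrier A\<rbrakk> \<Longrightarrow> f (x \<oplus>\<^bsub>A\<^esub> y) = f x \<oplus>\<^bsub>B\<^esub> f y"
    and fK: "\<And>x y. \<lbrakk>x \<in> carrier A; y \<in> carrier A\<rbrakk> \<Longrightarrow> nrm B (f x \<ominus>\<^bsub>B\<^esub> f y) \<le> K * nrm A (x \<ominus>\<^bsub>A\<^esub> y)"
    and fS: "\<And>x. x \<in> S \<Longrightarrow> f x \<in> clspan B T"
  shows "f x \<in> clspan B T"
  using assms(1)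
proof induction
  case (clspan_limit x)
  show ?case
  proof (rule clspan.clspan_limit)
    fix e :: real assume e: "e > 0"
    define d where "d = e / (\<bar>K\<bar> + 1)"
    have "d > 0" using e by (simp add: d_def)
    then obtain y where y: "y \<in> clspan A S" "nrm A (x \<ominus>\<^bsub>A\<^esub> y) < d" "f y \<in> clspan B T"
      using clspan_limit.IH by blast
    have yc: "y \<in> carrier A" using clspan_carrier[OF assms(2)] y by blast
    have "nrm B (f x \<ominus>\<^bsub>B\<^esub> f y) \<le> (\<bar>K\<bar> + 1) * nrm A (x \<ominus>\<^bsub>A\<^esub> y)"
      using fK[OF clspan_limit.hyps yc] nrm_nonneg[of "x \<ominus>\<^bsub>A\<^esub> y"] clspan_limit.hyps yc
      by (smt (verit) mult_right_mono minus_carrier)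
    also have "\<dots> < e" using y(2) by (simp add: d_def field_simps)
    finally show "\<exists>z. z \<in> clspan B T \<and> nrm B (f x \<ominus>\<^bsub>B\<^esub> z) < e" using y by blast
  qed (use f clspan_limit in auto)
next
  case (clspan_add x y)
  then show ?case
    using fadd[of x y] clspan_carrier[OF assms(2)] by (simp add: clspan.clspan_add)
qed (use fS in auto)

lemma clspan_mono: "\<lbrakk>x \<in> clspan A S; S \<subseteq> carrier A; S \<subseteq> clspan A T\<rbrakk> \<Longrightarrow> x \<in> clspan A T"
  by (erule clspan_map[where f = "\<lambda>x. x" and K = 1]) auto

lemma clspan_smult:
  assumes "S \<subseteq> carrier A" "\<And>c x. x \<in> S \<Longrightarrow> c \<odot>\<^bsub>A\<^esub> x \<in> S" "x \<in> clspan A S"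
  shows "c \<odot>\<^bsub>A\<^esub> x \<in> clspan A S"
  using assms(3,1)
  by (rule clspan_map[where K = "cmod c"])
    (auto simp: smult_plus_right nrm_smult clspan_base assms simp flip: smult_minus_right)

lemma clspan_mult_left:
  assumes "S \<subseteq> carrier A" "a \<in> carrier A" "\<And>x. x \<in> S \<Longrightarrow> a \<otimes>\<^bsub>A\<^esub> x \<in> clspan A T" "x \<in> clspan A S"
  shows "a \<otimes>\<^bsub>A\<^esub> x \<in> clspan A T"
  using assms(4,1)
  by (rule clspan_map[where K = "nrm A a"])
    (use assms in \<open>auto simp: mult_r_distr nrm_mult simp flip: minus_mult_right\<close>)

lemma clspan_mult_right:
  assumes "S \<subseteq> carrier A" "a \<in> carrier A" "\<And>x. x \<in> S \<Longrightarrow> x \<otimes>\<^bsub>A\<^esub> a \<in> clspan A T" "x \<in> clspan A S"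
  shows "x \<otimes>\<^bsub>A\<^esub> a \<in> clspan A T"
  using assms(4,1)
proof (rule clspan_map[where K = "nrm A a"])
  fix x y assume "x \<in> carrier A" "y \<in> carrier A"
  then show "nrm A (x \<otimes>\<^bsub>A\<^esub> a \<ominus>\<^bsub>A\<^esub> y \<otimes>\<^bsub>A\<^esub> a) \<le> nrm A a * nrm A (x \<ominus>\<^bsub>A\<^esub> y)"
    using nrm_mult[of "x \<ominus>\<^bsub>A\<^esub> y" a] assms(2) by (simp add: minus_mult_left mult.commute)
qed (use assms in \<open>auto simp: mult_l_distr\<close>)

lemma clspan_mult:
  assumes "S \<subseteq> carrier A" "\<And>x y. \<lbrakk>x \<in> S; y \<in> S\<rbrakk> \<Longrightarrow> x \<otimes>\<^bsub>A\<^esub> y \<in> clspan A S"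
    and x: "x \<in> clspan A S" and y: "y \<in> clspan A S"
  shows "x \<otimes>\<^bsub>A\<^esub> y \<in> clspan A S"
  using clspan_carrier[OF assms(1)] assms
  by (intro clspan_mult_right[OF assms(1) _ _ x] clspan_mult_left[OF assms(1) _ _ y]) auto

lemma clspan_star:
  assumes "S \<subseteq> carrier A" "\<And>x. x \<in> S \<Longrightarrow> star A x \<in> clspan A S" "x \<in> clspan A S"
  shows "star A x \<in> clspan A S"
  using assms(3,1)
  by (rule clspan_map[where K = 1]) (use assms in \<open>auto simp: star_add simp flip: star_minus\<close>)

text \<open>One constant \<open>K\<close> serves all parameters \<open>p\<close>, so the family is
  equicontinuous and convergence on the generators passes to their closed span by splitting the
  error into three parts.\<close>

lemma clspan_continuous:
  fixes F :: "'p \<Rightarrow> 'a \<Rightarrow> 'b"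
  assumes B: "cstar_algebra B" and "x \<in> clspan A S" "S \<subseteq> carrier A"
    and F: "\<And>p x. x \<in> carrier A \<Longrightarrow> F p x \<in> carrier B"
    and add: "\<And>p x y. \<lbrakk>x \<in> carrier A; y \<in> carrier A\<rbrakk> \<Longrightarrow> F p (x \<oplus>\<^bsub>A\<^esub> y) = F p x \<oplus>\<^bsub>B\<^esub> F p y"
    and K: "\<And>p x y. \<lbrakk>x \<in> carrier A; y \<in> carrier A\<rbrakk> \<Longrightarrow>
      nrm B (F p x \<ominus>\<^bsub>B\<^esub> F p y) \<le> K * nrm A (x \<ominus>\<^bsub>A\<^esub> y)"
    and S: "\<And>x. x \<in> S \<Longrightarrow> ((\<lambda>q. nrm B (F q x \<ominus>\<^bsub>B\<^esub> F p x)) \<longlongrightarrow> 0) Z"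
  shows "((\<lambda>q. nrm B (F q x \<ominus>\<^bsub>B\<^esub> F p x)) \<longlongrightarrow> 0) Z"
  using assms(2)
proof induction
  case (clspan_base x)
  then show ?case by (rule S)
next
  case (clspan_add x y)
  interpret B: cstar_algebra B by fact
  have xy: "x \<in> carrier A" "y \<in> carrier A" using clspan_add clspan_carrier[OF assms(3)] by auto
  show ?case
  proof (rule tendsto_sandwich[OF _ _ tendsto_const])
    show "((\<lambda>q. nrm B (F q x \<ominus>\<^bsub>B\<^esub> F p x) + nrm B (F q y \<ominus>\<^bsub>B\<^esub> F p y)) \<longlongrightarrow> 0) Z"
      using tendsto_add[OF clspan_add.IH] by simp
  qed (use xy in \<open>auto simp: B.nrm_nonneg F add B.add_minus_add B.nrm_triangle\<close>)
next
  case (clspan_limit x)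
  interpret B: cstar_algebra B by fact
  show ?case
  proof (rule tendstoI)
    fix e :: real assume e: "e > 0"
    define d where "d = e / (3 * (\<bar>K\<bar> + 1))"
    have "d > 0" using e by (simp add: d_def)
    then obtain y where y: "y \<in> clspan A S" "nrm A (x \<ominus>\<^bsub>A\<^esub> y) < d"
        "((\<lambda>q. nrm B (F q y \<ominus>\<^bsub>B\<^esub> F p y)) \<longlongrightarrow> 0) Z"
      using clspan_limit.IH by blast
    have yc: "y \<in> carrier A" using clspan_carrier[OF assms(3)] y by blast
    have x: "x \<in> carrier A" by fact
    have small: "nrm B (F q x \<ominus>\<^bsub>B\<^esub> F q y) < e / 3" for q
    proof -
      have "nrm B (F q x \<ominus>\<^bsub>B\<^esub> F q y) \<le> (\<bar>K\<bar> + 1) * nrm A (x \<ominus>\<^bsub>A\<^esub> y)"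
        using K[OF x yc, of q] nrm_nonneg[of "x \<ominus>\<^bsub>A\<^esub> y"] x yc
        by (smt (verit) mult_right_mono minus_carrier)
      also have "\<dots> < e / 3" using y(2) by (simp add: d_def field_simps)
      finally show ?thesis .
    qed
    have "\<forall>\<^sub>F q in Z. nrm B (F q y \<ominus>\<^bsub>B\<^esub> F p y) < e / 3"
      using tendstoD[OF y(3), of "e / 3"] e by (auto elim!: eventually_mono)
    then show "\<forall>\<^sub>F q in Z. dist (nrm B (F q x \<ominus>\<^bsub>B\<^esub> F p x)) 0 < e"
    proof (rule eventually_mono)
      fix q assume q: "nrm B (F q y \<ominus>\<^bsub>B\<^esub> F p y) < e / 3"
      have "nrm B (F q x \<ominus>\<^bsub>B\<^esub> F p x) \<le> nrm B (F q x \<ominus>\<^bsub>B\<^esub> F q y) + nrm B (F q y \<ominus>\<^bsub>B\<^esub> F p x)"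
        using x yc F by (intro B.nrm_minus_triangle) auto
      also have "nrm B (F q y \<ominus>\<^bsub>B\<^esub> F p x) \<le> nrm B (F q y \<ominus>\<^bsub>B\<^esub> F p y) + nrm B (F p y \<ominus>\<^bsub>B\<^esub> F p x)"
        using x yc F by (intro B.nrm_minus_triangle) auto
      finally show "dist (nrm B (F q x \<ominus>\<^bsub>B\<^esub> F p x)) 0 < e"
        using q small[of q] small[of p] B.nrm_minus_commute[of "F p y" "F p x"] x yc F
          B.nrm_nonneg[of "F q x \<ominus>\<^bsub>B\<^esub> F p x"] by simp
    qed
  qed
qed

end

section \<open>Norm-closed star-subalgebras\<close>

context cstar_algebra
begin

lemma subalgebra:
  assumes H: "H \<subseteq> carrier A" "\<zero>\<^bsub>A\<^esub> \<in> H"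
    and add: "\<And>x y. \<lbrakk>x \<in> H; y \<in> H\<rbrakk> \<Longrightarrow> x \<oplus>\<^bsub>A\<^esub> y \<in> H"
    and smult: "\<And>c x. x \<in> H \<Longrightarrow> c \<odot>\<^bsub>A\<^esub> x \<in> H"
    and mult: "\<And>x y. \<lbrakk>x \<in> H; y \<in> H\<rbrakk> \<Longrightarrow> x \<otimes>\<^bsub>A\<^esub> y \<in> H"
    and star: "\<And>x. x \<in> H \<Longrightarrow> star A x \<in> H"
    and limit: "\<And>x. \<lbrakk>x \<in> carrier A; \<And>e::real. e > 0 \<Longrightarrow> \<exists>y. y \<in> H \<and> nrm A (x \<ominus>\<^bsub>A\<^esub> y) < e\<rbrakk> \<Longrightarrow> x \<in> H"
  shows "cstar_algebra (A\<lparr>carrier := H\<rparr>)"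
proof (rule cstar_algebraI)
  have [simp, intro]: "x \<in> carrier A" if "x \<in> H" for x using that H by blast
  fix s :: "nat \<Rightarrow> 'a"
  assume s: "\<And>n. s n \<in> carrier (A\<lparr>carrier := H\<rparr>)"
    and C: "\<And>e. e > 0 \<Longrightarrow> \<exists>N. \<forall>m\<ge>N. \<forall>n\<ge>N. nrm (A\<lparr>carrier := H\<rparr>)
      (s m \<oplus>\<^bsub>A\<lparr>carrier := H\<rparr>\<^esub> (-1) \<odot>\<^bsub>A\<lparr>carrier := H\<rparr>\<^esub> s n) < e"
  have sH: "s n \<in> H" for n using s by simp
  then have sA: "s n \<in> carrier A" for n by blast
  have "\<exists>N. \<forall>m\<ge>N. \<forall>n\<ge>N. nrm A (s m \<ominus>\<^bsub>A\<^esub> s n) < e" if "e > 0" for e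
    using C[OF that] sA by (simp add: minus_eq_smult)
  then obtain x where x: "x \<in> carrier A" "(\<lambda>n. nrm A (s n \<ominus>\<^bsub>A\<^esub> x)) \<longlonglongrightarrow> 0"
    using Cauchy_converges[of s] sA by blast
  have "x \<in> H"
  proof (rule limit)
    fix e :: real assume "e > 0"
    then have "\<forall>\<^sub>F n in sequentially. nrm A (s n \<ominus>\<^bsub>A\<^esub> x) < e"
      using order_tendstoD(2)[OF x(2)] by blast
    then obtain n where "nrm A (s n \<ominus>\<^bsub>A\<^esub> x) < e"
      using eventually_happens by fastforce
    then show "\<exists>y. y \<in> H \<and> nrm A (x \<ominus>\<^bsub>A\<^esub> y) < e"
      using sH sA x(1) nrm_minus_commute by metis
  qed fact
  moreover have "(\<lambda>n. nrm A (s n \<oplus>\<^bsub>A\<^esub> (-1) \<odot>\<^bsub>A\<^esub> x)) \<longlonglongrightarrow> 0"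
    using x sA by (simp add: minus_eq_smult)
  ultimately show "\<exists>x\<in>carrier (A\<lparr>carrier := H\<rparr>). (\<lambda>n. nrm (A\<lparr>carrier := H\<rparr>)
      (s n \<oplus>\<^bsub>A\<lparr>carrier := H\<rparr>\<^esub> (-1) \<odot>\<^bsub>A\<lparr>carrier := H\<rparr>\<^esub> x)) \<longlonglongrightarrow> 0"
    by auto
next
  show "x \<oplus>\<^bsub>A\<lparr>carrier := H\<rparr>\<^esub> y = y \<oplus>\<^bsub>A\<lparr>carrier := H\<rparr>\<^esub> x"
    if "x \<in> carrier (A\<lparr>carrier := H\<rparr>)" "y \<in> carrier (A\<lparr>carrier := H\<rparr>)" for x y
    using that H M.a_comm by auto
qed (use assms in \<open>auto simp: subset_iff M.a_assoc smult_plus_left smult_plus_right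
    smult_smult mult_assoc mult_l_distr mult_r_distr smult_mult_left smult_mult_right star_add
    star_smult star_mult nrm_nonneg nrm_eq_0 nrm_triangle nrm_smult nrm_mult cstar_identity\<close>)

text \<open>The two differences use inverses taken in different carriers; they are compared after
  both are written as \<open>x \<oplus> (-1) \<odot> y\<close>.\<close>

lemma minus_subalgebra:
  assumes "cstar_algebra (A\<lparr>carrier := H\<rparr>)" "H \<subseteq> carrier A" "x \<in> H" "y \<in> H"
  shows "x \<ominus>\<^bsub>A\<lparr>carrier := H\<rparr>\<^esub> y = x \<ominus>\<^bsub>A\<^esub> y"
  using cstar_algebra.minus_eq_smult[OF assms(1), of x y] minus_eq_smult[of x y] assms(2-)
  by (simp add: subset_iff)

end

section \<open>The multiplier algebra is a unital C*-algebra\<close>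

lemma mult_alg_simps:
  "carrier (mult_alg A) = double_centralizers A"
  "x \<in> carrier A \<Longrightarrow> fst (m \<otimes>\<^bsub>mult_alg A\<^esub> n) x = fst m (fst n x)"
  "x \<in> carrier A \<Longrightarrow> snd (m \<otimes>\<^bsub>mult_alg A\<^esub> n) x = snd n (snd m x)"
  "x \<in> carrier A \<Longrightarrow> fst (m \<oplus>\<^bsub>mult_alg A\<^esub> n) x = fst m x \<oplus>\<^bsub>A\<^esub> fst n x"
  "x \<in> carrier A \<Longrightarrow> snd (m \<oplus>\<^bsub>mult_alg A\<^esub> n) x = snd m x \<oplus>\<^bsub>A\<^esub> snd n x"
  "x \<in> carrier A \<Longrightarrow> fst (c \<odot>\<^bsub>mult_alg A\<^esub> n) x = c \<odot>\<^bsub>A\<^esub> fst n x"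
  "x \<in> carrier A \<Longrightarrow> snd (c \<odot>\<^bsub>mult_alg A\<^esub> n) x = c \<odot>\<^bsub>A\<^esub> snd n x"
  "x \<in> carrier A \<Longrightarrow> fst \<zero>\<^bsub>mult_alg A\<^esub> x = \<zero>\<^bsub>A\<^esub>"
  "x \<in> carrier A \<Longrightarrow> snd \<zero>\<^bsub>mult_alg A\<^esub> x = \<zero>\<^bsub>A\<^esub>"
  "x \<in> carrier A \<Longrightarrow> fst \<one>\<^bsub>mult_alg A\<^esub> x = x"
  "x \<in> carrier A \<Longrightarrow> snd \<one>\<^bsub>mult_alg A\<^esub> x = x"
  "x \<in> carrier A \<Longrightarrow> fst (star (mult_alg A) m) x = star A (snd m (star A x))"
  "x \<in> carrier A \<Longrightarrow> snd (star (mult_alg A) m) x = star A (fst m (star A x))"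
  "nrm (mult_alg A) m = (SUP x\<in>{x \<in> carrier A. nrm A x \<le> 1}. nrm A (fst m x))"
  by (simp_all add: mult_alg_def case_prod_beta)

lemma mult_alg_eqs:
  "m \<otimes>\<^bsub>mult_alg A\<^esub> n = (\<lambda>x\<in>carrier A. fst m (fst n x), \<lambda>x\<in>carrier A. snd n (snd m x))"
  "m \<oplus>\<^bsub>mult_alg A\<^esub> n = (\<lambda>x\<in>carrier A. fst m x \<oplus>\<^bsub>A\<^esub> fst n x, \<lambda>x\<in>carrier A. snd m x \<oplus>\<^bsub>A\<^esub> snd n x)"
  "c \<odot>\<^bsub>mult_alg A\<^esub> n = (\<lambda>x\<in>carrier A. c \<odot>\<^bsub>A\<^esub> fst n x, \<lambda>x\<in>carrier A. c \<odot>\<^bsub>A\<^esub> snd n x)"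
  "\<zero>\<^bsub>mult_alg A\<^esub> = (\<lambda>x\<in>carrier A. \<zero>\<^bsub>A\<^esub>, \<lambda>x\<in>carrier A. \<zero>\<^bsub>A\<^esub>)"
  "\<one>\<^bsub>mult_alg A\<^esub> = (\<lambda>x\<in>carrier A. x, \<lambda>x\<in>carrier A. x)"
  "star (mult_alg A) m =
    (\<lambda>x\<in>carrier A. star A (snd m (star A x)), \<lambda>x\<in>carrier A. star A (fst m (star A x)))"
  by (simp_all add: mult_alg_def case_prod_beta)

lemma mult_embed_simps:
  "\<lbrakk>a \<in> carrier A; x \<in> carrier A\<rbrakk> \<Longrightarrow> fst (mult_embed A a) x = a \<otimes>\<^bsub>A\<^esub> x"
  "\<lbrakk>a \<in> carrier A; x \<in> carrier A\<rbrakk> \<Longrightarrow> snd (mult_embed A a) x = x \<otimes>\<^bsub>A\<^esub> a"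
  by (simp_all add: mult_embed_def)

context cstar_algebra
begin

abbreviation MA :: "'a mult cstar" where "MA \<equiv> mult_alg A"

lemma multD:
  assumes "m \<in> carrier MA"
  shows fst_carrier: "x \<in> carrier A \<Longrightarrow> fst m x \<in> carrier A"
    and snd_carrier: "x \<in> carrier A \<Longrightarrow> snd m x \<in> carrier A"
    and fst_add: "\<lbrakk>x \<in> carrier A; y \<in> carrier A\<rbrakk> \<Longrightarrow> fst m (x \<oplus>\<^bsub>A\<^esub> y) = fst m x \<oplus>\<^bsub>A\<^esub> fst m y"
    and fst_smult: "x \<in> carrier A \<Longrightarrow> fst m (c \<odot>\<^bsub>A\<^esub> x) = c \<odot>\<^bsub>A\<^esub> fst m x"
    and fst_mult: "\<lbrakk>x \<in> carrier A; y \<in> carrier A\<rbrakk> \<Longrightarrow> fst m (x \<otimes>\<^bsub>A\<^esub> y) = fst m x \<otimes>\<^bsub>A\<^esub> y"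
    and snd_fst: "\<lbrakk>x \<in> carrier A; y \<in> carrier A\<rbrakk> \<Longrightarrow> snd m x \<otimes>\<^bsub>A\<^esub> y = x \<otimes>\<^bsub>A\<^esub> fst m y"
    and fst_bounded: "\<exists>K. \<forall>x\<in>carrier A. nrm A (fst m x) \<le> K * nrm A x"
    and fst_ext: "fst m \<in> extensional (carrier A)"
    and snd_ext: "snd m \<in> extensional (carrier A)"
proof -
  obtain L R where "m = (L, R)" "bounded_op A L" "bounded_op A R"
    "\<forall>x\<in>carrier A. \<forall>y\<in>carrier A. L (x \<otimes>\<^bsub>A\<^esub> y) = L x \<otimes>\<^bsub>A\<^esub> y \<and>
        R (x \<otimes>\<^bsub>A\<^esub> y) = x \<otimes>\<^bsub>A\<^esub> R y \<and> R x \<otimes>\<^bsub>A\<^esub> y = x \<otimes>\<^bsub>A\<^esub> L y"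
    using assms by (auto simp: mult_alg_simps double_centralizers_def)
  then show "x \<in> carrier A \<Longrightarrow> fst m x \<in> carrier A" "x \<in> carrier A \<Longrightarrow> snd m x \<in> carrier A"
    "\<lbrakk>x \<in> carrier A; y \<in> carrier A\<rbrakk> \<Longrightarrow> fst m (x \<oplus>\<^bsub>A\<^esub> y) = fst m x \<oplus>\<^bsub>A\<^esub> fst m y"
    "x \<in> carrier A \<Longrightarrow> fst m (c \<odot>\<^bsub>A\<^esub> x) = c \<odot>\<^bsub>A\<^esub> fst m x"
    "\<lbrakk>x \<in> carrier A; y \<in> carrier A\<rbrakk> \<Longrightarrow> fst m (x \<otimes>\<^bsub>A\<^esub> y) = fst m x \<otimes>\<^bsub>A\<^esub> y"
    "\<lbrakk>x \<in> carrier A; y \<in> carrier A\<rbrakk> \<Longrightarrow> snd m x \<otimes>\<^bsub>A\<^esub> y = x \<otimes>\<^bsub>A\<^esub> fst m y"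
    "\<exists>K. \<forall>x\<in>carrier A. nrm A (fst m x) \<le> K * nrm A x"
    "fst m \<in> extensional (carrier A)" "snd m \<in> extensional (carrier A)"
    unfolding bounded_op_def PiE_def by auto
qed

text \<open>Transfers a bound from one half of a multiplier to the other: for \<open>z = R x\<close>
  and \<open>w = L (star z)\<close> the equation holds, and it gives
  \<open>||z||^2 <= ||x|| K ||z||\<close>.\<close>

lemma nrm_le_of_mult_star:
  assumes x: "x \<in> carrier A" and z: "z \<in> carrier A" and w: "w \<in> carrier A"
    and eq: "z \<otimes>\<^bsub>A\<^esub> star A z = x \<otimes>\<^bsub>A\<^esub> w" and le: "nrm A w \<le> K * nrm A z" and K: "0 \<le> K"
  shows "nrm A z \<le> K * nrm A x"
proof (cases "nrm A z = 0")
  case True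
  then show ?thesis using x K nrm_nonneg by simp
next
  case False
  then have pos: "nrm A z > 0" using nrm_nonneg[OF z] by simp
  have "(nrm A z)\<^sup>2 = nrm A (x \<otimes>\<^bsub>A\<^esub> w)" using z by (simp add: cstar_identity'[symmetric] eq)
  also have "\<dots> \<le> nrm A x * nrm A w" using x w by (rule nrm_mult)
  also have "\<dots> \<le> nrm A x * (K * nrm A z)" using le x nrm_nonneg by (intro mult_left_mono) auto
  finally show ?thesis using pos by (simp add: power2_eq_square mult.commute mult.left_commute)
qed

text \<open>The linking equation forces linearity and the module identities: after multiplication by
  an arbitrary element both sides of each identity agree, and that element can be cancelled. The
  bound for \<open>R\<close> comes from the bound for \<open>L\<close> by
  \<open>nrm_le_of_mult_star\<close>.\<close>

lemma mult_algI:
  assumes L: "L \<in> carrier A \<rightarrow>\<^sub>E carrier A" and R: "R \<in> carrier A \<rightarrow>\<^sub>E carrier A"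
    and RL: "\<And>x y. \<lbrakk>x \<in> carrier A; y \<in> carrier A\<rbrakk> \<Longrightarrow> R x \<otimes>\<^bsub>A\<^esub> y = x \<otimes>\<^bsub>A\<^esub> L y"
    and K: "\<And>x. x \<in> carrier A \<Longrightarrow> nrm A (L x) \<le> K * nrm A x"
  shows "(L, R) \<in> carrier MA"
proof -
  have [simp]: "L x \<in> carrier A" "R x \<in> carrier A" if "x \<in> carrier A" for x
    using that L R by auto
  have "L (x \<oplus>\<^bsub>A\<^esub> y) = L x \<oplus>\<^bsub>A\<^esub> L y" if "x \<in> carrier A" "y \<in> carrier A" for x y
    using that by - (rule left_cancel, simp_all add: RL[symmetric] mult_r_distr)
  moreover have "L (x \<otimes>\<^bsub>A\<^esub> y) = L x \<otimes>\<^bsub>A\<^esub> y" if "x \<in> carrier A" "y \<in> carrier A" for x y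
    using that by - (rule left_cancel, simp_all add: RL[symmetric] mult_assoc[symmetric])
  moreover have "L (c \<odot>\<^bsub>A\<^esub> x) = c \<odot>\<^bsub>A\<^esub> L x" if "x \<in> carrier A" for x c
    using that by - (rule left_cancel, simp_all add: RL[symmetric] smult_mult_right)
  moreover have "R (x \<oplus>\<^bsub>A\<^esub> y) = R x \<oplus>\<^bsub>A\<^esub> R y" if "x \<in> carrier A" "y \<in> carrier A" for x y
    using that by - (rule right_cancel, simp_all add: RL mult_l_distr)
  moreover have "R (x \<otimes>\<^bsub>A\<^esub> y) = x \<otimes>\<^bsub>A\<^esub> R y" if "x \<in> carrier A" "y \<in> carrier A" for x y
    using that by - (rule right_cancel, simp_all add: RL mult_assoc)
  moreover have "R (c \<odot>\<^bsub>A\<^esub> x) = c \<odot>\<^bsub>A\<^esub> R x" if "x \<in> carrier A" for x c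
    using that by - (rule right_cancel, simp_all add: RL smult_mult_left)
  moreover have "nrm A (R x) \<le> \<bar>K\<bar> * nrm A x" if x: "x \<in> carrier A" for x
  proof (rule nrm_le_of_mult_star[of x "R x" "L (star A (R x))"])
    have "K * nrm A (R x) \<le> \<bar>K\<bar> * nrm A (R x)" using x nrm_nonneg by (intro mult_right_mono) auto
    then show "nrm A (L (star A (R x))) \<le> \<bar>K\<bar> * nrm A (R x)" using K[of "star A (R x)"] x by simp
  qed (use x RL in auto)
  moreover note c = calculation
  have "bounded_op A L"
    unfolding bounded_op_def by (intro conjI L ballI allI exI[of _ K] c(1,3) K)
  moreover have "bounded_op A R"
    unfolding bounded_op_def by (intro conjI R ballI allI exI[of _ "\<bar>K\<bar>"] c(4,6,7))
  ultimately show ?thesis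
    using c(2,5) RL by (simp add: mult_alg_simps double_centralizers_def)
qed

text \<open>The left half determines the right half through the linking equation
  \<open>snd_fst\<close>, so later identities of multipliers are checked on left halves.\<close>

lemma mult_eqI:
  assumes "m \<in> carrier MA" "n \<in> carrier MA" "\<And>x. x \<in> carrier A \<Longrightarrow> fst m x = fst n x"
  shows "m = n"
proof (rule prod_eqI)
  show "fst m = fst n"
    using fst_ext[OF assms(1)] fst_ext[OF assms(2)] assms(3) by (rule extensionalityI)
  show "snd m = snd n"
  proof (rule extensionalityI[OF snd_ext snd_ext])
    fix x assume x: "x \<in> carrier A"
    show "snd m x = snd n x"
    proof (rule right_cancel)
      show "snd m x \<in> carrier A" "snd n x \<in> carrier A" using assms x by (auto intro: snd_carrier)
      fix z assume "z \<in> carrier A"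
      then show "snd m x \<otimes>\<^bsub>A\<^esub> z = snd n x \<otimes>\<^bsub>A\<^esub> z"
        using snd_fst[OF assms(1) x] snd_fst[OF assms(2) x] assms(3) by simp
    qed
  qed (use assms in auto)
qed

lemma unit_ball_nonempty: "{x \<in> carrier A. nrm A x \<le> 1} \<noteq> {}"
  using nrm_zero by (auto intro!: exI[of _ "\<zero>\<^bsub>A\<^esub>"])

lemma mult_nrm_bdd:
  assumes "m \<in> carrier MA"
  shows "bdd_above ((\<lambda>x. nrm A (fst m x)) ` {x \<in> carrier A. nrm A x \<le> 1})"
proof -
  obtain K where K: "\<And>x. x \<in> carrier A \<Longrightarrow> nrm A (fst m x) \<le> K * nrm A x"
    using fst_bounded[OF assms] by blast
  have "nrm A (fst m x) \<le> \<bar>K\<bar>" if "x \<in> carrier A" "nrm A x \<le> 1" for x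
  proof -
    have "K * nrm A x \<le> \<bar>K\<bar> * 1" using that nrm_nonneg[of x] by (intro mult_mono) auto
    then show ?thesis using K[OF that(1)] by simp
  qed
  then show ?thesis by (auto intro!: bdd_aboveI)
qed

lemma fst_zero [simp]: "m \<in> carrier MA \<Longrightarrow> fst m \<zero>\<^bsub>A\<^esub> = \<zero>\<^bsub>A\<^esub>"
  using fst_smult[of m "\<zero>\<^bsub>A\<^esub>" 0] fst_carrier[of m "\<zero>\<^bsub>A\<^esub>"] by simp

lemma nrm_fst_le:
  assumes "m \<in> carrier MA" "x \<in> carrier A"
  shows "nrm A (fst m x) \<le> nrm MA m * nrm A x"
proof (cases "nrm A x = 0")
  case True
  then show ?thesis using assms nrm_eq_0 by simp
next
  case False
  then have pos: "nrm A x > 0" using nrm_nonneg[OF assms(2)] by simp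
  define c where "c = complex_of_real (1 / nrm A x)"
  have "nrm A (fst m (c \<odot>\<^bsub>A\<^esub> x)) \<le> nrm MA m"
    unfolding mult_alg_simps using mult_nrm_bdd[OF assms(1)]
    by (rule cSUP_upper[rotated]) (use assms pos in \<open>auto simp: nrm_smult c_def norm_divide\<close>)
  moreover have "nrm A (fst m (c \<odot>\<^bsub>A\<^esub> x)) = (1 / nrm A x) * nrm A (fst m x)"
    using assms pos fst_carrier by (simp add: fst_smult nrm_smult c_def norm_divide)
  ultimately show ?thesis using pos by (simp add: field_simps)
qed

lemma mult_nrm_le:
  assumes "m \<in> carrier MA" "\<And>x. x \<in> carrier A \<Longrightarrow> nrm A (fst m x) \<le> K * nrm A x" "0 \<le> K"
  shows "nrm MA m \<le> K"
  unfolding mult_alg_simps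
proof (rule cSUP_least[OF unit_ball_nonempty])
  fix x assume x: "x \<in> {x \<in> carrier A. nrm A x \<le> 1}"
  then have "K * nrm A x \<le> K * 1" using assms(3) by (intro mult_left_mono) auto
  then show "nrm A (fst m x) \<le> K" using assms(2)[of x] x by simp
qed

lemma mult_nrm_nonneg:
  assumes "m \<in> carrier MA"
  shows "0 \<le> nrm MA m"
proof -
  have "nrm A (fst m \<zero>\<^bsub>A\<^esub>) \<le> nrm MA m"
    unfolding mult_alg_simps using mult_nrm_bdd[OF assms]
    by (rule cSUP_upper[rotated]) auto
  then show ?thesis using assms by simp
qed

lemma nrm_snd_le:
  assumes m: "m \<in> carrier MA" and z: "z \<in> carrier A"
  shows "nrm A (snd m z) \<le> nrm MA m * nrm A z"
proof (rule nrm_le_of_mult_star[of z "snd m z" "fst m (star A (snd m z))"])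
  have c: "snd m z \<in> carrier A" using assms by (rule snd_carrier)
  then show "nrm A (fst m (star A (snd m z))) \<le> nrm MA m * nrm A (snd m z)"
    using nrm_fst_le[OF m, of "star A (snd m z)"] by simp
qed (use assms snd_carrier fst_carrier[OF m] in \<open>auto simp: snd_fst mult_nrm_nonneg\<close>)

lemma mult_mult_closed:
  assumes "m \<in> carrier MA" "n \<in> carrier MA"
  shows "m \<otimes>\<^bsub>MA\<^esub> n \<in> carrier MA"
  unfolding mult_alg_eqs
proof (rule mult_algI)
  fix x assume x: "x \<in> carrier A"
  have "nrm A (fst m (fst n x)) \<le> nrm MA m * nrm A (fst n x)"
    using assms x by (intro nrm_fst_le fst_carrier)
  also have "\<dots> \<le> nrm MA m * (nrm MA n * nrm A x)"
    using assms x by (intro mult_left_mono nrm_fst_le mult_nrm_nonneg)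
  finally show "nrm A ((\<lambda>x\<in>carrier A. fst m (fst n x)) x) \<le> (nrm MA m * nrm MA n) * nrm A x"
    using x by (simp add: mult.assoc)
qed (use assms in \<open>auto simp: snd_fst fst_carrier snd_carrier\<close>)

lemma mult_add_closed:
  assumes "m \<in> carrier MA" "n \<in> carrier MA"
  shows "m \<oplus>\<^bsub>MA\<^esub> n \<in> carrier MA"
  unfolding mult_alg_eqs
proof (rule mult_algI)
  fix x assume x: "x \<in> carrier A"
  have "nrm A (fst m x \<oplus>\<^bsub>A\<^esub> fst n x) \<le> nrm MA m * nrm A x + nrm MA n * nrm A x"
    using assms x nrm_triangle[of "fst m x" "fst n x"] nrm_fst_le[of m x] nrm_fst_le[of n x] fst_carrier
    by fastforce
  then show "nrm A ((\<lambda>x\<in>carrier A. fst m x \<oplus>\<^bsub>A\<^esub> fst n x) x) \<le> (nrm MA m + nrm MA n) * nrm A x"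
    using x by (simp add: distrib_right)
qed (use assms in \<open>auto simp: snd_fst mult_l_distr mult_r_distr fst_carrier snd_carrier\<close>)

lemma mult_smult_closed:
  assumes "m \<in> carrier MA"
  shows "c \<odot>\<^bsub>MA\<^esub> m \<in> carrier MA"
  unfolding mult_alg_eqs
proof (rule mult_algI)
  fix x assume x: "x \<in> carrier A"
  then show "nrm A ((\<lambda>x\<in>carrier A. c \<odot>\<^bsub>A\<^esub> fst m x) x) \<le> (cmod c * nrm MA m) * nrm A x"
    using nrm_fst_le[OF assms x] fst_carrier[OF assms x]
    by (simp add: nrm_smult mult.assoc mult_left_mono)
qed (use assms in \<open>auto simp: snd_fst smult_mult_left smult_mult_right fst_carrier snd_carrier\<close>)

lemma mult_star_closed:
  assumes "m \<in> carrier MA"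
  shows "star MA m \<in> carrier MA"
  unfolding mult_alg_eqs
proof (rule mult_algI)
  fix x assume x: "x \<in> carrier A"
  show "(\<lambda>x\<in>carrier A. star A (fst m (star A x))) x \<otimes>\<^bsub>A\<^esub> y =
      x \<otimes>\<^bsub>A\<^esub> (\<lambda>x\<in>carrier A. star A (snd m (star A x))) y" if y: "y \<in> carrier A" for y
    using x y fst_carrier[OF assms, of "star A x"] snd_carrier[OF assms, of "star A y"]
      snd_fst[OF assms, of "star A y" "star A x"] star_mult[of "star A y" "fst m (star A x)"]
      star_mult[of "snd m (star A y)" "star A x"] by simp
  show "nrm A ((\<lambda>x\<in>carrier A. star A (snd m (star A x))) x) \<le> nrm MA m * nrm A x"
    using x nrm_snd_le[OF assms, of "star A x"] snd_carrier[OF assms] by simp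
qed (use assms in \<open>auto simp: fst_carrier snd_carrier\<close>)

lemma mult_one_closed: "\<one>\<^bsub>MA\<^esub> \<in> carrier MA"
  unfolding mult_alg_eqs by (rule mult_algI[where K = 1]) auto

lemma mult_zero_closed: "\<zero>\<^bsub>MA\<^esub> \<in> carrier MA"
  unfolding mult_alg_eqs by (rule mult_algI[where K = 0]) auto

text \<open>Both halves converge pointwise in \<open>A\<close>, and the linking equation survives
  the limit. Letting the second index tend to infinity in the Cauchy estimate makes the convergence
  uniform on the unit ball.\<close>

lemma mult_complete:
  fixes s :: "nat \<Rightarrow> 'a mult"
  assumes s: "\<And>n. s n \<in> carrier MA"
    and C: "\<And>e. e > 0 \<Longrightarrow> \<exists>N. \<forall>m\<ge>N. \<forall>n\<ge>N. nrm MA (s m \<oplus>\<^bsub>MA\<^esub> (-1) \<odot>\<^bsub>MA\<^esub> s n) < e"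
  shows "\<exists>x\<in>carrier MA. (\<lambda>n. nrm MA (s n \<oplus>\<^bsub>MA\<^esub> (-1) \<odot>\<^bsub>MA\<^esub> x)) \<longlonglongrightarrow> 0"
proof -
  have dc: "s m \<oplus>\<^bsub>MA\<^esub> (-1) \<odot>\<^bsub>MA\<^esub> s n \<in> carrier MA" for m n
    using s mult_add_closed mult_smult_closed by blast
  have df: "nrm A (fst (s m) x \<ominus>\<^bsub>A\<^esub> fst (s n) x) \<le> nrm MA (s m \<oplus>\<^bsub>MA\<^esub> (-1) \<odot>\<^bsub>MA\<^esub> s n) * nrm A x"
    if "x \<in> carrier A" for m n x
    using nrm_fst_le[OF dc that, of m n] that s fst_carrier by (simp add: mult_alg_simps minus_eq_smult)
  have ds: "nrm A (snd (s m) x \<ominus>\<^bsub>A\<^esub> snd (s n) x) \<le> nrm MA (s m \<oplus>\<^bsub>MA\<^esub> (-1) \<odot>\<^bsub>MA\<^esub> s n) * nrm A x"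
    if "x \<in> carrier A" for m n x
    using nrm_snd_le[OF dc that, of m n] that s snd_carrier by (simp add: mult_alg_simps minus_eq_smult)
  have conv: "\<exists>y\<in>carrier A. (\<lambda>n. nrm A (t n \<ominus>\<^bsub>A\<^esub> y)) \<longlonglongrightarrow> 0"
    if x: "x \<in> carrier A" and t: "\<And>n. t n \<in> carrier A"
      "\<And>m n. nrm A (t m \<ominus>\<^bsub>A\<^esub> t n) \<le> nrm MA (s m \<oplus>\<^bsub>MA\<^esub> (-1) \<odot>\<^bsub>MA\<^esub> s n) * nrm A x" for x and t :: "nat \<Rightarrow> 'a"
  proof (rule Cauchy_converges[of t])
    fix e :: real assume e: "e > 0"
    define d where "d = e / (nrm A x + 1)"
    have n0: "0 \<le> nrm A x" using x nrm_nonneg by simp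
    then have "d > 0" using e by (simp add: d_def)
    then obtain N where N: "\<forall>m\<ge>N. \<forall>n\<ge>N. nrm MA (s m \<oplus>\<^bsub>MA\<^esub> (-1) \<odot>\<^bsub>MA\<^esub> s n) < d" using C by blast
    have "nrm A (t m \<ominus>\<^bsub>A\<^esub> t n) < e" if "m \<ge> N" "n \<ge> N" for m n
    proof -
      have "nrm A (t m \<ominus>\<^bsub>A\<^esub> t n) \<le> d * nrm A x"
        using t(2)[of m n] N that mult_right_mono[OF less_imp_le n0] by (meson order_trans)
      also have "\<dots> < e" using e n0 by (simp add: d_def field_simps)
      finally show ?thesis .
    qed
    then show "\<exists>N. \<forall>m\<ge>N. \<forall>n\<ge>N. nrm A (t m \<ominus>\<^bsub>A\<^esub> t n) < e" by blast
  qed (use t in auto)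
  have "\<exists>y\<in>carrier A. (\<lambda>n. nrm A (fst (s n) x \<ominus>\<^bsub>A\<^esub> y)) \<longlonglongrightarrow> 0" if x: "x \<in> carrier A" for x
    using df[OF x] by (rule conv[OF x fst_carrier[OF s x]])
  then obtain L where L: "\<And>x. x \<in> carrier A \<Longrightarrow> L x \<in> carrier A"
    "\<And>x. x \<in> carrier A \<Longrightarrow> (\<lambda>n. nrm A (fst (s n) x \<ominus>\<^bsub>A\<^esub> L x)) \<longlonglongrightarrow> 0" by metis
  have "\<exists>y\<in>carrier A. (\<lambda>n. nrm A (snd (s n) x \<ominus>\<^bsub>A\<^esub> y)) \<longlonglongrightarrow> 0" if x: "x \<in> carrier A" for x
    using ds[OF x] by (rule conv[OF x snd_carrier[OF s x]])
  then obtain R where R: "\<And>x. x \<in> carrier A \<Longrightarrow> R x \<in> carrier A"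
    "\<And>x. x \<in> carrier A \<Longrightarrow> (\<lambda>n. nrm A (snd (s n) x \<ominus>\<^bsub>A\<^esub> R x)) \<longlonglongrightarrow> 0" by metis
  have key: "nrm A (fst (s m) x \<ominus>\<^bsub>A\<^esub> L x) \<le> e * nrm A x"
    if "\<forall>m\<ge>N. \<forall>n\<ge>N. nrm MA (s m \<oplus>\<^bsub>MA\<^esub> (-1) \<odot>\<^bsub>MA\<^esub> s n) < e" "m \<ge> N" "x \<in> carrier A" for m N x e
  proof -
    have "nrm A (fst (s m) x \<ominus>\<^bsub>A\<^esub> L x) \<le> e * nrm A x + nrm A (fst (s n) x \<ominus>\<^bsub>A\<^esub> L x)" if "n \<ge> N" for n
    proof -
      have "nrm A (fst (s m) x \<ominus>\<^bsub>A\<^esub> L x)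
          \<le> nrm A (fst (s m) x \<ominus>\<^bsub>A\<^esub> fst (s n) x) + nrm A (fst (s n) x \<ominus>\<^bsub>A\<^esub> L x)"
        using \<open>x \<in> carrier A\<close> s fst_carrier L by (intro nrm_minus_triangle) auto
      also have "nrm A (fst (s m) x \<ominus>\<^bsub>A\<^esub> fst (s n) x) \<le> e * nrm A x"
        using df[OF \<open>x \<in> carrier A\<close>, of m n] \<open>\<forall>m\<ge>N. _\<close> \<open>m \<ge> N\<close> \<open>n \<ge> N\<close> nrm_nonneg[OF \<open>x \<in> carrier A\<close>]
        by (meson less_imp_le mult_right_mono order_trans)
      finally show ?thesis by simp
    qed
    moreover have "(\<lambda>n. e * nrm A x + nrm A (fst (s n) x \<ominus>\<^bsub>A\<^esub> L x)) \<longlonglongrightarrow> e * nrm A x + 0"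
      using L(2)[OF that(3)] by (intro tendsto_add tendsto_const)
    ultimately show ?thesis
      by (intro tendsto_lowerbound[where F = sequentially and f = "\<lambda>n. e * nrm A x + nrm A (fst (s n) x \<ominus>\<^bsub>A\<^esub> L x)"])
        (auto simp: eventually_sequentially)
  qed
  define l where "l = (\<lambda>x\<in>carrier A. L x, \<lambda>x\<in>carrier A. R x)"
  have RL: "R x \<otimes>\<^bsub>A\<^esub> y = x \<otimes>\<^bsub>A\<^esub> L y" if x: "x \<in> carrier A" and y: "y \<in> carrier A" for x y
  proof (rule limit_unique[of "\<lambda>n. snd (s n) x \<otimes>\<^bsub>A\<^esub> y" _ _ sequentially])
    show "(\<lambda>n. nrm A (snd (s n) x \<otimes>\<^bsub>A\<^esub> y \<ominus>\<^bsub>A\<^esub> R x \<otimes>\<^bsub>A\<^esub> y)) \<longlonglongrightarrow> 0"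
    proof (rule tendsto_sandwich[OF _ _ tendsto_const])
      show "(\<lambda>n. nrm A (snd (s n) x \<ominus>\<^bsub>A\<^esub> R x) * nrm A y) \<longlonglongrightarrow> 0"
        using tendsto_mult_right[OF R(2)[OF x], of "nrm A y"] by simp
      show "\<forall>\<^sub>F n in sequentially. nrm A (snd (s n) x \<otimes>\<^bsub>A\<^esub> y \<ominus>\<^bsub>A\<^esub> R x \<otimes>\<^bsub>A\<^esub> y)
          \<le> nrm A (snd (s n) x \<ominus>\<^bsub>A\<^esub> R x) * nrm A y"
        using x y s snd_carrier R by (auto simp: nrm_mult simp flip: minus_mult_left)
    qed (use x y s snd_carrier R nrm_nonneg in auto)
    show "(\<lambda>n. nrm A (snd (s n) x \<otimes>\<^bsub>A\<^esub> y \<ominus>\<^bsub>A\<^esub> x \<otimes>\<^bsub>A\<^esub> L y)) \<longlonglongrightarrow> 0"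
    proof (rule tendsto_sandwich[OF _ _ tendsto_const])
      show "(\<lambda>n. nrm A x * nrm A (fst (s n) y \<ominus>\<^bsub>A\<^esub> L y)) \<longlonglongrightarrow> 0"
        using tendsto_mult_left[OF L(2)[OF y], of "nrm A x"] by simp
      show "\<forall>\<^sub>F n in sequentially. nrm A (snd (s n) x \<otimes>\<^bsub>A\<^esub> y \<ominus>\<^bsub>A\<^esub> x \<otimes>\<^bsub>A\<^esub> L y)
          \<le> nrm A x * nrm A (fst (s n) y \<ominus>\<^bsub>A\<^esub> L y)"
        using x y s fst_carrier L by (auto simp: snd_fst nrm_mult simp flip: minus_mult_right)
    qed (use x y s snd_carrier L nrm_nonneg in auto)
  qed (use x y s snd_carrier R L in auto)
  \<comment> \<open>One member of the sequence within distance 1 of the limit is enough to bound the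
    limit operator.\<close>
  obtain N1 where N1: "\<forall>m\<ge>N1. \<forall>n\<ge>N1. nrm MA (s m \<oplus>\<^bsub>MA\<^esub> (-1) \<odot>\<^bsub>MA\<^esub> s n) < 1" using C[of 1] by auto
  have l: "l \<in> carrier MA"
    unfolding l_def
  proof (rule mult_algI)
    fix x assume x: "x \<in> carrier A"
    have "nrm A (L x) \<le> nrm A (L x \<ominus>\<^bsub>A\<^esub> fst (s N1) x) + nrm A (fst (s N1) x)"
      using x L s fst_carrier by (intro nrm_le_minus) auto
    also have "\<dots> \<le> 1 * nrm A x + nrm MA (s N1) * nrm A x"
      using key[OF N1 order_refl x] nrm_fst_le[OF s x] nrm_minus_commute[of "L x" "fst (s N1) x"] x L s
        fst_carrier by (intro add_mono) auto
    finally show "nrm A ((\<lambda>x\<in>carrier A. L x) x) \<le> (1 + nrm MA (s N1)) * nrm A x"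
      using x by (simp add: distrib_right)
  qed (use L R RL in auto)
  moreover have "(\<lambda>n. nrm MA (s n \<oplus>\<^bsub>MA\<^esub> (-1) \<odot>\<^bsub>MA\<^esub> l)) \<longlonglongrightarrow> 0"
  proof (rule tendstoI)
    have dl: "s n \<oplus>\<^bsub>MA\<^esub> (-1) \<odot>\<^bsub>MA\<^esub> l \<in> carrier MA" for n
      using s l mult_add_closed mult_smult_closed by blast
    fix e :: real assume e: "e > 0"
    then obtain N where N: "\<forall>m\<ge>N. \<forall>n\<ge>N. nrm MA (s m \<oplus>\<^bsub>MA\<^esub> (-1) \<odot>\<^bsub>MA\<^esub> s n) < e / 2"
      using C[of "e / 2"] by auto
    have "nrm MA (s n \<oplus>\<^bsub>MA\<^esub> (-1) \<odot>\<^bsub>MA\<^esub> l) \<le> e / 2" if "n \<ge> N" for n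
    proof (rule mult_nrm_le[OF dl])
      fix x assume x: "x \<in> carrier A"
      then show "nrm A (fst (s n \<oplus>\<^bsub>MA\<^esub> (-1) \<odot>\<^bsub>MA\<^esub> l) x) \<le> e / 2 * nrm A x"
        using key[OF N that x] L fst_carrier s by (simp add: mult_alg_simps l_def minus_eq_smult)
    qed (use e in simp)
    then show "\<forall>\<^sub>F n in sequentially. dist (nrm MA (s n \<oplus>\<^bsub>MA\<^esub> (-1) \<odot>\<^bsub>MA\<^esub> l)) 0 < e"
      using e mult_nrm_nonneg[OF dl] by (intro eventually_sequentiallyI[of N]) (smt (verit) dist_real_def field_sum_of_halves)
  qed
  ultimately show ?thesis by blast
qed

text \<open>Reduces the C*-identity for multipliers to the one in \<open>A\<close> through
  \<open>star (m x) (m x) = star x ((star m m) x)\<close>.\<close>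

lemma mult_nrm_star_le:
  assumes m: "m \<in> carrier MA"
  shows "(nrm MA m)\<^sup>2 \<le> nrm MA (star MA m \<otimes>\<^bsub>MA\<^esub> m)"
proof -
  have mm: "star MA m \<otimes>\<^bsub>MA\<^esub> m \<in> carrier MA" by (rule mult_mult_closed[OF mult_star_closed[OF m] m])
  have "nrm MA m \<le> sqrt (nrm MA (star MA m \<otimes>\<^bsub>MA\<^esub> m))"
  proof (rule mult_nrm_le[OF m])
    fix x assume x: "x \<in> carrier A"
    have fx: "fst m x \<in> carrier A" using fst_carrier m x by blast
    have "star A (fst m x) \<otimes>\<^bsub>A\<^esub> fst m x = star A x \<otimes>\<^bsub>A\<^esub> fst (star MA m \<otimes>\<^bsub>MA\<^esub> m) x"
      using x fx snd_fst[OF mult_star_closed[OF m], of "star A x" "fst m x"]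
      by (simp add: mult_alg_simps(2,13))
    then have "(nrm A (fst m x))\<^sup>2 = nrm A (star A x \<otimes>\<^bsub>A\<^esub> fst (star MA m \<otimes>\<^bsub>MA\<^esub> m) x)"
      using fx by (simp add: cstar_identity[symmetric])
    also have "\<dots> \<le> nrm A x * nrm A (fst (star MA m \<otimes>\<^bsub>MA\<^esub> m) x)"
      using x nrm_mult[of "star A x"] fst_carrier[OF mm x] by fastforce
    also have "\<dots> \<le> nrm A x * (nrm MA (star MA m \<otimes>\<^bsub>MA\<^esub> m) * nrm A x)"
      using nrm_fst_le[OF mm x] nrm_nonneg[OF x] by (intro mult_left_mono) auto
    finally have "(nrm A (fst m x))\<^sup>2 \<le> nrm MA (star MA m \<otimes>\<^bsub>MA\<^esub> m) * (nrm A x)\<^sup>2"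
      by (simp add: power2_eq_square mult.commute mult.left_commute)
    then have "nrm A (fst m x) \<le> sqrt (nrm MA (star MA m \<otimes>\<^bsub>MA\<^esub> m) * (nrm A x)\<^sup>2)"
      by (rule real_le_rsqrt)
    then show "nrm A (fst m x) \<le> sqrt (nrm MA (star MA m \<otimes>\<^bsub>MA\<^esub> m)) * nrm A x"
      using nrm_nonneg[OF x] by (simp add: real_sqrt_mult)
  qed (use mult_nrm_nonneg[OF mm] in simp)
  then show ?thesis
    using mult_nrm_nonneg[OF m] mult_nrm_nonneg[OF mm] by (metis power_mono real_sqrt_pow2)
qed

lemma mult_nrm_mult:
  assumes "m \<in> carrier MA" "n \<in> carrier MA"
  shows "nrm MA (m \<otimes>\<^bsub>MA\<^esub> n) \<le> nrm MA m * nrm MA n"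
proof (rule mult_nrm_le)
  fix x assume x: "x \<in> carrier A"
  have "nrm A (fst m (fst n x)) \<le> nrm MA m * nrm A (fst n x)"
    using assms x by (intro nrm_fst_le fst_carrier)
  also have "\<dots> \<le> nrm MA m * (nrm MA n * nrm A x)"
    using assms x by (intro mult_left_mono nrm_fst_le mult_nrm_nonneg)
  finally show "nrm A (fst (m \<otimes>\<^bsub>MA\<^esub> n) x) \<le> nrm MA m * nrm MA n * nrm A x"
    using x by (simp add: mult_alg_simps mult.assoc)
qed (use assms mult_mult_closed mult_nrm_nonneg in auto)

text \<open>Repeats the argument of \<open>nrm_star\<close>, because the multiplier algebra is at
  this point not yet known to be a \<open>cstar_algebra\<close>.\<close>

lemma mult_nrm_star:
  assumes m: "m \<in> carrier MA"
  shows "nrm MA (star MA m) = nrm MA m"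
proof -
  have le: "nrm MA n \<le> nrm MA (star MA n)" if n: "n \<in> carrier MA" for n
  proof (cases "nrm MA n = 0")
    case True then show ?thesis using mult_nrm_nonneg[OF mult_star_closed[OF n]] by simp
  next
    case False
    then have "nrm MA n > 0" using mult_nrm_nonneg[OF n] by simp
    moreover have "nrm MA n * nrm MA n \<le> nrm MA (star MA n) * nrm MA n"
      using mult_nrm_star_le[OF n] mult_nrm_mult[OF mult_star_closed[OF n] n]
      by (simp add: power2_eq_square)
    ultimately show ?thesis by simp
  qed
  have "star MA (star MA m) = m"
    by (rule mult_eqI) (simp_all add: mult_alg_simps(2-13) mult_star_closed fst_carrier m)
  then show ?thesis using le[OF m] le[OF mult_star_closed[OF m]] by simp
qed

lemma cstar_algebra_mult_alg: "cstar_algebra MA"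
proof (rule cstar_algebraI)
  note closed = mult_add_closed mult_zero_closed mult_smult_closed mult_mult_closed mult_star_closed
  note simps = mult_alg_simps(2-13)
  show "m \<oplus>\<^bsub>MA\<^esub> n \<in> carrier MA" if "m \<in> carrier MA" "n \<in> carrier MA" for m n
    using that by (rule mult_add_closed)
  show "\<zero>\<^bsub>MA\<^esub> \<in> carrier MA" by (rule mult_zero_closed)
  show "m \<oplus>\<^bsub>MA\<^esub> n \<oplus>\<^bsub>MA\<^esub> k = m \<oplus>\<^bsub>MA\<^esub> (n \<oplus>\<^bsub>MA\<^esub> k)"
    if "m \<in> carrier MA" "n \<in> carrier MA" "k \<in> carrier MA" for m n k
    using that by (intro mult_eqI closed) (simp_all add: simps M.a_assoc fst_carrier)
  show "m \<oplus>\<^bsub>MA\<^esub> n = n \<oplus>\<^bsub>MA\<^esub> m" if "m \<in> carrier MA" "n \<in> carrier MA" for m n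
    using that by (intro mult_eqI closed) (simp_all add: simps M.a_comm fst_carrier)
  show "\<zero>\<^bsub>MA\<^esub> \<oplus>\<^bsub>MA\<^esub> m = m" if "m \<in> carrier MA" for m
    using that by (intro mult_eqI closed) (simp_all add: simps fst_carrier)
  show "c \<odot>\<^bsub>MA\<^esub> m \<in> carrier MA" if "m \<in> carrier MA" for c m
    using that by (rule mult_smult_closed)
  show "(c + d) \<odot>\<^bsub>MA\<^esub> m = c \<odot>\<^bsub>MA\<^esub> m \<oplus>\<^bsub>MA\<^esub> d \<odot>\<^bsub>MA\<^esub> m" if "m \<in> carrier MA" for c d m
    using that by (intro mult_eqI closed) (simp_all add: simps fst_carrier smult_plus_left)
  show "c \<odot>\<^bsub>MA\<^esub> (m \<oplus>\<^bsub>MA\<^esub> n) = c \<odot>\<^bsub>MA\<^esub> m \<oplus>\<^bsub>MA\<^esub> c \<odot>\<^bsub>MA\<^esub> n"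
    if "m \<in> carrier MA" "n \<in> carrier MA" for c m n
    using that by (intro mult_eqI closed) (simp_all add: simps fst_carrier smult_plus_right)
  show "(c * d) \<odot>\<^bsub>MA\<^esub> m = c \<odot>\<^bsub>MA\<^esub> (d \<odot>\<^bsub>MA\<^esub> m)" if "m \<in> carrier MA" for c d m
    using that by (intro mult_eqI closed) (simp_all add: simps fst_carrier smult_smult)
  show "1 \<odot>\<^bsub>MA\<^esub> m = m" if "m \<in> carrier MA" for m
    using that by (intro mult_eqI closed) (simp_all add: simps fst_carrier)
  show "0 \<odot>\<^bsub>MA\<^esub> m = \<zero>\<^bsub>MA\<^esub>" if "m \<in> carrier MA" for m
    using that by (intro mult_eqI closed) (simp_all add: simps fst_carrier)
  show "m \<otimes>\<^bsub>MA\<^esub> n \<in> carrier MA" if "m \<in> carrier MA" "n \<in> carrier MA" for m n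
    using that by (rule mult_mult_closed)
  show "m \<otimes>\<^bsub>MA\<^esub> n \<otimes>\<^bsub>MA\<^esub> k = m \<otimes>\<^bsub>MA\<^esub> (n \<otimes>\<^bsub>MA\<^esub> k)"
    if "m \<in> carrier MA" "n \<in> carrier MA" "k \<in> carrier MA" for m n k
    using that by (intro mult_eqI closed) (simp_all add: simps fst_carrier)
  show "(m \<oplus>\<^bsub>MA\<^esub> n) \<otimes>\<^bsub>MA\<^esub> k = m \<otimes>\<^bsub>MA\<^esub> k \<oplus>\<^bsub>MA\<^esub> n \<otimes>\<^bsub>MA\<^esub> k"
    if "m \<in> carrier MA" "n \<in> carrier MA" "k \<in> carrier MA" for m n k
    using that by (intro mult_eqI closed) (simp_all add: simps fst_carrier)
  show "k \<otimes>\<^bsub>MA\<^esub> (m \<oplus>\<^bsub>MA\<^esub> n) = k \<otimes>\<^bsub>MA\<^esub> m \<oplus>\<^bsub>MA\<^esub> k \<otimes>\<^bsub>MA\<^esub> n"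
    if "k \<in> carrier MA" "m \<in> carrier MA" "n \<in> carrier MA" for m n k
    using that by (intro mult_eqI closed) (simp_all add: simps fst_carrier fst_add)
  show "(c \<odot>\<^bsub>MA\<^esub> m) \<otimes>\<^bsub>MA\<^esub> n = c \<odot>\<^bsub>MA\<^esub> (m \<otimes>\<^bsub>MA\<^esub> n)"
    if "m \<in> carrier MA" "n \<in> carrier MA" for c m n
    using that by (intro mult_eqI closed) (simp_all add: simps fst_carrier)
  show "m \<otimes>\<^bsub>MA\<^esub> (c \<odot>\<^bsub>MA\<^esub> n) = c \<odot>\<^bsub>MA\<^esub> (m \<otimes>\<^bsub>MA\<^esub> n)"
    if "m \<in> carrier MA" "n \<in> carrier MA" for c m n
    using that by (intro mult_eqI closed) (simp_all add: simps fst_carrier fst_smult)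
  show "star MA m \<in> carrier MA" if "m \<in> carrier MA" for m
    using that by (rule mult_star_closed)
  show "star MA (star MA m) = m" if "m \<in> carrier MA" for m
    using that by (intro mult_eqI closed) (simp_all add: simps fst_carrier)
  show "star MA (m \<oplus>\<^bsub>MA\<^esub> n) = star MA m \<oplus>\<^bsub>MA\<^esub> star MA n"
    if "m \<in> carrier MA" "n \<in> carrier MA" for m n
    using that by (intro mult_eqI closed) (simp_all add: simps snd_carrier star_add)
  show "star MA (c \<odot>\<^bsub>MA\<^esub> m) = cnj c \<odot>\<^bsub>MA\<^esub> star MA m" if "m \<in> carrier MA" for c m
    using that by (intro mult_eqI closed) (simp_all add: simps snd_carrier star_smult)
  show "star MA (m \<otimes>\<^bsub>MA\<^esub> n) = star MA n \<otimes>\<^bsub>MA\<^esub> star MA m"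
    if "m \<in> carrier MA" "n \<in> carrier MA" for m n
    using that by (intro mult_eqI closed) (simp_all add: simps snd_carrier)
  show "0 \<le> nrm MA m" if "m \<in> carrier MA" for m using that by (rule mult_nrm_nonneg)
  show "nrm MA m = 0 \<longleftrightarrow> m = \<zero>\<^bsub>MA\<^esub>" if m: "m \<in> carrier MA" for m
  proof
    assume "nrm MA m = 0"
    then have "nrm A (fst m x) = 0" if "x \<in> carrier A" for x
      using nrm_fst_le[OF m that] nrm_nonneg[OF fst_carrier[OF m that]] by simp
    then show "m = \<zero>\<^bsub>MA\<^esub>"
      using m by (intro mult_eqI closed) (auto simp: simps nrm_eq_0 fst_carrier)
  next
    assume "m = \<zero>\<^bsub>MA\<^esub>"
    then have "nrm MA m \<le> 0" using m by (intro mult_nrm_le) (auto simp: simps)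
    then show "nrm MA m = 0" using mult_nrm_nonneg[OF m] by simp
  qed
  show "nrm MA (m \<oplus>\<^bsub>MA\<^esub> n) \<le> nrm MA m + nrm MA n"
    if "m \<in> carrier MA" "n \<in> carrier MA" for m n
  proof (rule mult_nrm_le)
    fix x assume x: "x \<in> carrier A"
    have "nrm A (fst m x \<oplus>\<^bsub>A\<^esub> fst n x) \<le> nrm A (fst m x) + nrm A (fst n x)"
      using that x by (intro nrm_triangle fst_carrier)
    also have "\<dots> \<le> nrm MA m * nrm A x + nrm MA n * nrm A x"
      using that x by (intro add_mono nrm_fst_le)
    finally show "nrm A (fst (m \<oplus>\<^bsub>MA\<^esub> n) x) \<le> (nrm MA m + nrm MA n) * nrm A x"
      using x by (simp add: simps distrib_right)
  qed (use that closed mult_nrm_nonneg in auto)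
  show "nrm MA (c \<odot>\<^bsub>MA\<^esub> m) = cmod c * nrm MA m" if m: "m \<in> carrier MA" for c m
  proof -
    have le: "nrm MA (c \<odot>\<^bsub>MA\<^esub> m) \<le> cmod c * nrm MA m" if m: "m \<in> carrier MA" for c m
    proof (rule mult_nrm_le)
      fix x assume x: "x \<in> carrier A"
      then show "nrm A (fst (c \<odot>\<^bsub>MA\<^esub> m) x) \<le> cmod c * nrm MA m * nrm A x"
        using nrm_fst_le[OF m x] fst_carrier[OF m x]
        by (simp add: simps nrm_smult mult.assoc mult_left_mono)
    qed (use m closed mult_nrm_nonneg in auto)
    show ?thesis
    proof (cases "c = 0")
      case True
      then show ?thesis using le[OF m, of 0] mult_nrm_nonneg[OF mult_smult_closed[OF m], of 0] by simp
    next
      case False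
      have "m = (1 / c) \<odot>\<^bsub>MA\<^esub> (c \<odot>\<^bsub>MA\<^esub> m)"
        using m False by (intro mult_eqI closed) (simp_all add: simps fst_carrier smult_smult)
      then have "nrm MA m \<le> cmod (1 / c) * nrm MA (c \<odot>\<^bsub>MA\<^esub> m)"
        using le[OF mult_smult_closed[OF m, of c], of "1 / c"] by simp
      then have "cmod c * nrm MA m \<le> nrm MA (c \<odot>\<^bsub>MA\<^esub> m)"
        using False by (simp add: norm_divide field_simps)
      then show ?thesis using le[OF m, of c] by simp
    qed
  qed
  show "nrm MA (m \<otimes>\<^bsub>MA\<^esub> n) \<le> nrm MA m * nrm MA n"
    if "m \<in> carrier MA" "n \<in> carrier MA" for m n using that by (rule mult_nrm_mult)
  show "nrm MA (star MA m \<otimes>\<^bsub>MA\<^esub> m) = (nrm MA m)\<^sup>2" if m: "m \<in> carrier MA" for m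
    using mult_nrm_star_le[OF m] mult_nrm_mult[OF mult_star_closed[OF m] m] mult_nrm_star[OF m]
    by (simp add: power2_eq_square)
qed (rule mult_complete)

end

section \<open>The canonical embedding of an algebra into its multipliers\<close>

context cstar_algebra
begin

lemma minus_minus_cancel: "\<lbrakk>x \<in> carrier A; y \<in> carrier A\<rbrakk> \<Longrightarrow> x \<ominus>\<^bsub>A\<^esub> (x \<ominus>\<^bsub>A\<^esub> y) = y"
  by (simp add: minus_eq_smult smult_plus_right smult_smult)
    (simp add: M.a_assoc[symmetric] M.r_neg uminus_eq_smult[symmetric])

lemma mult_embed_carrier [simp, intro]: "a \<in> carrier A \<Longrightarrow> mult_embed A a \<in> carrier MA"
  unfolding mult_embed_def
  by simp (rule mult_algI[where K = "nrm A a"], auto simp: mult_assoc nrm_mult)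

text \<open>Together with \<open>mult_embed_mult\<close> this makes the algebra a two-sided ideal in
  its multiplier algebra, with explicit formulas for the products.\<close>

lemma mult_mult_embed:
  "\<lbrakk>m \<in> carrier MA; a \<in> carrier A\<rbrakk> \<Longrightarrow> m \<otimes>\<^bsub>MA\<^esub> mult_embed A a = mult_embed A (fst m a)"
  by (rule mult_eqI)
    (simp_all add: mult_mult_closed fst_carrier mult_alg_simps(2) mult_embed_simps fst_mult)

lemma mult_embed_mult:
  "\<lbrakk>m \<in> carrier MA; a \<in> carrier A\<rbrakk> \<Longrightarrow> mult_embed A a \<otimes>\<^bsub>MA\<^esub> m = mult_embed A (snd m a)"
  by (rule mult_eqI)
    (simp_all add: mult_mult_closed fst_carrier snd_carrier mult_alg_simps(2) mult_embed_simps snd_fst)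

lemma mult_embed_hom: "mult_embed A \<in> star_hom A MA"
  unfolding star_hom_def
proof (intro CollectI conjI ballI allI)
  show "mult_embed A \<in> carrier A \<rightarrow>\<^sub>E carrier MA"
    by (auto simp: mult_embed_def simp flip: mult_embed_carrier[unfolded mult_embed_def])
      (use mult_embed_carrier in \<open>simp add: mult_embed_def\<close>)
next
  fix x y assume x: "x \<in> carrier A" and y: "y \<in> carrier A"
  show "mult_embed A (x \<oplus>\<^bsub>A\<^esub> y) = mult_embed A x \<oplus>\<^bsub>MA\<^esub> mult_embed A y"
    using x y by - (rule mult_eqI, simp_all add: mult_add_closed mult_alg_simps(4) mult_embed_simps mult_l_distr)
  show "mult_embed A (x \<otimes>\<^bsub>A\<^esub> y) = mult_embed A x \<otimes>\<^bsub>MA\<^esub> mult_embed A y"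
    using x y by (simp add: mult_mult_embed mult_embed_simps)
next
  fix c x assume x: "x \<in> carrier A"
  then show "mult_embed A (c \<odot>\<^bsub>A\<^esub> x) = c \<odot>\<^bsub>MA\<^esub> mult_embed A x"
    by - (rule mult_eqI, simp_all add: mult_smult_closed mult_alg_simps(6) mult_embed_simps smult_mult_left)
next
  fix x assume x: "x \<in> carrier A"
  then show "mult_embed A (star A x) = star MA (mult_embed A x)"
    by - (rule mult_eqI, simp_all add: mult_star_closed mult_alg_simps(12) mult_embed_simps star_mult)
qed

text \<open>Testing the multiplier on \<open>star a\<close> gives the lower bound by the
  C*-identity.\<close>

lemma nrm_mult_embed: "a \<in> carrier A \<Longrightarrow> nrm MA (mult_embed A a) = nrm A a"
proof (rule antisym)
  assume a: "a \<in> carrier A"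
  show "nrm MA (mult_embed A a) \<le> nrm A a"
    using a by (intro mult_nrm_le) (auto simp: mult_embed_simps nrm_mult nrm_nonneg)
  show "nrm A a \<le> nrm MA (mult_embed A a)"
  proof (cases "nrm A a = 0")
    case True
    then show ?thesis using a mult_nrm_nonneg by simp
  next
    case False
    then have "nrm A a > 0" using nrm_nonneg[OF a] by simp
    moreover have "nrm A a * nrm A a \<le> nrm MA (mult_embed A a) * nrm A a"
      using nrm_fst_le[OF mult_embed_carrier[OF a], of "star A a"] a
      by (simp add: mult_embed_simps cstar_identity' power2_eq_square)
    ultimately show ?thesis by simp
  qed
qed

end

lemma star_homD:
  assumes "f \<in> star_hom A B"
  shows "f \<in> carrier A \<rightarrow>\<^sub>E carrier B"
    and "x \<in> carrier A \<Longrightarrow> f x \<in> carrier B"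
    and "\<lbrakk>x \<in> carrier A; y \<in> carrier A\<rbrakk> \<Longrightarrow> f (x \<oplus>\<^bsub>A\<^esub> y) = f x \<oplus>\<^bsub>B\<^esub> f y"
    and "x \<in> carrier A \<Longrightarrow> f (c \<odot>\<^bsub>A\<^esub> x) = c \<odot>\<^bsub>B\<^esub> f x"
    and "\<lbrakk>x \<in> carrier A; y \<in> carrier A\<rbrakk> \<Longrightarrow> f (x \<otimes>\<^bsub>A\<^esub> y) = f x \<otimes>\<^bsub>B\<^esub> f y"
    and "x \<in> carrier A \<Longrightarrow> f (star A x) = star B (f x)"
  using assms by (auto simp: star_hom_def)

lemmas star_hom_carrier = star_homD(2)
  and star_hom_add = star_homD(3)
  and star_hom_smult = star_homD(4)
  and star_hom_mult = star_homD(5)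
  and star_hom_star = star_homD(6)

lemma star_hom_minus:
  assumes "f \<in> star_hom A B" "cstar_algebra A" "cstar_algebra B" "x \<in> carrier A" "y \<in> carrier A"
  shows "f (x \<ominus>\<^bsub>A\<^esub> y) = f x \<ominus>\<^bsub>B\<^esub> f y"
  using assms by (simp add: cstar_algebra.minus_eq_smult star_hom_carrier star_hom_add
      star_hom_smult cstar_algebra.smult_carrier)

section \<open>Unital C*-algebras are spanned by their unitaries\<close>

locale unital_cstar_algebra = cstar_algebra +
  assumes one_closed [simp, intro]: "\<one>\<^bsub>A\<^esub> \<in> carrier A"
    and one_mult [simp]: "x \<in> carrier A \<Longrightarrow> \<one>\<^bsub>A\<^esub> \<otimes>\<^bsub>A\<^esub> x = x"
    and mult_one [simp]: "x \<in> carrier A \<Longrightarrow> x \<otimes>\<^bsub>A\<^esub> \<one>\<^bsub>A\<^esub> = x"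

lemma (in cstar_algebra) unital_mult_alg: "unital_cstar_algebra MA"
proof -
  interpret M: cstar_algebra MA by (rule cstar_algebra_mult_alg)
  show ?thesis
  proof unfold_locales
    show "\<one>\<^bsub>MA\<^esub> \<in> carrier MA" by (rule mult_one_closed)
    show "\<one>\<^bsub>MA\<^esub> \<otimes>\<^bsub>MA\<^esub> m = m" "m \<otimes>\<^bsub>MA\<^esub> \<one>\<^bsub>MA\<^esub> = m" if "m \<in> carrier MA" for m
      using that mult_one_closed
      by - (rule mult_eqI, simp_all add: mult_mult_closed mult_alg_simps(2,10) fst_carrier)+
  qed
qed

context unital_cstar_algebra
begin

lemma star_one [simp]: "star A \<one>\<^bsub>A\<^esub> = \<one>\<^bsub>A\<^esub>"
  by (metis mult_one one_closed star_closed star_mult star_star one_mult)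

lemma nrm_one_le: "nrm A \<one>\<^bsub>A\<^esub> \<le> 1"
proof (cases "nrm A \<one>\<^bsub>A\<^esub> = 0")
  case False
  then show ?thesis using cstar_identity[of "\<one>\<^bsub>A\<^esub>"] by (simp add: power2_eq_square)
qed simp

text \<open>A closed ball in the self-adjoint part of the commutant of \<open>h\<close>. Running the
  contraction principle inside this complete set yields fixed points that are automatically
  self-adjoint and commute with \<open>h\<close>.\<close>

definition sa_commutant :: "'a \<Rightarrow> real \<Rightarrow> 'a set" where
  "sa_commutant h r = {x \<in> carrier A. star A x = x \<and> h \<otimes>\<^bsub>A\<^esub> x = x \<otimes>\<^bsub>A\<^esub> h \<and> nrm A x \<le> r}"

lemma limit_in_sa_commutant:
  assumes h: "h \<in> carrier A" and s: "\<And>n. s n \<in> sa_commutant h r" and x: "x \<in> carrier A"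
    and lim: "(\<lambda>n. nrm A (s n \<ominus>\<^bsub>A\<^esub> x)) \<longlonglongrightarrow> 0"
  shows "x \<in> sa_commutant h r"
proof -
  have sc: "s n \<in> carrier A" "star A (s n) = s n" "h \<otimes>\<^bsub>A\<^esub> s n = s n \<otimes>\<^bsub>A\<^esub> h" "nrm A (s n) \<le> r" for n
    using s[of n] by (auto simp: sa_commutant_def)
  have "(\<lambda>n. nrm A (star A (s n) \<ominus>\<^bsub>A\<^esub> star A x)) \<longlonglongrightarrow> 0"
    using lim sc(1) x nrm_star[of "s _ \<ominus>\<^bsub>A\<^esub> x"] by (simp add: star_minus[symmetric])
  then have "star A x = x"
    using sc x lim by (intro limit_unique[of s "star A x" x sequentially]) auto
  moreover have "h \<otimes>\<^bsub>A\<^esub> x = x \<otimes>\<^bsub>A\<^esub> h"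
  proof (rule limit_unique[of "\<lambda>n. h \<otimes>\<^bsub>A\<^esub> s n" _ _ sequentially])
    show "(\<lambda>n. nrm A (h \<otimes>\<^bsub>A\<^esub> s n \<ominus>\<^bsub>A\<^esub> h \<otimes>\<^bsub>A\<^esub> x)) \<longlonglongrightarrow> 0"
    proof (rule tendsto_sandwich[OF _ _ tendsto_const])
      show "(\<lambda>n. nrm A h * nrm A (s n \<ominus>\<^bsub>A\<^esub> x)) \<longlonglongrightarrow> 0"
        using tendsto_mult_left[OF lim, of "nrm A h"] by simp
    qed (use h x sc(1) in \<open>auto simp: nrm_mult nrm_nonneg simp flip: minus_mult_right\<close>)
    show "(\<lambda>n. nrm A (h \<otimes>\<^bsub>A\<^esub> s n \<ominus>\<^bsub>A\<^esub> x \<otimes>\<^bsub>A\<^esub> h)) \<longlonglongrightarrow> 0"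
    proof (rule tendsto_sandwich[OF _ _ tendsto_const])
      show "(\<lambda>n. nrm A (s n \<ominus>\<^bsub>A\<^esub> x) * nrm A h) \<longlonglongrightarrow> 0"
        using tendsto_mult_right[OF lim, of "nrm A h"] by simp
    qed (use h x sc(1) in \<open>auto simp: sc(3) nrm_mult nrm_nonneg simp flip: minus_mult_left\<close>)
  qed (use h x sc in auto)
  moreover have "nrm A x \<le> r"
  proof -
    have "(\<lambda>n. r + nrm A (s n \<ominus>\<^bsub>A\<^esub> x)) \<longlonglongrightarrow> r + 0" by (intro tendsto_add tendsto_const lim)
    moreover have "nrm A x \<le> r + nrm A (s n \<ominus>\<^bsub>A\<^esub> x)" for n
      using nrm_le_minus[of x "s n"] nrm_minus_commute[of x "s n"] sc(1,4)[of n] x by simp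
    ultimately show ?thesis
      using tendsto_lowerbound[of "\<lambda>n. r + nrm A (s n \<ominus>\<^bsub>A\<^esub> x)" "r + 0" sequentially "nrm A x"] by simp
  qed
  ultimately show ?thesis using x by (simp add: sa_commutant_def)
qed

lemma sa_commutant_fixpoint:
  assumes h: "h \<in> carrier A" and r: "0 \<le> r" and k: "k < 1"
    and f: "\<And>x. x \<in> sa_commutant h r \<Longrightarrow> f x \<in> sa_commutant h r"
    and contract: "\<And>x y. \<lbrakk>x \<in> sa_commutant h r; y \<in> sa_commutant h r\<rbrakk> \<Longrightarrow>
      nrm A (f x \<ominus>\<^bsub>A\<^esub> f y) \<le> k * nrm A (x \<ominus>\<^bsub>A\<^esub> y)"
  obtains x where "x \<in> sa_commutant h r" "f x = x"
proof -
  let ?C = "sa_commutant h r"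
  have C: "x \<in> carrier A" if "x \<in> ?C" for x using that by (simp add: sa_commutant_def)
  interpret sub: Submetric "carrier A" "cdist A" ?C
    by unfold_locales (use C in blast)
  have "sub.sub.mcomplete"
  proof (rule sub.sequentially_closedin_mcomplete_imp_mcomplete[OF complete])
    fix s l assume s: "range s \<subseteq> ?C \<and> limitin metric.mtopology s l sequentially"
    then have "s n \<in> ?C" for n by blast
    moreover from this have "s n \<in> carrier A" for n using C by blast
    moreover have "limitin (norm_topology A) s l sequentially"
      using s by (simp add: norm_topology_def)
    ultimately show "l \<in> ?C"
      using limitin_norm_iff[of s l sequentially] limit_in_sa_commutant[OF h, of s] by blast
  qed
  moreover have "\<zero>\<^bsub>A\<^esub> \<in> ?C" using h r by (simp add: sa_commutant_def)
  ultimately obtain x where "x \<in> ?C" "f x = x"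
    using f k contract C
    by - (rule sub.sub.Banach_fixedpoint_thm[of f k], auto simp: cdist_def)
  then show ?thesis using that by blast
qed

text \<open>The fixed point \<open>x\<close> of \<open>x \<mapsto> (h\<^sup>2 + x\<^sup>2) / 2\<close> satisfies \<open>(1 - x)\<^sup>2 = 1 - h\<^sup>2\<close>.\<close>

lemma sa_sqrt:
  assumes h: "h \<in> carrier A" "star A h = h" "nrm A h \<le> 1 / 2"
  obtains c where "c \<in> carrier A" "star A c = c" "h \<otimes>\<^bsub>A\<^esub> c = c \<otimes>\<^bsub>A\<^esub> h"
    "c \<otimes>\<^bsub>A\<^esub> c = \<one>\<^bsub>A\<^esub> \<ominus>\<^bsub>A\<^esub> h \<otimes>\<^bsub>A\<^esub> h"
proof -
  define f where "f x = (1/2) \<odot>\<^bsub>A\<^esub> (h \<otimes>\<^bsub>A\<^esub> h \<oplus>\<^bsub>A\<^esub> x \<otimes>\<^bsub>A\<^esub> x)" for x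
  let ?C = "sa_commutant h (1/2)"
  have C: "x \<in> carrier A" "star A x = x" "h \<otimes>\<^bsub>A\<^esub> x = x \<otimes>\<^bsub>A\<^esub> h" "nrm A x \<le> 1/2" if "x \<in> ?C" for x
    using that by (auto simp: sa_commutant_def)
  have quarter: "nrm A (x \<otimes>\<^bsub>A\<^esub> x) \<le> 1/4" if "x \<in> carrier A" "nrm A x \<le> 1/2" for x
  proof -
    have "nrm A (x \<otimes>\<^bsub>A\<^esub> x) \<le> nrm A x * nrm A x" using that nrm_mult by simp
    also have "\<dots> \<le> 1/2 * (1/2)" using that nrm_nonneg by (intro mult_mono) auto
    finally show ?thesis by simp
  qed
  \<comment> \<open>On the ball of radius 1/2 both squares have norm at most 1/4, so
    \<open>f\<close> stays inside; writing \<open>x x - y y = (x - y) x + y (x - y)\<close> gives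
    the contraction constant 1/2.\<close>
  obtain x where x: "x \<in> ?C" "f x = x"
  proof (rule sa_commutant_fixpoint[of h "1/2" "1/2" f])
    fix x assume x: "x \<in> ?C"
    note xc = C[OF x]
    have "nrm A (h \<otimes>\<^bsub>A\<^esub> h \<oplus>\<^bsub>A\<^esub> x \<otimes>\<^bsub>A\<^esub> x) \<le> 1/4 + 1/4"
      using h xc quarter[of h] quarter[of x] nrm_triangle[of "h \<otimes>\<^bsub>A\<^esub> h" "x \<otimes>\<^bsub>A\<^esub> x"] by simp
    moreover have "h \<otimes>\<^bsub>A\<^esub> (x \<otimes>\<^bsub>A\<^esub> x) = (x \<otimes>\<^bsub>A\<^esub> x) \<otimes>\<^bsub>A\<^esub> h"
      using xc h by (metis mult_assoc)
    ultimately show "f x \<in> ?C"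
      using h xc by (simp add: sa_commutant_def f_def star_smult star_add star_mult nrm_smult
          mult_l_distr mult_r_distr mult_assoc smult_mult_left smult_mult_right)
  next
    fix x y assume "x \<in> ?C" and "y \<in> ?C"
    note xc = C[OF \<open>x \<in> ?C\<close>] and yc = C[OF \<open>y \<in> ?C\<close>]
    have "f x \<ominus>\<^bsub>A\<^esub> f y = (1/2) \<odot>\<^bsub>A\<^esub> ((x \<ominus>\<^bsub>A\<^esub> y) \<otimes>\<^bsub>A\<^esub> x \<oplus>\<^bsub>A\<^esub> y \<otimes>\<^bsub>A\<^esub> (x \<ominus>\<^bsub>A\<^esub> y))"
      using h xc yc by (simp add: f_def smult_minus_right[symmetric] add_minus_add mult_minus_mult)
    moreover have "nrm A ((x \<ominus>\<^bsub>A\<^esub> y) \<otimes>\<^bsub>A\<^esub> x \<oplus>\<^bsub>A\<^esub> y \<otimes>\<^bsub>A\<^esub> (x \<ominus>\<^bsub>A\<^esub> y)) \<le> nrm A (x \<ominus>\<^bsub>A\<^esub> y)"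
    proof -
      have n: "0 \<le> nrm A (x \<ominus>\<^bsub>A\<^esub> y)" using xc yc nrm_nonneg by simp
      have "nrm A ((x \<ominus>\<^bsub>A\<^esub> y) \<otimes>\<^bsub>A\<^esub> x) \<le> nrm A (x \<ominus>\<^bsub>A\<^esub> y) * (1/2)"
        using nrm_mult[of "x \<ominus>\<^bsub>A\<^esub> y" x] xc yc mult_left_mono[OF xc(4) n] by simp
      moreover have "nrm A (y \<otimes>\<^bsub>A\<^esub> (x \<ominus>\<^bsub>A\<^esub> y)) \<le> (1/2) * nrm A (x \<ominus>\<^bsub>A\<^esub> y)"
        using nrm_mult[of y "x \<ominus>\<^bsub>A\<^esub> y"] xc yc mult_right_mono[OF yc(4) n] by simp
      moreover have "nrm A ((x \<ominus>\<^bsub>A\<^esub> y) \<otimes>\<^bsub>A\<^esub> x \<oplus>\<^bsub>A\<^esub> y \<otimes>\<^bsub>A\<^esub> (x \<ominus>\<^bsub>A\<^esub> y))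
          \<le> nrm A ((x \<ominus>\<^bsub>A\<^esub> y) \<otimes>\<^bsub>A\<^esub> x) + nrm A (y \<otimes>\<^bsub>A\<^esub> (x \<ominus>\<^bsub>A\<^esub> y))"
        using xc yc by (intro nrm_triangle) auto
      ultimately show ?thesis by simp
    qed
    ultimately show "nrm A (f x \<ominus>\<^bsub>A\<^esub> f y) \<le> 1/2 * nrm A (x \<ominus>\<^bsub>A\<^esub> y)"
      using xc yc by (simp add: nrm_smult)
  qed (use h in auto)
  note xc = C[OF x(1)]
  have xx: "x \<oplus>\<^bsub>A\<^esub> x = h \<otimes>\<^bsub>A\<^esub> h \<oplus>\<^bsub>A\<^esub> x \<otimes>\<^bsub>A\<^esub> x"
  proof -
    have "x \<oplus>\<^bsub>A\<^esub> x = (1/2 + 1/2) \<odot>\<^bsub>A\<^esub> (h \<otimes>\<^bsub>A\<^esub> h \<oplus>\<^bsub>A\<^esub> x \<otimes>\<^bsub>A\<^esub> x)"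
      using x(2) h xc by (subst smult_plus_left) (simp_all add: f_def)
    then show ?thesis using h xc by simp
  qed
  define c where "c = \<one>\<^bsub>A\<^esub> \<ominus>\<^bsub>A\<^esub> x"
  show ?thesis
  proof (rule that)
    show "c \<in> carrier A" "star A c = c" "h \<otimes>\<^bsub>A\<^esub> c = c \<otimes>\<^bsub>A\<^esub> h"
      using h xc by (simp_all add: c_def star_minus minus_mult_left minus_mult_right)
    have "c \<otimes>\<^bsub>A\<^esub> c = (\<one>\<^bsub>A\<^esub> \<ominus>\<^bsub>A\<^esub> (x \<oplus>\<^bsub>A\<^esub> x)) \<oplus>\<^bsub>A\<^esub> x \<otimes>\<^bsub>A\<^esub> x"
      using xc by (simp add: c_def minus_mult_left minus_mult_right)
        (simp add: a_minus_def M.minus_add M.a_ac)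
    also have "\<dots> = \<one>\<^bsub>A\<^esub> \<ominus>\<^bsub>A\<^esub> h \<otimes>\<^bsub>A\<^esub> h"
    proof -
      have "\<one>\<^bsub>A\<^esub> \<ominus>\<^bsub>A\<^esub> (x \<oplus>\<^bsub>A\<^esub> x) = (\<one>\<^bsub>A\<^esub> \<ominus>\<^bsub>A\<^esub> h \<otimes>\<^bsub>A\<^esub> h) \<ominus>\<^bsub>A\<^esub> x \<otimes>\<^bsub>A\<^esub> x"
        using xc(1) h(1) unfolding xx by (simp add: a_minus_def M.minus_add M.a_assoc)
      then show ?thesis using xc(1) h(1) by simp
    qed
    finally show "c \<otimes>\<^bsub>A\<^esub> c = \<one>\<^bsub>A\<^esub> \<ominus>\<^bsub>A\<^esub> h \<otimes>\<^bsub>A\<^esub> h" .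
  qed
qed

definition unitary :: "'a \<Rightarrow> bool" where
  "unitary u \<longleftrightarrow> u \<in> carrier A \<and> star A u \<otimes>\<^bsub>A\<^esub> u = \<one>\<^bsub>A\<^esub> \<and> u \<otimes>\<^bsub>A\<^esub> star A u = \<one>\<^bsub>A\<^esub>"

lemma nrm_unitary_le: "unitary u \<Longrightarrow> nrm A u \<le> 1"
  using cstar_identity[of u] nrm_one_le nrm_nonneg[of u]
  by (simp add: unitary_def) (metis abs_le_square_iff abs_of_nonneg one_power2 abs_one)

lemma unitary_star: "unitary u \<Longrightarrow> unitary (star A u)"
  by (auto simp: unitary_def)

text \<open>The element \<open>u = h + i c\<close> is unitary because \<open>h\<close> and
  \<open>c\<close> are commuting self-adjoint elements whose squares add up to one. The formula for
  \<open>c\<close> is recorded because it bounds the norm of \<open>c\<close> by 1 in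
  \<open>sa_resolvent\<close>.\<close>

lemma sa_unitary_sqrt:
  assumes h: "h \<in> carrier A" "star A h = h" "nrm A h \<le> 1 / 2"
  obtains c u where "c \<in> carrier A" "star A c = c" "h \<otimes>\<^bsub>A\<^esub> c = c \<otimes>\<^bsub>A\<^esub> h"
    "c \<otimes>\<^bsub>A\<^esub> c = \<one>\<^bsub>A\<^esub> \<ominus>\<^bsub>A\<^esub> h \<otimes>\<^bsub>A\<^esub> h" "unitary u"
    "h = (1/2) \<odot>\<^bsub>A\<^esub> (u \<oplus>\<^bsub>A\<^esub> star A u)" "c = (-\<i>/2) \<odot>\<^bsub>A\<^esub> (u \<ominus>\<^bsub>A\<^esub> star A u)"
proof -
  obtain c where c: "c \<in> carrier A" "star A c = c" "h \<otimes>\<^bsub>A\<^esub> c = c \<otimes>\<^bsub>A\<^esub> h"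
      "c \<otimes>\<^bsub>A\<^esub> c = \<one>\<^bsub>A\<^esub> \<ominus>\<^bsub>A\<^esub> h \<otimes>\<^bsub>A\<^esub> h"
    using sa_sqrt[OF h] by blast
  define u where "u = h \<oplus>\<^bsub>A\<^esub> \<i> \<odot>\<^bsub>A\<^esub> c"
  have su: "star A u = h \<oplus>\<^bsub>A\<^esub> (-\<i>) \<odot>\<^bsub>A\<^esub> c"
    using h c by (simp add: u_def star_add star_smult)
  have one: "h \<otimes>\<^bsub>A\<^esub> h \<oplus>\<^bsub>A\<^esub> c \<otimes>\<^bsub>A\<^esub> c = \<one>\<^bsub>A\<^esub>"
    using h c by (simp add: a_minus_def M.a_ac M.r_neg M.l_neg)
  have canc: "z \<odot>\<^bsub>A\<^esub> y \<oplus>\<^bsub>A\<^esub> (- z) \<odot>\<^bsub>A\<^esub> y = \<zero>\<^bsub>A\<^esub>" if "y \<in> carrier A" for y z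
    using that smult_plus_left[of y z "-z"] by simp
  have id1: "(h \<oplus>\<^bsub>A\<^esub> z \<odot>\<^bsub>A\<^esub> c) \<otimes>\<^bsub>A\<^esub> (h \<oplus>\<^bsub>A\<^esub> (- z) \<odot>\<^bsub>A\<^esub> c) = \<one>\<^bsub>A\<^esub>" if "z * z = -1" for z
  proof -
    have "(h \<oplus>\<^bsub>A\<^esub> z \<odot>\<^bsub>A\<^esub> c) \<otimes>\<^bsub>A\<^esub> (h \<oplus>\<^bsub>A\<^esub> (- z) \<odot>\<^bsub>A\<^esub> c)
        = (h \<otimes>\<^bsub>A\<^esub> h \<oplus>\<^bsub>A\<^esub> c \<otimes>\<^bsub>A\<^esub> c) \<oplus>\<^bsub>A\<^esub> (z \<odot>\<^bsub>A\<^esub> (c \<otimes>\<^bsub>A\<^esub> h) \<oplus>\<^bsub>A\<^esub> (- z) \<odot>\<^bsub>A\<^esub> (c \<otimes>\<^bsub>A\<^esub> h))"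
      using h c that by (simp add: mult_l_distr mult_r_distr smult_mult_left smult_mult_right
          smult_smult smult_plus_right M.a_ac)
    then show ?thesis using h c one canc by simp
  qed
  have "unitary u"
    using id1[of "\<i>"] id1[of "-\<i>"] h c unfolding unitary_def su by (simp add: u_def)
  moreover have "h = (1/2) \<odot>\<^bsub>A\<^esub> (u \<oplus>\<^bsub>A\<^esub> star A u)"
  proof -
    have "u \<oplus>\<^bsub>A\<^esub> star A u = (h \<oplus>\<^bsub>A\<^esub> h) \<oplus>\<^bsub>A\<^esub> (\<i> \<odot>\<^bsub>A\<^esub> c \<oplus>\<^bsub>A\<^esub> (-\<i>) \<odot>\<^bsub>A\<^esub> c)"
      using h c unfolding su by (simp add: u_def M.a_ac)
    also have "\<dots> = h \<oplus>\<^bsub>A\<^esub> h" using h c canc by simp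
    also have "(1/2) \<odot>\<^bsub>A\<^esub> \<dots> = h"
      using h smult_plus_left[of h "1/2" "1/2"] by (simp add: smult_plus_right)
    finally show ?thesis by simp
  qed
  moreover have "c = (-\<i>/2) \<odot>\<^bsub>A\<^esub> (u \<ominus>\<^bsub>A\<^esub> star A u)"
  proof -
    have "u \<ominus>\<^bsub>A\<^esub> star A u = (h \<ominus>\<^bsub>A\<^esub> h) \<oplus>\<^bsub>A\<^esub> (\<i> \<odot>\<^bsub>A\<^esub> c \<ominus>\<^bsub>A\<^esub> (-\<i>) \<odot>\<^bsub>A\<^esub> c)"
      unfolding su unfolding u_def by (rule add_minus_add) (use h c in auto)
    also have "\<i> \<odot>\<^bsub>A\<^esub> c \<ominus>\<^bsub>A\<^esub> (-\<i>) \<odot>\<^bsub>A\<^esub> c = \<i> \<odot>\<^bsub>A\<^esub> c \<oplus>\<^bsub>A\<^esub> \<i> \<odot>\<^bsub>A\<^esub> c"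
      using c(1) by (simp add: minus_eq_smult smult_smult)
    also have "(h \<ominus>\<^bsub>A\<^esub> h) \<oplus>\<^bsub>A\<^esub> (\<i> \<odot>\<^bsub>A\<^esub> c \<oplus>\<^bsub>A\<^esub> \<i> \<odot>\<^bsub>A\<^esub> c) = \<i> \<odot>\<^bsub>A\<^esub> c \<oplus>\<^bsub>A\<^esub> \<i> \<odot>\<^bsub>A\<^esub> c"
      using h(1) c(1) by simp
    also have "\<dots> = (2 * \<i>) \<odot>\<^bsub>A\<^esub> c"
      using smult_plus_left[OF c(1), of "\<i>" "\<i>"] by simp
    also have "(-\<i>/2) \<odot>\<^bsub>A\<^esub> \<dots> = c"
      using c by (simp add: smult_smult)
    finally show ?thesis by simp
  qed
  ultimately show ?thesis using that c by blast
qed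

lemma real_imag_parts:
  assumes m: "m \<in> carrier A"
  obtains h k where "h \<in> carrier A" "star A h = h" "k \<in> carrier A" "star A k = k"
    "m = h \<oplus>\<^bsub>A\<^esub> \<i> \<odot>\<^bsub>A\<^esub> k" "nrm A h \<le> nrm A m" "nrm A k \<le> nrm A m"
proof -
  define h where "h = (1/2) \<odot>\<^bsub>A\<^esub> (m \<oplus>\<^bsub>A\<^esub> star A m)"
  define k where "k = (-\<i>/2) \<odot>\<^bsub>A\<^esub> (m \<oplus>\<^bsub>A\<^esub> (-1) \<odot>\<^bsub>A\<^esub> star A m)"
  show ?thesis
  proof (rule that)
    show "h \<in> carrier A" "k \<in> carrier A" using m by (simp_all add: h_def k_def)
    show "star A h = h" "star A k = k"
      using m by (simp_all add: h_def k_def star_smult star_add M.a_comm smult_plus_right smult_smult)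
    have "\<i> \<odot>\<^bsub>A\<^esub> k = (1/2) \<odot>\<^bsub>A\<^esub> m \<oplus>\<^bsub>A\<^esub> (-1/2) \<odot>\<^bsub>A\<^esub> star A m"
      using m by (simp add: k_def smult_smult smult_plus_right)
    then have "h \<oplus>\<^bsub>A\<^esub> \<i> \<odot>\<^bsub>A\<^esub> k = ((1/2) \<odot>\<^bsub>A\<^esub> m \<oplus>\<^bsub>A\<^esub> (1/2) \<odot>\<^bsub>A\<^esub> m)
        \<oplus>\<^bsub>A\<^esub> ((1/2) \<odot>\<^bsub>A\<^esub> star A m \<oplus>\<^bsub>A\<^esub> (-1/2) \<odot>\<^bsub>A\<^esub> star A m)"
      using m by (simp add: h_def smult_plus_right M.a_ac)
    also have "\<dots> = m" using m by (simp add: smult_plus_left[symmetric])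
    finally show "m = h \<oplus>\<^bsub>A\<^esub> \<i> \<odot>\<^bsub>A\<^esub> k" by simp
    show "nrm A h \<le> nrm A m"
      using m nrm_triangle[of m "star A m"] by (simp add: h_def nrm_smult)
    show "nrm A k \<le> nrm A m"
      using m nrm_triangle[of m "(-1) \<odot>\<^bsub>A\<^esub> star A m"] by (simp add: k_def nrm_smult norm_divide)
  qed
qed

lemma sa_scale:
  assumes "h \<in> carrier A" "star A h = h"
  obtains t h' where "0 < t" "h' \<in> carrier A" "star A h' = h'" "nrm A h' \<le> 1/2"
    "h = complex_of_real t \<odot>\<^bsub>A\<^esub> h'"
proof
  \<comment> \<open>The summand 1 keeps \<open>t\<close> positive for \<open>h = 0\<close>.\<close>
  define t where "t = 2 * nrm A h + 1"
  have n: "0 \<le> nrm A h" using assms nrm_nonneg by simp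
  then show t: "0 < t" unfolding t_def by (intro add_nonneg_pos) auto
  show "complex_of_real (1/t) \<odot>\<^bsub>A\<^esub> h \<in> carrier A"
    "star A (complex_of_real (1/t) \<odot>\<^bsub>A\<^esub> h) = complex_of_real (1/t) \<odot>\<^bsub>A\<^esub> h"
    using assms by (simp_all add: star_smult)
  show "nrm A (complex_of_real (1/t) \<odot>\<^bsub>A\<^esub> h) \<le> 1/2"
  proof -
    have "nrm A (complex_of_real (1/t) \<odot>\<^bsub>A\<^esub> h) = nrm A h / t"
      using assms(1) t nrm_smult[of h "complex_of_real (1/t)"] unfolding norm_of_real by simp
    also have "\<dots> \<le> 1/2" using n t by (simp add: pos_divide_le_eq) (simp add: t_def)
    finally show ?thesis .
  qed
  show "h = complex_of_real t \<odot>\<^bsub>A\<^esub> (complex_of_real (1/t) \<odot>\<^bsub>A\<^esub> h)"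
    using assms t by (simp add: smult_smult)
qed

text \<open>The real and imaginary parts of \<open>m\<close>, rescaled to norm at most 1/2, are
  averages of a unitary and its adjoint.\<close>

lemma unitary_span_induct:
  assumes m: "m \<in> carrier A"
    and unitary: "\<And>u. unitary u \<Longrightarrow> P u"
    and add: "\<And>x y. \<lbrakk>x \<in> carrier A; y \<in> carrier A; P x; P y\<rbrakk> \<Longrightarrow> P (x \<oplus>\<^bsub>A\<^esub> y)"
    and smult: "\<And>c x. \<lbrakk>x \<in> carrier A; P x\<rbrakk> \<Longrightarrow> P (c \<odot>\<^bsub>A\<^esub> x)"
  shows "P m"
proof -
  have sa: "P h" if h: "h \<in> carrier A" "star A h = h" for h
  proof -
    obtain t h' where t: "0 < t" "h' \<in> carrier A" "star A h' = h'" "nrm A h' \<le> 1/2"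
        "h = complex_of_real t \<odot>\<^bsub>A\<^esub> h'" using sa_scale[OF h] by blast
    obtain u where u: "unitary u" "h' = (1/2) \<odot>\<^bsub>A\<^esub> (u \<oplus>\<^bsub>A\<^esub> star A u)"
      using sa_unitary_sqrt[OF t(2-4)] by blast
    have uc: "u \<in> carrier A" using u(1) by (simp add: unitary_def)
    have "P (u \<oplus>\<^bsub>A\<^esub> star A u)"
      using uc u(1) unitary unitary_star by (intro add) auto
    then have "P h'" unfolding u(2) using uc by (intro smult) auto
    then show ?thesis unfolding t(5) using t(2) by (intro smult)
  qed
  obtain h k where "h \<in> carrier A" "star A h = h" "k \<in> carrier A" "star A k = k"
    "m = h \<oplus>\<^bsub>A\<^esub> \<i> \<odot>\<^bsub>A\<^esub> k" using real_imag_parts[OF m] by blast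
  then show ?thesis using sa add smult by auto
qed

text \<open>With \<open>p = 1 - h\<^sup>2\<close>, of norm at most 1, the witness is \<open>w = (1 - (1 - d) p)\<^sup>-\<^sup>1\<close>, the fixed point of
  \<open>w \<mapsto> 1 + (1 - d) p w\<close>. As \<open>1 - h\<^sup>2 w = d p w\<close>, the elements \<open>h\<^sup>2 w\<close> act on \<open>h\<close> as an approximate unit
  for \<open>d \<rightarrow> 0\<close>.\<close>

lemma sa_resolvent:
  assumes h: "h \<in> carrier A" "star A h = h" "nrm A h \<le> 1 / 2" and d: "0 < d" "d < 1"
  obtains w where "w \<in> carrier A"
    "nrm A (h \<otimes>\<^bsub>A\<^esub> (h \<otimes>\<^bsub>A\<^esub> w)) \<le> 2"
    "nrm A (h \<ominus>\<^bsub>A\<^esub> (h \<otimes>\<^bsub>A\<^esub> (h \<otimes>\<^bsub>A\<^esub> w)) \<otimes>\<^bsub>A\<^esub> h) \<le> sqrt (2 * d)"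
proof -
  obtain c u where c: "c \<in> carrier A" "star A c = c" "h \<otimes>\<^bsub>A\<^esub> c = c \<otimes>\<^bsub>A\<^esub> h"
      "c \<otimes>\<^bsub>A\<^esub> c = \<one>\<^bsub>A\<^esub> \<ominus>\<^bsub>A\<^esub> h \<otimes>\<^bsub>A\<^esub> h"
    and u: "unitary u" "c = (-\<i>/2) \<odot>\<^bsub>A\<^esub> (u \<ominus>\<^bsub>A\<^esub> star A u)"
    using sa_unitary_sqrt[OF h] by blast
  have uc: "u \<in> carrier A" using u(1) by (simp add: unitary_def)
  \<comment> \<open>As the imaginary part of a unitary, \<open>c\<close> has norm at most 1, and
    therefore so has \<open>p = c c\<close>; no order structure is involved.\<close>
  have "nrm A c \<le> 1"
  proof -
    have "nrm A c = 1/2 * nrm A (u \<ominus>\<^bsub>A\<^esub> star A u)"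
      by (subst u(2)) (simp add: nrm_smult norm_divide uc)
    then show ?thesis using uc nrm_minus_le[of u "star A u"] nrm_unitary_le[OF u(1)] by simp
  qed
  define p where "p = c \<otimes>\<^bsub>A\<^esub> c"
  have p: "p \<in> carrier A" "star A p = p" using c(1,2) by (simp_all add: p_def star_mult del: c(4))
  have "nrm A p \<le> nrm A c * nrm A c" unfolding p_def using c(1) c(1) by (rule nrm_mult)
  also have "\<dots> \<le> 1 * 1" using \<open>nrm A c \<le> 1\<close> nrm_nonneg[OF c(1)] by (intro mult_mono) auto
  finally have np: "nrm A p \<le> 1" by simp
  have hp: "h \<otimes>\<^bsub>A\<^esub> p = p \<otimes>\<^bsub>A\<^esub> h" using h c by (metis mult_assoc p_def)
  have pw: "p \<otimes>\<^bsub>A\<^esub> w = w \<otimes>\<^bsub>A\<^esub> p" if "w \<in> carrier A" "h \<otimes>\<^bsub>A\<^esub> w = w \<otimes>\<^bsub>A\<^esub> h" for w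
  proof -
    have "(h \<otimes>\<^bsub>A\<^esub> h) \<otimes>\<^bsub>A\<^esub> w = w \<otimes>\<^bsub>A\<^esub> (h \<otimes>\<^bsub>A\<^esub> h)" using h that by (metis mult_assoc)
    then show ?thesis
      using that h unfolding p_def c(4) by (simp add: minus_mult_left minus_mult_right)
  qed
  \<comment> \<open>The radius solves \<open>1 + (1 - d) r = r\<close>, so the ball is mapped into
    itself.\<close>
  let ?C = "sa_commutant h (1/d)"
  have C: "x \<in> carrier A" "star A x = x" "h \<otimes>\<^bsub>A\<^esub> x = x \<otimes>\<^bsub>A\<^esub> h" "nrm A x \<le> 1/d" if "x \<in> ?C" for x
    using that by (auto simp: sa_commutant_def)
  define f where "f w = \<one>\<^bsub>A\<^esub> \<oplus>\<^bsub>A\<^esub> complex_of_real (1 - d) \<odot>\<^bsub>A\<^esub> (p \<otimes>\<^bsub>A\<^esub> w)" for w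
  have npx: "nrm A (p \<otimes>\<^bsub>A\<^esub> x) \<le> nrm A x" if "x \<in> carrier A" for x
  proof -
    have "nrm A p * nrm A x \<le> 1 * nrm A x"
      using np nrm_nonneg[OF that] by (intro mult_right_mono) auto
    then show ?thesis using nrm_mult[OF p(1) that] by simp
  qed
  obtain w where w: "w \<in> ?C" "f w = w"
  proof (rule sa_commutant_fixpoint[of h "1/d" "1 - d" f])
    fix x assume "x \<in> ?C"
    note xc = C[OF this]
    have "nrm A (f x) \<le> nrm A \<one>\<^bsub>A\<^esub> + (1 - d) * nrm A (p \<otimes>\<^bsub>A\<^esub> x)"
      using nrm_triangle[of "\<one>\<^bsub>A\<^esub>" "complex_of_real (1 - d) \<odot>\<^bsub>A\<^esub> (p \<otimes>\<^bsub>A\<^esub> x)"] p xc d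
        nrm_smult[of "p \<otimes>\<^bsub>A\<^esub> x" "complex_of_real (1 - d)"]
      by (simp add: f_def norm_of_real del: of_real_diff)
    also have "\<dots> \<le> 1 + (1 - d) * (1/d)"
      using nrm_one_le npx[OF xc(1)] xc(4) d by (intro add_mono mult_left_mono) auto
    also have "\<dots> = 1/d" using d by (simp add: field_simps)
    finally have "nrm A (f x) \<le> 1/d" .
    moreover have "star A (f x) = f x"
      using p xc pw by (simp add: f_def star_add star_smult star_mult)
    moreover have "h \<otimes>\<^bsub>A\<^esub> (p \<otimes>\<^bsub>A\<^esub> x) = (p \<otimes>\<^bsub>A\<^esub> x) \<otimes>\<^bsub>A\<^esub> h" using h p hp xc by (metis mult_assoc)
    then have "h \<otimes>\<^bsub>A\<^esub> f x = f x \<otimes>\<^bsub>A\<^esub> h"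
      using h p xc by (simp add: f_def mult_l_distr mult_r_distr smult_mult_left smult_mult_right)
    ultimately show "f x \<in> ?C" using p xc by (simp add: sa_commutant_def f_def)
  next
    fix x y assume "x \<in> ?C" and "y \<in> ?C"
    note xc = C[OF \<open>x \<in> ?C\<close>] and yc = C[OF \<open>y \<in> ?C\<close>]
    have "f x \<ominus>\<^bsub>A\<^esub> f y = complex_of_real (1 - d) \<odot>\<^bsub>A\<^esub> (p \<otimes>\<^bsub>A\<^esub> (x \<ominus>\<^bsub>A\<^esub> y))"
      using p xc yc by (simp add: f_def add_minus_add smult_minus_right minus_mult_right)
    then have "nrm A (f x \<ominus>\<^bsub>A\<^esub> f y) = (1 - d) * nrm A (p \<otimes>\<^bsub>A\<^esub> (x \<ominus>\<^bsub>A\<^esub> y))"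
      using p xc yc d nrm_smult[of "p \<otimes>\<^bsub>A\<^esub> (x \<ominus>\<^bsub>A\<^esub> y)" "complex_of_real (1 - d)"]
      by (simp add: norm_of_real del: of_real_diff)
    also have "\<dots> \<le> (1 - d) * nrm A (x \<ominus>\<^bsub>A\<^esub> y)"
      using npx[of "x \<ominus>\<^bsub>A\<^esub> y"] xc yc d by (intro mult_left_mono) auto
    finally show "nrm A (f x \<ominus>\<^bsub>A\<^esub> f y) \<le> (1 - d) * nrm A (x \<ominus>\<^bsub>A\<^esub> y)" .
  qed (use h d in auto)
  note wc = C[OF w(1)]
  \<comment> \<open>This will be \<open>1 - h h w\<close>; the radius \<open>1/d\<close> of the ball
    containing \<open>w\<close> bounds its norm by 1.\<close>
  define q where "q = complex_of_real d \<odot>\<^bsub>A\<^esub> (p \<otimes>\<^bsub>A\<^esub> w)"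
  have q: "q \<in> carrier A" using p wc by (simp add: q_def)
  have nq: "nrm A q \<le> 1"
    using npx[OF wc(1)] wc p d nrm_smult[of "p \<otimes>\<^bsub>A\<^esub> w" "complex_of_real d"]
    by (simp add: q_def) (metis mult.commute order_trans pos_le_divide_eq)
  define x where "x = h \<otimes>\<^bsub>A\<^esub> (h \<otimes>\<^bsub>A\<^esub> w)"
  have xA: "x \<in> carrier A" using h wc by (simp add: x_def)
  have xq: "x = \<one>\<^bsub>A\<^esub> \<ominus>\<^bsub>A\<^esub> q"
  proof -
    have "h \<otimes>\<^bsub>A\<^esub> h = \<one>\<^bsub>A\<^esub> \<ominus>\<^bsub>A\<^esub> p"
      using h by (simp add: p_def c(4) minus_minus_cancel)
    then have "x = w \<ominus>\<^bsub>A\<^esub> p \<otimes>\<^bsub>A\<^esub> w"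
      using h(1) wc(1) p(1) by (simp add: x_def mult_assoc[symmetric] minus_mult_left)
    also have "w = \<one>\<^bsub>A\<^esub> \<oplus>\<^bsub>A\<^esub> (1 + complex_of_real (- d)) \<odot>\<^bsub>A\<^esub> (p \<otimes>\<^bsub>A\<^esub> w)"
      using w(2) by (simp add: f_def)
    then have "w \<ominus>\<^bsub>A\<^esub> p \<otimes>\<^bsub>A\<^esub> w = \<one>\<^bsub>A\<^esub> \<oplus>\<^bsub>A\<^esub> (1 + complex_of_real (- d)) \<odot>\<^bsub>A\<^esub> (p \<otimes>\<^bsub>A\<^esub> w) \<ominus>\<^bsub>A\<^esub> p \<otimes>\<^bsub>A\<^esub> w"
      by simp
    also have "\<dots> = \<one>\<^bsub>A\<^esub> \<oplus>\<^bsub>A\<^esub> ((1 + complex_of_real (- d)) \<odot>\<^bsub>A\<^esub> (p \<otimes>\<^bsub>A\<^esub> w) \<oplus>\<^bsub>A\<^esub> (-1) \<odot>\<^bsub>A\<^esub> (p \<otimes>\<^bsub>A\<^esub> w))"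
      using p wc by (simp add: minus_eq_smult M.a_assoc)
    also have "\<dots> = \<one>\<^bsub>A\<^esub> \<oplus>\<^bsub>A\<^esub> complex_of_real (- d) \<odot>\<^bsub>A\<^esub> (p \<otimes>\<^bsub>A\<^esub> w)"
      using p wc by (simp add: smult_plus_left[symmetric])
    also have "\<dots> = \<one>\<^bsub>A\<^esub> \<ominus>\<^bsub>A\<^esub> q"
      using p wc by (simp add: q_def minus_eq_smult smult_smult)
    finally show ?thesis .
  qed
  show ?thesis
  proof (rule that)
    show "w \<in> carrier A" by fact
    show nx: "nrm A (h \<otimes>\<^bsub>A\<^esub> (h \<otimes>\<^bsub>A\<^esub> w)) \<le> 2"
      using nrm_minus_le[of "\<one>\<^bsub>A\<^esub>" q] nrm_one_le nq q unfolding x_def[symmetric] xq by simp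
    have hw: "h \<otimes>\<^bsub>A\<^esub> w = w \<otimes>\<^bsub>A\<^esub> h" by fact
    have pq: "q \<otimes>\<^bsub>A\<^esub> h = h \<otimes>\<^bsub>A\<^esub> q"
      using h p wc hp by (simp add: q_def smult_mult_left smult_mult_right) (metis mult_assoc)
    have sq: "star A q = q" using p wc pw by (simp add: q_def star_smult star_mult)
    have eq: "h \<ominus>\<^bsub>A\<^esub> x \<otimes>\<^bsub>A\<^esub> h = q \<otimes>\<^bsub>A\<^esub> h"
      using h q by (simp add: xq minus_mult_left minus_minus_cancel)
    \<comment> \<open>Since \<open>w h h = x\<close>, the product \<open>q h h\<close> equals
      \<open>d p x\<close>: one factor \<open>d\<close> is gained, while \<open>q\<close> and
      \<open>p x\<close> have norm at most 1 and 2.\<close>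
    have "(nrm A (q \<otimes>\<^bsub>A\<^esub> h))\<^sup>2 = nrm A (star A (q \<otimes>\<^bsub>A\<^esub> h) \<otimes>\<^bsub>A\<^esub> (q \<otimes>\<^bsub>A\<^esub> h))"
      using q h by (simp add: cstar_identity)
    also have "star A (q \<otimes>\<^bsub>A\<^esub> h) \<otimes>\<^bsub>A\<^esub> (q \<otimes>\<^bsub>A\<^esub> h) = q \<otimes>\<^bsub>A\<^esub> (q \<otimes>\<^bsub>A\<^esub> (h \<otimes>\<^bsub>A\<^esub> h))"
      using q h sq pq by (simp add: star_mult) (metis mult_assoc mult_closed)
    also have "\<dots> = complex_of_real d \<odot>\<^bsub>A\<^esub> (q \<otimes>\<^bsub>A\<^esub> (p \<otimes>\<^bsub>A\<^esub> x))"
    proof -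
      have "w \<otimes>\<^bsub>A\<^esub> (h \<otimes>\<^bsub>A\<^esub> h) = x" using h wc by (simp add: x_def) (metis mult_assoc)
      moreover have "q \<otimes>\<^bsub>A\<^esub> (h \<otimes>\<^bsub>A\<^esub> h) = complex_of_real d \<odot>\<^bsub>A\<^esub> (p \<otimes>\<^bsub>A\<^esub> (w \<otimes>\<^bsub>A\<^esub> (h \<otimes>\<^bsub>A\<^esub> h)))"
        using h p wc by (simp add: q_def smult_mult_left mult_assoc)
      ultimately show ?thesis using q p xA by (simp add: smult_mult_right)
    qed
    also have "nrm A \<dots> = d * nrm A (q \<otimes>\<^bsub>A\<^esub> (p \<otimes>\<^bsub>A\<^esub> x))"
      using q p xA d by (simp add: nrm_smult)
    also have "\<dots> \<le> d * (1 * 2)"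
    proof -
      have "nrm A (q \<otimes>\<^bsub>A\<^esub> (p \<otimes>\<^bsub>A\<^esub> x)) \<le> nrm A q * nrm A (p \<otimes>\<^bsub>A\<^esub> x)"
        using q p xA by (intro nrm_mult) auto
      also have "\<dots> \<le> 1 * 2"
        using nq npx[OF xA] nx q p xA nrm_nonneg unfolding x_def[symmetric]
        by (intro mult_mono) auto
      finally show ?thesis using d by (intro mult_left_mono) auto
    qed
    finally have "(nrm A (q \<otimes>\<^bsub>A\<^esub> h))\<^sup>2 \<le> 2 * d" by simp
    then show "nrm A (h \<ominus>\<^bsub>A\<^esub> (h \<otimes>\<^bsub>A\<^esub> (h \<otimes>\<^bsub>A\<^esub> w)) \<otimes>\<^bsub>A\<^esub> h) \<le> sqrt (2 * d)"
      unfolding x_def[symmetric] eq by (rule real_le_rsqrt)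
  qed
qed

end

text \<open>Apply \<open>sa_resolvent\<close> in the multiplier algebra to a multiple
  \<open>h0\<close> of \<open>b (star b)\<close>. The witness \<open>w\<close> is only a multiplier,
  but \<open>x = h0 (h0 w)\<close> lies in the algebra, which is an ideal. For
  \<open>z = b - x b\<close> the product \<open>z (star z)\<close> is \<open>z (star b)\<close>
  minus \<open>z (star b) (star x)\<close>, and \<open>z (star b)\<close> is a multiple of the small
  element \<open>h0 - x h0\<close>.\<close>

lemma (in cstar_algebra) approximate_left_unit:
  assumes b: "b \<in> carrier A" and e: "e > 0"
  obtains x where "x \<in> carrier A" "nrm A (b \<ominus>\<^bsub>A\<^esub> x \<otimes>\<^bsub>A\<^esub> b) < e"
proof -
  interpret M: unital_cstar_algebra MA by (rule unital_mult_alg)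
  \<comment> \<open>With this factor the norm of \<open>h0\<close> is \<open>s / (2 s + 1)\<close>
    for \<open>s = ||b||^2\<close>, hence at most 1/2.\<close>
  define t where "t = 1 / (2 * (nrm A b)\<^sup>2 + 1)"
  define h0 where "h0 = complex_of_real t \<odot>\<^bsub>A\<^esub> (b \<otimes>\<^bsub>A\<^esub> star A b)"
  have t: "0 < t" unfolding t_def by (intro divide_pos_pos add_nonneg_pos) auto
  have h0: "h0 \<in> carrier A" "star A h0 = h0" using b by (simp_all add: h0_def star_smult star_mult)
  have nh0: "nrm A h0 \<le> 1/2"
  proof -
    have "nrm A h0 = t * (nrm A b)\<^sup>2"
      using b t by (simp add: h0_def nrm_smult cstar_identity')
    also have "\<dots> \<le> 1/2"
    proof -
      have "s / (2 * s + 1) \<le> 1/2" if "0 \<le> s" for s :: real using that by (simp add: field_simps)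
      from this[of "(nrm A b)\<^sup>2"] show ?thesis by (simp add: t_def)
    qed
    finally show ?thesis .
  qed
  \<comment> \<open>Chosen to make \<open>sqrt (2 d)\<close> less than \<open>t e^2 / 3\<close>; the
    divisor 3 is \<open>1 + 2\<close>, with 2 the bound for \<open>||x||\<close>. The minimum keeps
    \<open>d\<close> below 1.\<close>
  define d where "d = min (1/2) ((t * e\<^sup>2 / 3)\<^sup>2 / 4)"
  have d: "0 < d" "d < 1" using t e by (auto simp: d_def)
  have sd: "sqrt (2 * d) < t * e\<^sup>2 / 3"
  proof -
    have "0 < (t * e\<^sup>2 / 3)\<^sup>2" using t e by simp
    then have "2 * d < (t * e\<^sup>2 / 3)\<^sup>2" unfolding d_def by linarith
    then show ?thesis using t e by (intro real_less_lsqrt) auto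
  qed
  let ?h = "mult_embed A h0"
  obtain w where w: "w \<in> carrier MA" "nrm MA (?h \<otimes>\<^bsub>MA\<^esub> (?h \<otimes>\<^bsub>MA\<^esub> w)) \<le> 2"
    "nrm MA (?h \<ominus>\<^bsub>MA\<^esub> (?h \<otimes>\<^bsub>MA\<^esub> (?h \<otimes>\<^bsub>MA\<^esub> w)) \<otimes>\<^bsub>MA\<^esub> ?h) \<le> sqrt (2 * d)"
  proof (rule M.sa_resolvent[of ?h d])
    show "star MA ?h = ?h"
      using star_hom_star[OF mult_embed_hom, of h0] h0 by simp
  qed (use h0 nh0 d nrm_mult_embed in auto)
  define x where "x = h0 \<otimes>\<^bsub>A\<^esub> snd w h0"
  have x: "x \<in> carrier A" using h0 w snd_carrier by (simp add: x_def)
  have hhw: "?h \<otimes>\<^bsub>MA\<^esub> (?h \<otimes>\<^bsub>MA\<^esub> w) = mult_embed A x"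
    using h0 w snd_carrier by (simp add: x_def mult_embed_mult star_hom_mult[OF mult_embed_hom])
  have nx: "nrm A x \<le> 2" using w(2) x nrm_mult_embed unfolding hhw by simp
  have "?h \<ominus>\<^bsub>MA\<^esub> (?h \<otimes>\<^bsub>MA\<^esub> (?h \<otimes>\<^bsub>MA\<^esub> w)) \<otimes>\<^bsub>MA\<^esub> ?h = mult_embed A (h0 \<ominus>\<^bsub>A\<^esub> x \<otimes>\<^bsub>A\<^esub> h0)"
    unfolding hhw using x h0
    by (simp add: star_hom_minus[OF mult_embed_hom] star_hom_mult[OF mult_embed_hom]
        cstar_algebra_axioms cstar_algebra_mult_alg)
  then have nh: "nrm A (h0 \<ominus>\<^bsub>A\<^esub> x \<otimes>\<^bsub>A\<^esub> h0) \<le> sqrt (2 * d)"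
    using w(3) x h0 nrm_mult_embed[of "h0 \<ominus>\<^bsub>A\<^esub> x \<otimes>\<^bsub>A\<^esub> h0"] by simp
  define z where "z = b \<ominus>\<^bsub>A\<^esub> x \<otimes>\<^bsub>A\<^esub> b"
  have z: "z \<in> carrier A" using b x by (simp add: z_def)
  have "complex_of_real t \<odot>\<^bsub>A\<^esub> (z \<otimes>\<^bsub>A\<^esub> star A b) = h0 \<ominus>\<^bsub>A\<^esub> x \<otimes>\<^bsub>A\<^esub> h0"
    using b x by (simp add: z_def h0_def minus_mult_left smult_minus_right smult_mult_right mult_assoc)
  then have "t * nrm A (z \<otimes>\<^bsub>A\<^esub> star A b) \<le> sqrt (2 * d)"
    using nh nrm_smult[of "z \<otimes>\<^bsub>A\<^esub> star A b" "complex_of_real t"] z b t by simp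
  then have nzb: "nrm A (z \<otimes>\<^bsub>A\<^esub> star A b) < e\<^sup>2 / 3"
  proof -
    have "t * nrm A (z \<otimes>\<^bsub>A\<^esub> star A b) < t * (e\<^sup>2 / 3)"
      using \<open>t * nrm A (z \<otimes>\<^bsub>A\<^esub> star A b) \<le> sqrt (2 * d)\<close> sd by simp
    then show ?thesis using t by (simp only: mult_less_cancel_left_pos)
  qed
  have "(nrm A z)\<^sup>2 = nrm A (z \<otimes>\<^bsub>A\<^esub> star A z)" using z by (simp add: cstar_identity')
  also have "z \<otimes>\<^bsub>A\<^esub> star A z = (z \<otimes>\<^bsub>A\<^esub> star A b) \<ominus>\<^bsub>A\<^esub> (z \<otimes>\<^bsub>A\<^esub> star A b) \<otimes>\<^bsub>A\<^esub> star A x"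
    using z b x by (subst (2) z_def) (simp add: star_minus star_mult minus_mult_right mult_assoc)
  also have "nrm A \<dots> \<le> nrm A (z \<otimes>\<^bsub>A\<^esub> star A b) + nrm A ((z \<otimes>\<^bsub>A\<^esub> star A b) \<otimes>\<^bsub>A\<^esub> star A x)"
    using z b x by (intro nrm_minus_le) auto
  also have "nrm A ((z \<otimes>\<^bsub>A\<^esub> star A b) \<otimes>\<^bsub>A\<^esub> star A x) \<le> nrm A (z \<otimes>\<^bsub>A\<^esub> star A b) * nrm A x"
    using z b x nrm_mult[of "z \<otimes>\<^bsub>A\<^esub> star A b" "star A x"] by simp
  also have "\<dots> \<le> nrm A (z \<otimes>\<^bsub>A\<^esub> star A b) * 2"
    using nx z b nrm_nonneg by (intro mult_left_mono) auto
  finally have "(nrm A z)\<^sup>2 < e\<^sup>2" using nzb by simp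
  then have "nrm A z < e" using e by (simp add: power2_less_imp_less)
  then show ?thesis using that x by (simp add: z_def)
qed

section \<open>Non-degenerate homomorphisms and their extensions\<close>

context cstar_algebra
begin

text \<open>Every \<open>b\<close> is approximated by a single product \<open>x b\<close>. This is
  the source of non-degeneracy for automorphisms and inclusions.\<close>

lemma clspan_products: "clspan A {x \<otimes>\<^bsub>A\<^esub> y | x y. x \<in> carrier A \<and> y \<in> carrier A} = carrier A"
  (is "clspan A ?S = _")
proof
  show "clspan A ?S \<subseteq> carrier A"
  proof
    fix x assume "x \<in> clspan A ?S"
    then show "x \<in> carrier A" by (rule clspan_carrier[rotated]) auto
  qed
  show "carrier A \<subseteq> clspan A ?S"
  proof
    fix b assume b: "b \<in> carrier A"
    show "b \<in> clspan A ?S"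
    proof (rule clspan_limit[OF b])
      fix e :: real assume "e > 0"
      then obtain x where "x \<in> carrier A" "nrm A (b \<ominus>\<^bsub>A\<^esub> x \<otimes>\<^bsub>A\<^esub> b) < e"
        using approximate_left_unit[OF b] by blast
      then show "\<exists>y. y \<in> clspan A ?S \<and> nrm A (b \<ominus>\<^bsub>A\<^esub> y) < e" using b by (auto intro: clspan_base)
    qed
  qed
qed

lemma finsum_lessThan_Suc:
  "f \<in> {..<Suc n} \<rightarrow> carrier A \<Longrightarrow> (\<Oplus>\<^bsub>A\<^esub>i\<in>{..<Suc n}. f i) = f n \<oplus>\<^bsub>A\<^esub> (\<Oplus>\<^bsub>A\<^esub>i\<in>{..<n}. f i)"
  unfolding lessThan_Suc by (subst M.finsum_insert) (auto simp: Pi_iff)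

text \<open>Replaces the closure of finite sums in the definition by the inductive span. A nonempty
  carrier supplies zero as a generator, which matches the empty sum.\<close>

lemma nondegenerate_hom_iff:
  assumes ne: "carrier P \<noteq> {}"
  shows "nondegenerate_hom P A \<phi> \<longleftrightarrow> \<phi> \<in> star_hom P MA \<and>
    clspan A {fst (\<phi> a) b | a b. a \<in> carrier P \<and> b \<in> carrier A} = carrier A"
proof (cases "\<phi> \<in> star_hom P MA")
  case True
  have act: "fst (\<phi> a) b \<in> carrier A" if "a \<in> carrier P" "b \<in> carrier A" for a b
    using star_hom_carrier[OF True that(1)] that(2) by (rule fst_carrier)
  let ?S = "{fst (\<phi> a) b | a b. a \<in> carrier P \<and> b \<in> carrier A}"
  let ?T = "{\<Oplus>\<^bsub>A\<^esub>i\<in>{..<n}. fst (\<phi> (a i)) (b i) | (n::nat) a b.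
          a \<in> {..<n} \<rightarrow> carrier P \<and> b \<in> {..<n} \<rightarrow> carrier A}"
  have S: "?S \<subseteq> carrier A" using act by auto
  have T: "?T \<subseteq> carrier A"
    by (auto intro!: M.finsum_closed act)
  obtain a0 where a0: "a0 \<in> carrier P" using ne by blast
  have "\<zero>\<^bsub>A\<^esub> \<in> ?S"
    using fst_zero[OF star_hom_carrier[OF True a0]] a0 by (force intro!: exI[of _ a0] exI[of _ "\<zero>\<^bsub>A\<^esub>"])
  have TS: "?T \<subseteq> clspan A ?S"
  proof (clarify)
    fix n :: nat and a b assume "a \<in> {..<n} \<rightarrow> carrier P" "b \<in> {..<n} \<rightarrow> carrier A"
    then show "(\<Oplus>\<^bsub>A\<^esub>i\<in>{..<n}. fst (\<phi> (a i)) (b i)) \<in> clspan A ?S"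
    proof (induction n)
      case 0
      then show ?case using \<open>\<zero>\<^bsub>A\<^esub> \<in> ?S\<close> by (auto intro: clspan_base)
    next
      case (Suc n)
      have "(\<Oplus>\<^bsub>A\<^esub>i\<in>{..<Suc n}. fst (\<phi> (a i)) (b i))
          = fst (\<phi> (a n)) (b n) \<oplus>\<^bsub>A\<^esub> (\<Oplus>\<^bsub>A\<^esub>i\<in>{..<n}. fst (\<phi> (a i)) (b i))"
        using Suc.prems by (intro finsum_lessThan_Suc) (auto simp: Pi_iff intro!: act)
      moreover have "fst (\<phi> (a n)) (b n) \<in> ?S" using Suc.prems by (auto simp: Pi_iff)
      moreover have "(\<Oplus>\<^bsub>A\<^esub>i\<in>{..<n}. fst (\<phi> (a i)) (b i)) \<in> clspan A ?S"
        using Suc.prems by (intro Suc.IH) (auto simp: Pi_iff)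
      ultimately show ?case by (metis (no_types, lifting) clspan_add clspan_base)
    qed
  qed
  have T1: "fst (\<phi> a) b \<oplus>\<^bsub>A\<^esub> t \<in> ?T" if "a \<in> carrier P" "b \<in> carrier A" "t \<in> ?T" for a b t
  proof -
    obtain n :: nat and a' b' where t: "t = (\<Oplus>\<^bsub>A\<^esub>i\<in>{..<n}. fst (\<phi> (a' i)) (b' i))"
        and ab: "a' \<in> {..<n} \<rightarrow> carrier P" "b' \<in> {..<n} \<rightarrow> carrier A" using \<open>t \<in> ?T\<close> by blast
    have ab': "a'(n := a) \<in> {..<Suc n} \<rightarrow> carrier P" "b'(n := b) \<in> {..<Suc n} \<rightarrow> carrier A"
      using ab that(1,2) by (auto simp: less_Suc_eq Pi_iff)
    have "(\<Oplus>\<^bsub>A\<^esub>i\<in>{..<Suc n}. fst (\<phi> ((a'(n := a)) i)) ((b'(n := b)) i))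
        = fst (\<phi> a) b \<oplus>\<^bsub>A\<^esub> (\<Oplus>\<^bsub>A\<^esub>i\<in>{..<n}. fst (\<phi> ((a'(n := a)) i)) ((b'(n := b)) i))"
      using ab that(1,2)
      by (subst finsum_lessThan_Suc) (auto simp: Pi_iff less_Suc_eq intro!: act)
    also have "(\<Oplus>\<^bsub>A\<^esub>i\<in>{..<n}. fst (\<phi> ((a'(n := a)) i)) ((b'(n := b)) i)) = t"
      unfolding t using ab by (intro M.finsum_cong') (auto intro!: act simp: Pi_iff)
    finally show ?thesis using ab'
      by (intro CollectI exI[of _ "Suc n"] exI[of _ "a'(n := a)"] exI[of _ "b'(n := b)"] conjI) simp_all
  qed
  have T2: "s \<oplus>\<^bsub>A\<^esub> t \<in> ?T" if s: "s \<in> ?T" and t: "t \<in> ?T" for s t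
  proof -
    have "(\<Oplus>\<^bsub>A\<^esub>i\<in>{..<n}. fst (\<phi> (a i)) (b i)) \<oplus>\<^bsub>A\<^esub> t \<in> ?T"
      if "a \<in> {..<n} \<rightarrow> carrier P" "b \<in> {..<n} \<rightarrow> carrier A" for n :: nat and a b
      using that
    proof (induction n)
      case 0
      have "t \<in> carrier A" by (rule subsetD[OF T t])
      then show ?case using t by simp
    next
      case (Suc n)
      have ab: "a \<in> {..<n} \<rightarrow> carrier P" "b \<in> {..<n} \<rightarrow> carrier A" using Suc.prems by (auto simp: Pi_iff)
      have "t \<in> carrier A" by (rule subsetD[OF T t])
      then have "(\<Oplus>\<^bsub>A\<^esub>i\<in>{..<Suc n}. fst (\<phi> (a i)) (b i)) \<oplus>\<^bsub>A\<^esub> t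
          = fst (\<phi> (a n)) (b n) \<oplus>\<^bsub>A\<^esub> ((\<Oplus>\<^bsub>A\<^esub>i\<in>{..<n}. fst (\<phi> (a i)) (b i)) \<oplus>\<^bsub>A\<^esub> t)"
        using Suc.prems ab
        by (subst finsum_lessThan_Suc) (auto simp: Pi_iff intro!: act M.a_assoc M.finsum_closed)
      then show ?case using T1[OF _ _ Suc.IH[OF ab]] Suc.prems by (simp add: Pi_iff)
    qed
    then show ?thesis using s by blast
  qed
  have ST: "clspan A ?S \<subseteq> norm_topology A closure_of ?T"
  proof
    fix x assume "x \<in> clspan A ?S"
    then show "x \<in> norm_topology A closure_of ?T"
    proof induction
      case (clspan_base x)
      then obtain a b where ab: "a \<in> carrier P" "b \<in> carrier A" "x = fst (\<phi> a) b" by blast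
      have "\<zero>\<^bsub>A\<^esub> \<in> ?T" by (auto intro!: exI[of _ 0])
      from T1[OF ab(1,2) this] have "x \<in> ?T" using act ab by simp
      then show ?case using T by (intro closure_of_subset[THEN subsetD]) auto
    next
      case (clspan_add x y)
      have xy: "x \<in> carrier A" "y \<in> carrier A" using clspan_add.IH unfolding in_closure_of_iff[OF T] by auto
      have "\<exists>t\<in>?T. nrm A ((x \<oplus>\<^bsub>A\<^esub> y) \<ominus>\<^bsub>A\<^esub> t) < e" if "e > 0" for e :: real
      proof -
        have "e / 2 > 0" using that by simp
        then obtain s t where st: "s \<in> ?T" "t \<in> ?T" "nrm A (x \<ominus>\<^bsub>A\<^esub> s) < e/2" "nrm A (y \<ominus>\<^bsub>A\<^esub> t) < e/2"
          using clspan_add.IH unfolding in_closure_of_iff[OF T] by meson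
        have c: "s \<in> carrier A" "t \<in> carrier A" using st(1,2) T by (blast dest: subsetD)+
        have "nrm A ((x \<oplus>\<^bsub>A\<^esub> y) \<ominus>\<^bsub>A\<^esub> (s \<oplus>\<^bsub>A\<^esub> t)) \<le> nrm A (x \<ominus>\<^bsub>A\<^esub> s) + nrm A (y \<ominus>\<^bsub>A\<^esub> t)"
          using c xy by (simp add: add_minus_add nrm_triangle)
        then have "nrm A ((x \<oplus>\<^bsub>A\<^esub> y) \<ominus>\<^bsub>A\<^esub> (s \<oplus>\<^bsub>A\<^esub> t)) < e" using st by simp
        then show ?thesis using T2[OF st(1,2)] by (rule rev_bexI[rotated])
      qed
      then show ?case unfolding in_closure_of_iff[OF T] using xy by blast
    next
      case (clspan_limit x)
      have "\<exists>t\<in>?T. nrm A (x \<ominus>\<^bsub>A\<^esub> t) < e" if "e > 0" for e :: real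
      proof -
        have "e / 2 > 0" using that by simp
        then obtain y where y: "y \<in> norm_topology A closure_of ?T" "nrm A (x \<ominus>\<^bsub>A\<^esub> y) < e/2"
          using clspan_limit.IH by blast
        then obtain t where t: "t \<in> ?T" "nrm A (y \<ominus>\<^bsub>A\<^esub> t) < e/2" and yc: "y \<in> carrier A"
          using \<open>e / 2 > 0\<close> unfolding in_closure_of_iff[OF T] by blast
        have "t \<in> carrier A" by (rule subsetD[OF T t(1)])
        then have "nrm A (x \<ominus>\<^bsub>A\<^esub> t) < e"
          using nrm_minus_triangle[of x y t] clspan_limit.hyps yc y t by simp
        then show ?thesis using t(1) by (rule rev_bexI[rotated])
      qed
      then show ?case unfolding in_closure_of_iff[OF T] using clspan_limit.hyps by blast
    qed
  qed
  have "norm_topology A closure_of ?T \<subseteq> clspan A ?S"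
  proof
    fix x assume "x \<in> norm_topology A closure_of ?T"
    then have x: "x \<in> carrier A" "\<And>e. e > 0 \<Longrightarrow> \<exists>t\<in>?T. nrm A (x \<ominus>\<^bsub>A\<^esub> t) < e"
      unfolding in_closure_of_iff[OF T] by auto
    show "x \<in> clspan A ?S"
    proof (rule clspan_limit[OF x(1)])
      fix e :: real assume "e > 0"
      from x(2)[OF this] show "\<exists>y. y \<in> clspan A ?S \<and> nrm A (x \<ominus>\<^bsub>A\<^esub> y) < e"
        using TS by blast
    qed
  qed
  then have "norm_topology A closure_of ?T = clspan A ?S" using ST by (rule subset_antisym)
  then show ?thesis unfolding nondegenerate_hom_def by simp
qed (simp add: nondegenerate_hom_def)

lemma star_fst_mult:
  assumes m: "m \<in> carrier MA" and x: "x \<in> carrier A" and y: "y \<in> carrier A"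
  shows "star A (fst m x) \<otimes>\<^bsub>A\<^esub> y = star A x \<otimes>\<^bsub>A\<^esub> fst (star MA m) y"
proof -
  have "star A (fst m x) \<otimes>\<^bsub>A\<^esub> y = star A (star A y \<otimes>\<^bsub>A\<^esub> fst m x)"
    using x y fst_carrier[OF m] by (simp add: star_mult)
  also have "star A y \<otimes>\<^bsub>A\<^esub> fst m x = snd m (star A y) \<otimes>\<^bsub>A\<^esub> x"
    using x y by (simp add: snd_fst[OF m])
  also have "star A \<dots> = star A x \<otimes>\<^bsub>A\<^esub> fst (star MA m) y"
    using x y snd_carrier[OF m] by (simp add: star_mult mult_alg_simps(12))
  finally show ?thesis .
qed

lemma mult_unitaries_iff: "u \<in> mult_unitaries A \<longleftrightarrow> unital_cstar_algebra.unitary MA u"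
  by (simp add: mult_unitaries_def unital_cstar_algebra.unitary_def[OF unital_mult_alg])

lemma fst_minus:
  assumes "m \<in> carrier MA" "x \<in> carrier A" "y \<in> carrier A"
  shows "fst m (x \<ominus>\<^bsub>A\<^esub> y) = fst m x \<ominus>\<^bsub>A\<^esub> fst m y"
  using assms by (simp add: minus_eq_smult fst_add fst_smult fst_carrier)

lemma fst_minus_mult:
  assumes "m \<in> carrier MA" "n \<in> carrier MA" "x \<in> carrier A"
  shows "fst (m \<ominus>\<^bsub>MA\<^esub> n) x = fst m x \<ominus>\<^bsub>A\<^esub> fst n x"
  using assms cstar_algebra.minus_eq_smult[OF cstar_algebra_mult_alg assms(1,2)]
  by (simp add: mult_alg_simps(4,6) minus_eq_smult fst_carrier)

end

text \<open>A crude bound suffices for the limit arguments. Unitaries go to unitaries, so a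
  self-adjoint \<open>h\<close> of norm at most 1/2, being an average of two unitaries, has image of
  norm at most 1. Rescaling gives the factor 2, and splitting into real and imaginary parts doubles
  it to 4.\<close>

lemma unital_star_hom_bounded:
  assumes A: "unital_cstar_algebra A" and B: "unital_cstar_algebra B"
    and f: "f \<in> star_hom A B" "f \<one>\<^bsub>A\<^esub> = \<one>\<^bsub>B\<^esub>" and m: "m \<in> carrier A"
  shows "nrm B (f m) \<le> 4 * nrm A m"
proof -
  interpret A: unital_cstar_algebra A by fact
  interpret B: unital_cstar_algebra B by fact
  note hom = star_homD(2-)[OF f(1)]
  have un: "B.unitary (f u)" if "A.unitary u" for u
    using that hom f(2) by (simp add: A.unitary_def B.unitary_def) (metis A.star_closed)
  have half: "nrm B (f h) \<le> 1" if h: "h \<in> carrier A" "star A h = h" "nrm A h \<le> 1/2" for h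
  proof -
    obtain u where u: "A.unitary u" "h = (1/2) \<odot>\<^bsub>A\<^esub> (u \<oplus>\<^bsub>A\<^esub> star A u)"
      using A.sa_unitary_sqrt[OF h] by blast
    have uc: "u \<in> carrier A" using u by (simp add: A.unitary_def)
    have "f h = (1/2) \<odot>\<^bsub>B\<^esub> (f u \<oplus>\<^bsub>B\<^esub> star B (f u))"
      unfolding u(2) using uc hom by simp
    then have "nrm B (f h) = 1/2 * nrm B (f u \<oplus>\<^bsub>B\<^esub> star B (f u))"
      using uc hom by (simp add: B.nrm_smult)
    also have "\<dots> \<le> 1/2 * (nrm B (f u) + nrm B (f u))"
      using uc hom(1) B.nrm_triangle[of "f u" "star B (f u)"] by simp
    also have "\<dots> \<le> 1" using B.nrm_unitary_le[OF un[OF u(1)]] by simp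
    finally show ?thesis .
  qed
  have sa: "nrm B (f h) \<le> 2 * nrm A h" if h: "h \<in> carrier A" "star A h = h" for h
  proof (cases "nrm A h = 0")
    case True
    then have "h = \<zero>\<^bsub>A\<^esub>" using h A.nrm_eq_0 by simp
    then have "f h = 0 \<odot>\<^bsub>B\<^esub> f h" using hom(3)[of h 0] h by simp
    then show ?thesis using True hom(1)[OF h(1)] by (metis B.nrm_zero B.smult_0_left mult_zero_right order_refl)
  next
    case False
    then have pos: "nrm A h > 0" using A.nrm_nonneg[OF h(1)] by simp
    define t where "t = 2 * nrm A h"
    have t: "t > 0" using pos by (simp add: t_def)
    have n: "nrm A (complex_of_real (1/t) \<odot>\<^bsub>A\<^esub> h) = nrm A h / t"
      using h(1) t A.nrm_smult[of h "complex_of_real (1/t)"] unfolding norm_of_real by simp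
    have "nrm B (f (complex_of_real (1/t) \<odot>\<^bsub>A\<^esub> h)) \<le> 1"
    proof (rule half)
      show "nrm A (complex_of_real (1/t) \<odot>\<^bsub>A\<^esub> h) \<le> 1/2" unfolding n using pos by (simp add: t_def)
    qed (use h in \<open>simp_all add: A.star_smult\<close>)
    moreover have "nrm B (f (complex_of_real (1/t) \<odot>\<^bsub>A\<^esub> h)) = nrm B (f h) / t"
      using hom h t B.nrm_smult[of "f h" "complex_of_real (1/t)"] unfolding norm_of_real by simp
    ultimately show ?thesis using t by (simp add: t_def pos_divide_le_eq)
  qed
  obtain h k where hk: "h \<in> carrier A" "star A h = h" "k \<in> carrier A" "star A k = k"
    "m = h \<oplus>\<^bsub>A\<^esub> \<i> \<odot>\<^bsub>A\<^esub> k" "nrm A h \<le> nrm A m" "nrm A k \<le> nrm A m"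
    using A.real_imag_parts[OF m] by blast
  have "f m = f h \<oplus>\<^bsub>B\<^esub> \<i> \<odot>\<^bsub>B\<^esub> f k" unfolding hk(5) using hk(1,3) hom by simp
  then have "nrm B (f m) \<le> nrm B (f h) + nrm B (f k)"
    using B.nrm_triangle[of "f h" "\<i> \<odot>\<^bsub>B\<^esub> f k"] hom(1) hk(1,3) by (simp add: B.nrm_smult)
  then show ?thesis using sa[OF hk(1,2)] sa[OF hk(3,4)] hk(6,7) by simp
qed

section \<open>Extension of a non-degenerate homomorphism to multipliers\<close>

locale nondeg_hom = A: cstar_algebra A + B: cstar_algebra B
  for A :: "'a cstar" and B :: "'b cstar" and \<phi> :: "'a \<Rightarrow> 'b mult" +
  assumes nondegenerate: "nondegenerate_hom A B \<phi>"
begin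

lemma hom: "\<phi> \<in> star_hom A (mult_alg B)"
  using nondegenerate by (simp add: nondegenerate_hom_def)

lemma hom_carrier [simp, intro]: "a \<in> carrier A \<Longrightarrow> \<phi> a \<in> carrier (mult_alg B)"
  using hom by (rule star_hom_carrier)

lemma span: "clspan B {fst (\<phi> a) b | a b. a \<in> carrier A \<and> b \<in> carrier B} = carrier B"
  using nondegenerate B.nondegenerate_hom_iff[of A \<phi>] A.M.zero_closed by blast

lemma act_carrier [simp, intro]:
  "\<lbrakk>a \<in> carrier A; b \<in> carrier B\<rbrakk> \<Longrightarrow> fst (\<phi> a) b \<in> carrier B"
  by (simp add: B.fst_carrier)

lemma span_subset: "{fst (\<phi> a) b | a b. a \<in> carrier A \<and> b \<in> carrier B} \<subseteq> carrier B"
  by auto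

lemma act_mult:
  "\<lbrakk>a \<in> carrier A; a' \<in> carrier A; b \<in> carrier B\<rbrakk> \<Longrightarrow> fst (\<phi> (a \<otimes>\<^bsub>A\<^esub> a')) b = fst (\<phi> a) (fst (\<phi> a') b)"
  by (simp add: star_hom_mult[OF hom] mult_alg_simps(2))

lemma act_star:
  "\<lbrakk>a \<in> carrier A; b \<in> carrier B; b' \<in> carrier B\<rbrakk> \<Longrightarrow>
    star B (fst (\<phi> a) b) \<otimes>\<^bsub>B\<^esub> b' = star B b \<otimes>\<^bsub>B\<^esub> fst (\<phi> (star A a)) b'"
  by (simp add: star_hom_star[OF hom] B.star_fst_mult)

text \<open>The product of \<open>star z\<close> with \<open>\<phi>(a) b\<close> depends on
  \<open>z\<close> only through \<open>\<phi>(star a) z\<close>, so \<open>star z\<close> and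
  \<open>star z'\<close> agree on \<open>\<phi>(A) B\<close>, hence on \<open>B\<close> by
  density.\<close>

lemma act_separates:
  assumes z: "z \<in> carrier B" and z': "z' \<in> carrier B"
    and eq: "\<And>a. a \<in> carrier A \<Longrightarrow> fst (\<phi> a) z = fst (\<phi> a) z'"
  shows "z = z'"
proof -
  have "star B z \<otimes>\<^bsub>B\<^esub> y = star B z' \<otimes>\<^bsub>B\<^esub> y" if "y \<in> carrier B" for y
  proof (rule B.clspan_eqI[OF _ span_subset B.cstar_algebra_axioms, of y "\<lambda>y. star B z \<otimes>\<^bsub>B\<^esub> y"
        "\<lambda>y. star B z' \<otimes>\<^bsub>B\<^esub> y" "nrm B z" "nrm B z'"])
    show "y \<in> clspan B {fst (\<phi> a) b | a b. a \<in> carrier A \<and> b \<in> carrier B}"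
      using span that by simp
    fix x assume "x \<in> {fst (\<phi> a) b | a b. a \<in> carrier A \<and> b \<in> carrier B}"
    then obtain a b where x: "x = fst (\<phi> a) b" "a \<in> carrier A" "b \<in> carrier B" by blast
    then show "star B z \<otimes>\<^bsub>B\<^esub> x = star B z' \<otimes>\<^bsub>B\<^esub> x"
      using act_star[of "star A a" z b] act_star[of "star A a" z' b] eq[of "star A a"] z z' by simp
  next
    fix x y assume xy: "x \<in> carrier B" "y \<in> carrier B"
    show "nrm B (star B z \<otimes>\<^bsub>B\<^esub> x \<ominus>\<^bsub>B\<^esub> star B z \<otimes>\<^bsub>B\<^esub> y) \<le> nrm B z * nrm B (x \<ominus>\<^bsub>B\<^esub> y)"
      using xy z B.nrm_mult[of "star B z" "x \<ominus>\<^bsub>B\<^esub> y"] by (simp add: B.minus_mult_right)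
    show "nrm B (star B z' \<otimes>\<^bsub>B\<^esub> x \<ominus>\<^bsub>B\<^esub> star B z' \<otimes>\<^bsub>B\<^esub> y) \<le> nrm B z' * nrm B (x \<ominus>\<^bsub>B\<^esub> y)"
      using xy z' B.nrm_mult[of "star B z'" "x \<ominus>\<^bsub>B\<^esub> y"] by (simp add: B.minus_mult_right)
  qed (use z z' in \<open>auto simp: B.mult_r_distr\<close>)
  then have "star B z = star B z'" using z z' by - (rule B.right_cancel, auto)
  then show ?thesis using z z' B.star_star by metis
qed

text \<open>\<open>ext_rel m b z\<close> says that \<open>z\<close> is the value of the extended homomorphism at \<open>m\<close>, applied to \<open>b\<close>:
  it determines \<open>z\<close> because \<open>\<phi>(a)z = \<phi>(am)b\<close>.\<close>

definition ext_rel :: "'a mult \<Rightarrow> 'b \<Rightarrow> 'b \<Rightarrow> bool" where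
  "ext_rel m b z \<longleftrightarrow> z \<in> carrier B \<and> (\<forall>a\<in>carrier A. fst (\<phi> a) z = fst (\<phi> (snd m a)) b)"

lemma ext_rel_unique: "\<lbrakk>ext_rel m b z; ext_rel m b z'\<rbrakk> \<Longrightarrow> z = z'"
  unfolding ext_rel_def by (rule act_separates) auto

text \<open>On generators the value is prescribed, because
  \<open>\<phi>(a') \<phi>(m a) b = \<phi>(a' m) \<phi>(a) b\<close>.\<close>

lemma ext_rel_gen:
  assumes "m \<in> carrier (mult_alg A)" "a \<in> carrier A" "b \<in> carrier B"
  shows "ext_rel m (fst (\<phi> a) b) (fst (\<phi> (fst m a)) b)"
  using assms A.fst_carrier[OF assms(1)] A.snd_carrier[OF assms(1)]
  by (simp add: ext_rel_def act_mult[symmetric] A.snd_fst)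

lemma ext_rel_add:
  assumes "m \<in> carrier (mult_alg A)" "b \<in> carrier B" "b' \<in> carrier B"
    "ext_rel m b z" "ext_rel m b' z'"
  shows "ext_rel m (b \<oplus>\<^bsub>B\<^esub> b') (z \<oplus>\<^bsub>B\<^esub> z')"
  using assms A.snd_carrier[OF assms(1)]
  by (simp add: ext_rel_def B.fst_add)

lemma ext_rel_minus:
  assumes "m \<in> carrier (mult_alg A)" "b \<in> carrier B" "b' \<in> carrier B"
    "ext_rel m b z" "ext_rel m b' z'"
  shows "ext_rel m (b \<ominus>\<^bsub>B\<^esub> b') (z \<ominus>\<^bsub>B\<^esub> z')"
  using assms A.snd_carrier[OF assms(1)]
  by (simp add: ext_rel_def B.fst_minus)

lemma ext_rel_add_mult:
  assumes "m \<in> carrier (mult_alg A)" "n \<in> carrier (mult_alg A)" "b \<in> carrier B"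
    "ext_rel m b z" "ext_rel n b z'"
  shows "ext_rel (m \<oplus>\<^bsub>mult_alg A\<^esub> n) b (z \<oplus>\<^bsub>B\<^esub> z')"
  using assms A.snd_carrier[OF assms(1)] A.snd_carrier[OF assms(2)]
  by (simp add: ext_rel_def B.fst_add mult_alg_simps(4,5) star_hom_add[OF hom])

lemma ext_rel_smult_mult:
  assumes "m \<in> carrier (mult_alg A)" "b \<in> carrier B" "ext_rel m b z"
  shows "ext_rel (c \<odot>\<^bsub>mult_alg A\<^esub> m) b (c \<odot>\<^bsub>B\<^esub> z)"
  using assms A.snd_carrier[OF assms(1)]
  by (simp add: ext_rel_def B.fst_smult mult_alg_simps(6,7) star_hom_smult[OF hom])

text \<open>For the \<open>B\<close>-valued inner product \<open>star y y'\<close>, passing to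
  related elements under a unitary preserves inner products; here the left entry is still a
  generator. It rests on \<open>star (u c) u = star c (star u u) = star c\<close>.\<close>

lemma ext_rel_unitary_gen:
  assumes u: "u \<in> mult_unitaries A" and c: "c \<in> carrier A" "d \<in> carrier B"
    and r: "b' \<in> carrier B" "ext_rel u b' z'"
  shows "star B (fst (\<phi> (fst u c)) d) \<otimes>\<^bsub>B\<^esub> z' = star B (fst (\<phi> c) d) \<otimes>\<^bsub>B\<^esub> b'"
proof -
  have uc: "u \<in> carrier (mult_alg A)" and uu: "star (mult_alg A) u \<otimes>\<^bsub>mult_alg A\<^esub> u = \<one>\<^bsub>mult_alg A\<^esub>"
    using u by (auto simp: mult_unitaries_def)
  have z': "z' \<in> carrier B" using r(2) by (simp add: ext_rel_def)
  have fc: "fst u c \<in> carrier A" using A.fst_carrier[OF uc c(1)] .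
  have "snd u (star A (fst u c)) = snd u (snd (star (mult_alg A) u) (star A c))"
    using c by (simp add: mult_alg_simps(13))
  also have "\<dots> = snd (star (mult_alg A) u \<otimes>\<^bsub>mult_alg A\<^esub> u) (star A c)"
    using c by (simp add: mult_alg_simps(3))
  also have "\<dots> = star A c" using c by (simp add: uu mult_alg_simps(11))
  finally have s: "snd u (star A (fst u c)) = star A c" .
  have "star B (fst (\<phi> (fst u c)) d) \<otimes>\<^bsub>B\<^esub> z' = star B d \<otimes>\<^bsub>B\<^esub> fst (\<phi> (star A (fst u c))) z'"
    using fc c z' by (simp add: act_star)
  also have "fst (\<phi> (star A (fst u c))) z' = fst (\<phi> (star A c)) b'"
    using r fc s by (simp add: ext_rel_def)
  also have "star B d \<otimes>\<^bsub>B\<^esub> \<dots> = star B (fst (\<phi> c) d) \<otimes>\<^bsub>B\<^esub> b'"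
    using c r by (simp add: act_star)
  finally show ?thesis .
qed

text \<open>The extension is first constructed for unitary multipliers, where it is isometric on the span of
  \<open>\<phi>(A)B\<close>. This replaces the usual argument with approximate units.\<close>

lemma ext_rel_unitary:
  assumes u: "u \<in> mult_unitaries A" and b: "b \<in> carrier B"
  shows "\<exists>z. ext_rel u b z \<and> (\<forall>b' z'. b' \<in> carrier B \<longrightarrow> ext_rel u b' z' \<longrightarrow>
    star B z \<otimes>\<^bsub>B\<^esub> z' = star B b \<otimes>\<^bsub>B\<^esub> b')"
proof -
  have uc: "u \<in> carrier (mult_alg A)" using u by (simp add: mult_unitaries_def)
  \<comment> \<open>Comparing \<open>z\<close> with every related pair, and not only with itself, is
    what the induction needs: inner products are additive, norms are not.\<close>
  let ?P = "\<lambda>b z. ext_rel u b z \<and> (\<forall>b' z'. b' \<in> carrier B \<longrightarrow> ext_rel u b' z' \<longrightarrow>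
    star B z \<otimes>\<^bsub>B\<^esub> z' = star B b \<otimes>\<^bsub>B\<^esub> b')"
  have "b \<in> clspan B {fst (\<phi> a) b | a b. a \<in> carrier A \<and> b \<in> carrier B}" using b span by simp
  then show ?thesis
  proof induction
    case (clspan_base x)
    then obtain c d where c: "c \<in> carrier A" "d \<in> carrier B" "x = fst (\<phi> c) d" by blast
    then show ?case
      using ext_rel_gen[OF uc c(1,2)] ext_rel_unitary_gen[OF u c(1,2)] by blast
  next
    case (clspan_add x y)
    have xy: "x \<in> carrier B" "y \<in> carrier B" using clspan_add.hyps span by auto
    obtain zx zy where z: "?P x zx" "?P y zy" using clspan_add.IH by blast
    then have "zx \<in> carrier B" "zy \<in> carrier B" by (auto simp: ext_rel_def)
    moreover have "z' \<in> carrier B" if "ext_rel u b' z'" for b' z' using that by (simp add: ext_rel_def)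
    ultimately have "?P (x \<oplus>\<^bsub>B\<^esub> y) (zx \<oplus>\<^bsub>B\<^esub> zy)"
      using z xy ext_rel_add[OF uc xy] by (simp add: B.star_add B.mult_l_distr)
    then show ?case by blast
  next
    case (clspan_limit x)
    note x = clspan_limit.hyps
    have "\<exists>y z. y \<in> carrier B \<and> nrm B (x \<ominus>\<^bsub>B\<^esub> y) < 1 / real (Suc n) \<and> ?P y z" for n
      using clspan_limit.IH[of "1 / real (Suc n)"] span by auto
    then obtain y z where yz: "\<And>n. y n \<in> carrier B" "\<And>n. nrm B (x \<ominus>\<^bsub>B\<^esub> y n) < 1 / real (Suc n)"
      "\<And>n. ?P (y n) (z n)" by metis
    have zc: "z n \<in> carrier B" for n using yz(3)[of n] by (simp add: ext_rel_def)
    have ylim: "(\<lambda>n. nrm B (y n \<ominus>\<^bsub>B\<^esub> x)) \<longlonglongrightarrow> 0"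
    proof (rule tendsto_sandwich[OF _ _ tendsto_const])
      show "(\<lambda>n. 1 / real (Suc n)) \<longlonglongrightarrow> 0" by (rule LIMSEQ_Suc[OF lim_1_over_n])
      show "\<forall>\<^sub>F n in sequentially. nrm B (y n \<ominus>\<^bsub>B\<^esub> x) \<le> 1 / real (Suc n)"
        using yz(1,2) x by (intro always_eventually) (metis B.nrm_minus_commute less_imp_le)
    qed (use yz x in \<open>simp add: B.nrm_nonneg\<close>)
    \<comment> \<open>Inner products with \<open>z m\<close> and \<open>z n\<close> combine to the
      norm of the difference, so the \<open>z n\<close> form a Cauchy sequence along with the
      \<open>y n\<close>.\<close>
    have iso: "nrm B (z m \<ominus>\<^bsub>B\<^esub> z n) = nrm B (y m \<ominus>\<^bsub>B\<^esub> y n)" for m n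
    proof -
      have r: "ext_rel u (y m \<ominus>\<^bsub>B\<^esub> y n) (z m \<ominus>\<^bsub>B\<^esub> z n)"
        using yz by (intro ext_rel_minus[OF uc]) auto
      have e: "star B (z k) \<otimes>\<^bsub>B\<^esub> (z m \<ominus>\<^bsub>B\<^esub> z n) = star B (y k) \<otimes>\<^bsub>B\<^esub> (y m \<ominus>\<^bsub>B\<^esub> y n)" for k
        using yz(3)[of k] r yz(1) by blast
      have "star B (z m \<ominus>\<^bsub>B\<^esub> z n) \<otimes>\<^bsub>B\<^esub> (z m \<ominus>\<^bsub>B\<^esub> z n) = star B (y m \<ominus>\<^bsub>B\<^esub> y n) \<otimes>\<^bsub>B\<^esub> (y m \<ominus>\<^bsub>B\<^esub> y n)"
        using zc yz(1) e[of m] e[of n] by (simp add: B.star_minus B.minus_mult_left)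
      then have "(nrm B (z m \<ominus>\<^bsub>B\<^esub> z n))\<^sup>2 = (nrm B (y m \<ominus>\<^bsub>B\<^esub> y n))\<^sup>2"
        using zc yz(1) by (simp add: B.cstar_identity[symmetric])
      then show ?thesis using zc yz(1) B.nrm_nonneg by (simp add: power2_eq_iff_nonneg)
    qed
    obtain w where w: "w \<in> carrier B" "(\<lambda>n. nrm B (z n \<ominus>\<^bsub>B\<^esub> w)) \<longlonglongrightarrow> 0"
    proof (rule B.Cauchy_converges[of z])
      fix e :: real assume e: "e > 0"
      then have "\<forall>\<^sub>F n in sequentially. nrm B (y n \<ominus>\<^bsub>B\<^esub> x) < e / 2"
        using order_tendstoD(2)[OF ylim, of "e / 2"] by simp
      then obtain N where N: "\<And>n. n \<ge> N \<Longrightarrow> nrm B (y n \<ominus>\<^bsub>B\<^esub> x) < e / 2"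
        by (auto simp: eventually_sequentially)
      have "nrm B (z m \<ominus>\<^bsub>B\<^esub> z n) < e" if "m \<ge> N" "n \<ge> N" for m n
        using N[OF that(1)] N[OF that(2)] B.nrm_minus_triangle[OF yz(1) x yz(1), of m n]
          B.nrm_minus_commute[OF x yz(1), of n] by (simp add: iso)
      then show "\<exists>N. \<forall>m\<ge>N. \<forall>n\<ge>N. nrm B (z m \<ominus>\<^bsub>B\<^esub> z n) < e" by blast
    qed (rule zc)
    \<comment> \<open>Passes an identity between two multipliers applied to convergent sequences to
      the limits. It is used for the relation itself and, through embedded elements, for inner
      products.\<close>
    have cont: "fst m v = fst m' v'"
      if "m \<in> carrier (mult_alg B)" "m' \<in> carrier (mult_alg B)" "\<And>n. fst m (s n) = fst m' (s' n)"
        "\<And>n. s n \<in> carrier B" "\<And>n. s' n \<in> carrier B" "v \<in> carrier B" "v' \<in> carrier B"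
        "(\<lambda>n. nrm B (s n \<ominus>\<^bsub>B\<^esub> v)) \<longlonglongrightarrow> 0" "(\<lambda>n. nrm B (s' n \<ominus>\<^bsub>B\<^esub> v')) \<longlonglongrightarrow> 0"
      for m m' and s s' :: "nat \<Rightarrow> 'b" and v v'
    proof (rule B.limit_unique[of "\<lambda>n. fst m (s n)" _ _ sequentially])
      have lim: "(\<lambda>n. nrm B (fst m (s n) \<ominus>\<^bsub>B\<^esub> fst m v)) \<longlonglongrightarrow> 0"
        if "m \<in> carrier (mult_alg B)" "\<And>n. s n \<in> carrier B" "v \<in> carrier B"
          "(\<lambda>n. nrm B (s n \<ominus>\<^bsub>B\<^esub> v)) \<longlonglongrightarrow> 0"
        for m and s :: "nat \<Rightarrow> 'b" and v
      proof (rule tendsto_sandwich[OF _ _ tendsto_const])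
        show "(\<lambda>n. nrm (mult_alg B) m * nrm B (s n \<ominus>\<^bsub>B\<^esub> v)) \<longlonglongrightarrow> 0"
          using tendsto_mult_left[OF that(4), of "nrm (mult_alg B) m"] by simp
        show "\<forall>\<^sub>F n in sequentially. nrm B (fst m (s n) \<ominus>\<^bsub>B\<^esub> fst m v)
            \<le> nrm (mult_alg B) m * nrm B (s n \<ominus>\<^bsub>B\<^esub> v)"
          using that by (intro always_eventually allI) (simp add: B.fst_minus[symmetric] B.nrm_fst_le)
      qed (use that in \<open>simp add: B.nrm_nonneg B.fst_carrier\<close>)
      show "(\<lambda>n. nrm B (fst m (s n) \<ominus>\<^bsub>B\<^esub> fst m v)) \<longlonglongrightarrow> 0" using that by (intro lim) auto
      show "(\<lambda>n. nrm B (fst m (s n) \<ominus>\<^bsub>B\<^esub> fst m' v')) \<longlonglongrightarrow> 0"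
        unfolding that(3) using that by (intro lim) auto
    qed (use that in \<open>auto intro: B.fst_carrier\<close>)
    have "ext_rel u x w"
      unfolding ext_rel_def
    proof (intro conjI ballI)
      fix a assume a: "a \<in> carrier A"
      have sa: "snd u a \<in> carrier A" using A.snd_carrier[OF uc a] .
      show "fst (\<phi> a) w = fst (\<phi> (snd u a)) x"
      proof (rule cont[of "\<phi> a" "\<phi> (snd u a)" z y])
        show "fst (\<phi> a) (z n) = fst (\<phi> (snd u a)) (y n)" for n
          using yz(3)[of n] a by (simp add: ext_rel_def)
      qed (use a sa yz(1) zc w x ylim in simp_all)
    qed fact
    moreover have "star B w \<otimes>\<^bsub>B\<^esub> z' = star B x \<otimes>\<^bsub>B\<^esub> b'" if b': "b' \<in> carrier B" "ext_rel u b' z'" for b' z'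
    proof -
      have z': "z' \<in> carrier B" using b' by (simp add: ext_rel_def)
      have "star B z' \<otimes>\<^bsub>B\<^esub> z n = star B b' \<otimes>\<^bsub>B\<^esub> y n" for n
      proof -
        have "star B (star B (z n) \<otimes>\<^bsub>B\<^esub> z') = star B (star B (y n) \<otimes>\<^bsub>B\<^esub> b')" using yz(3)[of n] b' by simp
        then show ?thesis using zc z' b' yz(1) by (simp add: B.star_mult)
      qed
      then have "fst (mult_embed B (star B z')) w = fst (mult_embed B (star B b')) x"
        using z' b'(1) zc yz(1) w x ylim
        by - (rule cont[of "mult_embed B (star B z')" "mult_embed B (star B b')" z y],
          simp_all add: mult_embed_simps)
      then have "star B (star B z' \<otimes>\<^bsub>B\<^esub> w) = star B (star B b' \<otimes>\<^bsub>B\<^esub> x)"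
        using z' b' w x by (simp add: mult_embed_simps)
      then show ?thesis using z' b' w x by (simp add: B.star_mult)
    qed
    ultimately show ?case by blast
  qed
qed

text \<open>The bound is uniform in \<open>b\<close> for fixed \<open>m\<close>. It is 1 for
  unitaries and survives linear combinations, so the extension becomes a bounded operator.\<close>

lemma ext_rel_exists:
  assumes m: "m \<in> carrier (mult_alg A)"
  shows "\<exists>K. \<forall>b\<in>carrier B. \<exists>z. ext_rel m b z \<and> nrm B z \<le> K * nrm B b"
proof (rule unital_cstar_algebra.unitary_span_induct[OF A.unital_mult_alg m])
  fix u assume "unital_cstar_algebra.unitary (mult_alg A) u"
  then have u: "u \<in> mult_unitaries A" by (simp add: A.mult_unitaries_iff)
  have "\<exists>z. ext_rel u b z \<and> nrm B z \<le> 1 * nrm B b" if b: "b \<in> carrier B" for b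
  proof -
    obtain z where z: "ext_rel u b z" "star B z \<otimes>\<^bsub>B\<^esub> z = star B b \<otimes>\<^bsub>B\<^esub> b"
      using ext_rel_unitary[OF u b] b by blast
    then have zc: "z \<in> carrier B" by (simp add: ext_rel_def)
    then have "(nrm B z)\<^sup>2 = (nrm B b)\<^sup>2" using z b by (simp add: B.cstar_identity[symmetric])
    then have "nrm B z = nrm B b" using zc b B.nrm_nonneg by (simp add: power2_eq_iff_nonneg)
    then show ?thesis using z by auto
  qed
  then show "\<exists>K. \<forall>b\<in>carrier B. \<exists>z. ext_rel u b z \<and> nrm B z \<le> K * nrm B b" by blast
next
  fix m n assume m: "m \<in> carrier (mult_alg A)" and n: "n \<in> carrier (mult_alg A)"
    and "\<exists>K. \<forall>b\<in>carrier B. \<exists>z. ext_rel m b z \<and> nrm B z \<le> K * nrm B b"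
    and "\<exists>K. \<forall>b\<in>carrier B. \<exists>z. ext_rel n b z \<and> nrm B z \<le> K * nrm B b"
  then obtain K L where K: "\<forall>b\<in>carrier B. \<exists>z. ext_rel m b z \<and> nrm B z \<le> K * nrm B b"
    and L: "\<forall>b\<in>carrier B. \<exists>z. ext_rel n b z \<and> nrm B z \<le> L * nrm B b" by blast
  have "\<exists>z. ext_rel (m \<oplus>\<^bsub>mult_alg A\<^esub> n) b z \<and> nrm B z \<le> (K + L) * nrm B b" if b: "b \<in> carrier B" for b
  proof -
    obtain z z' where z: "ext_rel m b z" "nrm B z \<le> K * nrm B b" "ext_rel n b z'" "nrm B z' \<le> L * nrm B b"
      using K L b by blast
    then have "z \<in> carrier B" "z' \<in> carrier B" by (auto simp: ext_rel_def)
    then have "nrm B (z \<oplus>\<^bsub>B\<^esub> z') \<le> (K + L) * nrm B b"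
      using B.nrm_triangle[of z z'] z by (simp add: distrib_right)
    then show ?thesis using ext_rel_add_mult[OF m n b z(1,3)] by blast
  qed
  then show "\<exists>K. \<forall>b\<in>carrier B. \<exists>z. ext_rel (m \<oplus>\<^bsub>mult_alg A\<^esub> n) b z \<and> nrm B z \<le> K * nrm B b" by blast
next
  fix c m assume m: "m \<in> carrier (mult_alg A)"
    and "\<exists>K. \<forall>b\<in>carrier B. \<exists>z. ext_rel m b z \<and> nrm B z \<le> K * nrm B b"
  then obtain K where K: "\<forall>b\<in>carrier B. \<exists>z. ext_rel m b z \<and> nrm B z \<le> K * nrm B b" by blast
  have "\<exists>z. ext_rel (c \<odot>\<^bsub>mult_alg A\<^esub> m) b z \<and> nrm B z \<le> (cmod c * K) * nrm B b"
    if b: "b \<in> carrier B" for b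
  proof -
    obtain z where z: "ext_rel m b z" "nrm B z \<le> K * nrm B b" using K b by blast
    then have "z \<in> carrier B" by (auto simp: ext_rel_def)
    then have "nrm B (c \<odot>\<^bsub>B\<^esub> z) \<le> (cmod c * K) * nrm B b"
      using z by (simp add: B.nrm_smult mult.assoc mult_left_mono)
    then show ?thesis using ext_rel_smult_mult[OF m b z(1)] by blast
  qed
  then show "\<exists>K. \<forall>b\<in>carrier B. \<exists>z. ext_rel (c \<odot>\<^bsub>mult_alg A\<^esub> m) b z \<and> nrm B z \<le> K * nrm B b" by blast
qed

definition ext_left :: "'a mult \<Rightarrow> 'b \<Rightarrow> 'b" where
  "ext_left m b = (THE z. ext_rel m b z)"

lemma ext_rel_ext_left:
  assumes "m \<in> carrier (mult_alg A)" "b \<in> carrier B"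
  shows "ext_rel m b (ext_left m b)"
proof -
  obtain z where z: "ext_rel m b z" using ext_rel_exists[OF assms(1)] assms(2) by blast
  show ?thesis
    unfolding ext_left_def
    by (rule theI[of "ext_rel m b", OF z]) (use z ext_rel_unique in blast)
qed

lemma ext_left_eqI:
  "\<lbrakk>m \<in> carrier (mult_alg A); b \<in> carrier B; ext_rel m b z\<rbrakk> \<Longrightarrow> ext_left m b = z"
  using ext_rel_ext_left ext_rel_unique by blast

lemma ext_left_carrier [simp, intro]:
  "\<lbrakk>m \<in> carrier (mult_alg A); b \<in> carrier B\<rbrakk> \<Longrightarrow> ext_left m b \<in> carrier B"
  using ext_rel_ext_left by (simp add: ext_rel_def)

lemma ext_left_bounded:
  assumes "m \<in> carrier (mult_alg A)"
  obtains K where "\<And>b. b \<in> carrier B \<Longrightarrow> nrm B (ext_left m b) \<le> K * nrm B b"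
  using ext_rel_exists[OF assms] ext_left_eqI[OF assms] by metis

lemma ext_left_add:
  "\<lbrakk>m \<in> carrier (mult_alg A); b \<in> carrier B; b' \<in> carrier B\<rbrakk> \<Longrightarrow>
    ext_left m (b \<oplus>\<^bsub>B\<^esub> b') = ext_left m b \<oplus>\<^bsub>B\<^esub> ext_left m b'"
  by (simp add: ext_left_eqI ext_rel_add ext_rel_ext_left)

lemma ext_left_minus:
  "\<lbrakk>m \<in> carrier (mult_alg A); b \<in> carrier B; b' \<in> carrier B\<rbrakk> \<Longrightarrow>
    ext_left m (b \<ominus>\<^bsub>B\<^esub> b') = ext_left m b \<ominus>\<^bsub>B\<^esub> ext_left m b'"
  by (simp add: ext_left_eqI ext_rel_minus ext_rel_ext_left)

lemma ext_left_gen: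
  "\<lbrakk>m \<in> carrier (mult_alg A); a \<in> carrier A; b \<in> carrier B\<rbrakk> \<Longrightarrow>
    ext_left m (fst (\<phi> a) b) = fst (\<phi> (fst m a)) b"
  by (simp add: ext_left_eqI ext_rel_gen)

text \<open>Density reduces the identity to generators \<open>\<phi>(c) d\<close> in place of
  \<open>b\<close>, where both sides are the adjoint of \<open>star b' \<phi>(m c) d\<close>. It
  supplies the right half of the extended multiplier and, with it, compatibility with the
  star.\<close>

lemma ext_left_adjoint:
  assumes m: "m \<in> carrier (mult_alg A)" and b: "b \<in> carrier B" and b': "b' \<in> carrier B"
  shows "star B b \<otimes>\<^bsub>B\<^esub> ext_left (star (mult_alg A) m) b' = star B (ext_left m b) \<otimes>\<^bsub>B\<^esub> b'"
proof -
  have sm: "star (mult_alg A) m \<in> carrier (mult_alg A)" using A.mult_star_closed[OF m] .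
  define z where "z = ext_left (star (mult_alg A) m) b'"
  have zc: "z \<in> carrier B" using sm b' by (simp add: z_def)
  have zr: "fst (\<phi> a) z = fst (\<phi> (snd (star (mult_alg A) m) a)) b'" if "a \<in> carrier A" for a
    using ext_rel_ext_left[OF sm b'] that by (simp add: ext_rel_def z_def)
  obtain K where K: "\<And>b. b \<in> carrier B \<Longrightarrow> nrm B (ext_left m b) \<le> K * nrm B b"
    using ext_left_bounded[OF m] by blast
  have "star B z \<otimes>\<^bsub>B\<^esub> b = star B b' \<otimes>\<^bsub>B\<^esub> ext_left m b"
  proof (rule B.clspan_eqI[OF _ span_subset B.cstar_algebra_axioms, of b "\<lambda>b. star B z \<otimes>\<^bsub>B\<^esub> b"
        "\<lambda>b. star B b' \<otimes>\<^bsub>B\<^esub> ext_left m b" "nrm B z" "nrm B b' * K"])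
    show "b \<in> clspan B {fst (\<phi> a) b | a b. a \<in> carrier A \<and> b \<in> carrier B}"
      using span b by simp
    fix x assume "x \<in> {fst (\<phi> a) b | a b. a \<in> carrier A \<and> b \<in> carrier B}"
    then obtain c d where x: "x = fst (\<phi> c) d" "c \<in> carrier A" "d \<in> carrier B" by blast
    have fc: "fst m c \<in> carrier A" using A.fst_carrier[OF m x(2)] .
    have "star B z \<otimes>\<^bsub>B\<^esub> x = star B (fst (\<phi> (star A c)) z) \<otimes>\<^bsub>B\<^esub> d"
      using x zc by (simp add: act_star)
    also have "fst (\<phi> (star A c)) z = fst (\<phi> (star A (fst m c))) b'"
      using zr[of "star A c"] x by (simp add: mult_alg_simps(13))
    also have "star B \<dots> \<otimes>\<^bsub>B\<^esub> d = star B b' \<otimes>\<^bsub>B\<^esub> fst (\<phi> (fst m c)) d"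
      using fc x b' by (simp add: act_star)
    also have "fst (\<phi> (fst m c)) d = ext_left m x"
      using x m by (simp add: ext_left_gen)
    finally show "star B z \<otimes>\<^bsub>B\<^esub> x = star B b' \<otimes>\<^bsub>B\<^esub> ext_left m x" .
  next
    fix x y assume xy: "x \<in> carrier B" "y \<in> carrier B"
    show "nrm B (star B z \<otimes>\<^bsub>B\<^esub> x \<ominus>\<^bsub>B\<^esub> star B z \<otimes>\<^bsub>B\<^esub> y) \<le> nrm B z * nrm B (x \<ominus>\<^bsub>B\<^esub> y)"
      using xy zc B.nrm_mult[of "star B z" "x \<ominus>\<^bsub>B\<^esub> y"] by (simp add: B.minus_mult_right)
    have "nrm B (star B b' \<otimes>\<^bsub>B\<^esub> ext_left m (x \<ominus>\<^bsub>B\<^esub> y)) \<le> nrm B b' * nrm B (ext_left m (x \<ominus>\<^bsub>B\<^esub> y))"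
      using xy b' m B.nrm_mult[of "star B b'" "ext_left m (x \<ominus>\<^bsub>B\<^esub> y)"] by simp
    also have "\<dots> \<le> nrm B b' * (K * nrm B (x \<ominus>\<^bsub>B\<^esub> y))"
      using xy b' B.nrm_nonneg by (intro mult_left_mono K) auto
    finally show "nrm B (star B b' \<otimes>\<^bsub>B\<^esub> ext_left m x \<ominus>\<^bsub>B\<^esub> star B b' \<otimes>\<^bsub>B\<^esub> ext_left m y)
        \<le> nrm B b' * K * nrm B (x \<ominus>\<^bsub>B\<^esub> y)"
      using xy b' m by (simp add: B.minus_mult_right ext_left_minus mult.assoc)
  qed (use zc b' m in \<open>auto simp: B.mult_r_distr ext_left_add\<close>)
  then have "star B (star B z \<otimes>\<^bsub>B\<^esub> b) = star B (star B b' \<otimes>\<^bsub>B\<^esub> ext_left m b)" by simp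
  then show ?thesis using zc b b' m by (simp add: B.star_mult z_def[symmetric])
qed

text \<open>The second component is forced: a right multiplication \<open>b m\<close> is the adjoint
  of \<open>star m\<close> applied to \<open>star b\<close>.\<close>

definition ext :: "'a mult \<Rightarrow> 'b mult" where
  "ext m = (\<lambda>b\<in>carrier B. ext_left m b, \<lambda>b\<in>carrier B. star B (ext_left (star (mult_alg A) m) (star B b)))"

lemma fst_ext: "b \<in> carrier B \<Longrightarrow> fst (ext m) b = ext_left m b"
  by (simp add: ext_def)

lemma ext_carrier:
  assumes m: "m \<in> carrier (mult_alg A)"
  shows "ext m \<in> carrier (mult_alg B)"
proof -
  have sm: "star (mult_alg A) m \<in> carrier (mult_alg A)" using A.mult_star_closed[OF m] .
  obtain K where K: "\<And>b. b \<in> carrier B \<Longrightarrow> nrm B (ext_left m b) \<le> K * nrm B b"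
    using ext_left_bounded[OF m] by blast
  show ?thesis
    unfolding ext_def
  proof (rule B.mult_algI)
    fix x y assume x: "x \<in> carrier B" and y: "y \<in> carrier B"
    have "star B (star B y \<otimes>\<^bsub>B\<^esub> ext_left (star (mult_alg A) m) (star B x)) =
        star B (star B (ext_left m y) \<otimes>\<^bsub>B\<^esub> star B x)"
      using ext_left_adjoint[OF m y, of "star B x"] x by simp
    then show "(\<lambda>b\<in>carrier B. star B (ext_left (star (mult_alg A) m) (star B b))) x \<otimes>\<^bsub>B\<^esub> y =
        x \<otimes>\<^bsub>B\<^esub> (\<lambda>b\<in>carrier B. ext_left m b) y"
      using x y m sm by (simp add: B.star_mult)
  qed (use m sm K in auto)
qed

lemma ext_hom: "(\<lambda>m\<in>carrier (mult_alg A). ext m) \<in> star_hom (mult_alg A) (mult_alg B)"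
proof -
  note rel = ext_rel_ext_left
  note c = A.mult_add_closed A.mult_smult_closed A.mult_mult_closed A.mult_star_closed
    B.mult_add_closed B.mult_smult_closed B.mult_mult_closed B.mult_star_closed ext_carrier
  show ?thesis
    unfolding star_hom_def
  proof (intro CollectI conjI ballI allI)
    show "(\<lambda>m\<in>carrier (mult_alg A). ext m) \<in> carrier (mult_alg A) \<rightarrow>\<^sub>E carrier (mult_alg B)"
      using ext_carrier by auto
  next
    fix m n assume m: "m \<in> carrier (mult_alg A)" and n: "n \<in> carrier (mult_alg A)"
    have "ext (m \<oplus>\<^bsub>mult_alg A\<^esub> n) = ext m \<oplus>\<^bsub>mult_alg B\<^esub> ext n"
      using m n c by (intro B.mult_eqI)
        (simp_all add: fst_ext mult_alg_simps(4) ext_left_eqI ext_rel_add_mult rel)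
    then show "(\<lambda>m\<in>carrier (mult_alg A). ext m) (m \<oplus>\<^bsub>mult_alg A\<^esub> n) =
        (\<lambda>m\<in>carrier (mult_alg A). ext m) m \<oplus>\<^bsub>mult_alg B\<^esub> (\<lambda>m\<in>carrier (mult_alg A). ext m) n"
      using m n c by simp
    have "ext (m \<otimes>\<^bsub>mult_alg A\<^esub> n) = ext m \<otimes>\<^bsub>mult_alg B\<^esub> ext n"
    proof (rule B.mult_eqI)
      fix b assume b: "b \<in> carrier B"
      have "ext_rel (m \<otimes>\<^bsub>mult_alg A\<^esub> n) b (ext_left m (ext_left n b))"
        using rel[OF m, of "ext_left n b"] rel[OF n b] m n b A.snd_carrier[OF m]
        by (simp add: ext_rel_def mult_alg_simps(3))
      then show "fst (ext (m \<otimes>\<^bsub>mult_alg A\<^esub> n)) b = fst (ext m \<otimes>\<^bsub>mult_alg B\<^esub> ext n) b"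
        using m n b c by (simp add: fst_ext mult_alg_simps(2) ext_left_eqI)
    qed (use m n c in auto)
    then show "(\<lambda>m\<in>carrier (mult_alg A). ext m) (m \<otimes>\<^bsub>mult_alg A\<^esub> n) =
        (\<lambda>m\<in>carrier (mult_alg A). ext m) m \<otimes>\<^bsub>mult_alg B\<^esub> (\<lambda>m\<in>carrier (mult_alg A). ext m) n"
      using m n c by simp
  next
    fix d m assume m: "m \<in> carrier (mult_alg A)"
    have "ext (d \<odot>\<^bsub>mult_alg A\<^esub> m) = d \<odot>\<^bsub>mult_alg B\<^esub> ext m"
      using m c by (intro B.mult_eqI)
        (simp_all add: fst_ext mult_alg_simps(6) ext_left_eqI ext_rel_smult_mult rel)
    then show "(\<lambda>m\<in>carrier (mult_alg A). ext m) (d \<odot>\<^bsub>mult_alg A\<^esub> m) =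
        d \<odot>\<^bsub>mult_alg B\<^esub> (\<lambda>m\<in>carrier (mult_alg A). ext m) m"
      using m c by simp
  next
    fix m assume m: "m \<in> carrier (mult_alg A)"
    have "ext (star (mult_alg A) m) = star (mult_alg B) (ext m)"
    proof (rule B.mult_eqI)
      fix b assume b: "b \<in> carrier B"
      then show "fst (ext (star (mult_alg A) m)) b = fst (star (mult_alg B) (ext m)) b"
        using A.mult_star_closed[OF m] by (simp add: fst_ext mult_alg_simps(12)) (simp add: ext_def)
    qed (use m c in auto)
    then show "(\<lambda>m\<in>carrier (mult_alg A). ext m) (star (mult_alg A) m) =
        star (mult_alg B) ((\<lambda>m\<in>carrier (mult_alg A). ext m) m)"
      using m c by simp
  qed
qed

lemma ext_embed:
  assumes a: "a \<in> carrier A"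
  shows "ext (mult_embed A a) = \<phi> a"
proof (rule B.mult_eqI)
  fix b assume b: "b \<in> carrier B"
  have "ext_rel (mult_embed A a) b (fst (\<phi> a) b)"
    using a b by (simp add: ext_rel_def mult_embed_simps act_mult)
  then show "fst (ext (mult_embed A a)) b = fst (\<phi> a) b"
    using a b by (simp add: fst_ext ext_left_eqI)
qed (use a ext_carrier in auto)

text \<open>Any extension \<open>\<Phi>\<close> satisfies
  \<open>\<phi>(a) \<Phi>(m) b = \<phi>(a m) b\<close>, which is the relation
  \<open>ext_rel\<close>; so the description in \<open>mult_ext\<close> has exactly one
  solution.\<close>

lemma mult_ext_eq: "mult_ext A B \<phi> = (\<lambda>m\<in>carrier (mult_alg A). ext m)"
  unfolding mult_ext_def
proof (rule the_equality)
  show "(\<lambda>m\<in>carrier (mult_alg A). ext m) \<in> star_hom (mult_alg A) (mult_alg B) \<and>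
     (\<forall>a\<in>carrier A. (\<lambda>m\<in>carrier (mult_alg A). ext m) (mult_embed A a) = \<phi> a)"
    using ext_hom ext_embed by simp
  fix \<Phi> assume \<Phi>: "\<Phi> \<in> star_hom (mult_alg A) (mult_alg B) \<and> (\<forall>a\<in>carrier A. \<Phi> (mult_embed A a) = \<phi> a)"
  then have \<Phi>h: "\<Phi> \<in> star_hom (mult_alg A) (mult_alg B)" and \<Phi>e: "\<And>a. a \<in> carrier A \<Longrightarrow> \<Phi> (mult_embed A a) = \<phi> a"
    by auto
  have "\<Phi> m = ext m" if m: "m \<in> carrier (mult_alg A)" for m
  proof (rule B.mult_eqI)
    show \<Phi>m: "\<Phi> m \<in> carrier (mult_alg B)" by (rule star_hom_carrier[OF \<Phi>h m])
    show "ext m \<in> carrier (mult_alg B)" by (rule ext_carrier[OF m])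
    fix b assume b: "b \<in> carrier B"
    have "fst (\<phi> a) (fst (\<Phi> m) b) = fst (\<phi> (snd m a)) b" if a: "a \<in> carrier A" for a
    proof -
      have "\<phi> a \<otimes>\<^bsub>mult_alg B\<^esub> \<Phi> m = \<Phi> (mult_embed A a \<otimes>\<^bsub>mult_alg A\<^esub> m)"
        using \<Phi>e a m by (simp add: star_hom_mult[OF \<Phi>h])
      also have "\<dots> = \<phi> (snd m a)" using \<Phi>e a m A.snd_carrier[OF m a] by (simp add: A.mult_embed_mult)
      finally show ?thesis using mult_alg_simps(2)[OF b, of "\<phi> a" "\<Phi> m"] by simp
    qed
    then have "ext_rel m b (fst (\<Phi> m) b)" using B.fst_carrier[OF \<Phi>m b] by (simp add: ext_rel_def)
    then show "fst (\<Phi> m) b = fst (ext m) b" using m b by (simp add: fst_ext ext_left_eqI)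
  qed
  then show "\<Phi> = (\<lambda>m\<in>carrier (mult_alg A). ext m)"
    using star_homD(1)[OF \<Phi>h] by (intro HOL.ext) (auto simp: PiE_def extensional_def)
qed

end

context nondeg_hom
begin

lemma mult_ext_hom: "mult_ext A B \<phi> \<in> star_hom (mult_alg A) (mult_alg B)"
  unfolding mult_ext_eq by (rule ext_hom)

lemma mult_ext_carrier [simp, intro]:
  "m \<in> carrier (mult_alg A) \<Longrightarrow> mult_ext A B \<phi> m \<in> carrier (mult_alg B)"
  using mult_ext_hom by (rule star_hom_carrier)

lemma mult_ext_embed: "a \<in> carrier A \<Longrightarrow> mult_ext A B \<phi> (mult_embed A a) = \<phi> a"
  unfolding mult_ext_eq by (simp add: ext_embed)

lemma mult_ext_act:
  "\<lbrakk>m \<in> carrier (mult_alg A); a \<in> carrier A; b \<in> carrier B\<rbrakk> \<Longrightarrow>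
    fst (mult_ext A B \<phi> m) (fst (\<phi> a) b) = fst (\<phi> (fst m a)) b"
  unfolding mult_ext_eq by (simp add: fst_ext ext_left_gen)

lemma mult_eq_spanI:
  assumes m: "m \<in> carrier (mult_alg B)" and n: "n \<in> carrier (mult_alg B)"
    and eq: "\<And>a b. \<lbrakk>a \<in> carrier A; b \<in> carrier B\<rbrakk> \<Longrightarrow> fst m (fst (\<phi> a) b) = fst n (fst (\<phi> a) b)"
  shows "m = n"
proof (rule B.mult_eqI[OF m n])
  fix y assume y: "y \<in> carrier B"
  show "fst m y = fst n y"
  proof (rule B.clspan_eqI[OF _ span_subset B.cstar_algebra_axioms, of y "fst m" "fst n"
        "nrm (mult_alg B) m" "nrm (mult_alg B) n"])
    show "y \<in> clspan B {fst (\<phi> a) b | a b. a \<in> carrier A \<and> b \<in> carrier B}"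
      using span y by simp
  qed (use m n eq in \<open>auto simp: B.fst_carrier B.fst_add B.fst_minus[symmetric] B.nrm_fst_le\<close>)
qed

text \<open>Identifies a single value of the extension from its action on
  \<open>\<phi>(A) B\<close>, without a homomorphism on all multipliers having to be
  constructed.\<close>

lemma mult_ext_eqI:
  assumes "m \<in> carrier (mult_alg A)" "n \<in> carrier (mult_alg B)"
    and "\<And>a b. \<lbrakk>a \<in> carrier A; b \<in> carrier B\<rbrakk> \<Longrightarrow> fst n (fst (\<phi> a) b) = fst (\<phi> (fst m a)) b"
  shows "mult_ext A B \<phi> m = n"
  using assms by (intro mult_eq_spanI) (auto simp: mult_ext_act)

lemma mult_ext_unique:
  assumes \<Phi>: "\<Phi> \<in> star_hom (mult_alg A) (mult_alg B)"
    and eq: "\<And>a. a \<in> carrier A \<Longrightarrow> \<Phi> (mult_embed A a) = \<phi> a"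
    and m: "m \<in> carrier (mult_alg A)"
  shows "mult_ext A B \<phi> m = \<Phi> m"
proof (rule mult_ext_eqI[OF m star_hom_carrier[OF \<Phi> m]])
  fix a b assume a: "a \<in> carrier A" and b: "b \<in> carrier B"
  have "\<Phi> m \<otimes>\<^bsub>mult_alg B\<^esub> \<phi> a = \<Phi> (m \<otimes>\<^bsub>mult_alg A\<^esub> mult_embed A a)"
    using eq a m by (simp add: star_hom_mult[OF \<Phi>])
  also have "\<dots> = \<phi> (fst m a)"
    using eq a m by (simp add: A.mult_mult_embed A.fst_carrier)
  finally show "fst (\<Phi> m) (fst (\<phi> a) b) = fst (\<phi> (fst m a)) b"
    using mult_alg_simps(2)[OF b, of "\<Phi> m" "\<phi> a"] by simp
qed

lemma mult_ext_one [simp]: "mult_ext A B \<phi> \<one>\<^bsub>mult_alg A\<^esub> = \<one>\<^bsub>mult_alg B\<^esub>"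
  by (rule mult_ext_eqI) (simp_all add: A.mult_one_closed B.mult_one_closed mult_alg_simps(10))

lemma mult_ext_unitary:
  assumes "u \<in> mult_unitaries A"
  shows "mult_ext A B \<phi> u \<in> mult_unitaries B"
proof -
  have u: "u \<in> carrier (mult_alg A)" "star (mult_alg A) u \<otimes>\<^bsub>mult_alg A\<^esub> u = \<one>\<^bsub>mult_alg A\<^esub>"
    "u \<otimes>\<^bsub>mult_alg A\<^esub> star (mult_alg A) u = \<one>\<^bsub>mult_alg A\<^esub>"
    using assms by (auto simp: mult_unitaries_def)
  have "mult_ext A B \<phi> (star (mult_alg A) u \<otimes>\<^bsub>mult_alg A\<^esub> u) = \<one>\<^bsub>mult_alg B\<^esub>"
    "mult_ext A B \<phi> (u \<otimes>\<^bsub>mult_alg A\<^esub> star (mult_alg A) u) = \<one>\<^bsub>mult_alg B\<^esub>"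
    unfolding u(2,3) by simp_all
  then show ?thesis
    using u(1) A.mult_star_closed[OF u(1)]
    by (simp add: mult_unitaries_def star_hom_mult[OF mult_ext_hom] star_hom_star[OF mult_ext_hom])
qed

lemma mult_ext_bounded:
  "m \<in> carrier (mult_alg A) \<Longrightarrow> nrm (mult_alg B) (mult_ext A B \<phi> m) \<le> 4 * nrm (mult_alg A) m"
  using A.unital_mult_alg B.unital_mult_alg mult_ext_hom mult_ext_one by (rule unital_star_hom_bounded)

lemma hom_bounded: "a \<in> carrier A \<Longrightarrow> nrm (mult_alg B) (\<phi> a) \<le> 4 * nrm A a"
  using mult_ext_bounded[of "mult_embed A a"] by (simp add: mult_ext_embed A.nrm_mult_embed)

lemma act_bounded:
  assumes "a \<in> carrier A" "a' \<in> carrier A" "b \<in> carrier B"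
  shows "nrm B (fst (\<phi> a) b \<ominus>\<^bsub>B\<^esub> fst (\<phi> a') b) \<le> 4 * nrm A (a \<ominus>\<^bsub>A\<^esub> a') * nrm B b"
proof -
  have "fst (\<phi> a) b \<ominus>\<^bsub>B\<^esub> fst (\<phi> a') b = fst (\<phi> (a \<ominus>\<^bsub>A\<^esub> a')) b"
    using assms star_hom_minus[OF hom A.cstar_algebra_axioms B.cstar_algebra_mult_alg, of a a']
    by (simp add: B.fst_minus_mult)
  also have "nrm B \<dots> \<le> nrm (mult_alg B) (\<phi> (a \<ominus>\<^bsub>A\<^esub> a')) * nrm B b"
    using assms by (intro B.nrm_fst_le) auto
  also have "\<dots> \<le> 4 * nrm A (a \<ominus>\<^bsub>A\<^esub> a') * nrm B b"
    using assms by (intro mult_right_mono hom_bounded B.nrm_nonneg) auto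
  finally show ?thesis .
qed

end

lemma nondeg_homI:
  "\<lbrakk>cstar_algebra A; cstar_algebra B; nondegenerate_hom A B \<phi>\<rbrakk> \<Longrightarrow> nondeg_hom A B \<phi>"
  by (simp add: nondeg_hom_def nondeg_hom_axioms_def)

lemma nondeg_homI_span:
  assumes A: "cstar_algebra A" and B: "cstar_algebra B" and hom: "\<phi> \<in> star_hom A (mult_alg B)"
    and span: "carrier B \<subseteq> clspan B {fst (\<phi> a) b | a b. a \<in> carrier A \<and> b \<in> carrier B}"
  shows "nondeg_hom A B \<phi>"
proof -
  interpret A: cstar_algebra A by fact
  interpret B: cstar_algebra B by fact
  have sub: "{fst (\<phi> a) b | a b. a \<in> carrier A \<and> b \<in> carrier B} \<subseteq> carrier B"
    using star_hom_carrier[OF hom] by (auto intro: B.fst_carrier)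
  have "clspan B {fst (\<phi> a) b | a b. a \<in> carrier A \<and> b \<in> carrier B} \<subseteq> carrier B"
    using B.clspan_carrier[OF sub] by blast
  then have "nondegenerate_hom A B \<phi>"
    using B.nondegenerate_hom_iff[of A \<phi>] A.M.zero_closed hom span by blast
  then show ?thesis using A B by (intro nondeg_homI)
qed

section \<open>Composition of non-degenerate homomorphisms\<close>

lemma star_hom_compose:
  assumes A: "cstar_algebra A" and f: "f \<in> star_hom A B" and g: "g \<in> star_hom B C"
  shows "compose (carrier A) g f \<in> star_hom A C"
proof -
  interpret A: cstar_algebra A by fact
  show ?thesis
    unfolding star_hom_def
    by (intro CollectI conjI ballI allI PiE_I)
      (simp_all add: compose_def star_homD(2-)[OF f] star_homD(2-)[OF g])
qed

lemma star_hom_eqI: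
  assumes "f \<in> star_hom A B" "g \<in> star_hom A B" "\<And>x. x \<in> carrier A \<Longrightarrow> f x = g x"
  shows "f = g"
  using star_homD(1)[OF assms(1)] star_homD(1)[OF assms(2)] assms(3) by (rule PiE_ext)

locale nondeg_hom_pair = first: nondeg_hom A B \<phi> + second: nondeg_hom B C \<psi>
  for A :: "'a cstar" and B :: "'b cstar" and C :: "'c cstar" and \<phi> \<psi>
begin

lemma hom_comp_apply: "a \<in> carrier A \<Longrightarrow> hom_comp A B C \<psi> \<phi> a = mult_ext B C \<psi> (\<phi> a)"
  by (simp add: hom_comp_def compose_def)

lemma hom_comp_hom: "hom_comp A B C \<psi> \<phi> \<in> star_hom A (mult_alg C)"
  unfolding hom_comp_def
  by (rule star_hom_compose[OF first.A.cstar_algebra_axioms first.hom second.mult_ext_hom])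

text \<open>Since \<open>\<psi>(\<phi>(a) b) d\<close> is the extension of \<open>\<psi>\<close> at
  \<open>\<phi>(a)\<close> applied to \<open>\<psi>(b) d\<close>, density of
  \<open>\<phi>(A) B\<close> in \<open>B\<close> is carried over by the Lipschitz maps
  \<open>b \<mapsto> \<psi>(b) d\<close>.\<close>

lemma nondeg_hom_comp: "nondeg_hom A C (hom_comp A B C \<psi> \<phi>)"
proof (rule nondeg_homI_span[OF first.A.cstar_algebra_axioms second.B.cstar_algebra_axioms hom_comp_hom])
  let ?S = "{fst (hom_comp A B C \<psi> \<phi> a) c | a c. a \<in> carrier A \<and> c \<in> carrier C}"
  have S: "?S \<subseteq> carrier C" by (auto simp: hom_comp_apply intro!: second.B.fst_carrier)
  have gen: "fst (\<psi> b) d \<in> clspan C ?S" if b: "b \<in> carrier B" and d: "d \<in> carrier C" for b d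
  proof (rule first.B.clspan_map[OF _ first.span_subset, of b "\<lambda>b. fst (\<psi> b) d" C "4 * nrm C d"])
    show "b \<in> clspan B {fst (\<phi> a) b | a b. a \<in> carrier A \<and> b \<in> carrier B}"
      using first.span b by simp
    fix x assume "x \<in> {fst (\<phi> a) b | a b. a \<in> carrier A \<and> b \<in> carrier B}"
    then obtain a b where x: "a \<in> carrier A" "b \<in> carrier B" "x = fst (\<phi> a) b" by blast
    have "fst (\<psi> x) d = fst (mult_ext B C \<psi> (\<phi> a)) (fst (\<psi> b) d)"
      using x d second.mult_ext_act[of "\<phi> a" b d] by simp
    then have "fst (\<psi> x) d \<in> ?S" using x d by (auto simp: hom_comp_apply[symmetric])
    then show "fst (\<psi> x) d \<in> clspan C ?S" by (rule clspan_base)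
  next
    fix x y assume "x \<in> carrier B" "y \<in> carrier B"
    then show "nrm C (fst (\<psi> x) d \<ominus>\<^bsub>C\<^esub> fst (\<psi> y) d) \<le> 4 * nrm C d * nrm B (x \<ominus>\<^bsub>B\<^esub> y)"
      using second.act_bounded[OF _ _ d, of x y] by (simp add: mult.assoc mult.commute mult.left_commute)
    show "fst (\<psi> (x \<oplus>\<^bsub>B\<^esub> y)) d = fst (\<psi> x) d \<oplus>\<^bsub>C\<^esub> fst (\<psi> y) d"
      using \<open>x \<in> carrier B\<close> \<open>y \<in> carrier B\<close> d by (simp add: star_hom_add[OF second.hom] mult_alg_simps(4))
  qed (use d in auto)
  show "carrier C \<subseteq> clspan C ?S"
  proof
    fix c assume "c \<in> carrier C"
    then have "c \<in> clspan C {fst (\<psi> b) d | b d. b \<in> carrier B \<and> d \<in> carrier C}"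
      using second.span by simp
    then show "c \<in> clspan C ?S"
      by (rule second.B.clspan_mono[OF _ second.span_subset]) (use gen in auto)
  qed
qed

text \<open>The composite of the two extensions extends the composite, and extensions are
  unique.\<close>

lemma mult_ext_hom_comp:
  assumes "m \<in> carrier (mult_alg A)"
  shows "mult_ext A C (hom_comp A B C \<psi> \<phi>) m = mult_ext B C \<psi> (mult_ext A B \<phi> m)"
proof -
  interpret comp: nondeg_hom A C "hom_comp A B C \<psi> \<phi>" by (rule nondeg_hom_comp)
  let ?\<Phi> = "compose (carrier (mult_alg A)) (mult_ext B C \<psi>) (mult_ext A B \<phi>)"
  have "mult_ext A C (hom_comp A B C \<psi> \<phi>) m = ?\<Phi> m"
  proof (rule comp.mult_ext_unique[OF _ _ assms])
    show "?\<Phi> \<in> star_hom (mult_alg A) (mult_alg C)"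
      by (rule star_hom_compose[OF first.A.cstar_algebra_mult_alg first.mult_ext_hom second.mult_ext_hom])
    show "?\<Phi> (mult_embed A a) = hom_comp A B C \<psi> \<phi> a" if "a \<in> carrier A" for a
      using that by (simp add: compose_def first.mult_ext_embed hom_comp_apply)
  qed
  then show ?thesis using assms by (simp add: compose_def)
qed

end

lemma nondeg_hom_pairI: "\<lbrakk>nondeg_hom A B \<phi>; nondeg_hom B C \<psi>\<rbrakk> \<Longrightarrow> nondeg_hom_pair A B C \<phi> \<psi>"
  by (simp add: nondeg_hom_pair_def)

lemma hom_comp_assoc:
  assumes "nondeg_hom A B \<phi>" "nondeg_hom B C \<psi>" "nondeg_hom C D \<omega>"
  shows "hom_comp A C D \<omega> (hom_comp A B C \<psi> \<phi>) = hom_comp A B D (hom_comp B C D \<omega> \<psi>) \<phi>"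
proof -
  interpret p1: nondeg_hom_pair A B C \<phi> \<psi> using assms by (intro nondeg_hom_pairI)
  interpret p2: nondeg_hom_pair B C D \<psi> \<omega> using assms by (intro nondeg_hom_pairI)
  have p3: "nondeg_hom_pair A C D (hom_comp A B C \<psi> \<phi>) \<omega>"
    using p1.nondeg_hom_comp assms by (intro nondeg_hom_pairI)
  have p4: "nondeg_hom_pair A B D \<phi> (hom_comp B C D \<omega> \<psi>)"
    using p2.nondeg_hom_comp assms by (intro nondeg_hom_pairI)
  show ?thesis
    by (rule star_hom_eqI[OF nondeg_hom_pair.hom_comp_hom[OF p3] nondeg_hom_pair.hom_comp_hom[OF p4]])
      (simp add: nondeg_hom_pair.hom_comp_apply[OF p3] nondeg_hom_pair.hom_comp_apply[OF p4]
        p1.hom_comp_apply p2.mult_ext_hom_comp)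
qed

section \<open>The identity and automorphisms as non-degenerate homomorphisms\<close>

context cstar_algebra
begin

text \<open>Surjectivity of \<open>\<alpha>\<close> turns the span of products into the required
  span. Hence \<open>aut_ext\<close> is a well-behaved instance of \<open>mult_ext\<close>, and the
  facts about extensions apply to it.\<close>

lemma nondeg_hom_embed_compose:
  assumes \<alpha>: "\<alpha> \<in> star_aut A"
  shows "nondeg_hom A A (compose (carrier A) (mult_embed A) \<alpha>)"
proof (rule nondeg_homI_span[OF cstar_algebra_axioms cstar_algebra_axioms])
  have hom: "\<alpha> \<in> star_hom A A" and bij: "bij_betw \<alpha> (carrier A) (carrier A)"
    using \<alpha> by (auto simp: star_aut_def)
  show "compose (carrier A) (mult_embed A) \<alpha> \<in> star_hom A MA"
    by (rule star_hom_compose[OF cstar_algebra_axioms hom mult_embed_hom])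
  have "{x \<otimes>\<^bsub>A\<^esub> y | x y. x \<in> carrier A \<and> y \<in> carrier A} =
      {fst (compose (carrier A) (mult_embed A) \<alpha> a) b | a b. a \<in> carrier A \<and> b \<in> carrier A}"
    (is "?S = ?T")
  proof
    show "?S \<subseteq> ?T"
    proof clarify
      fix x y assume "x \<in> carrier A" and y: "y \<in> carrier A"
      then obtain a where "a \<in> carrier A" "x = \<alpha> a" using bij by (auto simp: bij_betw_def)
      then show "\<exists>a b. x \<otimes>\<^bsub>A\<^esub> y = fst (compose (carrier A) (mult_embed A) \<alpha> a) b \<and> a \<in> carrier A \<and> b \<in> carrier A"
        using y star_hom_carrier[OF hom, of a]
        by (intro exI[of _ a] exI[of _ y]) (simp add: compose_def mult_embed_simps)
    qed
    show "?T \<subseteq> ?S"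
    proof clarify
      fix a b assume a: "a \<in> carrier A" and b: "b \<in> carrier A"
      then show "\<exists>x y. fst (compose (carrier A) (mult_embed A) \<alpha> a) b = x \<otimes>\<^bsub>A\<^esub> y \<and> x \<in> carrier A \<and> y \<in> carrier A"
        using star_hom_carrier[OF hom, of a]
        by (intro exI[of _ "\<alpha> a"] exI[of _ b]) (simp add: compose_def mult_embed_simps)
    qed
  qed
  then show "carrier A \<subseteq> clspan A ?T" using clspan_products by simp
qed

lemma id_star_aut: "(\<lambda>x\<in>carrier A. x) \<in> star_aut A"
  by (auto simp: star_aut_def star_hom_def bij_betw_def inj_on_def)

lemma compose_mult_embed_id: "compose (carrier A) (mult_embed A) (\<lambda>x\<in>carrier A. x) = mult_embed A"
  by (rule extensionalityI[of _ "carrier A"]) (auto simp: compose_def mult_embed_def)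

lemma nondeg_hom_mult_embed: "nondeg_hom A A (mult_embed A)"
  using nondeg_hom_embed_compose[OF id_star_aut] by (simp add: compose_mult_embed_id)

lemma mult_ext_mult_embed:
  assumes "m \<in> carrier MA"
  shows "mult_ext A A (mult_embed A) m = m"
  using nondeg_hom.mult_ext_eqI[OF nondeg_hom_mult_embed assms assms]
  by (simp add: assms mult_embed_simps fst_carrier fst_mult)

lemma aut_ext_id: "m \<in> carrier MA \<Longrightarrow> aut_ext A (\<lambda>x\<in>carrier A. x) m = m"
  by (simp add: aut_ext_def compose_mult_embed_id mult_ext_mult_embed)

lemma aut_ext_hom: "\<alpha> \<in> star_aut A \<Longrightarrow> aut_ext A \<alpha> \<in> star_hom MA MA"
  unfolding aut_ext_def by (rule nondeg_hom.mult_ext_hom[OF nondeg_hom_embed_compose])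

lemma aut_ext_embed: "\<lbrakk>\<alpha> \<in> star_aut A; a \<in> carrier A\<rbrakk> \<Longrightarrow> aut_ext A \<alpha> (mult_embed A a) = mult_embed A (\<alpha> a)"
  using nondeg_hom.mult_ext_embed[OF nondeg_hom_embed_compose, of \<alpha> a]
  by (simp add: aut_ext_def compose_def)

lemma aut_ext_one: "\<alpha> \<in> star_aut A \<Longrightarrow> aut_ext A \<alpha> \<one>\<^bsub>MA\<^esub> = \<one>\<^bsub>MA\<^esub>"
  unfolding aut_ext_def by (rule nondeg_hom.mult_ext_one[OF nondeg_hom_embed_compose])

lemma star_aut_carrier: "\<lbrakk>\<alpha> \<in> star_aut A; a \<in> carrier A\<rbrakk> \<Longrightarrow> \<alpha> a \<in> carrier A"
  by (auto simp: star_aut_def dest: star_hom_carrier)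

end

lemma (in nondeg_hom) hom_comp_mult_embed_right: "hom_comp A A B \<phi> (mult_embed A) = \<phi>"
proof -
  interpret p: nondeg_hom_pair A A B "mult_embed A" \<phi>
    by (rule nondeg_hom_pairI[OF A.nondeg_hom_mult_embed nondeg_hom_axioms])
  show ?thesis
    by (rule star_hom_eqI[OF p.hom_comp_hom hom]) (simp add: p.hom_comp_apply mult_ext_embed)
qed

lemma (in nondeg_hom) hom_comp_mult_embed_left: "hom_comp A B B (mult_embed B) \<phi> = \<phi>"
proof -
  interpret p: nondeg_hom_pair A B B \<phi> "mult_embed B"
    by (rule nondeg_hom_pairI[OF nondeg_hom_axioms B.nondeg_hom_mult_embed])
  show ?thesis
    by (rule star_hom_eqI[OF p.hom_comp_hom hom]) (simp add: p.hom_comp_apply B.mult_ext_mult_embed)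
qed

section \<open>Strict continuity\<close>

context cstar_algebra
begin

lemma strictly_continuous_iff:
  assumes "\<And>p. f p \<in> carrier MA"
  shows "strictly_continuous A f \<longleftrightarrow> (\<forall>a\<in>carrier A. \<forall>p.
    ((\<lambda>q. nrm A (fst (f q) a \<ominus>\<^bsub>A\<^esub> fst (f p) a)) \<longlongrightarrow> 0) (at p) \<and>
    ((\<lambda>q. nrm A (snd (f q) a \<ominus>\<^bsub>A\<^esub> snd (f p) a)) \<longlongrightarrow> 0) (at p))"
  using assms by (auto simp: strictly_continuous_def continuous_norm_iff fst_carrier snd_carrier)

lemma snd_eq_star:
  "\<lbrakk>m \<in> carrier MA; a \<in> carrier A\<rbrakk> \<Longrightarrow> snd m a = star A (fst (star MA m) (star A a))"
  by (simp add: mult_alg_simps(12) snd_carrier)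

text \<open>The right half of \<open>m\<close> is conjugate, under the isometric star, to the left
  half of \<open>star m\<close>. Conditions on left halves are the form that suits the density
  argument of \<open>clspan_continuous\<close>.\<close>

lemma strictly_continuousI:
  assumes f: "\<And>p. f p \<in> carrier MA"
    and l: "\<And>a p. a \<in> carrier A \<Longrightarrow> ((\<lambda>q. nrm A (fst (f q) a \<ominus>\<^bsub>A\<^esub> fst (f p) a)) \<longlongrightarrow> 0) (at p)"
    and r: "\<And>a p. a \<in> carrier A \<Longrightarrow>
      ((\<lambda>q. nrm A (fst (star MA (f q)) a \<ominus>\<^bsub>A\<^esub> fst (star MA (f p)) a)) \<longlongrightarrow> 0) (at p)"
  shows "strictly_continuous A f"
  unfolding strictly_continuous_iff[OF f]
proof (intro ballI allI conjI)
  fix a p assume a: "a \<in> carrier A"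
  show "((\<lambda>q. nrm A (fst (f q) a \<ominus>\<^bsub>A\<^esub> fst (f p) a)) \<longlongrightarrow> 0) (at p)" using l[OF a] .
  have "nrm A (snd (f q) a \<ominus>\<^bsub>A\<^esub> snd (f p) a) =
      nrm A (fst (star MA (f q)) (star A a) \<ominus>\<^bsub>A\<^esub> fst (star MA (f p)) (star A a))" for q
    using a fst_carrier[OF mult_star_closed[OF f]]
    by (simp add: snd_eq_star f star_minus[symmetric])
  then show "((\<lambda>q. nrm A (snd (f q) a \<ominus>\<^bsub>A\<^esub> snd (f p) a)) \<longlongrightarrow> 0) (at p)"
    using r[of "star A a"] a by simp
qed

lemma strictly_continuousD:
  assumes "strictly_continuous A f" "\<And>p. f p \<in> carrier MA" "a \<in> carrier A"
  shows "((\<lambda>q. nrm A (fst (f q) a \<ominus>\<^bsub>A\<^esub> fst (f p) a)) \<longlongrightarrow> 0) (at p)"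
    and "((\<lambda>q. nrm A (snd (f q) a \<ominus>\<^bsub>A\<^esub> snd (f p) a)) \<longlongrightarrow> 0) (at p)"
    and "((\<lambda>q. nrm A (fst (star MA (f q)) a \<ominus>\<^bsub>A\<^esub> fst (star MA (f p)) a)) \<longlongrightarrow> 0) (at p)"
proof -
  have *: "((\<lambda>q. nrm A (fst (f q) a \<ominus>\<^bsub>A\<^esub> fst (f p) a)) \<longlongrightarrow> 0) (at p)"
    "((\<lambda>q. nrm A (snd (f q) a \<ominus>\<^bsub>A\<^esub> snd (f p) a)) \<longlongrightarrow> 0) (at p)" if "a \<in> carrier A" for a
    using assms(1) that unfolding strictly_continuous_iff[OF assms(2)] by auto
  show "((\<lambda>q. nrm A (fst (f q) a \<ominus>\<^bsub>A\<^esub> fst (f p) a)) \<longlongrightarrow> 0) (at p)"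
    "((\<lambda>q. nrm A (snd (f q) a \<ominus>\<^bsub>A\<^esub> snd (f p) a)) \<longlongrightarrow> 0) (at p)" using *[OF assms(3)] .
  have "nrm A (fst (star MA (f q)) a \<ominus>\<^bsub>A\<^esub> fst (star MA (f p)) a) =
      nrm A (snd (f q) (star A a) \<ominus>\<^bsub>A\<^esub> snd (f p) (star A a))" for q
    using assms(2,3) snd_carrier[OF assms(2)]
    by (simp add: mult_alg_simps(12) star_minus[symmetric])
  then show "((\<lambda>q. nrm A (fst (star MA (f q)) a \<ominus>\<^bsub>A\<^esub> fst (star MA (f p)) a)) \<longlongrightarrow> 0) (at p)"
    using *(2)[of "star A a"] assms(3) by simp
qed

lemma strictly_continuous_const: "m \<in> carrier MA \<Longrightarrow> strictly_continuous A (\<lambda>_. m)"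
  by (rule strictly_continuousI) (simp_all add: fst_carrier mult_star_closed)

lemma strictly_continuous_compose:
  assumes "strictly_continuous A f" "continuous_on UNIV h"
  shows "strictly_continuous A (\<lambda>p. f (h p))"
proof -
  have h: "continuous_map euclidean euclidean h" using assms(2) by simp
  have comp: "continuous_map euclidean (norm_topology A) (\<lambda>p. g (h p))"
    if "continuous_map euclidean (norm_topology A) g" for g
    using continuous_map_compose[OF h that] by (simp add: o_def)
  show ?thesis
    unfolding strictly_continuous_def
  proof (intro ballI conjI)
    fix a assume "a \<in> carrier A"
    then have "continuous_map euclidean (norm_topology A) (\<lambda>p. fst (f p) a)"
      "continuous_map euclidean (norm_topology A) (\<lambda>p. snd (f p) a)"
      using assms(1) by (auto simp: strictly_continuous_def)
    from this[THEN comp]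
    show "continuous_map euclidean (norm_topology A) (\<lambda>p. fst (f (h p)) a)"
      "continuous_map euclidean (norm_topology A) (\<lambda>p. snd (f (h p)) a)" .
  qed
qed

text \<open>Splits \<open>f g - z\<close> into \<open>f (g - y)\<close> and \<open>f y - z\<close>;
  the uniform norm bound \<open>K\<close> controls the first summand. For families of unitaries the
  bound is 1.\<close>

lemma tendsto_fst_mult:
  assumes f: "\<And>q. f q \<in> carrier MA" and g: "\<And>q. g q \<in> carrier A" and y: "y \<in> carrier A"
    and K: "\<And>q. nrm MA (f q) \<le> K"
    and fy: "((\<lambda>q. nrm A (fst (f q) y \<ominus>\<^bsub>A\<^esub> z)) \<longlongrightarrow> 0) F" and z: "z \<in> carrier A"
    and gy: "((\<lambda>q. nrm A (g q \<ominus>\<^bsub>A\<^esub> y)) \<longlongrightarrow> 0) F"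
  shows "((\<lambda>q. nrm A (fst (f q) (g q) \<ominus>\<^bsub>A\<^esub> z)) \<longlongrightarrow> 0) F"
proof (rule tendsto_sandwich[OF _ _ tendsto_const])
  show "((\<lambda>q. K * nrm A (g q \<ominus>\<^bsub>A\<^esub> y) + nrm A (fst (f q) y \<ominus>\<^bsub>A\<^esub> z)) \<longlongrightarrow> 0) F"
    using tendsto_add[OF tendsto_mult_left[OF gy, of K] fy] by simp
  have "nrm A (fst (f q) (g q) \<ominus>\<^bsub>A\<^esub> z) \<le> K * nrm A (g q \<ominus>\<^bsub>A\<^esub> y) + nrm A (fst (f q) y \<ominus>\<^bsub>A\<^esub> z)" for q
  proof -
    have "nrm A (fst (f q) (g q) \<ominus>\<^bsub>A\<^esub> z)
        \<le> nrm A (fst (f q) (g q) \<ominus>\<^bsub>A\<^esub> fst (f q) y) + nrm A (fst (f q) y \<ominus>\<^bsub>A\<^esub> z)"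
      using f g y z by (intro nrm_minus_triangle fst_carrier)
    also have "fst (f q) (g q) \<ominus>\<^bsub>A\<^esub> fst (f q) y = fst (f q) (g q \<ominus>\<^bsub>A\<^esub> y)"
      using f g y by (simp add: fst_minus)
    also have "nrm A \<dots> \<le> nrm MA (f q) * nrm A (g q \<ominus>\<^bsub>A\<^esub> y)"
      using f g y by (intro nrm_fst_le) auto
    also have "\<dots> \<le> K * nrm A (g q \<ominus>\<^bsub>A\<^esub> y)"
      using K g y nrm_nonneg by (intro mult_right_mono) auto
    finally show ?thesis by simp
  qed
  then show "\<forall>\<^sub>F q in F. nrm A (fst (f q) (g q) \<ominus>\<^bsub>A\<^esub> z)
      \<le> K * nrm A (g q \<ominus>\<^bsub>A\<^esub> y) + nrm A (fst (f q) y \<ominus>\<^bsub>A\<^esub> z)" by simp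
qed (use f g z in \<open>auto simp: nrm_nonneg fst_carrier\<close>)

lemma strictly_continuous_mult:
  assumes f: "\<And>p. f p \<in> carrier MA" "strictly_continuous A f" "\<And>p. nrm MA (f p) \<le> K"
    and g: "\<And>p. g p \<in> carrier MA" "strictly_continuous A g" "\<And>p. nrm MA (g p) \<le> L"
  shows "strictly_continuous A (\<lambda>p. f p \<otimes>\<^bsub>MA\<^esub> g p)"
proof (rule strictly_continuousI)
  interpret M: cstar_algebra MA by (rule cstar_algebra_mult_alg)
  show "f p \<otimes>\<^bsub>MA\<^esub> g p \<in> carrier MA" for p using f g by simp
  fix a p assume a: "a \<in> carrier A"
  show "((\<lambda>q. nrm A (fst (f q \<otimes>\<^bsub>MA\<^esub> g q) a \<ominus>\<^bsub>A\<^esub> fst (f p \<otimes>\<^bsub>MA\<^esub> g p) a)) \<longlongrightarrow> 0) (at p)"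
    unfolding mult_alg_simps(2)[OF a]
    by (rule tendsto_fst_mult[where K = K, OF f(1) fst_carrier[OF g(1) a] fst_carrier[OF g(1) a] f(3)
          strictly_continuousD(1)[OF f(2,1) fst_carrier[OF g(1) a]] fst_carrier[OF f(1) fst_carrier[OF g(1) a]]
          strictly_continuousD(1)[OF g(2,1) a]])
  have s: "star MA (f q) \<in> carrier MA" "star MA (g q) \<in> carrier MA" for q using f g by auto
  show "((\<lambda>q. nrm A (fst (star MA (f q \<otimes>\<^bsub>MA\<^esub> g q)) a \<ominus>\<^bsub>A\<^esub> fst (star MA (f p \<otimes>\<^bsub>MA\<^esub> g p)) a)) \<longlongrightarrow> 0) (at p)"
    unfolding M.star_mult[OF f(1) g(1)] mult_alg_simps(2)[OF a]
  proof (rule tendsto_fst_mult[where K = L, OF s(2) fst_carrier[OF s(1) a] fst_carrier[OF s(1) a] _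
          strictly_continuousD(3)[OF g(2,1) fst_carrier[OF s(1) a]] fst_carrier[OF s(2) fst_carrier[OF s(1) a]]
          strictly_continuousD(3)[OF f(2,1) a]])
    show "nrm MA (star MA (g q)) \<le> L" for q using g by simp
  qed
qed

lemma unitary_nrm_le: "u \<in> mult_unitaries A \<Longrightarrow> nrm MA u \<le> 1"
  by (simp add: mult_unitaries_iff unital_cstar_algebra.nrm_unitary_le[OF unital_mult_alg])

lemma unitary_carrier: "u \<in> mult_unitaries A \<Longrightarrow> u \<in> carrier MA"
  by (simp add: mult_unitaries_def)

lemma unitary_mult:
  assumes "u \<in> mult_unitaries A" "v \<in> mult_unitaries A"
  shows "u \<otimes>\<^bsub>MA\<^esub> v \<in> mult_unitaries A"
proof -
  interpret M: unital_cstar_algebra MA by (rule unital_mult_alg)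
  have c: "u \<in> carrier MA" "v \<in> carrier MA" using assms by (auto simp: mult_unitaries_def)
  have "(star MA v \<otimes>\<^bsub>MA\<^esub> star MA u) \<otimes>\<^bsub>MA\<^esub> (u \<otimes>\<^bsub>MA\<^esub> v) = star MA v \<otimes>\<^bsub>MA\<^esub> ((star MA u \<otimes>\<^bsub>MA\<^esub> u) \<otimes>\<^bsub>MA\<^esub> v)"
    "(u \<otimes>\<^bsub>MA\<^esub> v) \<otimes>\<^bsub>MA\<^esub> (star MA v \<otimes>\<^bsub>MA\<^esub> star MA u) = u \<otimes>\<^bsub>MA\<^esub> ((v \<otimes>\<^bsub>MA\<^esub> star MA v) \<otimes>\<^bsub>MA\<^esub> star MA u)"
    using c by (simp_all add: M.mult_assoc)
  then show ?thesis using assms c by (simp add: mult_unitaries_def M.star_mult)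
qed

lemma unitary_star: "u \<in> mult_unitaries A \<Longrightarrow> star MA u \<in> mult_unitaries A"
  by (simp add: mult_unitaries_iff unital_cstar_algebra.unitary_star[OF unital_mult_alg])

lemma one_unitary: "\<one>\<^bsub>MA\<^esub> \<in> mult_unitaries A"
  by (simp add: mult_unitaries_iff unital_cstar_algebra.unitary_def[OF unital_mult_alg]
      unital_cstar_algebra.star_one[OF unital_mult_alg] unital_cstar_algebra.one_mult[OF unital_mult_alg]
      mult_one_closed)

end

text \<open>On a generator \<open>\<phi>(a) d\<close> the extension at \<open>f q\<close> gives
  \<open>\<phi>(f q a) d\<close>, and \<open>f q a\<close> converges in norm. The bound
  \<open>4 K\<close> is uniform in \<open>q\<close>, so \<open>clspan_continuous\<close> reaches all
  of \<open>B\<close>.\<close>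

lemma (in nondeg_hom) strictly_continuous_mult_ext:
  assumes f: "\<And>p. f p \<in> carrier (mult_alg A)" "strictly_continuous A f"
    "\<And>p. nrm (mult_alg A) (f p) \<le> K"
  shows "strictly_continuous B (\<lambda>p. mult_ext A B \<phi> (f p))"
proof (rule B.strictly_continuousI)
  interpret MA: cstar_algebra "mult_alg A" by (rule A.cstar_algebra_mult_alg)
  show "mult_ext A B \<phi> (f p) \<in> carrier (mult_alg B)" for p using f by simp
  have lim: "((\<lambda>q. nrm B (fst (mult_ext A B \<phi> (f q)) b \<ominus>\<^bsub>B\<^esub> fst (mult_ext A B \<phi> (f p)) b)) \<longlongrightarrow> 0) (at p)"
    if f: "\<And>p. f p \<in> carrier (mult_alg A)"
      "\<And>a p. a \<in> carrier A \<Longrightarrow> ((\<lambda>q. nrm A (fst (f q) a \<ominus>\<^bsub>A\<^esub> fst (f p) a)) \<longlongrightarrow> 0) (at p)"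
      "\<And>p. nrm (mult_alg A) (f p) \<le> K"
      and b: "b \<in> carrier B" for f :: "'p :: topological_space \<Rightarrow> 'a mult" and b p
  proof (rule B.clspan_continuous[OF B.cstar_algebra_axioms _ span_subset,
        where F = "\<lambda>q. fst (mult_ext A B \<phi> (f q))" and K = "4 * K"])
    show "b \<in> clspan B {fst (\<phi> a) b | a b. a \<in> carrier A \<and> b \<in> carrier B}" using b span by simp
    fix x assume "x \<in> {fst (\<phi> a) b | a b. a \<in> carrier A \<and> b \<in> carrier B}"
    then obtain a d where x: "x = fst (\<phi> a) d" "a \<in> carrier A" "d \<in> carrier B" by blast
    have fa: "fst (f q) a \<in> carrier A" for q using A.fst_carrier[OF f(1) x(2)] .
    show "((\<lambda>q. nrm B (fst (mult_ext A B \<phi> (f q)) x \<ominus>\<^bsub>B\<^esub> fst (mult_ext A B \<phi> (f p)) x)) \<longlongrightarrow> 0) (at p)"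
    proof (rule tendsto_sandwich[OF _ _ tendsto_const])
      show "((\<lambda>q. 4 * nrm A (fst (f q) a \<ominus>\<^bsub>A\<^esub> fst (f p) a) * nrm B d) \<longlongrightarrow> 0) (at p)"
        using tendsto_mult_right[OF tendsto_mult_left[OF f(2)[OF x(2), of p], of 4], of "nrm B d"] by simp
      show "\<forall>\<^sub>F q in at p. nrm B (fst (mult_ext A B \<phi> (f q)) x \<ominus>\<^bsub>B\<^esub> fst (mult_ext A B \<phi> (f p)) x)
          \<le> 4 * nrm A (fst (f q) a \<ominus>\<^bsub>A\<^esub> fst (f p) a) * nrm B d"
        unfolding x(1) using f(1) x(2,3) fa
        by (intro always_eventually allI) (simp add: mult_ext_act act_bounded)
    qed (use f(1) x(2,3) fa in \<open>simp add: x(1) mult_ext_act B.nrm_nonneg\<close>)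
  next
    fix q x y assume xy: "x \<in> carrier B" "y \<in> carrier B"
    have "nrm B (fst (mult_ext A B \<phi> (f q)) (x \<ominus>\<^bsub>B\<^esub> y)) \<le> nrm (mult_alg B) (mult_ext A B \<phi> (f q)) * nrm B (x \<ominus>\<^bsub>B\<^esub> y)"
      using xy f(1) by (intro B.nrm_fst_le) auto
    also have "\<dots> \<le> (4 * K) * nrm B (x \<ominus>\<^bsub>B\<^esub> y)"
    proof (rule mult_right_mono)
      show "nrm (mult_alg B) (mult_ext A B \<phi> (f q)) \<le> 4 * K"
        using mult_ext_bounded[OF f(1), of q] f(3)[of q] by simp
    qed (use xy in \<open>simp add: B.nrm_nonneg\<close>)
    finally show "nrm B (fst (mult_ext A B \<phi> (f q)) x \<ominus>\<^bsub>B\<^esub> fst (mult_ext A B \<phi> (f q)) y)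
        \<le> 4 * K * nrm B (x \<ominus>\<^bsub>B\<^esub> y)"
      using xy f(1) by (simp add: B.fst_minus)
  qed (use f(1) in \<open>auto simp: B.fst_carrier B.fst_add\<close>)
  fix b p assume b: "b \<in> carrier B"
  show "((\<lambda>q. nrm B (fst (mult_ext A B \<phi> (f q)) b \<ominus>\<^bsub>B\<^esub> fst (mult_ext A B \<phi> (f p)) b)) \<longlongrightarrow> 0) (at p)"
    using f b by (intro lim A.strictly_continuousD(1)) auto
  have "((\<lambda>q. nrm B (fst (mult_ext A B \<phi> (star (mult_alg A) (f q))) b
      \<ominus>\<^bsub>B\<^esub> fst (mult_ext A B \<phi> (star (mult_alg A) (f p))) b)) \<longlongrightarrow> 0) (at p)"
    using f b by (intro lim A.strictly_continuousD(3)) auto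
  then show "((\<lambda>q. nrm B (fst (star (mult_alg B) (mult_ext A B \<phi> (f q))) b
      \<ominus>\<^bsub>B\<^esub> fst (star (mult_alg B) (mult_ext A B \<phi> (f p))) b)) \<longlongrightarrow> 0) (at p)"
    using f(1) by (simp add: star_hom_star[OF mult_ext_hom])
qed

section \<open>Composition of cocycle representations\<close>

lemma (in cstar_algebra) Ad_hom:
  assumes u: "u \<in> mult_unitaries A"
  shows "(\<lambda>m\<in>carrier MA. Ad A u m) \<in> star_hom MA MA"
proof -
  interpret M: unital_cstar_algebra MA by (rule unital_mult_alg)
  have c: "u \<in> carrier MA" "star MA u \<in> carrier MA" and uu: "star MA u \<otimes>\<^bsub>MA\<^esub> u = \<one>\<^bsub>MA\<^esub>"
    using u by (auto simp: mult_unitaries_def)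
  have "u \<otimes>\<^bsub>MA\<^esub> (m \<otimes>\<^bsub>MA\<^esub> n) \<otimes>\<^bsub>MA\<^esub> star MA u = (u \<otimes>\<^bsub>MA\<^esub> m \<otimes>\<^bsub>MA\<^esub> star MA u) \<otimes>\<^bsub>MA\<^esub> (u \<otimes>\<^bsub>MA\<^esub> n \<otimes>\<^bsub>MA\<^esub> star MA u)"
    if "m \<in> carrier MA" "n \<in> carrier MA" for m n
  proof -
    have "(u \<otimes>\<^bsub>MA\<^esub> m \<otimes>\<^bsub>MA\<^esub> star MA u) \<otimes>\<^bsub>MA\<^esub> (u \<otimes>\<^bsub>MA\<^esub> n \<otimes>\<^bsub>MA\<^esub> star MA u)
        = u \<otimes>\<^bsub>MA\<^esub> m \<otimes>\<^bsub>MA\<^esub> ((star MA u \<otimes>\<^bsub>MA\<^esub> u) \<otimes>\<^bsub>MA\<^esub> (n \<otimes>\<^bsub>MA\<^esub> star MA u))"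
      using that c by (simp add: M.mult_assoc)
    then show ?thesis using that c by (simp add: uu M.mult_assoc)
  qed
  then show ?thesis
    using c by (auto simp: star_hom_def Ad_def M.mult_l_distr M.mult_r_distr M.smult_mult_left
        M.smult_mult_right M.star_mult M.mult_assoc)
qed

lemma (in cstar_algebra) Ad_mult:
  assumes "u \<in> carrier MA" "v \<in> carrier MA" "m \<in> carrier MA"
  shows "Ad A (u \<otimes>\<^bsub>MA\<^esub> v) m = Ad A u (Ad A v m)"
proof -
  interpret M: unital_cstar_algebra MA by (rule unital_mult_alg)
  show ?thesis using assms by (simp add: Ad_def M.star_mult M.mult_assoc)
qed

lemma twisted_algebraD:
  assumes "twisted_algebra \<A>"
  shows "cstar_algebra (alg \<A>)"
    and "act \<A> g \<in> star_aut (alg \<A>)"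
    and "a \<in> carrier (alg \<A>) \<Longrightarrow> continuous_map euclidean (norm_topology (alg \<A>)) (\<lambda>g. act \<A> g a)"
    and "twist \<A> s t \<in> mult_unitaries (alg \<A>)"
    and "strictly_continuous (alg \<A>) (\<lambda>(s, t). twist \<A> s t)"
  using assms by (auto simp: twisted_algebra_def Let_def)

lemma cocycle_rep_iff:
  "cocycle_rep \<A> \<B> (\<psi>, v) \<longleftrightarrow> nondegenerate_hom (alg \<A>) (alg \<B>) \<psi> \<and>
    (\<forall>g. v g \<in> mult_unitaries (alg \<B>)) \<and> strictly_continuous (alg \<B>) v \<and>
    (\<forall>g. \<forall>a\<in>carrier (alg \<A>).
      Ad (alg \<B>) (v g) (aut_ext (alg \<B>) (act \<B> g) (\<psi> a)) = \<psi> (act \<A> g a)) \<and>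
    (\<forall>g h. mult_ext (alg \<A>) (alg \<B>) \<psi> (twist \<A> g h) =
      v g \<otimes>\<^bsub>mult_alg (alg \<B>)\<^esub> aut_ext (alg \<B>) (act \<B> g) (v h) \<otimes>\<^bsub>mult_alg (alg \<B>)\<^esub> twist \<B> g h
        \<otimes>\<^bsub>mult_alg (alg \<B>)\<^esub> star (mult_alg (alg \<B>)) (v (g + h)))"
  by (simp add: cocycle_rep_def Let_def)

locale cocycle_representation =
  fixes \<A> :: "('g::topological_group_add, 'a) twisted" and \<B> :: "('g, 'b) twisted" and \<psi> v
  assumes twisted_source: "twisted_algebra \<A>" and twisted_target: "twisted_algebra \<B>"
    and rep: "cocycle_rep \<A> \<B> (\<psi>, v)"
begin

sublocale hom: nondeg_hom "alg \<A>" "alg \<B>" \<psi>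
  using twisted_source twisted_target rep
  by (auto intro!: nondeg_homI simp: cocycle_rep_iff twisted_algebraD(1))

lemma unitary: "v g \<in> mult_unitaries (alg \<B>)"
  using rep by (simp add: cocycle_rep_iff)

lemma unitary_carrier [simp, intro]: "v g \<in> carrier (mult_alg (alg \<B>))"
  using unitary by (rule hom.B.unitary_carrier)

text \<open>Both sides are star-homomorphisms in \<open>m\<close> whose values at an embedded
  \<open>a\<close> are \<open>\<psi>(\<alpha>_g a)\<close>, so uniqueness of extensions
  applies.\<close>

lemma covariance_ext:
  assumes m: "m \<in> carrier (mult_alg (alg \<A>))"
  shows "Ad (alg \<B>) (v g) (aut_ext (alg \<B>) (act \<B> g) (mult_ext (alg \<A>) (alg \<B>) \<psi> m)) =
    mult_ext (alg \<A>) (alg \<B>) \<psi> (aut_ext (alg \<A>) (act \<A> g) m)"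
proof -
  let ?A = "alg \<A>" and ?B = "alg \<B>"
  have \<alpha>: "act \<A> g \<in> star_aut ?A" and \<beta>: "act \<B> g \<in> star_aut ?B"
    using twisted_source twisted_target by (auto intro: twisted_algebraD)
  interpret p: nondeg_hom_pair ?A ?A ?B "compose (carrier ?A) (mult_embed ?A) (act \<A> g)" \<psi>
    by (rule nondeg_hom_pairI[OF hom.A.nondeg_hom_embed_compose[OF \<alpha>] hom.nondeg_hom_axioms])
  interpret c: nondeg_hom ?A ?B "hom_comp ?A ?A ?B \<psi> (compose (carrier ?A) (mult_embed ?A) (act \<A> g))"
    by (rule p.nondeg_hom_comp)
  let ?\<Phi> = "compose (carrier (mult_alg ?A)) (\<lambda>m\<in>carrier (mult_alg ?B). Ad ?B (v g) m)
    (compose (carrier (mult_alg ?A)) (aut_ext ?B (act \<B> g)) (mult_ext ?A ?B \<psi>))"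
  have aut: "aut_ext ?B (act \<B> g) (mult_ext ?A ?B \<psi> m) \<in> carrier (mult_alg ?B)"
    if "m \<in> carrier (mult_alg ?A)" for m
    using that by (intro star_hom_carrier[OF hom.B.aut_ext_hom[OF \<beta>]]) simp
  have "mult_ext ?A ?B (hom_comp ?A ?A ?B \<psi> (compose (carrier ?A) (mult_embed ?A) (act \<A> g))) m = ?\<Phi> m"
  proof (rule c.mult_ext_unique[OF _ _ m])
    show "?\<Phi> \<in> star_hom (mult_alg ?A) (mult_alg ?B)"
      by (rule star_hom_compose[OF hom.A.cstar_algebra_mult_alg star_hom_compose[OF
              hom.A.cstar_algebra_mult_alg hom.mult_ext_hom hom.B.aut_ext_hom[OF \<beta>]] hom.B.Ad_hom[OF unitary]])
    fix a assume a: "a \<in> carrier ?A"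
    have \<alpha>a: "act \<A> g a \<in> carrier ?A" using hom.A.star_aut_carrier[OF \<alpha> a] .
    have "?\<Phi> (mult_embed ?A a) = Ad ?B (v g) (aut_ext ?B (act \<B> g) (\<psi> a))"
      using a aut[of "mult_embed ?A a"] by (simp add: compose_def hom.mult_ext_embed)
    also have "\<dots> = \<psi> (act \<A> g a)" using rep a by (simp add: cocycle_rep_iff)
    also have "\<dots> = hom_comp ?A ?A ?B \<psi> (compose (carrier ?A) (mult_embed ?A) (act \<A> g)) a"
      using a \<alpha>a by (simp add: p.hom_comp_apply) (simp add: compose_def hom.mult_ext_embed)
    finally show "?\<Phi> (mult_embed ?A a) =
        hom_comp ?A ?A ?B \<psi> (compose (carrier ?A) (mult_embed ?A) (act \<A> g)) a" .
  qed
  then show ?thesis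
    using m aut[OF m] p.mult_ext_hom_comp[OF m] by (simp add: aut_ext_def compose_def)
qed

end

lemma cocycle_comp_eq:
  "cocycle_comp \<A> \<B> \<C> (\<psi>, v) (\<phi>, u) = (hom_comp (alg \<A>) (alg \<B>) (alg \<C>) \<psi> \<phi>,
    \<lambda>g. mult_ext (alg \<B>) (alg \<C>) \<psi> (u g) \<otimes>\<^bsub>mult_alg (alg \<C>)\<^esub> v g)"
  by (simp add: cocycle_comp_def)

locale cocycle_representation_pair =
  first: cocycle_representation \<A> \<B> \<phi> u + second: cocycle_representation \<B> \<C> \<psi> v
  for \<A> :: "('g::topological_group_add, 'a) twisted" and \<B> :: "('g, 'b) twisted"
    and \<C> :: "('g, 'c) twisted" and \<phi> u \<psi> v
begin

sublocale pair: nondeg_hom_pair "alg \<A>" "alg \<B>" "alg \<C>" \<phi> \<psi>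
  by (rule nondeg_hom_pairI[OF first.hom.nondeg_hom_axioms second.hom.nondeg_hom_axioms])

text \<open>In the cocycle identity, \<open>covariance_ext\<close> rewrites the image of
  \<open>\<beta>_g(u_h)\<close> as a conjugate by \<open>v_g\<close>, and its last factor
  \<open>star v_g\<close> cancels against the leading \<open>v_g\<close> in the identity for the
  second representation.\<close>

lemma comp_rep: "cocycle_rep \<A> \<C> (cocycle_comp \<A> \<B> \<C> (\<psi>, v) (\<phi>, u))"
proof -
  let ?A = "alg \<A>" and ?B = "alg \<B>" and ?C = "alg \<C>"
  let ?M = "mult_alg ?C"
  let ?\<Phi> = "mult_ext ?A ?B \<phi>" and ?\<Psi> = "mult_ext ?B ?C \<psi>"
  let ?w = "\<lambda>g. ?\<Psi> (u g) \<otimes>\<^bsub>?M\<^esub> v g"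
  interpret M: unital_cstar_algebra ?M by (rule second.hom.B.unital_mult_alg)
  have \<alpha>: "act \<A> g \<in> star_aut ?A" and \<beta>: "act \<B> g \<in> star_aut ?B" and \<gamma>: "act \<C> g \<in> star_aut ?C" for g
    using first.twisted_source first.twisted_target second.twisted_target by (auto intro: twisted_algebraD)
  have tA: "twist \<A> g h \<in> carrier (mult_alg ?A)" and tB: "twist \<B> g h \<in> carrier (mult_alg ?B)"
    and tC: "twist \<C> g h \<in> carrier ?M" for g h
    using twisted_algebraD(4)[OF first.twisted_source] twisted_algebraD(4)[OF first.twisted_target]
      twisted_algebraD(4)[OF second.twisted_target] by (auto simp: mult_unitaries_def)
  have \<Psi>u: "?\<Psi> (u g) \<in> mult_unitaries ?C" for g
    by (rule second.hom.mult_ext_unitary[OF first.unitary])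
  have vc: "v g \<in> carrier ?M" for g by simp
  have vv: "star ?M (v g) \<otimes>\<^bsub>?M\<^esub> v g = \<one>\<^bsub>?M\<^esub>" for g
    using second.unitary[of g] by (simp add: mult_unitaries_def)
  have \<gamma>c: "aut_ext ?C (act \<C> g) m \<in> carrier ?M" if "m \<in> carrier ?M" for g m
    using star_hom_carrier[OF second.hom.B.aut_ext_hom[OF \<gamma>] that] .
  have \<beta>c: "aut_ext ?B (act \<B> g) m \<in> carrier (mult_alg ?B)" if "m \<in> carrier (mult_alg ?B)" for g m
    using star_hom_carrier[OF first.hom.B.aut_ext_hom[OF \<beta>] that] .
  have "cocycle_rep \<A> \<C> (hom_comp ?A ?B ?C \<psi> \<phi>, ?w)"
    unfolding cocycle_rep_iff
  proof (intro conjI allI ballI)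
    show "nondegenerate_hom ?A ?C (hom_comp ?A ?B ?C \<psi> \<phi>)"
      by (rule nondeg_hom.nondegenerate[OF pair.nondeg_hom_comp])
    show "?w g \<in> mult_unitaries ?C" for g
      by (rule second.hom.B.unitary_mult[OF \<Psi>u second.unitary])
    show "strictly_continuous ?C ?w"
    proof (rule second.hom.B.strictly_continuous_mult)
      show "strictly_continuous ?C (\<lambda>g. ?\<Psi> (u g))"
      proof (rule second.hom.strictly_continuous_mult_ext)
        show "strictly_continuous ?B u" using first.rep by (simp add: cocycle_rep_iff)
        show "nrm (mult_alg ?B) (u g) \<le> 1" for g
          by (rule first.hom.B.unitary_nrm_le[OF first.unitary])
      qed simp
      show "strictly_continuous ?C v" using second.rep by (simp add: cocycle_rep_iff)
      show "nrm ?M (?\<Psi> (u g)) \<le> 1" "nrm ?M (v g) \<le> 1" for g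
        by (rule second.hom.B.unitary_nrm_le[OF \<Psi>u] second.hom.B.unitary_nrm_le[OF second.unitary])+
    qed simp_all
    fix g
    show "Ad ?C (?w g) (aut_ext ?C (act \<C> g) (hom_comp ?A ?B ?C \<psi> \<phi> a)) = hom_comp ?A ?B ?C \<psi> \<phi> (act \<A> g a)"
      if a: "a \<in> carrier ?A" for a
    proof -
      have "Ad ?C (?w g) (aut_ext ?C (act \<C> g) (hom_comp ?A ?B ?C \<psi> \<phi> a))
          = Ad ?C (?\<Psi> (u g)) (Ad ?C (v g) (aut_ext ?C (act \<C> g) (?\<Psi> (\<phi> a))))"
        using a by (simp add: pair.hom_comp_apply second.hom.B.Ad_mult \<gamma>c)
      also have "Ad ?C (v g) (aut_ext ?C (act \<C> g) (?\<Psi> (\<phi> a))) = ?\<Psi> (aut_ext ?B (act \<B> g) (\<phi> a))"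
        using a by (simp add: second.covariance_ext)
      also have "Ad ?C (?\<Psi> (u g)) \<dots> = ?\<Psi> (Ad ?B (u g) (aut_ext ?B (act \<B> g) (\<phi> a)))"
        using a \<beta>c[of "\<phi> a" g] first.hom.B.mult_mult_closed first.hom.B.mult_star_closed
        by (simp add: Ad_def star_hom_mult[OF second.hom.mult_ext_hom] star_hom_star[OF second.hom.mult_ext_hom])
      also have "Ad ?B (u g) (aut_ext ?B (act \<B> g) (\<phi> a)) = \<phi> (act \<A> g a)"
        using a first.rep by (simp add: cocycle_rep_iff)
      finally show ?thesis
        using a first.hom.A.star_aut_carrier[OF \<alpha> a] by (simp add: pair.hom_comp_apply)
    qed
    fix h
    have cov: "v g \<otimes>\<^bsub>?M\<^esub> aut_ext ?C (act \<C> g) (?\<Psi> (u h)) \<otimes>\<^bsub>?M\<^esub> star ?M (v g) = ?\<Psi> (aut_ext ?B (act \<B> g) (u h))"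
      using second.covariance_ext[of "u h" g] by (simp add: Ad_def)
    have "mult_ext ?A ?C (hom_comp ?A ?B ?C \<psi> \<phi>) (twist \<A> g h) = ?\<Psi> (?\<Phi> (twist \<A> g h))"
      by (rule pair.mult_ext_hom_comp[OF tA])
    also have "?\<Phi> (twist \<A> g h) = u g \<otimes>\<^bsub>mult_alg ?B\<^esub> aut_ext ?B (act \<B> g) (u h) \<otimes>\<^bsub>mult_alg ?B\<^esub> twist \<B> g h
        \<otimes>\<^bsub>mult_alg ?B\<^esub> star (mult_alg ?B) (u (g + h))"
      using first.rep by (simp add: cocycle_rep_iff)
    also have "?\<Psi> \<dots> = ?\<Psi> (u g) \<otimes>\<^bsub>?M\<^esub> ?\<Psi> (aut_ext ?B (act \<B> g) (u h)) \<otimes>\<^bsub>?M\<^esub> ?\<Psi> (twist \<B> g h)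
        \<otimes>\<^bsub>?M\<^esub> star ?M (?\<Psi> (u (g + h)))"
      using tB \<beta>c[of "u h" g] first.hom.B.mult_mult_closed first.hom.B.mult_star_closed
      by (simp add: star_hom_mult[OF second.hom.mult_ext_hom] star_hom_star[OF second.hom.mult_ext_hom])
    also have "?\<Psi> (twist \<B> g h) = v g \<otimes>\<^bsub>?M\<^esub> aut_ext ?C (act \<C> g) (v h) \<otimes>\<^bsub>?M\<^esub> twist \<C> g h
        \<otimes>\<^bsub>?M\<^esub> star ?M (v (g + h))"
      using second.rep by (simp add: cocycle_rep_iff)
    also have "?\<Psi> (u g) \<otimes>\<^bsub>?M\<^esub> ?\<Psi> (aut_ext ?B (act \<B> g) (u h))
          \<otimes>\<^bsub>?M\<^esub> (v g \<otimes>\<^bsub>?M\<^esub> aut_ext ?C (act \<C> g) (v h) \<otimes>\<^bsub>?M\<^esub> twist \<C> g h \<otimes>\<^bsub>?M\<^esub> star ?M (v (g + h)))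
          \<otimes>\<^bsub>?M\<^esub> star ?M (?\<Psi> (u (g + h)))
        = ?w g \<otimes>\<^bsub>?M\<^esub> aut_ext ?C (act \<C> g) (?w h) \<otimes>\<^bsub>?M\<^esub> twist \<C> g h \<otimes>\<^bsub>?M\<^esub> star ?M (?w (g + h))"
    proof -
      \<comment> \<open>Opaque names stop simplification from expanding the factors; what remains is
        associativity and the cancellation \<open>VV\<close>.\<close>
      define p where "p = v g"
      define x where "x = aut_ext ?C (act \<C> g) (?\<Psi> (u h))"
      define y where "y = aut_ext ?C (act \<C> g) (v h)"
      define z where "z = twist \<C> g h"
      define s where "s = star ?M (v (g + h))"
      have c: "p \<in> carrier ?M" "x \<in> carrier ?M" "y \<in> carrier ?M" "z \<in> carrier ?M" "s \<in> carrier ?M"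
        "star ?M p \<in> carrier ?M" "?\<Psi> (u g) \<in> carrier ?M" "star ?M (?\<Psi> (u (g + h))) \<in> carrier ?M"
        unfolding p_def x_def y_def z_def s_def using tC \<gamma>c by simp_all
      have VV: "star ?M p \<otimes>\<^bsub>?M\<^esub> (p \<otimes>\<^bsub>?M\<^esub> n) = n" if "n \<in> carrier ?M" for n
        using that c vv[of g] by (simp add: p_def M.mult_assoc[symmetric])
      have XY: "aut_ext ?C (act \<C> g) (?w h) = x \<otimes>\<^bsub>?M\<^esub> y"
        unfolding x_def y_def by (simp add: star_hom_mult[OF second.hom.B.aut_ext_hom[OF \<gamma>]])
      have "?\<Psi> (aut_ext ?B (act \<B> g) (u h)) = p \<otimes>\<^bsub>?M\<^esub> x \<otimes>\<^bsub>?M\<^esub> star ?M p"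
        unfolding cov[symmetric] p_def x_def ..
      then show ?thesis
        unfolding XY p_def[symmetric] y_def[symmetric] z_def[symmetric] s_def[symmetric]
        using c by (simp add: M.star_mult M.mult_assoc VV s_def[symmetric])
    qed
    finally show "mult_ext ?A ?C (hom_comp ?A ?B ?C \<psi> \<phi>) (twist \<A> g h)
        = ?w g \<otimes>\<^bsub>?M\<^esub> aut_ext ?C (act \<C> g) (?w h) \<otimes>\<^bsub>?M\<^esub> twist \<C> g h \<otimes>\<^bsub>?M\<^esub> star ?M (?w (g + h))" .
  qed
  then show ?thesis by (simp add: cocycle_comp_eq)
qed

end

lemma cocycle_comp_rep:
  assumes "twisted_algebra \<A>" "twisted_algebra \<B>" "twisted_algebra \<C>"
    "cocycle_rep \<A> \<B> f" "cocycle_rep \<B> \<C> g"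
  shows "cocycle_rep \<A> \<C> (cocycle_comp \<A> \<B> \<C> g f)"
proof -
  obtain \<phi> u \<psi> v where "f = (\<phi>, u)" "g = (\<psi>, v)" by (cases f, cases g)
  moreover from this have "cocycle_representation_pair \<A> \<B> \<C> \<phi> u \<psi> v"
    using assms by (simp add: cocycle_representation_pair_def cocycle_representation_def)
  ultimately show ?thesis using cocycle_representation_pair.comp_rep by blast
qed

lemma cocycle_comp_assoc:
  assumes "twisted_algebra \<A>" "twisted_algebra \<B>" "twisted_algebra \<C>" "twisted_algebra \<D>"
    "cocycle_rep \<A> \<B> f" "cocycle_rep \<B> \<C> g" "cocycle_rep \<C> \<D> h"
  shows "cocycle_comp \<A> \<C> \<D> h (cocycle_comp \<A> \<B> \<C> g f) = cocycle_comp \<A> \<B> \<D> (cocycle_comp \<B> \<C> \<D> h g) f"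
proof -
  obtain \<phi> u \<psi> v \<theta> w where e: "f = (\<phi>, u)" "g = (\<psi>, v)" "h = (\<theta>, w)" by (cases f, cases g, cases h)
  interpret f: cocycle_representation \<A> \<B> \<phi> u using assms e by (simp add: cocycle_representation_def)
  interpret g: cocycle_representation \<B> \<C> \<psi> v using assms e by (simp add: cocycle_representation_def)
  interpret h: cocycle_representation \<C> \<D> \<theta> w using assms e by (simp add: cocycle_representation_def)
  interpret gh: nondeg_hom_pair "alg \<B>" "alg \<C>" "alg \<D>" \<psi> \<theta>
    by (rule nondeg_hom_pairI[OF g.hom.nondeg_hom_axioms h.hom.nondeg_hom_axioms])
  interpret M: cstar_algebra "mult_alg (alg \<D>)" by (rule h.hom.B.cstar_algebra_mult_alg)
  have "hom_comp (alg \<A>) (alg \<C>) (alg \<D>) \<theta> (hom_comp (alg \<A>) (alg \<B>) (alg \<C>) \<psi> \<phi>) =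
      hom_comp (alg \<A>) (alg \<B>) (alg \<D>) (hom_comp (alg \<B>) (alg \<C>) (alg \<D>) \<theta> \<psi>) \<phi>"
    by (rule hom_comp_assoc[OF f.hom.nondeg_hom_axioms g.hom.nondeg_hom_axioms h.hom.nondeg_hom_axioms])
  then show ?thesis
    by (simp add: e cocycle_comp_eq gh.mult_ext_hom_comp star_hom_mult[OF h.hom.mult_ext_hom] M.mult_assoc)
qed

definition cocycle_id :: "('g, 'a) twisted \<Rightarrow> ('g, 'a, 'a) cocycle_pair" where
  "cocycle_id \<A> = (mult_embed (alg \<A>), \<lambda>_. \<one>\<^bsub>mult_alg (alg \<A>)\<^esub>)"

lemma cocycle_id_rep:
  assumes "twisted_algebra \<A>"
  shows "cocycle_rep \<A> \<A> (cocycle_id \<A>)"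
proof -
  interpret A: cstar_algebra "alg \<A>" using assms by (rule twisted_algebraD)
  interpret M: unital_cstar_algebra "mult_alg (alg \<A>)" by (rule A.unital_mult_alg)
  have \<alpha>: "act \<A> g \<in> star_aut (alg \<A>)" for g using assms by (rule twisted_algebraD)
  have t: "twist \<A> g h \<in> carrier (mult_alg (alg \<A>))" for g h
    using twisted_algebraD(4)[OF assms] A.unitary_carrier by blast
  show ?thesis
    unfolding cocycle_id_def cocycle_rep_iff
    using nondeg_hom.nondegenerate[OF A.nondeg_hom_mult_embed] t A.star_aut_carrier[OF \<alpha>]
    by (simp add: A.one_unitary A.strictly_continuous_const Ad_def A.aut_ext_embed[OF \<alpha>]
        A.aut_ext_one[OF \<alpha>] A.mult_ext_mult_embed)
qed

lemma cocycle_comp_id_right: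
  assumes "twisted_algebra \<A>" "twisted_algebra \<B>" "cocycle_rep \<A> \<B> f"
  shows "cocycle_comp \<A> \<A> \<B> f (cocycle_id \<A>) = f"
proof -
  obtain \<phi> u where e: "f = (\<phi>, u)" by (cases f)
  interpret f: cocycle_representation \<A> \<B> \<phi> u using assms e by (simp add: cocycle_representation_def)
  interpret M: unital_cstar_algebra "mult_alg (alg \<B>)" by (rule f.hom.B.unital_mult_alg)
  show ?thesis by (simp add: e cocycle_id_def cocycle_comp_eq f.hom.hom_comp_mult_embed_right)
qed

lemma cocycle_comp_id_left:
  assumes "twisted_algebra \<A>" "twisted_algebra \<B>" "cocycle_rep \<A> \<B> f"
  shows "cocycle_comp \<A> \<B> \<B> (cocycle_id \<B>) f = f"
proof -
  obtain \<phi> u where e: "f = (\<phi>, u)" by (cases f)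
  interpret f: cocycle_representation \<A> \<B> \<phi> u using assms e by (simp add: cocycle_representation_def)
  interpret M: unital_cstar_algebra "mult_alg (alg \<B>)" by (rule f.hom.B.unital_mult_alg)
  show ?thesis
    by (simp add: e cocycle_id_def cocycle_comp_eq f.hom.hom_comp_mult_embed_left f.hom.B.mult_ext_mult_embed)
qed

section \<open>Covariant representations as cocycle representations\<close>

definition trivial_twisted :: "'d cstar \<Rightarrow> ('g, 'd) twisted" where
  "trivial_twisted D = \<lparr>alg = D, act = (\<lambda>_. \<lambda>x\<in>carrier D. x), twist = (\<lambda>_ _. \<one>\<^bsub>mult_alg D\<^esub>)\<rparr>"

lemma trivial_twisted_simps [simp]:
  "alg (trivial_twisted D) = D"
  "act (trivial_twisted D) g = (\<lambda>x\<in>carrier D. x)"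
  "twist (trivial_twisted D) g h = \<one>\<^bsub>mult_alg D\<^esub>"
  by (simp_all add: trivial_twisted_def)

lemma (in cstar_algebra) twisted_algebra_trivial:
  "twisted_algebra (trivial_twisted A :: ('g::topological_group_add, 'a) twisted)"
proof -
  interpret M: unital_cstar_algebra MA by (rule unital_mult_alg)
  show ?thesis
    by (simp add: twisted_algebra_def Let_def cstar_algebra_axioms id_star_aut one_unitary
        continuous_norm_iff Ad_def aut_ext_id mult_one_closed case_prod_unfold strictly_continuous_const)
qed

text \<open>The two forms of the cocycle condition differ by right multiplication with the unitary
  \<open>U (g + h)\<close> or its adjoint, and the trivial action extends to the identity on
  multipliers.\<close>

lemma covariant_rep_iff:
  assumes A: "twisted_algebra \<A>" and D: "cstar_algebra D"
  shows "covariant_rep \<A> D (\<pi>, U) \<longleftrightarrow> cocycle_rep \<A> (trivial_twisted D) (\<pi>, U)"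
proof (cases "nondegenerate_hom (alg \<A>) D \<pi> \<and> (\<forall>g. U g \<in> mult_unitaries D)")
  case True
  interpret D: cstar_algebra D by fact
  interpret M: unital_cstar_algebra "mult_alg D" by (rule D.unital_mult_alg)
  interpret h: nondeg_hom "alg \<A>" D \<pi>
    using True A D by (intro nondeg_homI) (auto simp: twisted_algebraD)
  let ?M = "mult_alg D" and ?\<Pi> = "mult_ext (alg \<A>) D \<pi>"
  have Uc: "U g \<in> carrier ?M" and UU: "star ?M (U g) \<otimes>\<^bsub>?M\<^esub> U g = \<one>\<^bsub>?M\<^esub>" "U g \<otimes>\<^bsub>?M\<^esub> star ?M (U g) = \<one>\<^bsub>?M\<^esub>" for g
    using True by (auto simp: mult_unitaries_def)
  have t: "?\<Pi> (twist \<A> g h) \<in> carrier ?M" for g h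
    using twisted_algebraD(4)[OF A] h.A.unitary_carrier by blast
  have "U g \<otimes>\<^bsub>?M\<^esub> U h = ?\<Pi> (twist \<A> g h) \<otimes>\<^bsub>?M\<^esub> U (g + h) \<longleftrightarrow>
      ?\<Pi> (twist \<A> g h) = U g \<otimes>\<^bsub>?M\<^esub> U h \<otimes>\<^bsub>?M\<^esub> star ?M (U (g + h))" (is "?l = ?r \<longleftrightarrow> ?t = _") for g h
  proof
    assume "?l = ?r"
    then have "?l \<otimes>\<^bsub>?M\<^esub> star ?M (U (g + h)) = ?r \<otimes>\<^bsub>?M\<^esub> star ?M (U (g + h))" by simp
    then show "?t = ?l \<otimes>\<^bsub>?M\<^esub> star ?M (U (g + h))"
      using Uc t by (simp add: M.mult_assoc UU)
  next
    assume *: "?t = ?l \<otimes>\<^bsub>?M\<^esub> star ?M (U (g + h))"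
    show "?l = ?r" using Uc by (simp add: * M.mult_assoc UU)
  qed
  then show ?thesis
    using True Uc by (auto simp: covariant_rep_def cocycle_rep_iff Let_def D.aut_ext_id)
qed (auto simp: covariant_rep_def cocycle_rep_iff Let_def)

text \<open>Homomorphisms between crossed products thereby join the same calculus: following a
  covariant representation by such a homomorphism is a composition of cocycle representations, to
  which associativity applies.\<close>

lemma cocycle_rep_trivial_iff:
  assumes P: "cstar_algebra P" and Q: "cstar_algebra Q"
  shows "cocycle_rep (trivial_twisted P :: ('g::topological_group_add, 'p) twisted) (trivial_twisted Q)
      (\<Theta>, \<lambda>_. \<one>\<^bsub>mult_alg Q\<^esub>) \<longleftrightarrow> nondegenerate_hom P Q \<Theta>"
proof (cases "nondegenerate_hom P Q \<Theta>")
  case True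
  interpret h: nondeg_hom P Q \<Theta> using True P Q by (intro nondeg_homI)
  interpret M: unital_cstar_algebra "mult_alg Q" by (rule h.B.unital_mult_alg)
  show ?thesis
    using True by (simp add: cocycle_rep_iff h.B.one_unitary h.B.strictly_continuous_const Ad_def
        h.B.aut_ext_id)
qed (simp add: cocycle_rep_iff)

section \<open>C*-subalgebras of multiplier algebras\<close>

text \<open>The universal property of a crossed product is tested only on C*-algebras carried by sets of
  multipliers. A C*-algebra \<open>Q\<close> is moved there by passing to its canonical copy in \<open>\<M>(Q)\<close>.\<close>

abbreviation mult_sub :: "'a cstar \<Rightarrow> 'a mult set \<Rightarrow> 'a mult cstar" where
  "mult_sub A H \<equiv> (mult_alg A)\<lparr>carrier := H\<rparr>"

context cstar_algebra
begin

text \<open>The embedding is isometric, so the preimages of a convergent sequence of embedded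
  elements are Cauchy and converge in \<open>A\<close>.\<close>

lemma mult_embed_image_closed:
  assumes x: "x \<in> carrier MA"
    and lim: "\<And>e::real. e > 0 \<Longrightarrow> \<exists>y. y \<in> mult_embed A ` carrier A \<and> nrm MA (x \<ominus>\<^bsub>MA\<^esub> y) < e"
  shows "x \<in> mult_embed A ` carrier A"
proof -
  interpret M: cstar_algebra MA by (rule cstar_algebra_mult_alg)
  have "\<exists>y. y \<in> carrier A \<and> nrm MA (x \<ominus>\<^bsub>MA\<^esub> mult_embed A y) < 1 / real (Suc n)" for n
    using lim[of "1 / real (Suc n)"] by auto
  then obtain y where y: "\<And>n. y n \<in> carrier A" "\<And>n. nrm MA (x \<ominus>\<^bsub>MA\<^esub> mult_embed A (y n)) < 1 / real (Suc n)"
    by metis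
  have ylim: "(\<lambda>n. nrm MA (mult_embed A (y n) \<ominus>\<^bsub>MA\<^esub> x)) \<longlonglongrightarrow> 0"
  proof (rule tendsto_sandwich[OF _ _ tendsto_const])
    show "(\<lambda>n. 1 / real (Suc n)) \<longlonglongrightarrow> 0" by (rule LIMSEQ_Suc[OF lim_1_over_n])
    show "\<forall>\<^sub>F n in sequentially. nrm MA (mult_embed A (y n) \<ominus>\<^bsub>MA\<^esub> x) \<le> 1 / real (Suc n)"
      using y x by (intro always_eventually allI) (metis M.nrm_minus_commute less_imp_le mult_embed_carrier)
  qed (use y x in \<open>simp add: M.nrm_nonneg\<close>)
  have emb: "nrm A (a \<ominus>\<^bsub>A\<^esub> b) = nrm MA (mult_embed A a \<ominus>\<^bsub>MA\<^esub> mult_embed A b)"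
    if "a \<in> carrier A" "b \<in> carrier A" for a b
    using that nrm_mult_embed[of "a \<ominus>\<^bsub>A\<^esub> b"]
    by (simp add: star_hom_minus[OF mult_embed_hom cstar_algebra_axioms cstar_algebra_mult_alg])
  obtain z where z: "z \<in> carrier A" "(\<lambda>n. nrm A (y n \<ominus>\<^bsub>A\<^esub> z)) \<longlonglongrightarrow> 0"
  proof (rule Cauchy_converges[of y])
    fix e :: real assume e: "e > 0"
    then have "\<forall>\<^sub>F n in sequentially. nrm MA (mult_embed A (y n) \<ominus>\<^bsub>MA\<^esub> x) < e / 2"
      using order_tendstoD(2)[OF ylim, of "e / 2"] by simp
    then obtain N where N: "\<And>n. n \<ge> N \<Longrightarrow> nrm MA (mult_embed A (y n) \<ominus>\<^bsub>MA\<^esub> x) < e / 2"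
      by (auto simp: eventually_sequentially)
    have "nrm A (y m \<ominus>\<^bsub>A\<^esub> y n) < e" if "m \<ge> N" "n \<ge> N" for m n
      using N[OF that(1)] N[OF that(2)] emb[OF y(1) y(1), of m n]
        M.nrm_minus_triangle[of "mult_embed A (y m)" x "mult_embed A (y n)"]
        M.nrm_minus_commute[of x "mult_embed A (y n)"] x y(1) by simp
    then show "\<exists>N. \<forall>m\<ge>N. \<forall>n\<ge>N. nrm A (y m \<ominus>\<^bsub>A\<^esub> y n) < e" by blast
  qed (rule y(1))
  have "mult_embed A z = x"
    using z y(1) x ylim
    by (intro M.limit_unique[of "\<lambda>n. mult_embed A (y n)" _ _ sequentially]) (auto simp: emb)
  then show ?thesis using z by blast
qed

lemma carrier_subset_clspan_products:
  assumes "{x \<otimes>\<^bsub>A\<^esub> y | x y. x \<in> carrier A \<and> y \<in> carrier A} \<subseteq> T" (is "?S \<subseteq> T")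
  shows "carrier A \<subseteq> clspan A T"
proof
  fix x assume "x \<in> carrier A"
  then have "x \<in> clspan A ?S" using clspan_products by simp
  then show "x \<in> clspan A T"
    by (rule clspan_mono) (use assms in \<open>auto intro: clspan_base\<close>)
qed

lemma cstar_algebra_mult_sub_embed: "cstar_algebra (mult_sub A (mult_embed A ` carrier A))"
proof -
  interpret M: cstar_algebra MA by (rule cstar_algebra_mult_alg)
  have hom: "mult_embed A \<zero>\<^bsub>A\<^esub> = \<zero>\<^bsub>MA\<^esub>"
    using star_hom_smult[OF mult_embed_hom, of "\<zero>\<^bsub>A\<^esub>" 0] M.smult_0_left[of "mult_embed A \<zero>\<^bsub>A\<^esub>"] by simp
  show ?thesis
  proof (rule M.subalgebra)
    show "\<zero>\<^bsub>MA\<^esub> \<in> mult_embed A ` carrier A" by (rule image_eqI[of _ _ "\<zero>\<^bsub>A\<^esub>"]) (simp_all add: hom)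
  qed (auto simp: star_homD(3-)[OF mult_embed_hom, symmetric] intro: mult_embed_image_closed)
qed

end

text \<open>A C*-algebra between \<open>Q\<close> and its multiplier algebra. Containing
  \<open>Q\<close> makes the inclusion non-degenerate, hence extendable to multipliers. Two
  instances occur: the copy of \<open>Q\<close> itself, and later the algebra
  \<open>core\<close>.\<close>

locale mult_subalgebra = Q: cstar_algebra Q for Q :: "'x cstar" +
  fixes H :: "'x mult set"
  assumes sub: "cstar_algebra (mult_sub Q H)"
    and H_carrier: "H \<subseteq> carrier (mult_alg Q)"
    and embed_H: "mult_embed Q ` carrier Q \<subseteq> H"
begin

sublocale H: cstar_algebra "mult_sub Q H" by (rule sub)

lemma incl_hom: "(\<lambda>h\<in>H. h) \<in> star_hom (mult_sub Q H) (mult_alg Q)"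
proof -
  note closed = H.M.add.m_closed H.smult_carrier H.mult_closed H.star_closed
  show ?thesis
    using H_carrier closed by (auto simp: star_hom_def)
qed

lemma incl_nondeg: "nondeg_hom (mult_sub Q H) Q (\<lambda>h\<in>H. h)"
proof (rule nondeg_homI_span[OF sub Q.cstar_algebra_axioms incl_hom])
  have "{x \<otimes>\<^bsub>Q\<^esub> y | x y. x \<in> carrier Q \<and> y \<in> carrier Q} \<subseteq>
      {fst ((\<lambda>h\<in>H. h) a) b | a b. a \<in> carrier (mult_sub Q H) \<and> b \<in> carrier Q}"
  proof clarify
    fix x y assume x: "x \<in> carrier Q" and y: "y \<in> carrier Q"
    then have "mult_embed Q x \<in> H" using embed_H by blast
    then show "\<exists>a b. x \<otimes>\<^bsub>Q\<^esub> y = fst ((\<lambda>h\<in>H. h) a) b \<and> a \<in> carrier (mult_sub Q H) \<and> b \<in> carrier Q"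
      using x y by (intro exI[of _ "mult_embed Q x"] exI[of _ y]) (simp add: mult_embed_simps)
  qed
  then show "carrier Q \<subseteq> clspan Q {fst ((\<lambda>h\<in>H. h) a) b | a b. a \<in> carrier (mult_sub Q H) \<and> b \<in> carrier Q}"
    by (rule Q.carrier_subset_clspan_products)
qed

sublocale incl: nondeg_hom "mult_sub Q H" Q "\<lambda>h\<in>H. h" by (rule incl_nondeg)

end

section \<open>The universal property\<close>

lemma trivial_comp:
  assumes "nondeg_hom P D \<Theta>" "nondeg_hom D E \<Omega>"
  shows "cocycle_comp (trivial_twisted P) (trivial_twisted D) (trivial_twisted E)
    (\<Omega>, \<lambda>_. \<one>\<^bsub>mult_alg E\<^esub>) (\<Theta>, \<lambda>_. \<one>\<^bsub>mult_alg D\<^esub>) = (hom_comp P D E \<Omega> \<Theta>, \<lambda>_. \<one>\<^bsub>mult_alg E\<^esub>)"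
proof -
  interpret nondeg_hom D E \<Omega> by fact
  interpret M: unital_cstar_algebra "mult_alg E" by (rule B.unital_mult_alg)
  show ?thesis by (simp add: cocycle_comp_eq)
qed

text \<open>The equation \<open>\<Theta> \<circ> k = f\<close> for the universal representation
  \<open>k\<close>. The carrier type of \<open>D\<close> is left free, since the universal property
  is first available over \<open>'x mult\<close> and then transferred to \<open>'x\<close>.\<close>

definition factors ::
  "('g::topological_group_add, 'a) twisted \<Rightarrow> ('g, 'a, 'x) crossed \<Rightarrow> 'd cstar \<Rightarrow> ('x \<Rightarrow> 'd mult) \<Rightarrow>
    ('g, 'a, 'd) cocycle_pair \<Rightarrow> bool" where
  "factors \<A> K D \<Theta> f \<longleftrightarrow> nondegenerate_hom (cp_alg K) D \<Theta> \<and>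
    cocycle_comp \<A> (trivial_twisted (cp_alg K)) (trivial_twisted D)
      (\<Theta>, \<lambda>_. \<one>\<^bsub>mult_alg D\<^esub>) (cp_hom K, cp_unitary K) = f"

locale crossed_product =
  fixes \<A> :: "('g::topological_group_add, 'a) twisted" and K :: "('g, 'a, 'x) crossed"
  assumes twisted: "twisted_algebra \<A>" and crossed: "is_crossed_product \<A> K"
begin

sublocale A: cstar_algebra "alg \<A>" by (rule twisted_algebraD[OF twisted])

sublocale P: cstar_algebra "cp_alg K"
  using crossed by (simp add: is_crossed_product_def)

lemma rep: "cocycle_rep \<A> (trivial_twisted (cp_alg K)) (cp_hom K, cp_unitary K)"
  using crossed covariant_rep_iff[OF twisted P.cstar_algebra_axioms] by (simp add: is_crossed_product_def)

sublocale universal: cocycle_representation \<A> "trivial_twisted (cp_alg K)" "cp_hom K" "cp_unitary K"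
  using twisted P.twisted_algebra_trivial rep by (rule cocycle_representation.intro)

lemma factors_iff:
  assumes D: "cstar_algebra D" and f: "cocycle_rep \<A> (trivial_twisted D) (\<pi>, U)"
  shows "factors \<A> K D \<Theta> (\<pi>, U) \<longleftrightarrow> nondegenerate_hom (cp_alg K) D \<Theta> \<and>
    (\<forall>a\<in>carrier (alg \<A>). mult_ext (cp_alg K) D \<Theta> (cp_hom K a) = \<pi> a) \<and>
    (\<forall>g. mult_ext (cp_alg K) D \<Theta> (cp_unitary K g) = U g)"
proof (cases "nondegenerate_hom (cp_alg K) D \<Theta>")
  case True
  interpret \<Theta>: nondeg_hom "cp_alg K" D \<Theta>
    using P.cstar_algebra_axioms D True by (rule nondeg_homI)
  interpret M: unital_cstar_algebra "mult_alg D" by (rule \<Theta>.B.unital_mult_alg)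
  interpret pair: nondeg_hom_pair "alg \<A>" "cp_alg K" D "cp_hom K" \<Theta>
    using universal.hom.nondeg_hom_axioms \<Theta>.nondeg_hom_axioms by (intro nondeg_hom_pairI) simp_all
  have \<pi>: "\<pi> \<in> star_hom (alg \<A>) (mult_alg D)"
    using f by (simp add: cocycle_rep_iff nondegenerate_hom_def)
  have u: "cp_unitary K g \<in> carrier (mult_alg (cp_alg K))" for g
    using universal.unitary_carrier[of g] by simp
  have "hom_comp (alg \<A>) (cp_alg K) D \<Theta> (cp_hom K) = \<pi> \<longleftrightarrow>
      (\<forall>a\<in>carrier (alg \<A>). mult_ext (cp_alg K) D \<Theta> (cp_hom K a) = \<pi> a)"
  proof
    assume "hom_comp (alg \<A>) (cp_alg K) D \<Theta> (cp_hom K) = \<pi>"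
    then show "\<forall>a\<in>carrier (alg \<A>). mult_ext (cp_alg K) D \<Theta> (cp_hom K a) = \<pi> a"
      using pair.hom_comp_apply by metis
  next
    assume "\<forall>a\<in>carrier (alg \<A>). mult_ext (cp_alg K) D \<Theta> (cp_hom K a) = \<pi> a"
    then show "hom_comp (alg \<A>) (cp_alg K) D \<Theta> (cp_hom K) = \<pi>"
      using pair.hom_comp_apply by (intro star_hom_eqI[OF pair.hom_comp_hom \<pi>]) simp
  qed
  then show ?thesis
    using True u by (simp add: factors_def cocycle_comp_eq fun_eq_iff)
qed (simp add: factors_def)

text \<open>Associativity in the form \<open>\<Omega> \<circ> (\<Theta> \<circ> k) = (\<Omega>
  \<circ> \<Theta>) \<circ> k\<close>.\<close>

lemma factors_compose:
  fixes D :: "'c cstar" and E :: "'d cstar"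
  assumes \<Theta>: "cstar_algebra D" "factors \<A> K D \<Theta> f" and \<Omega>: "nondeg_hom D E \<Omega>"
  shows "factors \<A> K E (hom_comp (cp_alg K) D E \<Omega> \<Theta>)
    (cocycle_comp \<A> (trivial_twisted D) (trivial_twisted E) (\<Omega>, \<lambda>_. \<one>\<^bsub>mult_alg E\<^esub>) f)"
proof -
  interpret \<Omega>: nondeg_hom D E \<Omega> by fact
  have nd: "nondeg_hom (cp_alg K) D \<Theta>"
    using \<Theta> P.cstar_algebra_axioms by (intro nondeg_homI) (auto simp: factors_def)
  interpret pair: nondeg_hom_pair "cp_alg K" D E \<Theta> \<Omega> using nd \<Omega> by (rule nondeg_hom_pairI)
  let ?k = "(cp_hom K, cp_unitary K)"
  let ?P = "trivial_twisted (cp_alg K) :: ('g, 'x) twisted"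
  let ?D = "trivial_twisted D :: ('g, 'c) twisted" and ?E = "trivial_twisted E :: ('g, 'd) twisted"
  have f: "f = cocycle_comp \<A> ?P ?D (\<Theta>, \<lambda>_. \<one>\<^bsub>mult_alg D\<^esub>) ?k"
    using \<Theta> by (simp add: factors_def)
  have "cocycle_comp \<A> ?D ?E (\<Omega>, \<lambda>_. \<one>\<^bsub>mult_alg E\<^esub>) f =
      cocycle_comp \<A> ?P ?E (cocycle_comp ?P ?D ?E (\<Omega>, \<lambda>_. \<one>\<^bsub>mult_alg E\<^esub>) (\<Theta>, \<lambda>_. \<one>\<^bsub>mult_alg D\<^esub>)) ?k"
    unfolding f using nd \<Omega>
    by (intro cocycle_comp_assoc twisted P.twisted_algebra_trivial \<Omega>.A.twisted_algebra_trivial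
        \<Omega>.B.twisted_algebra_trivial rep)
      (simp_all add: cocycle_rep_trivial_iff P.cstar_algebra_axioms \<Omega>.A.cstar_algebra_axioms
        \<Omega>.B.cstar_algebra_axioms nondeg_hom.nondegenerate)
  also have "\<dots> = cocycle_comp \<A> ?P ?E (hom_comp (cp_alg K) D E \<Omega> \<Theta>, \<lambda>_. \<one>\<^bsub>mult_alg E\<^esub>) ?k"
    unfolding trivial_comp[OF nd \<Omega>] ..
  finally show ?thesis
    using nondeg_hom.nondegenerate[OF pair.nondeg_hom_comp] by (simp add: factors_def)
qed

lemma universal_property_mult:
  fixes D :: "'x mult cstar"
  assumes D: "cstar_algebra D" and f: "cocycle_rep \<A> (trivial_twisted D) f"
  shows "\<exists>!\<Theta>. factors \<A> K D \<Theta> f"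
proof -
  obtain \<pi> U where e: "f = (\<pi>, U)" by (cases f)
  have "\<exists>!\<Theta>. nondegenerate_hom (cp_alg K) D \<Theta> \<and>
          (\<forall>a\<in>carrier (alg \<A>). mult_ext (cp_alg K) D \<Theta> (cp_hom K a) = \<pi> a) \<and>
          (\<forall>g. mult_ext (cp_alg K) D \<Theta> (cp_unitary K g) = U g)"
    using crossed D f covariant_rep_iff[OF twisted D, of \<pi> U] unfolding is_crossed_product_def e by blast
  then show ?thesis using factors_iff[OF D f[unfolded e]] by (simp add: e)
qed

text \<open>Let \<open>j\<close> map \<open>Q\<close> into the multipliers of its copy
  \<open>Q'\<close>, and let \<open>\<rho>\<close> include \<open>Q'\<close> in the multipliers of
  \<open>Q\<close>, so that \<open>\<rho> \<circ> j\<close> is the identity morphism. A solution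
  over \<open>Q'\<close> followed by \<open>\<rho>\<close> gives existence. Uniqueness holds because
  \<open>\<Theta> = \<rho> \<circ> (j \<circ> \<Theta>)\<close> and
  \<open>j \<circ> \<Theta>\<close> is unique over \<open>Q'\<close>.\<close>

lemma universal_property:
  fixes Q :: "'x cstar"
  assumes Q: "cstar_algebra Q" and f: "cocycle_rep \<A> (trivial_twisted Q) f"
  shows "\<exists>!\<Theta>. factors \<A> K Q \<Theta> f"
proof -
  interpret Q: cstar_algebra Q by fact
  interpret mult_subalgebra Q "mult_embed Q ` carrier Q"
    by (intro mult_subalgebra.intro mult_subalgebra_axioms.intro Q Q.cstar_algebra_mult_sub_embed) auto
  let ?Q' = "mult_sub Q (mult_embed Q ` carrier Q)"
  let ?\<rho> = "\<lambda>h\<in>mult_embed Q ` carrier Q. h"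
  define j where "j = compose (carrier Q) (mult_embed ?Q') (mult_embed Q)"
  have embed_hom: "mult_embed Q \<in> star_hom Q ?Q'"
  proof -
    have "mult_embed Q \<in> carrier Q \<rightarrow>\<^sub>E mult_embed Q ` carrier Q"
      by (rule PiE_I) (erule imageI, simp add: mult_embed_def)
    then show ?thesis by (simp add: star_hom_def star_homD(3-)[OF Q.mult_embed_hom])
  qed
  have j: "nondeg_hom Q ?Q' j"
  proof (rule nondeg_homI_span[OF Q H.cstar_algebra_axioms])
    show "j \<in> star_hom Q (mult_alg ?Q')"
      unfolding j_def by (rule star_hom_compose[OF Q embed_hom H.mult_embed_hom])
    have "{x \<otimes>\<^bsub>?Q'\<^esub> y | x y. x \<in> carrier ?Q' \<and> y \<in> carrier ?Q'} \<subseteq>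
        {fst (j a) b | a b. a \<in> carrier Q \<and> b \<in> carrier ?Q'}"
    proof
      fix z assume "z \<in> {x \<otimes>\<^bsub>?Q'\<^esub> y | x y. x \<in> carrier ?Q' \<and> y \<in> carrier ?Q'}"
      then obtain x y where xy: "x \<in> carrier ?Q'" "y \<in> carrier ?Q'" "z = x \<otimes>\<^bsub>?Q'\<^esub> y" by blast
      then obtain a where a: "a \<in> carrier Q" "x = mult_embed Q a" by auto
      then have "fst (j a) y = z"
        using xy mult_embed_simps(1)[of x ?Q' y] by (simp add: j_def compose_def)
      then show "z \<in> {fst (j a) b | a b. a \<in> carrier Q \<and> b \<in> carrier ?Q'}"
        using a xy(2) by blast
    qed
    then show "carrier ?Q' \<subseteq> clspan ?Q' {fst (j a) b | a b. a \<in> carrier Q \<and> b \<in> carrier ?Q'}"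
      by (rule H.carrier_subset_clspan_products)
  qed
  interpret j\<rho>: nondeg_hom_pair Q ?Q' Q j ?\<rho> using j incl_nondeg by (rule nondeg_hom_pairI)
  have \<rho>j: "hom_comp Q ?Q' Q ?\<rho> j = mult_embed Q"
  proof (rule star_hom_eqI[OF j\<rho>.hom_comp_hom Q.mult_embed_hom])
    fix q assume q: "q \<in> carrier Q"
    then have "hom_comp Q ?Q' Q ?\<rho> j q = mult_ext ?Q' Q ?\<rho> (mult_embed ?Q' (mult_embed Q q))"
      unfolding j\<rho>.hom_comp_apply[OF q] by (simp add: j_def compose_def)
    also have "\<dots> = mult_embed Q q"
      using q incl.mult_ext_embed[of "mult_embed Q q"] by simp
    finally show "hom_comp Q ?Q' Q ?\<rho> j q = mult_embed Q q" .
  qed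
  let ?TQ = "trivial_twisted Q :: ('g, 'x) twisted"
  let ?TQ' = "trivial_twisted ?Q' :: ('g, 'x mult) twisted"
  define f' where "f' = cocycle_comp \<A> ?TQ ?TQ' (j, \<lambda>_. \<one>\<^bsub>mult_alg ?Q'\<^esub>) f"
  have jrep: "cocycle_rep ?TQ ?TQ' (j, \<lambda>_. \<one>\<^bsub>mult_alg ?Q'\<^esub>)"
    and \<rho>rep: "cocycle_rep ?TQ' ?TQ (?\<rho>, \<lambda>_. \<one>\<^bsub>mult_alg Q\<^esub>)"
    using nondeg_hom.nondegenerate[OF j] incl.nondegenerate
    by (simp_all add: cocycle_rep_trivial_iff Q H.cstar_algebra_axioms)
  have f': "cocycle_rep \<A> ?TQ' f'"
    unfolding f'_def
    by (rule cocycle_comp_rep[OF twisted Q.twisted_algebra_trivial H.twisted_algebra_trivial f jrep])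
  have retract: "cocycle_comp \<A> ?TQ' ?TQ (?\<rho>, \<lambda>_. \<one>\<^bsub>mult_alg Q\<^esub>) f' = f"
  proof -
    have "cocycle_comp \<A> ?TQ' ?TQ (?\<rho>, \<lambda>_. \<one>\<^bsub>mult_alg Q\<^esub>) f' =
        cocycle_comp \<A> ?TQ ?TQ (cocycle_comp ?TQ ?TQ' ?TQ (?\<rho>, \<lambda>_. \<one>\<^bsub>mult_alg Q\<^esub>) (j, \<lambda>_. \<one>\<^bsub>mult_alg ?Q'\<^esub>)) f"
      unfolding f'_def
      by (rule cocycle_comp_assoc[OF twisted Q.twisted_algebra_trivial H.twisted_algebra_trivial
            Q.twisted_algebra_trivial f jrep \<rho>rep])
    also have "\<dots> = cocycle_comp \<A> ?TQ ?TQ (cocycle_id ?TQ) f"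
      unfolding trivial_comp[OF j incl_nondeg] \<rho>j by (simp add: cocycle_id_def)
    also have "\<dots> = f" by (rule cocycle_comp_id_left[OF twisted Q.twisted_algebra_trivial f])
    finally show ?thesis .
  qed
  have uniq: "\<exists>!\<Theta>. factors \<A> K ?Q' \<Theta> f'" by (rule universal_property_mult[OF H.cstar_algebra_axioms f'])
  then obtain \<Theta>' where "factors \<A> K ?Q' \<Theta>' f'" by blast
  from factors_compose[OF H.cstar_algebra_axioms this incl_nondeg]
  have ex: "factors \<A> K Q (hom_comp (cp_alg K) ?Q' Q ?\<rho> \<Theta>') f" unfolding retract .
  have "\<Theta>1 = \<Theta>2" if "factors \<A> K Q \<Theta>1 f" "factors \<A> K Q \<Theta>2 f" for \<Theta>1 \<Theta>2
  proof -
    have "factors \<A> K ?Q' (hom_comp (cp_alg K) Q ?Q' j \<Theta>1) f'" "factors \<A> K ?Q' (hom_comp (cp_alg K) Q ?Q' j \<Theta>2) f'"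
      unfolding f'_def using that by (auto intro: factors_compose[OF Q _ j])
    then have eq: "hom_comp (cp_alg K) Q ?Q' j \<Theta>1 = hom_comp (cp_alg K) Q ?Q' j \<Theta>2" using uniq by blast
    have "hom_comp (cp_alg K) ?Q' Q ?\<rho> (hom_comp (cp_alg K) Q ?Q' j \<Theta>) = \<Theta>" if "factors \<A> K Q \<Theta> f" for \<Theta>
    proof -
      have \<Theta>: "nondeg_hom (cp_alg K) Q \<Theta>"
        using that P.cstar_algebra_axioms Q by (intro nondeg_homI) (auto simp: factors_def)
      show ?thesis
        unfolding hom_comp_assoc[OF \<Theta> j incl_nondeg] \<rho>j by (rule nondeg_hom.hom_comp_mult_embed_left[OF \<Theta>])
    qed
    then show ?thesis using that eq by metis
  qed
  then show ?thesis using ex by blast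
qed

end

section \<open>Crossed products of cocycle representations\<close>

locale crossed_product_pair = K: crossed_product \<A> K + K': crossed_product \<B> K'
  for \<A> :: "('g::topological_group_add, 'a) twisted" and \<B> :: "('g, 'b) twisted"
    and K :: "('g, 'a, 'x) crossed" and K' :: "('g, 'b, 'x) crossed" +
  fixes f :: "('g, 'a, 'b) cocycle_pair"
  assumes f: "cocycle_rep \<A> \<B> f"
begin

definition induced :: "('g, 'a, 'x) cocycle_pair" where
  "induced = cocycle_comp \<A> \<B> (trivial_twisted (cp_alg K')) (cp_hom K', cp_unitary K') f"

lemma induced_rep: "cocycle_rep \<A> (trivial_twisted (cp_alg K')) induced"
  unfolding induced_def
  by (rule cocycle_comp_rep[OF K.twisted K'.twisted K'.P.twisted_algebra_trivial f K'.rep])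

lemma crossed_map_eq: "crossed_map \<A> \<B> K K' f = (THE \<Theta>. factors \<A> K (cp_alg K') \<Theta> induced)"
proof -
  obtain \<theta> x where e: "f = (\<theta>, x)" by (cases f)
  interpret \<theta>: cocycle_representation \<A> \<B> \<theta> x
    using K.twisted K'.twisted f unfolding e by (rule cocycle_representation.intro)
  interpret pair: nondeg_hom_pair "alg \<A>" "alg \<B>" "cp_alg K'" \<theta> "cp_hom K'"
    using \<theta>.hom.nondeg_hom_axioms K'.universal.hom.nondeg_hom_axioms by (intro nondeg_hom_pairI) simp_all
  have i: "induced = (hom_comp (alg \<A>) (alg \<B>) (cp_alg K') (cp_hom K') \<theta>,
      \<lambda>g. mult_ext (alg \<B>) (cp_alg K') (cp_hom K') (x g) \<otimes>\<^bsub>mult_alg (cp_alg K')\<^esub> cp_unitary K' g)"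
    unfolding induced_def unfolding e cocycle_comp_eq by simp
  show ?thesis
    unfolding i K.factors_iff[OF K'.P.cstar_algebra_axioms induced_rep[unfolded i]]
    by (simp add: crossed_map_def e Let_def pair.hom_comp_apply)
qed

lemma ex1_factors: "\<exists>!\<Theta>. factors \<A> K (cp_alg K') \<Theta> induced"
  by (rule K.universal_property[OF K'.P.cstar_algebra_axioms induced_rep])

lemma crossed_map_factors: "factors \<A> K (cp_alg K') (crossed_map \<A> \<B> K K' f) induced"
  unfolding crossed_map_eq by (rule theI'[OF ex1_factors])

lemma crossed_map_unique: "factors \<A> K (cp_alg K') \<Theta> induced \<Longrightarrow> crossed_map \<A> \<B> K K' f = \<Theta>"
  using ex1_factors crossed_map_factors by blast

lemma crossed_map_nondeg: "nondeg_hom (cp_alg K) (cp_alg K') (crossed_map \<A> \<B> K K' f)"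
  using K.P.cstar_algebra_axioms K'.P.cstar_algebra_axioms crossed_map_factors
  by (intro nondeg_homI) (auto simp: factors_def)

end

lemma crossed_product_pairI:
  "\<lbrakk>twisted_algebra \<A>; twisted_algebra \<B>; is_crossed_product \<A> K; is_crossed_product \<B> K';
    cocycle_rep \<A> \<B> f\<rbrakk> \<Longrightarrow> crossed_product_pair \<A> \<B> K K' f"
  by (simp add: crossed_product_pair_def crossed_product_pair_axioms_def crossed_product_def)

text \<open>Writing \<open>\<Theta>_f\<close> and \<open>\<Theta>_g\<close> for the induced maps,
  \<open>\<Theta>_g \<circ> \<Theta>_f \<circ> k_A = \<Theta>_g \<circ> k_B \<circ> f = k_C \<circ>
  g \<circ> f\<close>, so the composite solves the equation that characterises the map induced by
  \<open>g \<circ> f\<close>.\<close>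

lemma crossed_map_comp:
  assumes A: "twisted_algebra \<A>" "is_crossed_product \<A> K\<^sub>A"
    and B: "twisted_algebra \<B>" "is_crossed_product \<B> K\<^sub>B"
    and C: "twisted_algebra \<C>" "is_crossed_product \<C> K\<^sub>C"
    and f: "cocycle_rep \<A> \<B> f" and g: "cocycle_rep \<B> \<C> g"
  shows "hom_comp (cp_alg K\<^sub>A) (cp_alg K\<^sub>B) (cp_alg K\<^sub>C)
      (crossed_map \<B> \<C> K\<^sub>B K\<^sub>C g) (crossed_map \<A> \<B> K\<^sub>A K\<^sub>B f)
    = crossed_map \<A> \<C> K\<^sub>A K\<^sub>C (cocycle_comp \<A> \<B> \<C> g f)"
proof -
  interpret f: crossed_product_pair \<A> \<B> K\<^sub>A K\<^sub>B f using assms by (intro crossed_product_pairI)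
  interpret g: crossed_product_pair \<B> \<C> K\<^sub>B K\<^sub>C g using assms by (intro crossed_product_pairI)
  have gf: "cocycle_rep \<A> \<C> (cocycle_comp \<A> \<B> \<C> g f)"
    by (rule cocycle_comp_rep[OF A(1) B(1) C(1) f g])
  interpret gf: crossed_product_pair \<A> \<C> K\<^sub>A K\<^sub>C "cocycle_comp \<A> \<B> \<C> g f"
    using assms gf by (intro crossed_product_pairI)
  let ?TB = "trivial_twisted (cp_alg K\<^sub>B)" and ?TC = "trivial_twisted (cp_alg K\<^sub>C)"
  let ?\<Psi> = "(crossed_map \<B> \<C> K\<^sub>B K\<^sub>C g, \<lambda>_. \<one>\<^bsub>mult_alg (cp_alg K\<^sub>C)\<^esub>)"
  have \<Psi>: "cocycle_rep ?TB ?TC ?\<Psi>"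
    using nondeg_hom.nondegenerate[OF g.crossed_map_nondeg]
    by (simp add: cocycle_rep_trivial_iff f.K'.P.cstar_algebra_axioms g.K'.P.cstar_algebra_axioms)
  have "cocycle_comp \<A> ?TB ?TC ?\<Psi> f.induced =
      cocycle_comp \<A> \<B> ?TC (cocycle_comp \<B> ?TB ?TC ?\<Psi> (cp_hom K\<^sub>B, cp_unitary K\<^sub>B)) f"
    unfolding f.induced_def
    by (rule cocycle_comp_assoc[OF A(1) B(1) f.K'.P.twisted_algebra_trivial
          g.K'.P.twisted_algebra_trivial f f.K'.rep \<Psi>])
  also have "cocycle_comp \<B> ?TB ?TC ?\<Psi> (cp_hom K\<^sub>B, cp_unitary K\<^sub>B) = g.induced"
    using g.crossed_map_factors by (simp add: factors_def)
  also have "cocycle_comp \<A> \<B> ?TC g.induced f = gf.induced"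
    unfolding g.induced_def gf.induced_def
    by (rule cocycle_comp_assoc[OF A(1) B(1) C(1) g.K'.P.twisted_algebra_trivial f g g.K'.rep, symmetric])
  finally have "cocycle_comp \<A> ?TB ?TC ?\<Psi> f.induced = gf.induced" .
  moreover have "factors \<A> K\<^sub>A (cp_alg K\<^sub>C) (hom_comp (cp_alg K\<^sub>A) (cp_alg K\<^sub>B) (cp_alg K\<^sub>C)
      (crossed_map \<B> \<C> K\<^sub>B K\<^sub>C g) (crossed_map \<A> \<B> K\<^sub>A K\<^sub>B f)) (cocycle_comp \<A> ?TB ?TC ?\<Psi> f.induced)"
    by (rule f.K.factors_compose[OF f.K'.P.cstar_algebra_axioms f.crossed_map_factors g.crossed_map_nondeg])
  ultimately show ?thesis using gf.crossed_map_unique by simp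
qed

lemma crossed_map_id:
  assumes A: "twisted_algebra \<A>" "is_crossed_product \<A> K"
  shows "crossed_map \<A> \<A> K K (cocycle_id \<A>) = mult_embed (cp_alg K)"
proof -
  interpret crossed_product_pair \<A> \<A> K K "cocycle_id \<A>"
    using A cocycle_id_rep[OF A(1)] by (intro crossed_product_pairI)
  have "induced = (cp_hom K, cp_unitary K)"
    unfolding induced_def by (rule cocycle_comp_id_right[OF A(1) K.P.twisted_algebra_trivial K.rep])
  moreover have "factors \<A> K (cp_alg K) (mult_embed (cp_alg K)) (cp_hom K, cp_unitary K)"
    using cocycle_comp_id_left[OF A(1) K.P.twisted_algebra_trivial K.rep]
      nondeg_hom.nondegenerate[OF K.P.nondeg_hom_mult_embed]
    by (simp add: factors_def cocycle_id_def)
  ultimately show ?thesis using crossed_map_unique by simp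
qed

section \<open>Cocycle morphisms induce maps into the crossed product\<close>

text \<open>Here \<open>f\<close> converges in norm, but \<open>g\<close> converges only after
  multiplication by the limit \<open>f0\<close>. This is the shape of
  \<open>\<pi>(a_g) U_g n\<close>, where \<open>a_g\<close> is norm continuous and \<open>n\<close>
  is in \<open>cont_mult\<close>.\<close>

lemma (in cstar_algebra) tendsto_mult_bounded:
  assumes f: "\<And>q. f q \<in> carrier A" "f0 \<in> carrier A" and g: "\<And>q. g q \<in> carrier A" "g0 \<in> carrier A"
    and K: "\<And>q. nrm A (g q) \<le> K"
    and flim: "((\<lambda>q. nrm A (f q \<ominus>\<^bsub>A\<^esub> f0)) \<longlongrightarrow> 0) F"
    and glim: "((\<lambda>q. nrm A (f0 \<otimes>\<^bsub>A\<^esub> g q \<ominus>\<^bsub>A\<^esub> f0 \<otimes>\<^bsub>A\<^esub> g0)) \<longlongrightarrow> 0) F"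
  shows "((\<lambda>q. nrm A (f q \<otimes>\<^bsub>A\<^esub> g q \<ominus>\<^bsub>A\<^esub> f0 \<otimes>\<^bsub>A\<^esub> g0)) \<longlongrightarrow> 0) F"
proof (rule tendsto_sandwich[OF _ _ tendsto_const])
  show "((\<lambda>q. nrm A (f q \<ominus>\<^bsub>A\<^esub> f0) * K + nrm A (f0 \<otimes>\<^bsub>A\<^esub> g q \<ominus>\<^bsub>A\<^esub> f0 \<otimes>\<^bsub>A\<^esub> g0)) \<longlongrightarrow> 0) F"
    using tendsto_add[OF tendsto_mult_right[OF flim, of K] glim] by simp
  have "nrm A (f q \<otimes>\<^bsub>A\<^esub> g q \<ominus>\<^bsub>A\<^esub> f0 \<otimes>\<^bsub>A\<^esub> g0)
      \<le> nrm A (f q \<ominus>\<^bsub>A\<^esub> f0) * K + nrm A (f0 \<otimes>\<^bsub>A\<^esub> g q \<ominus>\<^bsub>A\<^esub> f0 \<otimes>\<^bsub>A\<^esub> g0)" for q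
  proof -
    have "nrm A (f q \<otimes>\<^bsub>A\<^esub> g q \<ominus>\<^bsub>A\<^esub> f0 \<otimes>\<^bsub>A\<^esub> g0)
        \<le> nrm A (f q \<otimes>\<^bsub>A\<^esub> g q \<ominus>\<^bsub>A\<^esub> f0 \<otimes>\<^bsub>A\<^esub> g q) + nrm A (f0 \<otimes>\<^bsub>A\<^esub> g q \<ominus>\<^bsub>A\<^esub> f0 \<otimes>\<^bsub>A\<^esub> g0)"
      using f g by (intro nrm_minus_triangle) auto
    also have "nrm A (f q \<otimes>\<^bsub>A\<^esub> g q \<ominus>\<^bsub>A\<^esub> f0 \<otimes>\<^bsub>A\<^esub> g q) \<le> nrm A (f q \<ominus>\<^bsub>A\<^esub> f0) * nrm A (g q)"
      using nrm_mult[of "f q \<ominus>\<^bsub>A\<^esub> f0" "g q"] f g by (simp add: minus_mult_left)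
    also have "\<dots> \<le> nrm A (f q \<ominus>\<^bsub>A\<^esub> f0) * K"
      using f K nrm_nonneg by (intro mult_left_mono) auto
    finally show ?thesis by simp
  qed
  then show "\<forall>\<^sub>F q in F. nrm A (f q \<otimes>\<^bsub>A\<^esub> g q \<ominus>\<^bsub>A\<^esub> f0 \<otimes>\<^bsub>A\<^esub> g0)
      \<le> nrm A (f q \<ominus>\<^bsub>A\<^esub> f0) * K + nrm A (f0 \<otimes>\<^bsub>A\<^esub> g q \<ominus>\<^bsub>A\<^esub> f0 \<otimes>\<^bsub>A\<^esub> g0)" by simp
qed (use f g in \<open>auto simp: nrm_nonneg\<close>)

lemma (in cstar_algebra) tendsto_mult_left_const:
  assumes c: "c \<in> carrier A" and g: "\<And>q. g q \<in> carrier A" "g0 \<in> carrier A"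
    and lim: "((\<lambda>q. nrm A (g q \<ominus>\<^bsub>A\<^esub> g0)) \<longlongrightarrow> 0) F"
  shows "((\<lambda>q. nrm A (c \<otimes>\<^bsub>A\<^esub> g q \<ominus>\<^bsub>A\<^esub> c \<otimes>\<^bsub>A\<^esub> g0)) \<longlongrightarrow> 0) F"
proof (rule tendsto_sandwich[OF _ _ tendsto_const])
  show "((\<lambda>q. nrm A c * nrm A (g q \<ominus>\<^bsub>A\<^esub> g0)) \<longlongrightarrow> 0) F"
    using tendsto_mult_left[OF lim, of "nrm A c"] by simp
qed (use c g in \<open>auto simp: nrm_nonneg nrm_mult simp flip: minus_mult_right\<close>)

lemma (in cstar_algebra) tendsto_mult_right_const:
  assumes c: "c \<in> carrier A" and g: "\<And>q. g q \<in> carrier A" "g0 \<in> carrier A"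
    and lim: "((\<lambda>q. nrm A (g q \<ominus>\<^bsub>A\<^esub> g0)) \<longlongrightarrow> 0) F"
  shows "((\<lambda>q. nrm A (g q \<otimes>\<^bsub>A\<^esub> c \<ominus>\<^bsub>A\<^esub> g0 \<otimes>\<^bsub>A\<^esub> c)) \<longlongrightarrow> 0) F"
proof (rule tendsto_sandwich[OF _ _ tendsto_const])
  show "((\<lambda>q. nrm A (g q \<ominus>\<^bsub>A\<^esub> g0) * nrm A c) \<longlongrightarrow> 0) F"
    using tendsto_mult_right[OF lim, of "nrm A c"] by simp
qed (use c g in \<open>auto simp: nrm_nonneg nrm_mult simp flip: minus_mult_left\<close>)

lemma tendsto_bounded_hom:
  assumes A: "cstar_algebra A" and B: "cstar_algebra B" and f: "f \<in> star_hom A B"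
    and K: "\<And>x. x \<in> carrier A \<Longrightarrow> nrm B (f x) \<le> K * nrm A x"
    and g: "\<And>q. g q \<in> carrier A" "g0 \<in> carrier A"
    and lim: "((\<lambda>q. nrm A (g q \<ominus>\<^bsub>A\<^esub> g0)) \<longlongrightarrow> 0) F"
  shows "((\<lambda>q. nrm B (f (g q) \<ominus>\<^bsub>B\<^esub> f g0)) \<longlongrightarrow> 0) F"
proof (rule tendsto_sandwich[OF _ _ tendsto_const])
  interpret A: cstar_algebra A by fact
  interpret B: cstar_algebra B by fact
  show "((\<lambda>q. K * nrm A (g q \<ominus>\<^bsub>A\<^esub> g0)) \<longlongrightarrow> 0) F"
    using tendsto_mult_left[OF lim, of K] by simp
  show "\<forall>\<^sub>F q in F. nrm B (f (g q) \<ominus>\<^bsub>B\<^esub> f g0) \<le> K * nrm A (g q \<ominus>\<^bsub>A\<^esub> g0)"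
    using g K by (intro always_eventually allI) (simp add: star_hom_minus[OF f A B, symmetric])
  show "\<forall>\<^sub>F q in F. 0 \<le> nrm B (f (g q) \<ominus>\<^bsub>B\<^esub> f g0)"
    using g star_hom_carrier[OF f] by (simp add: B.nrm_nonneg)
qed

section \<open>Multipliers with norm-continuous translates, and the algebra they generate\<close>

context crossed_product
begin

abbreviation "MP \<equiv> mult_alg (cp_alg K)"
abbreviation mult_MP (infixl "\<cdot>" 70) where "m \<cdot> n \<equiv> m \<otimes>\<^bsub>mult_alg (cp_alg K)\<^esub> n"
abbreviation "\<pi> \<equiv> cp_hom K"
abbreviation "U \<equiv> cp_unitary K"
abbreviation "\<Psi> \<equiv> mult_ext (alg \<A>) (cp_alg K) (cp_hom K)"

sublocale MP: unital_cstar_algebra "mult_alg (cp_alg K)" by (rule P.unital_mult_alg)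
sublocale \<pi>: nondeg_hom "alg \<A>" "cp_alg K" "cp_hom K"
  using universal.hom.nondeg_hom_axioms by simp

lemma U_unitary: "U g \<in> mult_unitaries (cp_alg K)"
  using universal.unitary by simp

lemma U_carrier [simp, intro]: "U g \<in> carrier MP"
  using U_unitary by (rule P.unitary_carrier)

lemma U_simps [simp]: "star MP (U g) \<cdot> U g = \<one>\<^bsub>MP\<^esub>" "U g \<cdot> star MP (U g) = \<one>\<^bsub>MP\<^esub>"
  using U_unitary by (auto simp: mult_unitaries_def)

lemma covariant: "covariant_rep \<A> (cp_alg K) (\<pi>, U)"
  using crossed by (simp add: is_crossed_product_def)

lemma twist_carrier [simp, intro]: "twist \<A> g h \<in> carrier (mult_alg (alg \<A>))"
  using twisted_algebraD(4)[OF twisted] by (rule A.unitary_carrier)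

lemma act_aut: "act \<A> g \<in> star_aut (alg \<A>)"
  by (rule twisted_algebraD[OF twisted])

lemma act_in [simp, intro]: "a \<in> carrier (alg \<A>) \<Longrightarrow> act \<A> g a \<in> carrier (alg \<A>)"
  by (rule A.star_aut_carrier[OF act_aut])

lemma U_mult: "U g \<cdot> U h = \<Psi> (twist \<A> g h) \<cdot> U (g + h)"
  using covariant by (simp add: covariant_rep_def Let_def)

lemma U_\<pi>:
  assumes "a \<in> carrier (alg \<A>)"
  shows "U g \<cdot> \<pi> a = \<pi> (act \<A> g a) \<cdot> U g"
proof -
  have "\<pi> (act \<A> g a) = U g \<cdot> \<pi> a \<cdot> star MP (U g)"
    using covariant assms by (simp add: covariant_rep_def Let_def Ad_def)
  then show ?thesis using assms by (simp add: MP.mult_assoc)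
qed

lemma U_star_\<pi>:
  assumes "a \<in> carrier (alg \<A>)"
  shows "star MP (U g) \<cdot> \<pi> (act \<A> g a) = \<pi> a \<cdot> star MP (U g)"
proof -
  have "star MP (U g) \<cdot> (\<pi> (act \<A> g a) \<cdot> U g) \<cdot> star MP (U g)
      = star MP (U g) \<cdot> (U g \<cdot> \<pi> a) \<cdot> star MP (U g)"
    using assms by (simp add: U_\<pi>)
  also have "\<dots> = (star MP (U g) \<cdot> U g) \<cdot> \<pi> a \<cdot> star MP (U g)"
    using assms by (simp add: MP.mult_assoc del: U_simps)
  finally show ?thesis using assms by (simp add: MP.mult_assoc)
qed

lemma \<Psi>_\<pi>:
  assumes "m \<in> carrier (mult_alg (alg \<A>))" "a \<in> carrier (alg \<A>)"
  shows "\<Psi> m \<cdot> \<pi> a = \<pi> (fst m a)" "\<pi> a \<cdot> \<Psi> m = \<pi> (snd m a)"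
proof -
  have "\<Psi> (m \<otimes>\<^bsub>mult_alg (alg \<A>)\<^esub> mult_embed (alg \<A>) a) = \<Psi> m \<cdot> \<pi> a"
    "\<Psi> (mult_embed (alg \<A>) a \<otimes>\<^bsub>mult_alg (alg \<A>)\<^esub> m) = \<pi> a \<cdot> \<Psi> m"
    using assms by (simp_all add: star_hom_mult[OF \<pi>.mult_ext_hom] \<pi>.mult_ext_embed)
  then show "\<Psi> m \<cdot> \<pi> a = \<pi> (fst m a)" "\<pi> a \<cdot> \<Psi> m = \<pi> (snd m a)"
    using assms A.fst_carrier[OF assms] A.snd_carrier[OF assms]
    by (simp_all add: A.mult_mult_embed A.mult_embed_mult \<pi>.mult_ext_embed)
qed

text \<open>The multipliers on which \<open>U\<close> acts norm-continuously after cutting down by \<open>\<pi>\<close>. In the crossed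
  product itself this cut-down continuity is automatic; conversely the algebra \<open>core\<close> of products
  of such multipliers turns out to be no larger than the crossed product.\<close>

definition cont_mult :: "'x mult set" where
  "cont_mult = {m \<in> carrier MP. \<forall>a\<in>carrier (alg \<A>). \<forall>p.
    ((\<lambda>g. nrm MP (\<pi> a \<cdot> (U g \<cdot> m) \<ominus>\<^bsub>MP\<^esub> \<pi> a \<cdot> (U p \<cdot> m))) \<longlongrightarrow> 0) (at p)}"

lemma cont_mult_carrier: "m \<in> cont_mult \<Longrightarrow> m \<in> carrier MP"
  by (simp add: cont_mult_def)

lemma cont_multD:
  "\<lbrakk>m \<in> cont_mult; a \<in> carrier (alg \<A>)\<rbrakk> \<Longrightarrow>
    ((\<lambda>g. nrm MP (\<pi> a \<cdot> (U g \<cdot> m) \<ominus>\<^bsub>MP\<^esub> \<pi> a \<cdot> (U p \<cdot> m))) \<longlongrightarrow> 0) (at p)"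
  by (simp add: cont_mult_def)

lemma cont_mult_right_ideal:
  assumes n: "n \<in> cont_mult" and m: "m \<in> carrier MP"
  shows "n \<cdot> m \<in> cont_mult"
  unfolding cont_mult_def
proof (intro CollectI conjI ballI allI)
  have nc: "n \<in> carrier MP" using n by (rule cont_mult_carrier)
  then show "n \<cdot> m \<in> carrier MP" using m by simp
  fix a p assume a: "a \<in> carrier (alg \<A>)"
  have "((\<lambda>g. nrm MP ((\<pi> a \<cdot> (U g \<cdot> n)) \<cdot> m \<ominus>\<^bsub>MP\<^esub> (\<pi> a \<cdot> (U p \<cdot> n)) \<cdot> m)) \<longlongrightarrow> 0) (at p)"
    using cont_multD[OF n a] a nc by (intro MP.tendsto_mult_right_const[OF m]) auto
  then show "((\<lambda>g. nrm MP (\<pi> a \<cdot> (U g \<cdot> (n \<cdot> m)) \<ominus>\<^bsub>MP\<^esub> \<pi> a \<cdot> (U p \<cdot> (n \<cdot> m)))) \<longlongrightarrow> 0) (at p)"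
    using a nc m by (simp add: MP.mult_assoc)
qed

lemma nrm_unitary_mult_le:
  assumes "u \<in> mult_unitaries (cp_alg K)" "m \<in> carrier MP"
  shows "nrm MP (u \<cdot> m) \<le> nrm MP m"
proof -
  have "nrm MP (u \<cdot> m) \<le> nrm MP u * nrm MP m"
    using assms by (intro MP.nrm_mult) (auto intro: P.unitary_carrier)
  also have "\<dots> \<le> 1 * nrm MP m"
    using assms P.unitary_nrm_le MP.nrm_nonneg by (intro mult_right_mono) auto
  finally show ?thesis by simp
qed

text \<open>Moving \<open>V\<close> past \<open>U_g\<close> gives
  \<open>\<pi>(a) U_g V n = \<pi>(a z_g) U_{g+h} n\<close>. The multipliers \<open>z_g\<close> are
  only strictly continuous, but \<open>a z_g\<close> is norm continuous, and translation by
  \<open>h\<close> is a continuous change of variable.\<close>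

lemma cont_mult_shift:
  assumes n: "n \<in> cont_mult" and V: "V \<in> carrier MP"
    and eq: "\<And>g. U g \<cdot> V = \<Psi> (z g) \<cdot> U (g + h)"
    and z: "\<And>g. z g \<in> carrier (mult_alg (alg \<A>))" "strictly_continuous (alg \<A>) z"
  shows "V \<cdot> n \<in> cont_mult"
  unfolding cont_mult_def
proof (intro CollectI conjI ballI allI)
  have nc: "n \<in> carrier MP" using n by (rule cont_mult_carrier)
  then show "V \<cdot> n \<in> carrier MP" using V by simp
  fix a p assume a: "a \<in> carrier (alg \<A>)"
  have za: "snd (z g) a \<in> carrier (alg \<A>)" for g using A.snd_carrier[OF z(1) a] .
  have rw: "\<pi> a \<cdot> (U g \<cdot> (V \<cdot> n)) = \<pi> (snd (z g) a) \<cdot> (U (g + h) \<cdot> n)" for g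
  proof -
    have "\<pi> a \<cdot> (U g \<cdot> (V \<cdot> n)) = \<pi> a \<cdot> ((U g \<cdot> V) \<cdot> n)"
      using a V nc by (simp add: MP.mult_assoc)
    also have "\<dots> = (\<pi> a \<cdot> \<Psi> (z g)) \<cdot> (U (g + h) \<cdot> n)"
      using a nc z(1) unfolding eq by (simp add: MP.mult_assoc)
    finally show ?thesis using a z(1) by (simp add: \<Psi>_\<pi>)
  qed
  show "((\<lambda>g. nrm MP (\<pi> a \<cdot> (U g \<cdot> (V \<cdot> n)) \<ominus>\<^bsub>MP\<^esub> \<pi> a \<cdot> (U p \<cdot> (V \<cdot> n)))) \<longlongrightarrow> 0) (at p)"
    unfolding rw
  proof (rule MP.tendsto_mult_bounded)
    show "nrm MP (U (g + h) \<cdot> n) \<le> nrm MP n" for g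
      using nrm_unitary_mult_le[OF U_unitary nc] .
    show "((\<lambda>g. nrm MP (\<pi> (snd (z g) a) \<ominus>\<^bsub>MP\<^esub> \<pi> (snd (z p) a))) \<longlongrightarrow> 0) (at p)"
      using A.cstar_algebra_axioms MP.cstar_algebra_axioms \<pi>.hom \<pi>.hom_bounded za za
      by (rule tendsto_bounded_hom[OF _ _ _ _ _ _ A.strictly_continuousD(2)[OF z(2,1) a]])
    have "((\<lambda>g. nrm MP (\<pi> (snd (z p) a) \<cdot> (U g \<cdot> n)
        \<ominus>\<^bsub>MP\<^esub> \<pi> (snd (z p) a) \<cdot> (U (p + h) \<cdot> n))) \<longlongrightarrow> 0) (at (p + h))"
      by (rule cont_multD[OF n za])
    \<comment> \<open>The difference vanishes at the limit point, so the punctured filter may be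
      replaced by \<open>nhds\<close>, as composition with the translation requires.\<close>
    then have "((\<lambda>g. nrm MP (\<pi> (snd (z p) a) \<cdot> (U g \<cdot> n)
        \<ominus>\<^bsub>MP\<^esub> \<pi> (snd (z p) a) \<cdot> (U (p + h) \<cdot> n))) \<longlongrightarrow> 0) (nhds (p + h))"
      using za nc by (subst tendsto_nhds_iff) simp
    moreover have "filterlim (\<lambda>g. g + h) (nhds (p + h)) (at p)"
      by (intro tendsto_intros)
    ultimately show "((\<lambda>g. nrm MP (\<pi> (snd (z p) a) \<cdot> (U (g + h) \<cdot> n)
        \<ominus>\<^bsub>MP\<^esub> \<pi> (snd (z p) a) \<cdot> (U (p + h) \<cdot> n))) \<longlongrightarrow> 0) (at p)"
      by (rule filterlim_compose)
  qed (use za nc in auto)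
qed

lemma twist_strictly_continuous:
  assumes "continuous_on UNIV s"
  shows "strictly_continuous (alg \<A>) (\<lambda>g. twist \<A> (s g) k)"
  using A.strictly_continuous_compose[OF twisted_algebraD(5)[OF twisted], of "\<lambda>g. (s g, k)"] assms
  by (simp add: continuous_on_Pair)

lemma cont_mult_U:
  assumes "n \<in> cont_mult"
  shows "U k \<cdot> n \<in> cont_mult"
  using assms U_carrier U_mult twist_carrier twist_strictly_continuous[OF continuous_on_id]
  by (rule cont_mult_shift)

text \<open>From \<open>U_{g-k} U_k = \<Psi>(t) U_g\<close>, with \<open>t\<close> the twist at
  \<open>g - k\<close> and \<open>k\<close>, follows
  \<open>U_g (star U_k) = \<Psi>(star t) U_{g-k}\<close>. So the shift is \<open>-k\<close> and the
  coefficients are adjoints of twists.\<close>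

lemma cont_mult_U_star:
  assumes n: "n \<in> cont_mult"
  shows "star MP (U k) \<cdot> n \<in> cont_mult"
proof (rule cont_mult_shift[OF n, where h = "- k" and z = "\<lambda>g. star (mult_alg (alg \<A>)) (twist \<A> (g + - k) k)"])
  have c: "continuous_on UNIV (\<lambda>g :: 'g. g + - k)" by (intro continuous_intros)
  have t: "twist \<A> s t \<in> mult_unitaries (alg \<A>)" for s t
    by (rule twisted_algebraD[OF twisted])
  show "strictly_continuous (alg \<A>) (\<lambda>g. star (mult_alg (alg \<A>)) (twist \<A> (g + - k) k))"
  proof (rule A.strictly_continuousI)
    interpret MA: cstar_algebra "mult_alg (alg \<A>)" by (rule A.cstar_algebra_mult_alg)
    show "star (mult_alg (alg \<A>)) (twist \<A> (g + - k) k) \<in> carrier (mult_alg (alg \<A>))" for g by simp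
    fix a p assume a: "a \<in> carrier (alg \<A>)"
    note s = A.strictly_continuousD[OF twist_strictly_continuous[OF c, of k] twist_carrier a, of p]
    show "((\<lambda>q. nrm (alg \<A>) (fst (star (mult_alg (alg \<A>)) (twist \<A> (q + - k) k)) a
        \<ominus>\<^bsub>alg \<A>\<^esub> fst (star (mult_alg (alg \<A>)) (twist \<A> (p + - k) k)) a)) \<longlongrightarrow> 0) (at p)"
      by (rule s(3))
    show "((\<lambda>q. nrm (alg \<A>) (fst (star (mult_alg (alg \<A>)) (star (mult_alg (alg \<A>)) (twist \<A> (q + - k) k))) a
        \<ominus>\<^bsub>alg \<A>\<^esub> fst (star (mult_alg (alg \<A>)) (star (mult_alg (alg \<A>)) (twist \<A> (p + - k) k))) a)) \<longlongrightarrow> 0) (at p)"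
      using s(1) by (simp add: MA.star_star)
  qed
  fix g
  define w where "w = \<Psi> (twist \<A> (g + - k) k)"
  have w: "w \<in> carrier MP" "star MP w \<cdot> w = \<one>\<^bsub>MP\<^esub>"
    using \<pi>.mult_ext_unitary[OF t] by (auto simp: w_def mult_unitaries_def)
  have "U (g + - k) \<cdot> U k = w \<cdot> U g"
    using U_mult[of "g + - k" k] by (simp add: w_def add.assoc)
  then have "star MP w \<cdot> (U (g + - k) \<cdot> U k) \<cdot> star MP (U k)
      = star MP w \<cdot> (w \<cdot> U g) \<cdot> star MP (U k)" by simp
  also have "\<dots> = (star MP w \<cdot> w) \<cdot> U g \<cdot> star MP (U k)"
    using w(1) by (simp add: MP.mult_assoc)
  also have "\<dots> = U g \<cdot> star MP (U k)" by (simp add: w(2))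
  finally show "U g \<cdot> star MP (U k) =
      \<Psi> (star (mult_alg (alg \<A>)) (twist \<A> (g + - k) k)) \<cdot> U (g + - k)"
    using w(1) by (simp add: MP.mult_assoc star_hom_star[OF \<pi>.mult_ext_hom] w_def)
  show "star (mult_alg (alg \<A>)) (twist \<A> (g + - k) k) \<in> carrier (mult_alg (alg \<A>))"
    by (rule A.mult_star_closed[OF twist_carrier])
qed simp

text \<open>As \<open>cont_mult\<close> is a right ideal, the generators are written
  \<open>X (star Y)\<close> with \<open>X\<close> and \<open>Y\<close> in
  \<open>\<pi>(A) cont_mult\<close>: the adjoint swaps the two factors, and in a product of
  generators everything between the outer factors is absorbed into the first element of
  \<open>cont_mult\<close>.\<close>

definition core_gen :: "'x mult set" where
  "core_gen = {(\<pi> a \<cdot> n) \<cdot> star MP (\<pi> b \<cdot> m) | a b n m.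
    a \<in> carrier (alg \<A>) \<and> b \<in> carrier (alg \<A>) \<and> n \<in> cont_mult \<and> m \<in> cont_mult}"

definition core :: "'x mult set" where
  "core = clspan MP core_gen"

lemma core_genI:
  "\<lbrakk>a \<in> carrier (alg \<A>); b \<in> carrier (alg \<A>); n \<in> cont_mult; m \<in> cont_mult\<rbrakk> \<Longrightarrow>
    (\<pi> a \<cdot> n) \<cdot> star MP (\<pi> b \<cdot> m) \<in> core_gen"
  unfolding core_gen_def by blast

lemma core_genE:
  assumes "s \<in> core_gen"
  obtains a b n m where "a \<in> carrier (alg \<A>)" "b \<in> carrier (alg \<A>)" "n \<in> cont_mult" "m \<in> cont_mult"
    "n \<in> carrier MP" "m \<in> carrier MP" "s = (\<pi> a \<cdot> n) \<cdot> star MP (\<pi> b \<cdot> m)"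
  using assms unfolding core_gen_def by (blast intro: cont_mult_carrier)

lemma core_gen_carrier: "core_gen \<subseteq> carrier MP"
  by (auto elim!: core_genE)

lemma core_carrier: "s \<in> core \<Longrightarrow> s \<in> carrier MP"
  unfolding core_def using MP.clspan_carrier[OF core_gen_carrier] by blast

lemma zero_cont_mult: "\<zero>\<^bsub>MP\<^esub> \<in> cont_mult"
  by (simp add: cont_mult_def)

lemma core_gen_smult:
  assumes "s \<in> core_gen"
  shows "c \<odot>\<^bsub>MP\<^esub> s \<in> core_gen"
  using assms
proof (rule core_genE)
  fix a b n m assume *: "a \<in> carrier (alg \<A>)" "b \<in> carrier (alg \<A>)" "n \<in> cont_mult" "m \<in> cont_mult"
    "n \<in> carrier MP" "m \<in> carrier MP" "s = (\<pi> a \<cdot> n) \<cdot> star MP (\<pi> b \<cdot> m)"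
  then have "c \<odot>\<^bsub>MP\<^esub> s = (\<pi> (c \<odot>\<^bsub>alg \<A>\<^esub> a) \<cdot> n) \<cdot> star MP (\<pi> b \<cdot> m)"
    by (simp add: star_hom_smult[OF \<pi>.hom] MP.smult_mult_left)
  then show ?thesis using * by (simp add: core_genI)
qed

lemma core_gen_mult:
  assumes "s \<in> core_gen" "t \<in> core_gen"
  shows "s \<cdot> t \<in> core_gen"
  using assms(1)
proof (rule core_genE)
  fix a b n m assume s: "a \<in> carrier (alg \<A>)" "b \<in> carrier (alg \<A>)" "n \<in> cont_mult" "m \<in> cont_mult"
    "n \<in> carrier MP" "m \<in> carrier MP" "s = (\<pi> a \<cdot> n) \<cdot> star MP (\<pi> b \<cdot> m)"
  show ?thesis
    using assms(2)
  proof (rule core_genE)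
    fix a' b' n' m' assume t: "a' \<in> carrier (alg \<A>)" "b' \<in> carrier (alg \<A>)" "n' \<in> cont_mult" "m' \<in> cont_mult"
      "n' \<in> carrier MP" "m' \<in> carrier MP" "t = (\<pi> a' \<cdot> n') \<cdot> star MP (\<pi> b' \<cdot> m')"
    have "s \<cdot> t = (\<pi> a \<cdot> (n \<cdot> (star MP (\<pi> b \<cdot> m) \<cdot> (\<pi> a' \<cdot> n'))))
        \<cdot> star MP (\<pi> b' \<cdot> m')"
      unfolding s(7) t(7) using s(1,2,5,6) t(1,2,5,6) by (simp add: MP.mult_assoc del: MP.star_mult)
    moreover have "n \<cdot> (star MP (\<pi> b \<cdot> m) \<cdot> (\<pi> a' \<cdot> n')) \<in> cont_mult"
      using s t by (intro cont_mult_right_ideal) auto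
    ultimately show ?thesis using core_genI[OF s(1) t(2) _ t(4)] by simp
  qed
qed

lemma core_gen_star:
  assumes "s \<in> core_gen"
  shows "star MP s \<in> core_gen"
  using assms
proof (rule core_genE)
  fix a b n m assume *: "a \<in> carrier (alg \<A>)" "b \<in> carrier (alg \<A>)" "n \<in> cont_mult" "m \<in> cont_mult"
    "n \<in> carrier MP" "m \<in> carrier MP" "s = (\<pi> a \<cdot> n) \<cdot> star MP (\<pi> b \<cdot> m)"
  have "star MP s = (\<pi> b \<cdot> m) \<cdot> star MP (\<pi> a \<cdot> n)"
    unfolding *(7) using *(1,2,5,6) MP.star_mult[of "\<pi> a \<cdot> n" "star MP (\<pi> b \<cdot> m)"] by simp
  then show ?thesis using * by (simp add: core_genI)
qed

lemma core_star: "s \<in> core \<Longrightarrow> star MP s \<in> core"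
  unfolding core_def
  by (rule MP.clspan_star[OF core_gen_carrier]) (auto intro: clspan_base core_gen_star)

lemma core_subset_carrier: "core \<subseteq> carrier MP"
  using core_carrier by blast

lemma cstar_algebra_core: "cstar_algebra (mult_sub (cp_alg K) core)"
proof (rule MP.subalgebra)
  show "core \<subseteq> carrier MP" by (rule core_subset_carrier)
  show sm: "c \<odot>\<^bsub>MP\<^esub> s \<in> core" if "s \<in> core" for c s
    unfolding core_def
  proof (rule MP.clspan_smult[OF core_gen_carrier])
    show "s \<in> clspan MP core_gen" using that by (simp add: core_def)
  qed (rule core_gen_smult)
  have "(\<pi> \<zero>\<^bsub>alg \<A>\<^esub> \<cdot> \<zero>\<^bsub>MP\<^esub>) \<cdot> star MP (\<pi> \<zero>\<^bsub>alg \<A>\<^esub> \<cdot> \<zero>\<^bsub>MP\<^esub>) \<in> core_gen"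
    by (rule core_genI) (simp_all add: zero_cont_mult)
  then show "\<zero>\<^bsub>MP\<^esub> \<in> core" by (simp add: core_def clspan_base)
  show "s \<oplus>\<^bsub>MP\<^esub> t \<in> core" if "s \<in> core" "t \<in> core" for s t
    using that unfolding core_def by (rule clspan_add)
  show "s \<cdot> t \<in> core" if "s \<in> core" "t \<in> core" for s t
    unfolding core_def
  proof (rule MP.clspan_mult[OF core_gen_carrier])
    show "s \<in> clspan MP core_gen" "t \<in> clspan MP core_gen" using that by (simp_all add: core_def)
  qed (rule clspan_base[OF core_gen_mult])
  show "star MP s \<in> core" if "s \<in> core" for s using that by (rule core_star)
  show "x \<in> core" if "x \<in> carrier MP" "\<And>e::real. e > 0 \<Longrightarrow> \<exists>y. y \<in> core \<and> nrm MP (x \<ominus>\<^bsub>MP\<^esub> y) < e" for x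
    using that unfolding core_def by (rule clspan_limit)
qed

text \<open>A criterion applied both to the embedding of the crossed product and to induced maps.
  The algebra \<open>R\<close> is spanned by products, and
  \<open>G (x y) = G x (star (G (star y)))\<close>, so it suffices that \<open>G\<close> maps the
  generators \<open>\<kappa>(d) r\<close> into \<open>\<pi>(A) cont_mult\<close>.\<close>

lemma hom_into_core:
  assumes \<kappa>: "nondeg_hom D R \<kappa>" and G: "G \<in> star_hom R MP"
    and bound: "\<And>r. r \<in> carrier R \<Longrightarrow> nrm MP (G r) \<le> L * nrm R r"
    and gen: "\<And>d r. \<lbrakk>d \<in> carrier D; r \<in> carrier R\<rbrakk> \<Longrightarrow>
      \<exists>a\<in>carrier (alg \<A>). \<exists>n\<in>cont_mult. G (fst (\<kappa> d) r) = \<pi> a \<cdot> n"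
    and r: "r \<in> carrier R"
  shows "G r \<in> core"
proof -
  interpret \<kappa>: nondeg_hom D R \<kappa> by fact
  let ?T = "{fst (\<kappa> d) r | d r. d \<in> carrier D \<and> r \<in> carrier R}"
  note Gc = star_hom_carrier[OF G]
  have diff: "nrm MP (G x \<ominus>\<^bsub>MP\<^esub> G y) \<le> L * nrm R (x \<ominus>\<^bsub>R\<^esub> y)" if "x \<in> carrier R" "y \<in> carrier R" for x y
    using that bound[of "x \<ominus>\<^bsub>R\<^esub> y"]
    by (simp add: star_hom_minus[OF G \<kappa>.B.cstar_algebra_axioms MP.cstar_algebra_axioms, symmetric])
  have lipl: "nrm MP (G x \<cdot> c \<ominus>\<^bsub>MP\<^esub> G y \<cdot> c) \<le> L * nrm MP c * nrm R (x \<ominus>\<^bsub>R\<^esub> y)"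
    if "x \<in> carrier R" "y \<in> carrier R" "c \<in> carrier MP" for x y c
  proof -
    have "nrm MP (G x \<cdot> c \<ominus>\<^bsub>MP\<^esub> G y \<cdot> c) \<le> nrm MP (G x \<ominus>\<^bsub>MP\<^esub> G y) * nrm MP c"
      using that Gc MP.nrm_mult[of "G x \<ominus>\<^bsub>MP\<^esub> G y" c] by (simp add: MP.minus_mult_left)
    also have "\<dots> \<le> L * nrm R (x \<ominus>\<^bsub>R\<^esub> y) * nrm MP c"
      using that diff MP.nrm_nonneg by (intro mult_right_mono) auto
    finally show ?thesis by (simp add: mult.commute mult.left_commute)
  qed
  have lipr: "nrm MP (c \<cdot> star MP (G x) \<ominus>\<^bsub>MP\<^esub> c \<cdot> star MP (G y)) \<le> L * nrm MP c * nrm R (x \<ominus>\<^bsub>R\<^esub> y)"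
    if "x \<in> carrier R" "y \<in> carrier R" "c \<in> carrier MP" for x y c
  proof -
    have "nrm MP (c \<cdot> star MP (G x) \<ominus>\<^bsub>MP\<^esub> c \<cdot> star MP (G y)) \<le> nrm MP c * nrm MP (G x \<ominus>\<^bsub>MP\<^esub> G y)"
      using that Gc MP.nrm_mult[of c "star MP (G x \<ominus>\<^bsub>MP\<^esub> G y)"]
      by (simp add: MP.minus_mult_right MP.star_minus)
        (metis MP.minus_carrier MP.nrm_star MP.star_minus)
    also have "\<dots> \<le> nrm MP c * (L * nrm R (x \<ominus>\<^bsub>R\<^esub> y))"
      using that diff MP.nrm_nonneg by (intro mult_left_mono) auto
    finally show ?thesis by (simp add: mult.commute mult.left_commute)
  qed
  \<comment> \<open>Density is used in one variable at a time: first in \<open>y\<close> with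
    \<open>x\<close> a generator, then in \<open>x\<close>.\<close>
  have 1: "G x \<cdot> star MP (G y) \<in> clspan MP core_gen" if x: "x \<in> ?T" and y: "y \<in> carrier R" for x y
  proof (rule \<kappa>.B.clspan_map[OF _ \<kappa>.span_subset, of y "\<lambda>y. G x \<cdot> star MP (G y)" MP "L * nrm MP (G x)"])
    have xc: "x \<in> carrier R" using x \<kappa>.span_subset by blast
    show "y \<in> clspan R ?T" using y \<kappa>.span by simp
    show "G x \<cdot> star MP (G y) \<in> carrier MP" if "y \<in> carrier R" for y using xc that Gc by simp
    show "G x \<cdot> star MP (G (y \<oplus>\<^bsub>R\<^esub> y')) = G x \<cdot> star MP (G y) \<oplus>\<^bsub>MP\<^esub> G x \<cdot> star MP (G y')"
      if "y \<in> carrier R" "y' \<in> carrier R" for y y'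
      using xc that Gc by (simp add: star_hom_add[OF G] MP.star_add MP.mult_r_distr)
    show "nrm MP (G x \<cdot> star MP (G y) \<ominus>\<^bsub>MP\<^esub> G x \<cdot> star MP (G y')) \<le> L * nrm MP (G x) * nrm R (y \<ominus>\<^bsub>R\<^esub> y')"
      if "y \<in> carrier R" "y' \<in> carrier R" for y y' using lipr[OF that Gc[OF xc]] .
    fix y assume y: "y \<in> ?T"
    from x obtain d r where d: "d \<in> carrier D" "r \<in> carrier R" "x = fst (\<kappa> d) r" by blast
    from y obtain d' r' where d': "d' \<in> carrier D" "r' \<in> carrier R" "y = fst (\<kappa> d') r'" by blast
    obtain a n where an: "a \<in> carrier (alg \<A>)" "n \<in> cont_mult" "G x = \<pi> a \<cdot> n"
      using gen[OF d(1,2)] d(3) by blast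
    obtain b m where bm: "b \<in> carrier (alg \<A>)" "m \<in> cont_mult" "G y = \<pi> b \<cdot> m"
      using gen[OF d'(1,2)] d'(3) by blast
    show "G x \<cdot> star MP (G y) \<in> clspan MP core_gen"
      unfolding an(3) bm(3) by (rule clspan_base[OF core_genI[OF an(1) bm(1) an(2) bm(2)]])
  qed
  have 2: "G x \<cdot> star MP (G y) \<in> clspan MP core_gen" if x: "x \<in> carrier R" and y: "y \<in> carrier R" for x y
  proof (rule \<kappa>.B.clspan_map[OF _ \<kappa>.span_subset, of x "\<lambda>x. G x \<cdot> star MP (G y)" MP "L * nrm MP (star MP (G y))"])
    show "x \<in> clspan R ?T" using x \<kappa>.span by simp
    show "G x \<cdot> star MP (G y) \<in> carrier MP" if "x \<in> carrier R" for x using y that Gc by simp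
    show "G (x \<oplus>\<^bsub>R\<^esub> x') \<cdot> star MP (G y) = G x \<cdot> star MP (G y) \<oplus>\<^bsub>MP\<^esub> G x' \<cdot> star MP (G y)"
      if "x \<in> carrier R" "x' \<in> carrier R" for x x'
      using y that Gc by (simp add: star_hom_add[OF G] MP.mult_l_distr)
    show "nrm MP (G x \<cdot> star MP (G y) \<ominus>\<^bsub>MP\<^esub> G x' \<cdot> star MP (G y))
        \<le> L * nrm MP (star MP (G y)) * nrm R (x \<ominus>\<^bsub>R\<^esub> x')"
      if "x \<in> carrier R" "x' \<in> carrier R" for x x'
      using y Gc that by (intro lipl) auto
  qed (rule 1[OF _ y])
  have "r \<in> clspan R {x \<otimes>\<^bsub>R\<^esub> y | x y. x \<in> carrier R \<and> y \<in> carrier R}"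
    using \<kappa>.B.clspan_products r by simp
  then show ?thesis
    unfolding core_def
  proof (rule \<kappa>.B.clspan_map[where K = L])
    fix s assume "s \<in> {x \<otimes>\<^bsub>R\<^esub> y | x y. x \<in> carrier R \<and> y \<in> carrier R}"
    then obtain x y where s: "x \<in> carrier R" "y \<in> carrier R" "s = x \<otimes>\<^bsub>R\<^esub> y" by blast
    then have "G s = G x \<cdot> star MP (G (star R y))"
      using Gc by (simp add: star_hom_mult[OF G] star_hom_star[OF G])
    then show "G s \<in> clspan MP core_gen" using 2[OF s(1), of "star R y"] s(2) by simp
  qed (use Gc diff in \<open>auto simp: star_hom_add[OF G]\<close>)
qed

text \<open>Cutting down turns \<open>\<Psi>(z_g) W_g\<close> into \<open>\<pi>(a z_g) W_g\<close>,
  a product of norm continuous families. The family \<open>z\<close> is constant for the crossed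
  product itself and consists of adjoint cocycle values for an induced map.\<close>

lemma cont_multI_hom:
  assumes m: "m \<in> carrier MP" and W: "\<And>g. W g \<in> carrier MP" "\<And>g. nrm MP (W g) \<le> L"
    "\<And>p. ((\<lambda>g. nrm MP (W g \<ominus>\<^bsub>MP\<^esub> W p)) \<longlongrightarrow> 0) (at p)"
    and z: "\<And>g. z g \<in> carrier (mult_alg (alg \<A>))" "strictly_continuous (alg \<A>) z"
    and eq: "\<And>g. U g \<cdot> m = \<Psi> (z g) \<cdot> W g"
  shows "m \<in> cont_mult"
  unfolding cont_mult_def
proof (intro CollectI conjI ballI allI)
  fix a p assume a: "a \<in> carrier (alg \<A>)"
  have za: "snd (z g) a \<in> carrier (alg \<A>)" for g using A.snd_carrier[OF z(1) a] .
  have rw: "\<pi> a \<cdot> (U g \<cdot> m) = \<pi> (snd (z g) a) \<cdot> W g" for g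
    using a z(1) W(1) unfolding eq by (simp add: MP.mult_assoc[symmetric] \<Psi>_\<pi>)
  show "((\<lambda>g. nrm MP (\<pi> a \<cdot> (U g \<cdot> m) \<ominus>\<^bsub>MP\<^esub> \<pi> a \<cdot> (U p \<cdot> m))) \<longlongrightarrow> 0) (at p)"
    unfolding rw
  proof (rule MP.tendsto_mult_bounded[OF _ _ W(1) W(1) W(2)])
    show "((\<lambda>g. nrm MP (\<pi> (snd (z g) a) \<ominus>\<^bsub>MP\<^esub> \<pi> (snd (z p) a))) \<longlongrightarrow> 0) (at p)"
      using A.cstar_algebra_axioms MP.cstar_algebra_axioms \<pi>.hom \<pi>.hom_bounded za za
      by (rule tendsto_bounded_hom[OF _ _ _ _ _ _ A.strictly_continuousD(2)[OF z(2,1) a]])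
    show "((\<lambda>g. nrm MP (\<pi> (snd (z p) a) \<cdot> W g \<ominus>\<^bsub>MP\<^esub> \<pi> (snd (z p) a) \<cdot> W p)) \<longlongrightarrow> 0) (at p)"
      using za W by (intro MP.tendsto_mult_left_const) auto
  qed (use za in auto)
qed (rule m)

lemma U_strictly_continuous: "strictly_continuous (cp_alg K) U"
  using covariant by (simp add: covariant_rep_def Let_def)

text \<open>Strict continuity of \<open>U\<close> makes \<open>U_g r\<close> norm continuous in
  \<open>g\<close>, so \<open>\<pi>(d) r\<close> has the form required by
  \<open>hom_into_core\<close>.\<close>

lemma embed_core: "mult_embed (cp_alg K) ` carrier (cp_alg K) \<subseteq> core"
proof (rule image_subsetI)
  fix q assume q: "q \<in> carrier (cp_alg K)"
  show "mult_embed (cp_alg K) q \<in> core"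
  proof (rule hom_into_core[OF \<pi>.nondeg_hom_axioms P.mult_embed_hom, where L = 1])
    show "nrm MP (mult_embed (cp_alg K) r) \<le> 1 * nrm (cp_alg K) r" if "r \<in> carrier (cp_alg K)" for r
      using that by (simp add: P.nrm_mult_embed)
    fix d r assume d: "d \<in> carrier (alg \<A>)" and r: "r \<in> carrier (cp_alg K)"
    have Ur: "fst (U g) r \<in> carrier (cp_alg K)" for g using P.fst_carrier[OF U_carrier r] .
    have "mult_embed (cp_alg K) r \<in> cont_mult"
    proof (rule cont_multI_hom[where W = "\<lambda>g. mult_embed (cp_alg K) (fst (U g) r)" and
          z = "\<lambda>_. \<one>\<^bsub>mult_alg (alg \<A>)\<^esub>" and L = "nrm (cp_alg K) r"])
      show "nrm MP (mult_embed (cp_alg K) (fst (U g) r)) \<le> nrm (cp_alg K) r" for g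
        using nrm_unitary_mult_le[OF U_unitary, of "mult_embed (cp_alg K) r" g] r
        by (simp add: P.mult_mult_embed P.nrm_mult_embed)
      show "((\<lambda>g. nrm MP (mult_embed (cp_alg K) (fst (U g) r) \<ominus>\<^bsub>MP\<^esub> mult_embed (cp_alg K) (fst (U p) r))) \<longlongrightarrow> 0) (at p)" for p
        by (rule tendsto_bounded_hom[OF P.cstar_algebra_axioms MP.cstar_algebra_axioms P.mult_embed_hom _ Ur Ur
              P.strictly_continuousD(1)[OF U_strictly_continuous U_carrier r], where K = 1])
          (simp add: P.nrm_mult_embed)
      show "strictly_continuous (alg \<A>) (\<lambda>_. \<one>\<^bsub>mult_alg (alg \<A>)\<^esub>)"
        by (rule A.strictly_continuous_const[OF A.mult_one_closed])
    qed (use r Ur in \<open>auto simp: P.mult_mult_embed mult_alg_simps(10) intro: A.mult_one_closed\<close>)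
    then show "\<exists>a\<in>carrier (alg \<A>). \<exists>n\<in>cont_mult. mult_embed (cp_alg K) (fst (\<pi> d) r) = \<pi> a \<cdot> n"
      using d P.mult_mult_embed[OF \<pi>.hom_carrier[OF d] r] by (metis (no_types))
  qed (rule q)
qed

sublocale core: mult_subalgebra "cp_alg K" core
  by (intro mult_subalgebra.intro mult_subalgebra_axioms.intro P.cstar_algebra_axioms
      cstar_algebra_core core_subset_carrier embed_core)

end

section \<open>The covariant representation on the core\<close>

context crossed_product
begin

abbreviation "core_alg \<equiv> mult_sub (cp_alg K) core"

lemma core_left:
  assumes V: "V \<in> carrier MP"
    and gen: "\<And>a n. \<lbrakk>a \<in> carrier (alg \<A>); n \<in> cont_mult\<rbrakk> \<Longrightarrow>
      \<exists>a'\<in>carrier (alg \<A>). \<exists>n'\<in>cont_mult. V \<cdot> (\<pi> a \<cdot> n) = \<pi> a' \<cdot> n'"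
    and s: "s \<in> core"
  shows "V \<cdot> s \<in> core"
  unfolding core_def
proof (rule MP.clspan_mult_left[OF core_gen_carrier V])
  show "s \<in> clspan MP core_gen" using s by (simp add: core_def)
  fix x assume "x \<in> core_gen"
  then show "V \<cdot> x \<in> clspan MP core_gen"
  proof (rule core_genE)
    fix a b n m assume *: "a \<in> carrier (alg \<A>)" "b \<in> carrier (alg \<A>)" "n \<in> cont_mult" "m \<in> cont_mult"
      "n \<in> carrier MP" "m \<in> carrier MP" "x = (\<pi> a \<cdot> n) \<cdot> star MP (\<pi> b \<cdot> m)"
    obtain a' n' where an: "a' \<in> carrier (alg \<A>)" "n' \<in> cont_mult" "V \<cdot> (\<pi> a \<cdot> n) = \<pi> a' \<cdot> n'"
      using gen[OF *(1,3)] by blast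
    have "V \<cdot> x = (V \<cdot> (\<pi> a \<cdot> n)) \<cdot> star MP (\<pi> b \<cdot> m)"
      unfolding *(7) using V *(1,2,5,6) by (intro MP.mult_assoc[symmetric]) auto
    then show ?thesis
      unfolding an(3) using core_genI[OF an(1) *(2) an(2) *(4)] by (simp add: clspan_base)
  qed
qed

lemma core_left_\<pi>: "\<lbrakk>b \<in> carrier (alg \<A>); s \<in> core\<rbrakk> \<Longrightarrow> \<pi> b \<cdot> s \<in> core"
proof (rule core_left)
  fix a n assume b: "b \<in> carrier (alg \<A>)" and a: "a \<in> carrier (alg \<A>)" and n: "n \<in> cont_mult"
  have "\<pi> b \<cdot> (\<pi> a \<cdot> n) = \<pi> (b \<otimes>\<^bsub>alg \<A>\<^esub> a) \<cdot> n"
    using a b cont_mult_carrier[OF n] by (simp add: star_hom_mult[OF \<pi>.hom] MP.mult_assoc)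
  then show "\<exists>a'\<in>carrier (alg \<A>). \<exists>n'\<in>cont_mult. \<pi> b \<cdot> (\<pi> a \<cdot> n) = \<pi> a' \<cdot> n'"
    using a b n by blast
qed auto

lemma core_left_\<Psi>: "\<lbrakk>m \<in> carrier (mult_alg (alg \<A>)); s \<in> core\<rbrakk> \<Longrightarrow> \<Psi> m \<cdot> s \<in> core"
proof (rule core_left)
  fix a n assume m: "m \<in> carrier (mult_alg (alg \<A>))" and a: "a \<in> carrier (alg \<A>)" and n: "n \<in> cont_mult"
  have "\<Psi> m \<cdot> (\<pi> a \<cdot> n) = \<pi> (fst m a) \<cdot> n"
    using a m cont_mult_carrier[OF n] by (simp add: \<Psi>_\<pi>(1)[symmetric] MP.mult_assoc)
  then show "\<exists>a'\<in>carrier (alg \<A>). \<exists>n'\<in>cont_mult. \<Psi> m \<cdot> (\<pi> a \<cdot> n) = \<pi> a' \<cdot> n'"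
    using A.fst_carrier[OF m a] n by blast
qed auto

lemma core_left_U: "s \<in> core \<Longrightarrow> U g \<cdot> s \<in> core"
proof (rule core_left)
  fix a n assume a: "a \<in> carrier (alg \<A>)" and n: "n \<in> cont_mult"
  have "U g \<cdot> (\<pi> a \<cdot> n) = (U g \<cdot> \<pi> a) \<cdot> n"
    using a cont_mult_carrier[OF n] by (simp add: MP.mult_assoc)
  also have "\<dots> = \<pi> (act \<A> g a) \<cdot> (U g \<cdot> n)"
    using a cont_mult_carrier[OF n] unfolding U_\<pi>[OF a] by (simp add: MP.mult_assoc)
  finally show "\<exists>a'\<in>carrier (alg \<A>). \<exists>n'\<in>cont_mult. U g \<cdot> (\<pi> a \<cdot> n) = \<pi> a' \<cdot> n'"
    using act_in[OF a] cont_mult_U[OF n] by blast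
qed auto

lemma core_left_U_star: "s \<in> core \<Longrightarrow> star MP (U g) \<cdot> s \<in> core"
proof (rule core_left)
  fix a n assume a: "a \<in> carrier (alg \<A>)" and n: "n \<in> cont_mult"
  \<comment> \<open>Surjectivity of the automorphism brings \<open>a\<close> into the form that
    \<open>U_star_\<pi>\<close> can move past the adjoint unitary.\<close>
  obtain b where b: "b \<in> carrier (alg \<A>)" "a = act \<A> g b"
    using act_aut[of g] a by (auto simp: star_aut_def bij_betw_def)
  have "star MP (U g) \<cdot> (\<pi> a \<cdot> n) = (star MP (U g) \<cdot> \<pi> (act \<A> g b)) \<cdot> n"
    using b cont_mult_carrier[OF n] by (simp add: MP.mult_assoc)
  also have "\<dots> = \<pi> b \<cdot> (star MP (U g) \<cdot> n)"
    using b cont_mult_carrier[OF n] unfolding U_star_\<pi>[OF b(1)] by (simp add: MP.mult_assoc)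
  finally show "\<exists>a'\<in>carrier (alg \<A>). \<exists>n'\<in>cont_mult. star MP (U g) \<cdot> (\<pi> a \<cdot> n) = \<pi> a' \<cdot> n'"
    using b(1) cont_mult_U_star[OF n] by blast
qed auto

text \<open>The idealizer of \<open>core\<close> in the multiplier algebra. Its elements restrict to
  multipliers of \<open>core\<close> by \<open>res\<close>, and it contains all
  \<open>\<pi> a\<close>, \<open>\<Psi> m\<close> and \<open>U g\<close>.\<close>

definition preserves_core :: "'x mult \<Rightarrow> bool" where
  "preserves_core V \<longleftrightarrow> V \<in> carrier MP \<and> (\<forall>s\<in>core. V \<cdot> s \<in> core \<and> s \<cdot> V \<in> core)"

text \<open>Right multiplication by \<open>V\<close> is left multiplication by \<open>star V\<close>
  seen through the star, under which \<open>core\<close> is stable.\<close>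

lemma preserves_coreI:
  assumes V: "V \<in> carrier MP" and left: "\<And>s. s \<in> core \<Longrightarrow> V \<cdot> s \<in> core"
    and right: "\<And>s. s \<in> core \<Longrightarrow> star MP V \<cdot> s \<in> core"
  shows "preserves_core V"
  unfolding preserves_core_def
proof (intro conjI ballI V left)
  fix s assume s: "s \<in> core"
  have "star MP (star MP V \<cdot> star MP s) \<in> core"
    using s by (intro core_star right)
  then show "s \<cdot> V \<in> core" using V core_carrier[OF s] by (simp add: MP.star_mult)
qed

lemma preserves_coreD:
  assumes "preserves_core V"
  shows "V \<in> carrier MP" "s \<in> core \<Longrightarrow> V \<cdot> s \<in> core" "s \<in> core \<Longrightarrow> s \<cdot> V \<in> core"
  using assms by (auto simp: preserves_core_def)

lemma preserves_core_\<pi>: "a \<in> carrier (alg \<A>) \<Longrightarrow> preserves_core (\<pi> a)"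
  using core_left_\<pi>[of "star (alg \<A>) a"]
  by (intro preserves_coreI) (auto simp: core_left_\<pi> star_hom_star[OF \<pi>.hom])

lemma preserves_core_\<Psi>: "m \<in> carrier (mult_alg (alg \<A>)) \<Longrightarrow> preserves_core (\<Psi> m)"
  using core_left_\<Psi>[of "star (mult_alg (alg \<A>)) m"] A.mult_star_closed[of m]
  by (intro preserves_coreI) (auto simp: core_left_\<Psi> star_hom_star[OF \<pi>.mult_ext_hom])

lemma preserves_core_U: "preserves_core (U g)"
  by (intro preserves_coreI) (auto simp: core_left_U core_left_U_star)

lemma preserves_core_mult:
  assumes V: "preserves_core V" and W: "preserves_core W"
  shows "preserves_core (V \<cdot> W)"
  unfolding preserves_core_def
proof (intro conjI ballI)
  show "V \<cdot> W \<in> carrier MP" using preserves_coreD(1)[OF V] preserves_coreD(1)[OF W] by simp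
  fix s assume s: "s \<in> core"
  have "V \<cdot> (W \<cdot> s) \<in> core" "(s \<cdot> V) \<cdot> W \<in> core"
    using preserves_coreD(2,3)[OF V] preserves_coreD(2,3)[OF W] s by blast+
  then show "(V \<cdot> W) \<cdot> s \<in> core" "s \<cdot> (V \<cdot> W) \<in> core"
    using preserves_coreD(1)[OF V] preserves_coreD(1)[OF W] core_carrier[OF s] by (simp_all add: MP.mult_assoc)
qed

lemma preserves_core_star:
  assumes V: "preserves_core V"
  shows "preserves_core (star MP V)"
proof (rule preserves_coreI)
  show "star MP V \<in> carrier MP" using preserves_coreD(1)[OF V] by simp
  fix s assume s: "s \<in> core"
  show "star MP (star MP V) \<cdot> s \<in> core" using preserves_coreD[OF V] s by simp
  have "star MP (star MP s \<cdot> V) \<in> core" using preserves_coreD(3)[OF V] s core_star by blast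
  then show "star MP V \<cdot> s \<in> core"
    using preserves_coreD(1)[OF V] core_carrier[OF s] by (simp add: MP.star_mult)
qed

definition res :: "'x mult \<Rightarrow> 'x mult mult" where
  "res V = (\<lambda>s\<in>core. V \<cdot> s, \<lambda>s\<in>core. s \<cdot> V)"

lemma fst_res: "s \<in> core \<Longrightarrow> fst (res V) s = V \<cdot> s"
  and snd_res: "s \<in> core \<Longrightarrow> snd (res V) s = s \<cdot> V"
  by (simp_all add: res_def)

lemma res_carrier:
  assumes V: "preserves_core V"
  shows "res V \<in> carrier (mult_alg core_alg)"
  unfolding res_def
proof -
  note Vc = preserves_coreD[OF V]
  have "(\<lambda>s\<in>carrier core_alg. V \<cdot> s, \<lambda>s\<in>carrier core_alg. s \<cdot> V) \<in> carrier (mult_alg core_alg)"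
  proof (rule core.H.mult_algI[where K = "nrm MP V"])
    show "nrm core_alg ((\<lambda>s\<in>carrier core_alg. V \<cdot> s) s) \<le> nrm MP V * nrm core_alg s"
      if "s \<in> carrier core_alg" for s
      using that Vc(1) core_carrier by (simp add: MP.nrm_mult)
  qed (use Vc core_carrier in \<open>auto simp: MP.mult_assoc\<close>)
  then show "(\<lambda>s\<in>core. V \<cdot> s, \<lambda>s\<in>core. s \<cdot> V) \<in> carrier (mult_alg core_alg)" by simp
qed

lemma res_eqI:
  assumes "m \<in> carrier (mult_alg core_alg)" "preserves_core V"
    and "\<And>s. s \<in> core \<Longrightarrow> fst m s = V \<cdot> s"
  shows "m = res V"
  using assms res_carrier[OF assms(2)] by (intro core.H.mult_eqI) (auto simp: fst_res)

lemma res_mult: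
  assumes "preserves_core V" "preserves_core W"
  shows "res V \<otimes>\<^bsub>mult_alg core_alg\<^esub> res W = res (V \<cdot> W)"
proof (rule res_eqI[OF _ preserves_core_mult[OF assms]])
  show "res V \<otimes>\<^bsub>mult_alg core_alg\<^esub> res W \<in> carrier (mult_alg core_alg)"
    using assms by (intro core.H.mult_mult_closed res_carrier)
  fix s assume s: "s \<in> core"
  then show "fst (res V \<otimes>\<^bsub>mult_alg core_alg\<^esub> res W) s = V \<cdot> W \<cdot> s"
    using preserves_coreD[OF assms(1)] preserves_coreD[OF assms(2)] core_carrier[OF s]
    by (simp add: mult_alg_simps(2)[of _ core_alg] fst_res MP.mult_assoc)
qed

lemma res_star:
  assumes V: "preserves_core V"
  shows "star (mult_alg core_alg) (res V) = res (star MP V)"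
proof (rule res_eqI[OF _ preserves_core_star[OF V]])
  show "star (mult_alg core_alg) (res V) \<in> carrier (mult_alg core_alg)"
    using V by (intro core.H.mult_star_closed res_carrier)
  fix s assume s: "s \<in> core"
  then show "fst (star (mult_alg core_alg) (res V)) s = star MP V \<cdot> s"
    using preserves_coreD(1)[OF V] core_carrier[OF s] core_star[OF s]
    by (simp add: mult_alg_simps(12)[of _ core_alg] snd_res MP.star_mult)
qed

lemma res_one: "res \<one>\<^bsub>MP\<^esub> = \<one>\<^bsub>mult_alg core_alg\<^esub>"
proof (rule res_eqI[symmetric])
  show "preserves_core \<one>\<^bsub>MP\<^esub>" by (rule preserves_coreI) (simp_all add: core_carrier)
qed (use core.H.mult_one_closed in \<open>auto simp: mult_alg_simps(10)[of _ core_alg] core_carrier\<close>)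

definition core_hom :: "'a \<Rightarrow> 'x mult mult" where
  "core_hom = (\<lambda>a\<in>carrier (alg \<A>). res (\<pi> a))"

lemma core_hom_hom: "core_hom \<in> star_hom (alg \<A>) (mult_alg core_alg)"
  unfolding star_hom_def
proof (intro CollectI conjI ballI allI)
  have c: "res (\<pi> a) \<in> carrier (mult_alg core_alg)" if "a \<in> carrier (alg \<A>)" for a
    by (rule res_carrier[OF preserves_core_\<pi>[OF that]])
  show "core_hom \<in> carrier (alg \<A>) \<rightarrow>\<^sub>E carrier (mult_alg core_alg)"
    unfolding core_hom_def using c by (intro restrict_PiE_iff[THEN iffD2]) auto
  fix x assume x: "x \<in> carrier (alg \<A>)"
  show "core_hom (star (alg \<A>) x) = star (mult_alg core_alg) (core_hom x)"
    using x by (simp add: core_hom_def res_star preserves_core_\<pi> star_hom_star[OF \<pi>.hom])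
  show "core_hom (d \<odot>\<^bsub>alg \<A>\<^esub> x) = d \<odot>\<^bsub>mult_alg core_alg\<^esub> core_hom x" for d
  proof -
    have "d \<odot>\<^bsub>mult_alg core_alg\<^esub> res (\<pi> x) = res (\<pi> (d \<odot>\<^bsub>alg \<A>\<^esub> x))"
      using x c core_carrier
      by (intro res_eqI core.H.mult_smult_closed preserves_core_\<pi>)
        (simp_all add: mult_alg_simps(6)[of _ core_alg] fst_res star_hom_smult[OF \<pi>.hom] MP.smult_mult_left)
    then show ?thesis using x by (simp add: core_hom_def)
  qed
  fix y assume y: "y \<in> carrier (alg \<A>)"
  show "core_hom (x \<otimes>\<^bsub>alg \<A>\<^esub> y) = core_hom x \<otimes>\<^bsub>mult_alg core_alg\<^esub> core_hom y"
    using x y by (simp add: core_hom_def res_mult preserves_core_\<pi> star_hom_mult[OF \<pi>.hom])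
  have "res (\<pi> x) \<oplus>\<^bsub>mult_alg core_alg\<^esub> res (\<pi> y) = res (\<pi> (x \<oplus>\<^bsub>alg \<A>\<^esub> y))"
    using x y c core_carrier
    by (intro res_eqI core.H.mult_add_closed preserves_core_\<pi>)
      (simp_all add: mult_alg_simps(4)[of _ core_alg] fst_res star_hom_add[OF \<pi>.hom] MP.mult_l_distr)
  then show "core_hom (x \<oplus>\<^bsub>alg \<A>\<^esub> y) = core_hom x \<oplus>\<^bsub>mult_alg core_alg\<^esub> core_hom y"
    using x y by (simp add: core_hom_def)
qed

lemma core_gen_subset: "core_gen \<subseteq> core"
  unfolding core_def by (auto intro: clspan_base)

lemma minus_core: "\<lbrakk>s \<in> core; t \<in> core\<rbrakk> \<Longrightarrow> s \<ominus>\<^bsub>core_alg\<^esub> t = s \<ominus>\<^bsub>MP\<^esub> t"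
  by (rule MP.minus_subalgebra[OF cstar_algebra_core core_subset_carrier])

text \<open>The span inside \<open>core_alg\<close> is a different inductive set: its limit rule
  uses the smaller carrier and measures distances with the \<open>\<ominus>\<close> of that
  carrier.\<close>

lemma clspan_core_gen: "s \<in> clspan MP core_gen \<Longrightarrow> s \<in> clspan core_alg core_gen"
proof (induction rule: clspan.induct)
  case (clspan_base x)
  then show ?case by (rule clspan.clspan_base)
next
  case (clspan_add x y)
  then show ?case using clspan.clspan_add[of x core_alg core_gen y] by simp
next
  case (clspan_limit x)
  have x: "x \<in> core"
    unfolding core_def using clspan_limit.hyps
    by (rule clspan.clspan_limit) (use clspan_limit.IH in blast)
  show ?case
  proof (rule clspan.clspan_limit)
    show "x \<in> carrier core_alg" using x by simp
    fix e :: real assume "e > 0"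
    then obtain y where y: "y \<in> clspan MP core_gen" "y \<in> clspan core_alg core_gen"
      "nrm MP (x \<ominus>\<^bsub>MP\<^esub> y) < e"
      using clspan_limit.IH by blast
    moreover have "y \<in> core" using y(1) by (simp add: core_def)
    ultimately show "\<exists>y. y \<in> clspan core_alg core_gen \<and> nrm core_alg (x \<ominus>\<^bsub>core_alg\<^esub> y) < e"
      using x by (intro exI[of _ y]) (simp add: minus_core)
  qed
qed

text \<open>A generator is \<open>s = \<pi>(a) r\<close>, where \<open>r\<close> is not known to lie
  in \<open>core\<close>. Choosing \<open>x\<close> with \<open>x a\<close> close to
  \<open>a\<close> makes \<open>\<pi>(x) s\<close> close to \<open>s\<close>, and
  \<open>\<pi>(x) s\<close> is in the required span because \<open>s\<close> itself is in
  \<open>core\<close>.\<close>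

lemma core_hom_nondeg: "nondeg_hom (alg \<A>) core_alg core_hom"
proof (rule nondeg_homI_span[OF A.cstar_algebra_axioms core.H.cstar_algebra_axioms core_hom_hom])
  let ?T = "{fst (core_hom a) s | a s. a \<in> carrier (alg \<A>) \<and> s \<in> carrier core_alg}"
  have gen: "core_gen \<subseteq> clspan core_alg ?T"
  proof
    fix s assume sg: "s \<in> core_gen"
    then have s: "s \<in> core" using core_gen_subset by blast
    from sg show "s \<in> clspan core_alg ?T"
    proof (rule core_genE)
      fix a b n m assume *: "a \<in> carrier (alg \<A>)" "b \<in> carrier (alg \<A>)" "n \<in> cont_mult" "m \<in> cont_mult"
        "n \<in> carrier MP" "m \<in> carrier MP" "s = (\<pi> a \<cdot> n) \<cdot> star MP (\<pi> b \<cdot> m)"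
      define r where "r = n \<cdot> star MP (\<pi> b \<cdot> m)"
      have r: "r \<in> carrier MP" "s = \<pi> a \<cdot> r" using * by (simp_all add: r_def MP.mult_assoc del: MP.star_mult)
      show ?thesis
      proof (rule clspan_limit)
        show "s \<in> carrier core_alg" using s by simp
        fix e :: real assume e: "e > 0"
        \<comment> \<open>The 4 is the norm bound for \<open>\<pi>\<close> from
          \<open>hom_bounded\<close>; the summand 1 allows \<open>r = 0\<close>.\<close>
        define d where "d = e / (4 * nrm MP r + 1)"
        have nr: "0 \<le> nrm MP r" using r MP.nrm_nonneg by simp
        then have d: "d > 0" using e by (simp add: d_def)
        obtain x where x: "x \<in> carrier (alg \<A>)" "nrm (alg \<A>) (a \<ominus>\<^bsub>alg \<A>\<^esub> x \<otimes>\<^bsub>alg \<A>\<^esub> a) < d"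
          using A.approximate_left_unit[OF *(1) d] by blast
        have xs: "\<pi> x \<cdot> s \<in> core" using core_left_\<pi> x s by blast
        have "s \<ominus>\<^bsub>core_alg\<^esub> \<pi> x \<cdot> s = s \<ominus>\<^bsub>MP\<^esub> \<pi> x \<cdot> s" by (rule minus_core[OF s xs])
        also have "\<dots> = \<pi> (a \<ominus>\<^bsub>alg \<A>\<^esub> x \<otimes>\<^bsub>alg \<A>\<^esub> a) \<cdot> r"
          using r x *(1) by (simp add: star_hom_minus[OF \<pi>.hom A.cstar_algebra_axioms MP.cstar_algebra_axioms]
              star_hom_mult[OF \<pi>.hom] MP.minus_mult_left MP.mult_assoc)
        also have "nrm MP \<dots> \<le> nrm MP (\<pi> (a \<ominus>\<^bsub>alg \<A>\<^esub> x \<otimes>\<^bsub>alg \<A>\<^esub> a)) * nrm MP r"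
          using r x *(1) by (intro MP.nrm_mult) auto
        also have "\<dots> \<le> (4 * d) * nrm MP r"
        proof (rule mult_right_mono[OF _ nr])
          show "nrm MP (\<pi> (a \<ominus>\<^bsub>alg \<A>\<^esub> x \<otimes>\<^bsub>alg \<A>\<^esub> a)) \<le> 4 * d"
            using \<pi>.hom_bounded[of "a \<ominus>\<^bsub>alg \<A>\<^esub> x \<otimes>\<^bsub>alg \<A>\<^esub> a"] x *(1) by simp
        qed
        also have "\<dots> < e" using e nr by (simp add: d_def field_simps)
        finally have "nrm core_alg (s \<ominus>\<^bsub>core_alg\<^esub> \<pi> x \<cdot> s) < e" by simp
        moreover have "fst (core_hom x) s = \<pi> x \<cdot> s" using x s by (simp add: core_hom_def fst_res)
        then have "\<pi> x \<cdot> s \<in> ?T" using x(1) s by (intro CollectI exI[of _ x] exI[of _ s]) simp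
        then have "\<pi> x \<cdot> s \<in> clspan core_alg ?T" by (rule clspan_base)
        ultimately show "\<exists>y. y \<in> clspan core_alg ?T \<and> nrm core_alg (s \<ominus>\<^bsub>core_alg\<^esub> y) < e" by blast
      qed
    qed
  qed
  show "carrier core_alg \<subseteq> clspan core_alg ?T"
  proof
    fix s assume "s \<in> carrier core_alg"
    then have "s \<in> clspan core_alg core_gen" using clspan_core_gen by (simp add: core_def)
    then show "s \<in> clspan core_alg ?T"
      by (rule core.H.clspan_mono) (use gen core_gen_subset in auto)
  qed
qed

lemma act_continuous:
  "a \<in> carrier (alg \<A>) \<Longrightarrow> ((\<lambda>g. nrm (alg \<A>) (act \<A> g a \<ominus>\<^bsub>alg \<A>\<^esub> act \<A> p a)) \<longlongrightarrow> 0) (at p)"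
  using twisted_algebraD(3)[OF twisted] by (simp add: A.continuous_norm_iff)

text \<open>Covariance turns \<open>U_g \<pi>(a) n\<close> into
  \<open>\<pi>(\<alpha>_g a) U_g n\<close>, where \<open>\<alpha>_g a\<close> is norm continuous and
  the rest is controlled by the cut-down condition on \<open>n\<close>. So on \<open>core\<close>
  the unitaries act continuously with no cut-down left.\<close>

lemma core_U_continuous:
  assumes s: "s \<in> core"
  shows "((\<lambda>g. nrm MP (U g \<cdot> s \<ominus>\<^bsub>MP\<^esub> U p \<cdot> s)) \<longlongrightarrow> 0) (at p)"
proof (rule MP.clspan_continuous[OF MP.cstar_algebra_axioms _ core_gen_carrier, where K = 1])
  show "s \<in> clspan MP core_gen" using s by (simp add: core_def)
  show "nrm MP (U g \<cdot> x \<ominus>\<^bsub>MP\<^esub> U g \<cdot> y) \<le> 1 * nrm MP (x \<ominus>\<^bsub>MP\<^esub> y)"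
    if "x \<in> carrier MP" "y \<in> carrier MP" for g x y
    using nrm_unitary_mult_le[OF U_unitary, of "x \<ominus>\<^bsub>MP\<^esub> y" g] that by (simp add: MP.minus_mult_right)
  fix x assume "x \<in> core_gen"
  then show "((\<lambda>g. nrm MP (U g \<cdot> x \<ominus>\<^bsub>MP\<^esub> U p \<cdot> x)) \<longlongrightarrow> 0) (at p)"
  proof (rule core_genE)
    fix a b n m assume *: "a \<in> carrier (alg \<A>)" "b \<in> carrier (alg \<A>)" "n \<in> cont_mult" "m \<in> cont_mult"
      "n \<in> carrier MP" "m \<in> carrier MP" "x = (\<pi> a \<cdot> n) \<cdot> star MP (\<pi> b \<cdot> m)"
    have rw: "U g \<cdot> x = (\<pi> (act \<A> g a) \<cdot> (U g \<cdot> n)) \<cdot> star MP (\<pi> b \<cdot> m)" for g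
    proof -
      have "U g \<cdot> x = ((U g \<cdot> \<pi> a) \<cdot> n) \<cdot> star MP (\<pi> b \<cdot> m)"
        unfolding *(7) using *(1,2,5,6) by (simp add: MP.mult_assoc del: MP.star_mult)
      then show ?thesis unfolding U_\<pi>[OF *(1)] using *(1,5) by (simp add: MP.mult_assoc)
    qed
    show ?thesis
      unfolding rw
    proof (rule MP.tendsto_mult_right_const)
      show "((\<lambda>g. nrm MP (\<pi> (act \<A> g a) \<cdot> (U g \<cdot> n) \<ominus>\<^bsub>MP\<^esub> \<pi> (act \<A> p a) \<cdot> (U p \<cdot> n))) \<longlongrightarrow> 0) (at p)"
      proof (rule MP.tendsto_mult_bounded)
        show "nrm MP (U g \<cdot> n) \<le> nrm MP n" for g
          by (rule nrm_unitary_mult_le[OF U_unitary *(5)])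
        show "((\<lambda>g. nrm MP (\<pi> (act \<A> g a) \<ominus>\<^bsub>MP\<^esub> \<pi> (act \<A> p a))) \<longlongrightarrow> 0) (at p)"
          using A.cstar_algebra_axioms MP.cstar_algebra_axioms \<pi>.hom \<pi>.hom_bounded act_in[OF *(1)] act_in[OF *(1)]
          by (rule tendsto_bounded_hom[OF _ _ _ _ _ _ act_continuous[OF *(1)]])
        show "((\<lambda>g. nrm MP (\<pi> (act \<A> p a) \<cdot> (U g \<cdot> n) \<ominus>\<^bsub>MP\<^esub> \<pi> (act \<A> p a) \<cdot> (U p \<cdot> n))) \<longlongrightarrow> 0) (at p)"
          by (rule cont_multD[OF *(3) act_in[OF *(1)]])
      qed (use *(1,5) in auto)
    qed (use *(1,2,5,6) in auto)
  qed
qed (auto simp: MP.mult_r_distr)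

text \<open>With \<open>t = star U_p s\<close> the difference equals
  \<open>star U_g (U_p t - U_g t)\<close>, so continuity of \<open>U\<close> at the fixed element
  \<open>t\<close> suffices.\<close>

lemma core_U_star_continuous:
  assumes s: "s \<in> core"
  shows "((\<lambda>g. nrm MP (star MP (U g) \<cdot> s \<ominus>\<^bsub>MP\<^esub> star MP (U p) \<cdot> s)) \<longlongrightarrow> 0) (at p)"
proof (rule tendsto_sandwich[OF _ _ tendsto_const])
  define t where "t = star MP (U p) \<cdot> s"
  have t: "t \<in> core" unfolding t_def by (rule core_left_U_star[OF s])
  have c: "s \<in> carrier MP" "t \<in> carrier MP" using s t by (auto intro: core_carrier)
  show "((\<lambda>g. nrm MP (U g \<cdot> t \<ominus>\<^bsub>MP\<^esub> U p \<cdot> t)) \<longlongrightarrow> 0) (at p)"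
    by (rule core_U_continuous[OF t])
  have "nrm MP (star MP (U g) \<cdot> s \<ominus>\<^bsub>MP\<^esub> star MP (U p) \<cdot> s) \<le> nrm MP (U g \<cdot> t \<ominus>\<^bsub>MP\<^esub> U p \<cdot> t)" for g
  proof -
    have "U p \<cdot> t = s" unfolding t_def using c by (simp add: MP.mult_assoc[symmetric])
    moreover have "star MP (U g) \<cdot> (U g \<cdot> t) = t" using c by (simp add: MP.mult_assoc[symmetric])
    ultimately have "star MP (U g) \<cdot> (U p \<cdot> t \<ominus>\<^bsub>MP\<^esub> U g \<cdot> t) = star MP (U g) \<cdot> s \<ominus>\<^bsub>MP\<^esub> t"
      using c by (simp add: MP.minus_mult_right)
    then have "nrm MP (star MP (U g) \<cdot> s \<ominus>\<^bsub>MP\<^esub> t) \<le> nrm MP (U p \<cdot> t \<ominus>\<^bsub>MP\<^esub> U g \<cdot> t)"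
      using nrm_unitary_mult_le[OF P.unitary_star[OF U_unitary], of "U p \<cdot> t \<ominus>\<^bsub>MP\<^esub> U g \<cdot> t" g] c by simp
    also have "\<dots> = nrm MP (U g \<cdot> t \<ominus>\<^bsub>MP\<^esub> U p \<cdot> t)" using c by (intro MP.nrm_minus_commute) auto
    finally show ?thesis by (simp add: t_def)
  qed
  then show "\<forall>\<^sub>F g in at p. nrm MP (star MP (U g) \<cdot> s \<ominus>\<^bsub>MP\<^esub> star MP (U p) \<cdot> s)
      \<le> nrm MP (U g \<cdot> t \<ominus>\<^bsub>MP\<^esub> U p \<cdot> t)" by simp
  show "\<forall>\<^sub>F g in at p. 0 \<le> nrm MP (star MP (U g) \<cdot> s \<ominus>\<^bsub>MP\<^esub> star MP (U p) \<cdot> s)"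
    using c by (simp add: MP.nrm_nonneg)
qed

text \<open>The extension of \<open>core_hom\<close> at \<open>m\<close> is the restriction of
  \<open>\<Psi> m\<close>, so the relations between \<open>\<pi>\<close> and \<open>U\<close>
  restrict to \<open>core\<close>.\<close>

lemma core_covariant: "covariant_rep \<A> core_alg (core_hom, \<lambda>g. res (U g))"
proof -
  interpret ch: nondeg_hom "alg \<A>" core_alg core_hom by (rule core_hom_nondeg)
  have ext: "mult_ext (alg \<A>) core_alg core_hom m = res (\<Psi> m)" if m: "m \<in> carrier (mult_alg (alg \<A>))" for m
  proof (rule ch.mult_ext_eqI[OF m res_carrier[OF preserves_core_\<Psi>[OF m]]])
    fix a s assume a: "a \<in> carrier (alg \<A>)" and "s \<in> carrier core_alg"
    then have s: "s \<in> core" by simp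
    have "\<Psi> m \<cdot> (\<pi> a \<cdot> s) = \<pi> (fst m a) \<cdot> s"
      using a m core_carrier[OF s] by (simp add: \<Psi>_\<pi>(1)[symmetric] MP.mult_assoc)
    then show "fst (res (\<Psi> m)) (fst (core_hom a) s) = fst (core_hom (fst m a)) s"
      using a s A.fst_carrier[OF m a] core_left_\<pi> by (simp add: core_hom_def fst_res)
  qed
  have "res (U g) \<in> mult_unitaries core_alg" for g
    using res_carrier[OF preserves_core_U]
    by (simp add: mult_unitaries_def res_star preserves_core_U res_mult preserves_core_star res_one)
  moreover have "strictly_continuous core_alg (\<lambda>g. res (U g))"
  proof (rule core.H.strictly_continuousI)
    show "res (U g) \<in> carrier (mult_alg core_alg)" for g by (rule res_carrier[OF preserves_core_U])
    fix s p assume "s \<in> carrier core_alg"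
    then have s: "s \<in> core" by simp
    show "((\<lambda>g. nrm core_alg (fst (res (U g)) s \<ominus>\<^bsub>core_alg\<^esub> fst (res (U p)) s)) \<longlongrightarrow> 0) (at p)"
      using core_U_continuous[OF s] core_left_U[OF s] s by (simp add: fst_res minus_core)
    show "((\<lambda>g. nrm core_alg (fst (star (mult_alg core_alg) (res (U g))) s
        \<ominus>\<^bsub>core_alg\<^esub> fst (star (mult_alg core_alg) (res (U p))) s)) \<longlongrightarrow> 0) (at p)"
      using core_U_star_continuous[OF s] core_left_U_star[OF s] s
      by (simp add: fst_res minus_core res_star preserves_core_U)
  qed
  moreover have "res (U g) \<otimes>\<^bsub>mult_alg core_alg\<^esub> res (U h) =
      mult_ext (alg \<A>) core_alg core_hom (twist \<A> g h) \<otimes>\<^bsub>mult_alg core_alg\<^esub> res (U (g + h))" for g h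
    by (simp add: ext res_mult preserves_core_U preserves_core_\<Psi> U_mult)
  moreover have "Ad core_alg (res (U g)) (core_hom a) = core_hom (act \<A> g a)" if a: "a \<in> carrier (alg \<A>)" for g a
  proof -
    have "\<pi> (act \<A> g a) = U g \<cdot> \<pi> a \<cdot> star MP (U g)"
      using covariant a by (simp add: covariant_rep_def Let_def Ad_def)
    then show ?thesis
      using a by (simp add: Ad_def core_hom_def res_star res_mult preserves_core_U preserves_core_\<pi>
          preserves_core_star preserves_core_mult)
  qed
  ultimately show ?thesis
    by (simp add: covariant_rep_def Let_def ch.nondegenerate)
qed

text \<open>Extending the inclusion undoes the restriction. Composing the representation on
  \<open>core\<close> with the inclusion therefore returns \<open>\<pi>\<close> and
  \<open>U\<close>.\<close>

lemma incl_res: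
  assumes V: "preserves_core V"
  shows "mult_ext core_alg (cp_alg K) (\<lambda>s\<in>core. s) (res V) = V"
proof (rule core.incl.mult_ext_eqI[OF res_carrier[OF V] preserves_coreD(1)[OF V]])
  fix s q assume "s \<in> carrier core_alg" and q: "q \<in> carrier (cp_alg K)"
  then have s: "s \<in> core" by simp
  then show "fst V (fst ((\<lambda>s\<in>core. s) s) q) = fst ((\<lambda>s\<in>core. s) (fst (res V) s)) q"
    using preserves_coreD(2)[OF V s] q by (simp add: fst_res mult_alg_simps(2))
qed

text \<open>The universal property yields a non-degenerate \<open>\<Theta>\<close> from the crossed product to the multipliers
  of \<open>core\<close>. By uniqueness \<open>\<Theta>(q)s = qs\<close>, which lies in the crossed product because it is an ideal of
  its multiplier algebra; non-degeneracy of \<open>\<Theta>\<close> then forces \<open>core\<close> into the crossed product.\<close>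

lemma core_subset_embed: "core \<subseteq> mult_embed (cp_alg K) ` carrier (cp_alg K)"
proof -
  let ?Q = "cp_alg K" and ?i = "\<lambda>s\<in>core. s"
  let ?TC = "trivial_twisted core_alg :: ('g, 'x mult) twisted" and ?TQ = "trivial_twisted ?Q :: ('g, 'x) twisted"
  have rep': "cocycle_rep \<A> ?TC (core_hom, \<lambda>g. res (U g))"
    using core_covariant covariant_rep_iff[OF twisted core.H.cstar_algebra_axioms] by blast
  obtain \<Theta> where \<Theta>: "factors \<A> K core_alg \<Theta> (core_hom, \<lambda>g. res (U g))"
    using universal_property_mult[OF core.H.cstar_algebra_axioms rep'] by blast
  interpret \<Theta>: nondeg_hom ?Q core_alg \<Theta>
    using \<Theta> P.cstar_algebra_axioms core.H.cstar_algebra_axioms by (intro nondeg_homI) (auto simp: factors_def)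
  interpret \<Theta>i: nondeg_hom_pair ?Q core_alg ?Q \<Theta> ?i
    using \<Theta>.nondeg_hom_axioms core.incl_nondeg by (rule nondeg_hom_pairI)
  interpret ci: nondeg_hom_pair "alg \<A>" core_alg ?Q core_hom ?i
    using core_hom_nondeg core.incl_nondeg by (rule nondeg_hom_pairI)
  have "hom_comp (alg \<A>) core_alg ?Q ?i core_hom = \<pi>"
    by (rule star_hom_eqI[OF ci.hom_comp_hom \<pi>.hom])
      (simp add: ci.hom_comp_apply, simp add: core_hom_def incl_res preserves_core_\<pi>)
  then have "cocycle_comp \<A> ?TC ?TQ (?i, \<lambda>_. \<one>\<^bsub>MP\<^esub>) (core_hom, \<lambda>g. res (U g)) = (\<pi>, U)"
    by (simp add: cocycle_comp_eq incl_res preserves_core_U)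
  then have "factors \<A> K ?Q (hom_comp ?Q core_alg ?Q ?i \<Theta>) (\<pi>, U)"
    using factors_compose[OF core.H.cstar_algebra_axioms \<Theta> core.incl_nondeg] by simp
  moreover have "factors \<A> K ?Q (mult_embed ?Q) (\<pi>, U)"
    using cocycle_comp_id_left[OF twisted P.twisted_algebra_trivial rep]
      nondeg_hom.nondegenerate[OF P.nondeg_hom_mult_embed]
    by (simp add: factors_def cocycle_id_def)
  \<comment> \<open>Both maps carry the universal representation to itself, so uniqueness identifies
    the composite with the identity morphism \<open>mult_embed\<close>.\<close>
  ultimately have eq: "hom_comp ?Q core_alg ?Q ?i \<Theta> = mult_embed ?Q"
    using universal_property[OF P.cstar_algebra_axioms rep] by blast
  have gen: "fst (\<Theta> q) s \<in> mult_embed ?Q ` carrier ?Q" if q: "q \<in> carrier ?Q" and s: "s \<in> core" for q s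
  proof -
    have sc: "s \<in> carrier MP" using core_carrier[OF s] .
    have fc: "fst (\<Theta> q) s \<in> core" using \<Theta>.act_carrier[OF q, of s] s by simp
    have "fst (\<Theta> q) s = mult_ext core_alg ?Q ?i (mult_embed core_alg (fst (\<Theta> q) s))"
      using fc core.incl.mult_ext_embed[of "fst (\<Theta> q) s"] by simp
    also have "mult_embed core_alg (fst (\<Theta> q) s) = \<Theta> q \<otimes>\<^bsub>mult_alg core_alg\<^esub> mult_embed core_alg s"
      using core.H.mult_mult_embed[of "\<Theta> q" s] q s by simp
    also have "mult_ext core_alg ?Q ?i \<dots> = mult_ext core_alg ?Q ?i (\<Theta> q) \<cdot> mult_ext core_alg ?Q ?i (mult_embed core_alg s)"
      using q s core.H.mult_embed_carrier[of s] by (intro star_hom_mult[OF core.incl.mult_ext_hom]) auto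
    also have "mult_ext core_alg ?Q ?i (mult_embed core_alg s) = s"
      using s core.incl.mult_ext_embed[of s] by simp
    also have "mult_ext core_alg ?Q ?i (\<Theta> q) = mult_embed ?Q q"
      using \<Theta>i.hom_comp_apply[OF q] eq by simp
    also have "mult_embed ?Q q \<cdot> s = mult_embed ?Q (snd s q)"
      by (rule P.mult_embed_mult[OF sc q])
    finally show ?thesis using P.snd_carrier[OF sc q] by simp
  qed
  \<comment> \<open>The embedded copy is closed under sums and norm limits, so it contains the whole
    closed span, which is \<open>core\<close> by non-degeneracy of \<open>\<Theta>\<close>.\<close>
  have "s \<in> mult_embed ?Q ` carrier ?Q"
    if "s \<in> clspan core_alg {fst (\<Theta> q) s | q s. q \<in> carrier ?Q \<and> s \<in> carrier core_alg}" for s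
    using that
  proof induction
    case (clspan_base x)
    then show ?case using gen by auto
  next
    case (clspan_add x y)
    then obtain a b where "a \<in> carrier ?Q" "x = mult_embed ?Q a" "b \<in> carrier ?Q" "y = mult_embed ?Q b" by blast
    then show ?case
      by (intro image_eqI[of _ _ "a \<oplus>\<^bsub>?Q\<^esub> b"]) (simp_all add: star_hom_add[OF P.mult_embed_hom])
  next
    case (clspan_limit x)
    then have x: "x \<in> core" by simp
    show ?case
    proof (rule P.mult_embed_image_closed[OF core_carrier[OF x]])
      fix e :: real assume "e > 0"
      then obtain y where y: "y \<in> clspan core_alg {fst (\<Theta> q) s | q s. q \<in> carrier ?Q \<and> s \<in> carrier core_alg}"
        "nrm core_alg (x \<ominus>\<^bsub>core_alg\<^esub> y) < e" "y \<in> mult_embed ?Q ` carrier ?Q"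
        using clspan_limit.IH by blast
      have "y \<in> core" using y(3) embed_core by blast
      then show "\<exists>y. y \<in> mult_embed ?Q ` carrier ?Q \<and> nrm MP (x \<ominus>\<^bsub>MP\<^esub> y) < e"
        using y(2,3) minus_core[OF x] by auto
    qed
  qed
  then show ?thesis using \<Theta>.span by auto
qed

end

text \<open>Apply \<open>hom_into_core\<close> to the induced map \<open>\<Theta>\<close>, with
  primes marking the target. As \<open>\<theta>(d)\<close> is an element \<open>b\<close> of the
  target algebra, \<open>\<Theta>(\<pi>(d) r) = \<pi>'(b) \<Theta>(r)\<close>. From
  \<open>\<Theta>(U_g r) = \<Psi>'(x_g) U'_g \<Theta>(r)\<close> follows
  \<open>U'_g \<Theta>(r) = \<Psi>'(star x_g) \<Theta>(U_g r)\<close>, whose last factor is norm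
  continuous in \<open>g\<close>; so \<open>\<Theta>(r)\<close> is in \<open>cont_mult\<close>. The
  range then lies in the core, which \<open>core_subset_embed\<close> places inside the crossed
  product.\<close>

lemma (in crossed_product_pair) crossed_map_image:
  assumes image: "fst f ` carrier (alg \<A>) \<subseteq> mult_embed (alg \<B>) ` carrier (alg \<B>)"
  shows "crossed_map \<A> \<B> K K' f ` carrier (cp_alg K) \<subseteq> mult_embed (cp_alg K') ` carrier (cp_alg K')"
proof -
  obtain \<theta> x where e: "f = (\<theta>, x)" by (cases f)
  interpret \<theta>: cocycle_representation \<A> \<B> \<theta> x
    using K.twisted K'.twisted f unfolding e by (rule cocycle_representation.intro)
  let ?\<Theta> = "crossed_map \<A> \<B> K K' f" and ?P = "cp_alg K" and ?Q = "cp_alg K'"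
  interpret \<Theta>: nondeg_hom ?P ?Q ?\<Theta> by (rule crossed_map_nondeg)
  interpret pair: nondeg_hom_pair "alg \<A>" "alg \<B>" ?Q \<theta> "cp_hom K'"
    by (rule nondeg_hom_pairI[OF \<theta>.hom.nondeg_hom_axioms K'.\<pi>.nondeg_hom_axioms])
  let ?M = "mult_alg ?Q"
  have i: "induced = (hom_comp (alg \<A>) (alg \<B>) ?Q (cp_hom K') \<theta>,
      \<lambda>g. K'.\<Psi> (x g) \<otimes>\<^bsub>?M\<^esub> cp_unitary K' g)"
    unfolding induced_def unfolding e cocycle_comp_eq by simp
  have ext: "mult_ext ?P ?Q ?\<Theta> (cp_hom K a) = K'.\<Psi> (\<theta> a)" "mult_ext ?P ?Q ?\<Theta> (cp_unitary K g) = K'.\<Psi> (x g) \<otimes>\<^bsub>?M\<^esub> cp_unitary K' g"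
    if "a \<in> carrier (alg \<A>)" for a g
    using crossed_map_factors K.factors_iff[OF K'.P.cstar_algebra_axioms induced_rep[unfolded i], of ?\<Theta>] that
    unfolding i by (auto simp: pair.hom_comp_apply)
  have ext_mult: "?\<Theta> (fst m p) = mult_ext ?P ?Q ?\<Theta> m \<otimes>\<^bsub>?M\<^esub> ?\<Theta> p" if "m \<in> carrier (mult_alg ?P)" "p \<in> carrier ?P" for m p
  proof -
    have "mult_ext ?P ?Q ?\<Theta> (m \<otimes>\<^bsub>mult_alg ?P\<^esub> mult_embed ?P p) = mult_ext ?P ?Q ?\<Theta> m \<otimes>\<^bsub>?M\<^esub> ?\<Theta> p"
      using that by (simp add: star_hom_mult[OF \<Theta>.mult_ext_hom] \<Theta>.mult_ext_embed)
    then show ?thesis using that K.P.fst_carrier[OF that] by (simp add: K.P.mult_mult_embed \<Theta>.mult_ext_embed)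
  qed
  have "?\<Theta> p \<in> K'.core" if p: "p \<in> carrier ?P" for p
  proof (rule K'.hom_into_core[OF K.\<pi>.nondeg_hom_axioms \<Theta>.hom, where L = 4])
    show "nrm ?M (?\<Theta> r) \<le> 4 * nrm ?P r" if "r \<in> carrier ?P" for r using \<Theta>.hom_bounded[OF that] .
    fix d r assume d: "d \<in> carrier (alg \<A>)" and r: "r \<in> carrier ?P"
    obtain b where b: "b \<in> carrier (alg \<B>)" "\<theta> d = mult_embed (alg \<B>) b"
      using image d by (auto simp: e)
    have Ur: "fst (cp_unitary K g) r \<in> carrier ?P" for g using K.P.fst_carrier[OF K.U_carrier r] .
    have "?\<Theta> (fst (cp_hom K d) r) = cp_hom K' b \<otimes>\<^bsub>?M\<^esub> ?\<Theta> r"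
      using d r b by (simp add: ext_mult ext K'.\<pi>.mult_ext_embed)
    moreover have "?\<Theta> r \<in> K'.cont_mult"
    proof (rule K'.cont_multI_hom[where W = "\<lambda>g. ?\<Theta> (fst (cp_unitary K g) r)" and
          z = "\<lambda>g. star (mult_alg (alg \<B>)) (x g)" and L = "4 * nrm ?P r"])
      show "?\<Theta> r \<in> carrier ?M" using r by simp
      show "?\<Theta> (fst (cp_unitary K g) r) \<in> carrier ?M" for g using Ur by simp
      show "nrm ?M (?\<Theta> (fst (cp_unitary K g) r)) \<le> 4 * nrm ?P r" for g
      proof -
        have "nrm ?P (fst (cp_unitary K g) r) \<le> nrm (mult_alg ?P) (cp_unitary K g) * nrm ?P r"
          using r by (intro K.P.nrm_fst_le) auto
        also have "\<dots> \<le> 1 * nrm ?P r"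
          using r K.P.unitary_nrm_le[OF K.U_unitary] K.P.nrm_nonneg by (intro mult_right_mono) auto
        finally show ?thesis using \<Theta>.hom_bounded[OF Ur, of g] by simp
      qed
      show "((\<lambda>g. nrm ?M (?\<Theta> (fst (cp_unitary K g) r) \<ominus>\<^bsub>?M\<^esub> ?\<Theta> (fst (cp_unitary K p) r))) \<longlongrightarrow> 0) (at p)" for p
        using K.P.cstar_algebra_axioms K'.MP.cstar_algebra_axioms \<Theta>.hom \<Theta>.hom_bounded Ur Ur
        by (rule tendsto_bounded_hom[OF _ _ _ _ _ _ K.P.strictly_continuousD(1)[OF K.U_strictly_continuous K.U_carrier r]])
      show "star (mult_alg (alg \<B>)) (x g) \<in> carrier (mult_alg (alg \<B>))" for g
        by (rule K'.A.mult_star_closed[OF \<theta>.unitary_carrier])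
      have xs: "strictly_continuous (alg \<B>) x" using \<theta>.rep by (simp add: cocycle_rep_iff)
      interpret MB: cstar_algebra "mult_alg (alg \<B>)" by (rule K'.A.cstar_algebra_mult_alg)
      show "strictly_continuous (alg \<B>) (\<lambda>g. star (mult_alg (alg \<B>)) (x g))"
        using K'.A.strictly_continuousD[OF xs \<theta>.unitary_carrier]
        by (intro K'.A.strictly_continuousI) (simp_all add: MB.star_star)
      fix g
      have u: "K'.\<Psi> (x g) \<in> carrier ?M" "star ?M (K'.\<Psi> (x g)) \<otimes>\<^bsub>?M\<^esub> K'.\<Psi> (x g) = \<one>\<^bsub>?M\<^esub>"
        using K'.\<pi>.mult_ext_unitary[OF \<theta>.unitary] by (auto simp: mult_unitaries_def)
      have "?\<Theta> (fst (cp_unitary K g) r) = K'.\<Psi> (x g) \<otimes>\<^bsub>?M\<^esub> cp_unitary K' g \<otimes>\<^bsub>?M\<^esub> ?\<Theta> r"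
        using ext_mult[OF K.U_carrier r] ext(2)[OF d] by simp
      then have "star ?M (K'.\<Psi> (x g)) \<otimes>\<^bsub>?M\<^esub> ?\<Theta> (fst (cp_unitary K g) r)
          = (star ?M (K'.\<Psi> (x g)) \<otimes>\<^bsub>?M\<^esub> K'.\<Psi> (x g)) \<otimes>\<^bsub>?M\<^esub> (cp_unitary K' g \<otimes>\<^bsub>?M\<^esub> ?\<Theta> r)"
        using u(1) r by (simp add: K'.MP.mult_assoc)
      then show "cp_unitary K' g \<otimes>\<^bsub>?M\<^esub> ?\<Theta> r = K'.\<Psi> (star (mult_alg (alg \<B>)) (x g)) \<otimes>\<^bsub>?M\<^esub> ?\<Theta> (fst (cp_unitary K g) r)"
        using u r by (simp add: star_hom_star[OF K'.\<pi>.mult_ext_hom])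
    qed
    ultimately show "\<exists>a\<in>carrier (alg \<B>). \<exists>n\<in>K'.cont_mult. ?\<Theta> (fst (cp_hom K d) r) = cp_hom K' a \<otimes>\<^bsub>?M\<^esub> n"
      using b(1) by blast
  qed (rule p)
  then show ?thesis using K'.core_subset_embed by blast
qed

section \<open>Functoriality\<close>

lemma cocycle_morphism_comp:
  assumes tw: "twisted_algebra \<A>" "twisted_algebra \<B>" "twisted_algebra \<C>"
    and f: "cocycle_morphism \<A> \<B> f" and g: "cocycle_morphism \<B> \<C> g"
  shows "cocycle_morphism \<A> \<C> (cocycle_comp \<A> \<B> \<C> g f)"
proof -
  obtain \<phi> u \<psi> v where e: "f = (\<phi>, u)" "g = (\<psi>, v)" by (cases f, cases g)
  interpret cocycle_representation_pair \<A> \<B> \<C> \<phi> u \<psi> v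
    using tw f g e by (simp add: cocycle_representation_pair_def cocycle_representation_def cocycle_morphism_def)
  have "hom_comp (alg \<A>) (alg \<B>) (alg \<C>) \<psi> \<phi> a \<in> mult_embed (alg \<C>) ` carrier (alg \<C>)"
    if a: "a \<in> carrier (alg \<A>)" for a
  proof -
    obtain b where "b \<in> carrier (alg \<B>)" "\<phi> a = mult_embed (alg \<B>) b"
      using f a by (auto simp: cocycle_morphism_def e)
    then show ?thesis
      using a g by (auto simp: pair.hom_comp_apply second.hom.mult_ext_embed cocycle_morphism_def e)
  qed
  then show ?thesis using comp_rep by (auto simp: cocycle_morphism_def e cocycle_comp_eq)
qed

lemma cocycle_cat_category: "is_category cocycle_cat"
  unfolding is_category_def cocycle_cat_def
proof (simp add: cocycle_id_def[symmetric], intro conjI allI impI)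
  fix \<A> \<B> \<C> \<D> :: "('a, 'b) twisted" and f g h
  assume \<A>: "twisted_algebra \<A>"
  show "cocycle_morphism \<A> \<A> (cocycle_id \<A>)"
    using cocycle_id_rep[OF \<A>] by (simp add: cocycle_morphism_def cocycle_id_def)
  assume \<B>: "twisted_algebra \<B>"
  show "cocycle_comp \<A> \<A> \<B> f (cocycle_id \<A>) = f" "cocycle_comp \<A> \<B> \<B> (cocycle_id \<B>) f = f"
    if "cocycle_morphism \<A> \<B> f"
    using that \<A> \<B> by (auto simp: cocycle_morphism_def intro: cocycle_comp_id_left cocycle_comp_id_right)
  assume \<C>: "twisted_algebra \<C>"
  show "cocycle_morphism \<A> \<C> (cocycle_comp \<A> \<B> \<C> g f)"
    if "cocycle_morphism \<A> \<B> f" "cocycle_morphism \<B> \<C> g"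
    by (rule cocycle_morphism_comp[OF \<A> \<B> \<C> that])
  assume \<D>: "twisted_algebra \<D>"
  show "cocycle_comp \<A> \<B> \<D> (cocycle_comp \<B> \<C> \<D> h g) f = cocycle_comp \<A> \<C> \<D> h (cocycle_comp \<A> \<B> \<C> g f)"
    if "cocycle_morphism \<A> \<B> f" "cocycle_morphism \<B> \<C> g" "cocycle_morphism \<C> \<D> h"
    using that \<A> \<B> \<C> \<D> by (intro cocycle_comp_assoc[symmetric]) (auto simp: cocycle_morphism_def)
qed

lemma hom_comp_image:
  assumes "nondeg_hom P Q \<phi>" "nondeg_hom Q R \<psi>"
    "\<phi> ` carrier P \<subseteq> mult_embed Q ` carrier Q" "\<psi> ` carrier Q \<subseteq> mult_embed R ` carrier R"
  shows "hom_comp P Q R \<psi> \<phi> ` carrier P \<subseteq> mult_embed R ` carrier R"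
proof (rule image_subsetI)
  interpret nondeg_hom_pair P Q R \<phi> \<psi> using assms by (intro nondeg_hom_pairI)
  fix p assume p: "p \<in> carrier P"
  then obtain q where q: "q \<in> carrier Q" "\<phi> p = mult_embed Q q" using assms(3) by blast
  then have "hom_comp P Q R \<psi> \<phi> p = \<psi> q"
    using p by (simp add: hom_comp_apply second.mult_ext_embed)
  then show "hom_comp P Q R \<psi> \<phi> p \<in> mult_embed R ` carrier R" using q(1) assms(4) by auto
qed

lemma cstar_cat_category: "is_category cstar_cat"
  unfolding is_category_def cstar_cat_def
proof (simp, intro conjI allI impI ballI)
  fix P Q R S :: "'a cstar" and f g h
  assume P: "cstar_algebra P"
  show "nondegenerate_hom P P (mult_embed P)"
    by (rule nondeg_hom.nondegenerate[OF cstar_algebra.nondeg_hom_mult_embed[OF P]])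
  assume Q: "cstar_algebra Q"
  show "hom_comp P P Q f (mult_embed P) = f" "hom_comp P Q Q (mult_embed Q) f = f"
    if "nondegenerate_hom P Q f \<and> f ` carrier P \<subseteq> mult_embed Q ` carrier Q"
    using that P Q by (auto intro!: nondeg_hom.hom_comp_mult_embed_right nondeg_hom.hom_comp_mult_embed_left
        intro: nondeg_homI)
  assume R: "cstar_algebra R"
  show "nondegenerate_hom P R (hom_comp P Q R g f)"
    "hom_comp P Q R g f ` carrier P \<subseteq> mult_embed R ` carrier R"
    if "nondegenerate_hom P Q f \<and> f ` carrier P \<subseteq> mult_embed Q ` carrier Q"
      "nondegenerate_hom Q R g \<and> g ` carrier Q \<subseteq> mult_embed R ` carrier R"
  proof -
    have *: "nondeg_hom P Q f" "nondeg_hom Q R g" using that P Q R by (auto intro: nondeg_homI)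
    show "nondegenerate_hom P R (hom_comp P Q R g f)"
      by (rule nondeg_hom.nondegenerate[OF nondeg_hom_pair.nondeg_hom_comp[OF nondeg_hom_pairI[OF *]]])
    show "hom_comp P Q R g f ` carrier P \<subseteq> mult_embed R ` carrier R"
      using hom_comp_image[OF *] that by blast
  qed
  assume S: "cstar_algebra S"
  show "hom_comp P Q S (hom_comp Q R S h g) f = hom_comp P R S h (hom_comp P Q R g f)"
    if "nondegenerate_hom P Q f \<and> f ` carrier P \<subseteq> mult_embed Q ` carrier Q"
      "nondegenerate_hom Q R g \<and> g ` carrier Q \<subseteq> mult_embed R ` carrier R"
      "nondegenerate_hom R S h \<and> h ` carrier R \<subseteq> mult_embed S ` carrier S"
    using that P Q R S by (intro hom_comp_assoc[symmetric] nondeg_homI) auto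
qed

theorem proposition1p26:
  assumes "locally_compact_space
    (euclidean :: 'g::{topological_group_add, t2_space, second_countable_topology} topology)"
  shows
    "(\<forall>(\<A> :: ('g, 'a) twisted) (\<B> :: ('g, 'b) twisted) (\<C> :: ('g, 'c) twisted)
        (K\<^sub>A :: ('g, 'a, 'x) crossed) (K\<^sub>B :: ('g, 'b, 'x) crossed) (K\<^sub>C :: ('g, 'c, 'x) crossed)
        \<phi> u \<psi> v.
        twisted_algebra \<A> \<and> twisted_algebra \<B> \<and> twisted_algebra \<C> \<and>
        is_crossed_product \<A> K\<^sub>A \<and> is_crossed_product \<B> K\<^sub>B \<and> is_crossed_product \<C> K\<^sub>C \<and>
        cocycle_rep \<A> \<B> (\<phi>, u) \<and> cocycle_rep \<B> \<C> (\<psi>, v) \<longrightarrow>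
        hom_comp (cp_alg K\<^sub>A) (cp_alg K\<^sub>B) (cp_alg K\<^sub>C)
            (crossed_map \<B> \<C> K\<^sub>B K\<^sub>C (\<psi>, v)) (crossed_map \<A> \<B> K\<^sub>A K\<^sub>B (\<phi>, u))
          = crossed_map \<A> \<C> K\<^sub>A K\<^sub>C (cocycle_comp \<A> \<B> \<C> (\<psi>, v) (\<phi>, u))) \<and>
     (\<forall>K :: ('g, 'a) twisted \<Rightarrow> ('g, 'a, 'x) crossed.
        (\<forall>\<A>. twisted_algebra \<A> \<longrightarrow> is_crossed_product \<A> (K \<A>)) \<longrightarrow>
        is_functor cocycle_cat cstar_cat
          (\<lambda>\<A>. cp_alg (K \<A>)) (\<lambda>\<A> \<B>. crossed_map \<A> \<B> (K \<A>) (K \<B>)))"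
proof (intro conjI allI impI)
  fix \<A> :: "('g, 'a) twisted" and \<B> :: "('g, 'b) twisted" and \<C> :: "('g, 'c) twisted"
    and K\<^sub>A :: "('g, 'a, 'x) crossed" and K\<^sub>B :: "('g, 'b, 'x) crossed" and K\<^sub>C :: "('g, 'c, 'x) crossed"
    and \<phi> u \<psi> v
  assume "twisted_algebra \<A> \<and> twisted_algebra \<B> \<and> twisted_algebra \<C> \<and>
    is_crossed_product \<A> K\<^sub>A \<and> is_crossed_product \<B> K\<^sub>B \<and> is_crossed_product \<C> K\<^sub>C \<and>
    cocycle_rep \<A> \<B> (\<phi>, u) \<and> cocycle_rep \<B> \<C> (\<psi>, v)"
  then show "hom_comp (cp_alg K\<^sub>A) (cp_alg K\<^sub>B) (cp_alg K\<^sub>C)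
      (crossed_map \<B> \<C> K\<^sub>B K\<^sub>C (\<psi>, v)) (crossed_map \<A> \<B> K\<^sub>A K\<^sub>B (\<phi>, u))
    = crossed_map \<A> \<C> K\<^sub>A K\<^sub>C (cocycle_comp \<A> \<B> \<C> (\<psi>, v) (\<phi>, u))"
    by (intro crossed_map_comp) auto
next
  fix K :: "('g, 'a) twisted \<Rightarrow> ('g, 'a, 'x) crossed"
  assume "\<forall>\<A>. twisted_algebra \<A> \<longrightarrow> is_crossed_product \<A> (K \<A>)"
  then have K: "is_crossed_product \<A> (K \<A>)" if "twisted_algebra \<A>" for \<A> using that by blast
  have obj: "\<A> \<in> Obj cocycle_cat \<longleftrightarrow> twisted_algebra \<A>" for \<A> :: "('g, 'a) twisted"
    by (simp add: cocycle_cat_def)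
  have hom: "f \<in> Hom cocycle_cat \<A> \<B> \<longleftrightarrow> cocycle_morphism \<A> \<B> f" for \<A> \<B> :: "('g, 'a) twisted" and f
    by (simp add: cocycle_cat_def)
  show "is_functor cocycle_cat cstar_cat
      (\<lambda>\<A>. cp_alg (K \<A>)) (\<lambda>\<A> \<B>. crossed_map \<A> \<B> (K \<A>) (K \<B>))"
    unfolding is_functor_def
  proof (intro conjI ballI cocycle_cat_category cstar_cat_category)
    fix \<A> :: "('g, 'a) twisted" assume "\<A> \<in> Obj cocycle_cat"
    then have \<A>: "twisted_algebra \<A>" by (simp add: obj)
    show "cp_alg (K \<A>) \<in> Obj cstar_cat"
      using K[OF \<A>] by (simp add: cstar_cat_def is_crossed_product_def)
    show "crossed_map \<A> \<A> (K \<A>) (K \<A>) (Id cocycle_cat \<A>) = Id cstar_cat (cp_alg (K \<A>))"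
      using crossed_map_id[OF \<A> K[OF \<A>]] by (simp add: cocycle_cat_def cstar_cat_def cocycle_id_def)
    fix \<B> :: "('g, 'a) twisted" assume "\<B> \<in> Obj cocycle_cat"
    then have \<B>: "twisted_algebra \<B>" by (simp add: obj)
    fix f assume "f \<in> Hom cocycle_cat \<A> \<B>"
    then have f: "cocycle_rep \<A> \<B> f" "fst f ` carrier (alg \<A>) \<subseteq> mult_embed (alg \<B>) ` carrier (alg \<B>)"
      by (simp_all add: hom cocycle_morphism_def)
    interpret fm: crossed_product_pair \<A> \<B> "K \<A>" "K \<B>" f
      by (rule crossed_product_pairI[OF \<A> \<B> K[OF \<A>] K[OF \<B>] f(1)])
    show "crossed_map \<A> \<B> (K \<A>) (K \<B>) f \<in> Hom cstar_cat (cp_alg (K \<A>)) (cp_alg (K \<B>))"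
      using nondeg_hom.nondegenerate[OF fm.crossed_map_nondeg] fm.crossed_map_image[OF f(2)]
      by (simp add: cstar_cat_def)
    fix \<C> :: "('g, 'a) twisted" and g
    assume "\<C> \<in> Obj cocycle_cat" "g \<in> Hom cocycle_cat \<B> \<C>"
    then have \<C>: "twisted_algebra \<C>" "cocycle_rep \<B> \<C> g"
      by (simp_all add: obj hom cocycle_morphism_def)
    show "crossed_map \<A> \<C> (K \<A>) (K \<C>) (Comp cocycle_cat \<A> \<B> \<C> g f) =
        Comp cstar_cat (cp_alg (K \<A>)) (cp_alg (K \<B>)) (cp_alg (K \<C>))
          (crossed_map \<B> \<C> (K \<B>) (K \<C>) g) (crossed_map \<A> \<B> (K \<A>) (K \<B>) f)"
      using crossed_map_comp[OF \<A> K[OF \<A>] \<B> K[OF \<B>] \<C>(1) K[OF \<C>(1)] f(1) \<C>(2)]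
      by (simp add: cocycle_cat_def cstar_cat_def)
  qed
qed

end
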